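(* Let $\mathbf{F}$ be a complete algebraically closed non-archimedean valued field of characteristic zero. Let $X$ be a nonsingular projective variety defined over $\mathbf{F}$ and let $D$ be a simple normal crossing divisor on $X$. Let $0<R<\infty$ and let $f:A(0,R]\to X\setminus D$ be a rigid analytic map. If there exist integers $k,m\ge 1$, an ample line bundle $\mathcal{A}$ on $X$ and a global section $$\omega\in H^0\big(X,E^{GG}_{k,m}T_X^*(\log D)\otimes\mathcal{A}^{-1}\big)$$ such that $f^*\omega\not\equiv 0$, then $f$ extends to a rigid analytic map from $A[0,R]$ to $X$.
   Context: The absolute value $|\cdot|$ on $\mathbf{F}$ is non-trivial, as usual in rigid analytic geometry. Varieties are identified with their rigid analytifications when speaking of rigid analytic maps. $A(0,R]=\{z\in\mathbf{F}: 0<|z|\le R\}$ is the punctured closed disc and $A[0,R]=\{z\in\mathbf{F}:|z|\le R\}$ the closed disc. Logarithmic Green–Griffiths bundle: let $n=\dim X$. Around a point $x\in X$ choose local coordinates $z_1,\dots,z_n$ in which $D=\{z_1\cdots z_\ell=0\}$ with $\ell=\ell(x)$. A logarithmic jet differential of order $k$ and weight $m$ along $D$ is, locally, a polynomial with analytic coefficients in the symbols $d^j\log z_i$ ($1\le j\le k$, $1\le i\le\ell$) and $d^jz_i$ ($1\le j\le k$, $\ell+1\le i\le n$), weighted homogeneous of degree $m$ when $d^j\log z_i$ and $d^jz_i$ are given weight $j$. These glue (via Faà di Bruno's formula) to a vector bundle $E^{GG}_{k,m}T_X^*(\log D)$ on $X$. Pullback: for a rigid analytic map $f$ from an annulus with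 global coordinate $\xi$ to $X\setminus D$, $f^*\omega$ is obtained by substituting $\frac{d^j}{d\xi^j}\log(z_i\circ f)$, i.e. $\frac{d^{j-1}}{d\xi^{j-1}}\big(\frac{(z_i\circ f)'}{z_i\circ f}\big)$, for $d^j\log z_i$, substituting $(z_i\circ f)^{(j)}$ for $d^jz_i$, composing the coefficients with $f$, and multiplying by $(d\xi)^m$. When $\omega$ is twisted by $\mathcal{A}^{-1}$, $f^*\omega$ is a section of $f^*\mathcal{A}^{-1}\otimes(d\xi)^m$; the condition $f^*\omega\not\equiv0$ is computed in local trivializations of $\mathcal{A}$ and does not depend on them. *)

theory Defs
  imports
    "HOL-Analysis.Infinite_Sum"
    "HOL-Computational_Algebra.Computational_Algebra"
    "HOL-Library.Poly_Mapping"
begin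

section \<open>The ground field\<close>

text \<open>
  A complete algebraically closed non-archimedean field of characteristic zero with non-trivial
  absolute value \<open>absv\<close>, which is definite and nonnegative because it defines the metric. The
  classes of normed fields of the library cannot be used, since they are algebras over the reals.
\<close>

class complete_nonarch_field = alg_closed_field + field_char_0 + complete_space +
  fixes absv :: "'a \<Rightarrow> real"
  assumes dist_absv: "dist x y = absv (x - y)"
    and absv_mult: "absv (x * y) = absv x * absv y"
    and absv_add_le: "absv (x + y) \<le> max (absv x) (absv y)"
    and absv_nontrivial: "\<exists>x. x \<noteq> 0 \<and> absv x \<noteq> 1"


section \<open>Projective varieties\<close>

text \<open>
  All projective spaces live in one type of points with homogeneous coordinates indexed by the
  natural numbers; \<open>pspace N\<close> is the projective space of dimension \<open>N\<close>. Varieties are reduced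
  and the field is algebraically closed, so they are identified with their sets of rational points,
  and regular (or rigid analytic) functions with functions on these points.
\<close>

definition proportional :: "(nat \<Rightarrow> 'a::field) \<Rightarrow> (nat \<Rightarrow> 'a) \<Rightarrow> bool" where
  "proportional x y \<longleftrightarrow> (\<exists>i. x i \<noteq> 0) \<and> (\<exists>c. c \<noteq> 0 \<and> y = (\<lambda>i. c * x i))"

quotient_type (overloaded) 'a ppoint = "nat \<Rightarrow> 'a::field" / partial: proportional
proof (rule part_equivpI)
  show "\<exists>x :: nat \<Rightarrow> 'a. proportional x x"
    by (rule exI[of _ "\<lambda>_. 1"]) (auto simp: proportional_def intro!: exI[of _ 1])
  show "symp (proportional :: (nat \<Rightarrow> 'a) \<Rightarrow> _)"
  proof (rule sympI)
    fix x y :: "nat \<Rightarrow> 'a" assume "proportional x y"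
    then obtain c i where "c \<noteq> 0" "y = (\<lambda>i. c * x i)" "x i \<noteq> 0"
      by (auto simp: proportional_def)
    then show "proportional y x"
      by (auto simp: proportional_def fun_eq_iff intro!: exI[of _ i] exI[of _ "inverse c"])
  qed
  show "transp (proportional :: (nat \<Rightarrow> 'a) \<Rightarrow> _)"
  proof (rule transpI)
    fix x y z :: "nat \<Rightarrow> 'a" assume "proportional x y" "proportional y z"
    then obtain c d i where "c \<noteq> 0" "y = (\<lambda>i. c * x i)" "d \<noteq> 0" "z = (\<lambda>i. d * y i)" "x i \<noteq> 0"
      by (auto simp: proportional_def)
    then show "proportional x z"
      by (auto simp: proportional_def fun_eq_iff intro!: exI[of _ i] exI[of _ "d * c"])
  qed
qed

text \<open>
  A choice of homogeneous coordinates of a point. It is only used in expressions that do not depend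
  on the choice.
\<close>

definition hcoord :: "'a::field ppoint \<Rightarrow> nat \<Rightarrow> 'a" where
  "hcoord p = rep_ppoint p"

definition pspace :: "nat \<Rightarrow> 'a::field ppoint set" where
  "pspace N = {p. \<forall>i>N. hcoord p i = 0}"

text \<open>The affine coordinate \<open>x\<^sub>j / x\<^sub>i\<close>.\<close>

definition ratio :: "nat \<Rightarrow> nat \<Rightarrow> 'a::field ppoint \<Rightarrow> 'a" where
  "ratio j i p = hcoord p j / hcoord p i"

type_synonym 'a mpoly = "(nat \<Rightarrow>\<^sub>0 nat) \<Rightarrow>\<^sub>0 'a"

definition homogeneous :: "nat \<Rightarrow> 'a::field mpoly \<Rightarrow> bool" where
  "homogeneous d P \<longleftrightarrow>
     (\<forall>\<nu>\<in>Poly_Mapping.keys P. (\<Sum>i\<in>Poly_Mapping.keys \<nu>. Poly_Mapping.lookup \<nu> i) = d)"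

definition peval :: "'a::field mpoly \<Rightarrow> 'a ppoint \<Rightarrow> 'a" where
  "peval P p = (\<Sum>\<nu>\<in>Poly_Mapping.keys P. Poly_Mapping.lookup P \<nu> *
     (\<Prod>i\<in>Poly_Mapping.keys \<nu>. hcoord p i ^ Poly_Mapping.lookup \<nu> i))"

definition pclosed :: "'a::field ppoint set \<Rightarrow> bool" where
  "pclosed Z \<longleftrightarrow> (\<exists>T. (\<forall>P\<in>T. \<exists>d. homogeneous d P) \<and> Z = {p. \<forall>P\<in>T. peval P p = 0})"

definition irreducible_closed :: "'a::field ppoint set \<Rightarrow> bool" where
  "irreducible_closed Z \<longleftrightarrow> pclosed Z \<and> Z \<noteq> {} \<and>
     (\<forall>A B. pclosed A \<and> pclosed B \<and> Z \<subseteq> A \<union> B \<longrightarrow> Z \<subseteq> A \<or> Z \<subseteq> B)"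

definition projective_variety :: "nat \<Rightarrow> 'a::field ppoint set \<Rightarrow> bool" where
  "projective_variety N X \<longleftrightarrow> irreducible_closed X \<and> X \<subseteq> pspace N"

definition zopen :: "'a::field ppoint set \<Rightarrow> 'a ppoint set \<Rightarrow> bool" where
  "zopen X U \<longleftrightarrow> (\<exists>Z. pclosed Z \<and> U = X - Z)"

text \<open>The Krull dimension of the Zariski topology.\<close>

definition variety_dim :: "'a::field ppoint set \<Rightarrow> nat" where
  "variety_dim X = (GREATEST n. \<exists>Z. (\<forall>i\<le>n. irreducible_closed (Z i) \<and> Z i \<subseteq> X) \<and>
     (\<forall>i<n. Z i \<subset> Z (Suc i)))"

text \<open>The regular functions on \<open>U\<close>; the values outside of \<open>U\<close> are irrelevant.\<close>

definition regular_functions :: "'a::field ppoint set \<Rightarrow> 'a ppoint set \<Rightarrow> ('a ppoint \<Rightarrow> 'a) set" where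
  "regular_functions X U = {h. \<forall>p\<in>U. \<exists>V P Q d. zopen X V \<and> p \<in> V \<and> V \<subseteq> U \<and>
     homogeneous d P \<and> homogeneous d Q \<and> (\<forall>q\<in>V. peval Q q \<noteq> 0 \<and> h q = peval P q / peval Q q)}"

definition morphism :: "'a::field ppoint set \<Rightarrow> 'a ppoint set \<Rightarrow> ('a ppoint \<Rightarrow> 'a ppoint) \<Rightarrow> bool" where
  "morphism X Y \<phi> \<longleftrightarrow> \<phi> ` X \<subseteq> Y \<and> (\<forall>V. zopen Y V \<longrightarrow> zopen X (X \<inter> \<phi> -` V) \<and>
     (\<forall>h\<in>regular_functions Y V. h \<circ> \<phi> \<in> regular_functions X (X \<inter> \<phi> -` V)))"

text \<open>An isomorphism onto a closed subvariety.\<close>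

definition closed_immersion :: "'a::field ppoint set \<Rightarrow> ('a ppoint \<Rightarrow> 'a ppoint) \<Rightarrow> bool" where
  "closed_immersion X \<phi> \<longleftrightarrow> pclosed (\<phi> ` X) \<and> inj_on \<phi> X \<and>
     morphism X (\<phi> ` X) \<phi> \<and> morphism (\<phi> ` X) X (inv_into X \<phi>)"


section \<open>Regular parameters, nonsingularity, normal crossings\<close>

text \<open>
  The local ring at \<open>p\<close> is presented as the direct limit of the rings \<open>A\<close> of functions on \<open>U\<close>, for
  \<open>(U, A)\<close> in a directed family \<open>\<N>\<close> of neighbourhoods of \<open>p\<close>. The functions \<open>zs\<close> are regular
  parameters if the differences \<open>z - z(p)\<close> generate the maximal ideal of this ring and their number
  \<open>n\<close> is its dimension.
\<close>

definition regular_parameters ::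
    "nat \<Rightarrow> ('p set \<times> ('p \<Rightarrow> 'a::field) set) set \<Rightarrow> 'p \<Rightarrow> ('p \<Rightarrow> 'a) list \<Rightarrow> bool" where
  "regular_parameters n \<N> p zs \<longleftrightarrow> length zs = n \<and> (\<exists>(U, A)\<in>\<N>. set zs \<subseteq> A) \<and>
     (\<forall>(U, A)\<in>\<N>. \<forall>h\<in>A. \<exists>(V, B)\<in>\<N>. V \<subseteq> U \<and> (\<exists>u. (\<forall>i<n. u i \<in> B) \<and>
        (\<forall>q\<in>V. h q - h p = (\<Sum>i<n. u i q * ((zs ! i) q - (zs ! i) p)))))"

definition zariski_nbhds :: "'a::field ppoint set \<Rightarrow> 'a ppoint \<Rightarrow>
    ('a ppoint set \<times> ('a ppoint \<Rightarrow> 'a) set) set" where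
  "zariski_nbhds X p = {(U, regular_functions X U) | U. zopen X U \<and> p \<in> U}"

definition nonsingular :: "'a::field ppoint set \<Rightarrow> bool" where
  "nonsingular X \<longleftrightarrow> (\<forall>p\<in>X. \<exists>zs. regular_parameters (variety_dim X) (zariski_nbhds X p) p zs)"

definition prime_divisor :: "'a::field ppoint set \<Rightarrow> 'a ppoint set \<Rightarrow> bool" where
  "prime_divisor X E \<longleftrightarrow> irreducible_closed E \<and> E \<subseteq> X \<and> variety_dim E + 1 = variety_dim X"

text \<open>
  A simple normal crossing divisor is reduced, hence given by the set \<open>\<D>\<close> of its irreducible
  components. Near each point, the components through it are distinct coordinate hyperplanes of a
  regular system of parameters; in particular each component is nonsingular.
\<close>

definition snc_divisor :: "'a::field ppoint set \<Rightarrow> 'a ppoint set set \<Rightarrow> bool" where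
  "snc_divisor X \<D> \<longleftrightarrow> finite \<D> \<and> (\<forall>E\<in>\<D>. prime_divisor X E) \<and>
     (\<forall>p\<in>X. \<exists>U zs l e. zopen X U \<and> p \<in> U \<and> set zs \<subseteq> regular_functions X U \<and>
        regular_parameters (variety_dim X) (zariski_nbhds X p) p zs \<and>
        l \<le> variety_dim X \<and> bij_betw e {..<l} {E\<in>\<D>. p \<in> E} \<and>
        (\<forall>i<l. U \<inter> e i = {q\<in>U. (zs ! i) q = 0}))"


section \<open>Line bundles\<close>

text \<open>
  A line bundle is trivial over the members of a finite Zariski open covering \<open>Vs\<close>, with
  transition functions \<open>g\<close>: a section is a family of functions with \<open>s\<^sub>i = g\<^sub>i\<^sub>j s\<^sub>j\<close>.
\<close>

definition line_bundle :: "'a::field ppoint set \<Rightarrow> 'a ppoint set list \<Rightarrow>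
    (nat \<Rightarrow> nat \<Rightarrow> 'a ppoint \<Rightarrow> 'a) \<Rightarrow> bool" where
  "line_bundle X Vs g \<longleftrightarrow> (\<forall>V\<in>set Vs. zopen X V) \<and> \<Union>(set Vs) = X \<and>
     (\<forall>i<length Vs. \<forall>j<length Vs. g i j \<in> regular_functions X (Vs ! i \<inter> Vs ! j)) \<and>
     (\<forall>i<length Vs. \<forall>p\<in>Vs ! i. g i i p = 1) \<and>
     (\<forall>i<length Vs. \<forall>j<length Vs. \<forall>k<length Vs. \<forall>p\<in>Vs ! i \<inter> Vs ! j \<inter> Vs ! k.
        g i j p * g j k p = g i k p)"

definition bundle_section :: "'a::field ppoint set \<Rightarrow> 'a ppoint set list \<Rightarrow>
    (nat \<Rightarrow> nat \<Rightarrow> 'a ppoint \<Rightarrow> 'a) \<Rightarrow> (nat \<Rightarrow> 'a ppoint \<Rightarrow> 'a) \<Rightarrow> bool" where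
  "bundle_section X Vs g s \<longleftrightarrow> (\<forall>i<length Vs. s i \<in> regular_functions X (Vs ! i)) \<and>
     (\<forall>i<length Vs. \<forall>j<length Vs. \<forall>p\<in>Vs ! i \<inter> Vs ! j. s i p = g i j p * s j p)"

text \<open>
  Global sections \<open>s\<^sub>0, \<dots>, s\<^sub>M\<close> without common zeros define a closed immersion
  \<open>[s\<^sub>0 : \<dots> : s\<^sub>M]\<close>, along which \<open>\<O>(1)\<close> pulls back to the bundle.
\<close>

definition very_ample :: "'a::field ppoint set \<Rightarrow> 'a ppoint set list \<Rightarrow>
    (nat \<Rightarrow> nat \<Rightarrow> 'a ppoint \<Rightarrow> 'a) \<Rightarrow> bool" where
  "very_ample X Vs g \<longleftrightarrow> (\<exists>M s \<phi>. (\<forall>r\<le>M. bundle_section X Vs g (s r)) \<and>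
     (\<forall>i<length Vs. \<forall>p\<in>Vs ! i. (\<exists>r\<le>M. s r i p \<noteq> 0) \<and>
        \<phi> p = abs_ppoint (\<lambda>r. if r \<le> M then s r i p else 0)) \<and>
     closed_immersion X \<phi>)"

definition ample :: "'a::field ppoint set \<Rightarrow> 'a ppoint set list \<Rightarrow>
    (nat \<Rightarrow> nat \<Rightarrow> 'a ppoint \<Rightarrow> 'a) \<Rightarrow> bool" where
  "ample X Vs g \<longleftrightarrow> (\<exists>d\<ge>1. very_ample X Vs (\<lambda>i j p. g i j p ^ d))"


section \<open>Rigid analytic geometry\<close>

text \<open>
  A reduced affinoid space is presented by its set of points together with a finite list of
  functions of absolute value at most one that are affinoid generators of its algebra: the
  analytic functions are the power series in the generators whose coefficients tend to zero.
\<close>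

type_synonym ('p, 'a) affinoid = "'p set \<times> ('p \<Rightarrow> 'a) list"

definition analytic_functions ::
    "('p, 'a::complete_nonarch_field) affinoid \<Rightarrow> ('p \<Rightarrow> 'a) set" where
  "analytic_functions W = {h. \<exists>c :: (nat \<Rightarrow>\<^sub>0 nat) \<Rightarrow> 'a.
     (\<forall>\<nu>. \<not> Poly_Mapping.keys \<nu> \<subseteq> {..<length (snd W)} \<longrightarrow> c \<nu> = 0) \<and>
     (\<forall>\<epsilon>>0. finite {\<nu>. absv (c \<nu>) \<ge> \<epsilon>}) \<and>
     (\<forall>p\<in>fst W. ((\<lambda>\<nu>. c \<nu> * (\<Prod>i<length (snd W). (snd W ! i) p ^ Poly_Mapping.lookup \<nu> i))
        has_sum h p) UNIV)}"

text \<open>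
  The rational subdomain \<open>|f| \<le> |g|\<close> (\<open>f\<close> in \<open>fs\<close>), where \<open>g\<close> and \<open>fs\<close> have no common zero,
  i.e. generate the unit ideal. Every admissible covering of an affinoid space is refined by a
  finite covering by rational subdomains, and all such coverings are admissible.
\<close>

definition rational_subdomain ::
    "('p, 'a::complete_nonarch_field) affinoid \<Rightarrow> ('p, 'a) affinoid \<Rightarrow> bool" where
  "rational_subdomain W W' \<longleftrightarrow> (\<exists>g fs. g \<in> analytic_functions W \<and> set fs \<subseteq> analytic_functions W \<and>
     (\<forall>p\<in>fst W. \<exists>f\<in>set (g # fs). f p \<noteq> 0) \<and>
     fst W' = {p\<in>fst W. \<forall>f\<in>set fs. absv (f p) \<le> absv (g p)} \<and>
     snd W' = snd W @ map (\<lambda>f p. f p / g p) fs)"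

definition unit_chart :: "nat \<Rightarrow> 'a::complete_nonarch_field ppoint set" where
  "unit_chart i = {p. hcoord p i \<noteq> 0 \<and> (\<forall>j. absv (hcoord p j) \<le> absv (hcoord p i))}"

text \<open>
  The analytification of \<open>X\<close> is covered by the affinoids \<open>|x\<^sub>j| \<le> |x\<^sub>i|\<close> (all \<open>j\<close>), for \<open>i \<le> N\<close>.
\<close>

definition standard_affinoid :: "nat \<Rightarrow> 'a::complete_nonarch_field ppoint set \<Rightarrow> nat \<Rightarrow>
    ('a ppoint, 'a) affinoid" where
  "standard_affinoid N X i = (X \<inter> unit_chart i, map (\<lambda>j. ratio j i) [0..<Suc N])"

definition affinoids :: "nat \<Rightarrow> 'a::complete_nonarch_field ppoint set \<Rightarrow>
    ('a ppoint, 'a) affinoid set" where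
  "affinoids N X = {W. \<exists>i\<le>N. rational_subdomain (standard_affinoid N X i) W}"

definition rigid_nbhds :: "nat \<Rightarrow> 'a::complete_nonarch_field ppoint set \<Rightarrow> 'a ppoint \<Rightarrow>
    ('a ppoint set \<times> ('a ppoint \<Rightarrow> 'a) set) set" where
  "rigid_nbhds N X p = {(fst W, analytic_functions W) | W. W \<in> affinoids N X \<and> p \<in> fst W}"

text \<open>
  Rigid analytic maps from an affinoid space to \<open>Y\<close>, where \<open>Y\<close> is a Zariski closed set or the
  difference of two Zariski closed sets: the source has a finite covering by rational subdomains
  on each of which some \<open>x\<^sub>i\<close> is dominant and all \<open>x\<^sub>j / x\<^sub>i\<close> are analytic.
\<close>

definition rigid_map :: "('p, 'a::complete_nonarch_field) affinoid \<Rightarrow> 'a ppoint set \<Rightarrow>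
    ('p \<Rightarrow> 'a ppoint) \<Rightarrow> bool" where
  "rigid_map W Y f \<longleftrightarrow> f ` fst W \<subseteq> Y \<and>
     (\<exists>Ws. fst W = \<Union>(fst ` set Ws) \<and> (\<forall>W'\<in>set Ws. rational_subdomain W W' \<and>
        (\<exists>i. f ` fst W' \<subseteq> unit_chart i \<and> (\<forall>j. ratio j i \<circ> f \<in> analytic_functions W'))))"

text \<open>The affinoid disc \<open>|z| \<le> |b|\<close> and the affinoid annulus \<open>|a| \<le> |z| \<le> |b|\<close>.\<close>

definition disc :: "'a::complete_nonarch_field \<Rightarrow> ('a, 'a) affinoid" where
  "disc b = ({z. absv z \<le> absv b}, [\<lambda>z. z / b])"

definition annulus :: "'a::complete_nonarch_field \<Rightarrow> 'a \<Rightarrow> ('a, 'a) affinoid" where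
  "annulus a b = ({z. absv a \<le> absv z \<and> absv z \<le> absv b}, [\<lambda>z. z / b, \<lambda>z. a / z])"

text \<open>
  The punctured disc \<open>A(0,R]\<close> and the disc \<open>A[0,R]\<close> are admissibly covered by the affinoid annuli,
  respectively discs, that they contain. The radius \<open>R\<close> need not be the absolute value of an
  element of the field.
\<close>

definition rigid_map_punctured_disc :: "real \<Rightarrow> 'a::complete_nonarch_field ppoint set \<Rightarrow>
    ('a \<Rightarrow> 'a ppoint) \<Rightarrow> bool" where
  "rigid_map_punctured_disc R Y f \<longleftrightarrow>
     (\<forall>a b. a \<noteq> 0 \<and> absv a \<le> absv b \<and> absv b \<le> R \<longrightarrow> rigid_map (annulus a b) Y f)"

definition rigid_map_closed_disc :: "real \<Rightarrow> 'a::complete_nonarch_field ppoint set \<Rightarrow>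
    ('a \<Rightarrow> 'a ppoint) \<Rightarrow> bool" where
  "rigid_map_closed_disc R Y f \<longleftrightarrow> (\<forall>b. b \<noteq> 0 \<and> absv b \<le> R \<longrightarrow> rigid_map (disc b) Y f)"

definition nonarch_deriv :: "('a::complete_nonarch_field \<Rightarrow> 'a) \<Rightarrow> 'a \<Rightarrow> 'a" where
  "nonarch_deriv h \<xi> = Lim (at \<xi>) (\<lambda>\<eta>. (h \<eta> - h \<xi>) / (\<eta> - \<xi>))"


section \<open>Logarithmic jet differentials\<close>

text \<open>
  A local expression of a twisted logarithmic jet differential: an affinoid \<open>dom\<close>, the index
  \<open>triv\<close> of a trivialization of the line bundle over it, local coordinates \<open>z\<^sub>0, \<dots>, z\<^sub>n\<^sub>-\<^sub>1\<close> for
  which \<open>D\<close> is \<open>z\<^sub>0 \<cdots> z\<^sub>l\<^sub>-\<^sub>1 = 0\<close> with \<open>l = nlog\<close>, and the coefficients of a polynomial in the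
  symbols indexed by \<open>(j, i)\<close>, where \<open>(j, i)\<close> stands for \<open>d\<^sup>j log z\<^sub>i\<close> if \<open>i < l\<close> and for
  \<open>d\<^sup>j z\<^sub>i\<close> otherwise.
\<close>

record (overloaded) 'a jet_expression =
  dom :: "('a::field ppoint, 'a) affinoid"
  triv :: nat
  coords :: "('a ppoint \<Rightarrow> 'a) list"
  nlog :: nat
  coeffs :: "((nat \<times> nat) \<Rightarrow>\<^sub>0 nat) \<Rightarrow> 'a ppoint \<Rightarrow> 'a"

text \<open>The monomials of weight \<open>m\<close> in the symbols \<open>(j, i)\<close>, \<open>1 \<le> j \<le> k\<close>, \<open>i < n\<close>, of weight \<open>j\<close>.\<close>

definition jet_monomials :: "nat \<Rightarrow> nat \<Rightarrow> nat \<Rightarrow> ((nat \<times> nat) \<Rightarrow>\<^sub>0 nat) set" where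
  "jet_monomials n k m = {\<nu>. Poly_Mapping.keys \<nu> \<subseteq> {1..k} \<times> {..<n} \<and>
     (\<Sum>(j, i)\<in>Poly_Mapping.keys \<nu>. j * Poly_Mapping.lookup \<nu> (j, i)) = m}"

definition log_jet_expression :: "nat \<Rightarrow> 'a::complete_nonarch_field ppoint set \<Rightarrow>
    'a ppoint set \<Rightarrow> nat \<Rightarrow> nat \<Rightarrow> 'a jet_expression \<Rightarrow> bool" where
  "log_jet_expression N X D k m \<omega> \<longleftrightarrow> dom \<omega> \<in> affinoids N X \<and>
     set (coords \<omega>) \<subseteq> analytic_functions (dom \<omega>) \<and>
     (\<forall>p\<in>fst (dom \<omega>). regular_parameters (variety_dim X) (rigid_nbhds N X p) p (coords \<omega>)) \<and>
     nlog \<omega> \<le> variety_dim X \<and>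
     fst (dom \<omega>) \<inter> D = {p\<in>fst (dom \<omega>). (\<Prod>i<nlog \<omega>. (coords \<omega> ! i) p) = 0} \<and>
     (\<forall>\<nu>\<in>jet_monomials (variety_dim X) k m. coeffs \<omega> \<nu> \<in> analytic_functions (dom \<omega>))"

text \<open>The value of the symbol \<open>(j, i)\<close>, \<open>j \<ge> 1\<close>, along a curve \<open>\<gamma>\<close> at the parameter \<open>\<xi>\<close>.\<close>

definition jet_symbol :: "'a::complete_nonarch_field jet_expression \<Rightarrow> ('a \<Rightarrow> 'a ppoint) \<Rightarrow>
    nat \<Rightarrow> nat \<Rightarrow> 'a \<Rightarrow> 'a" where
  "jet_symbol \<omega> \<gamma> j i =
     (let h = (coords \<omega> ! i) \<circ> \<gamma> in
      if i < nlog \<omega> then (nonarch_deriv ^^ (j - 1)) (\<lambda>\<xi>. nonarch_deriv h \<xi> / h \<xi>)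
      else (nonarch_deriv ^^ j) h)"

text \<open>The coefficient of \<open>(d\<xi>)\<^sup>m\<close> in \<open>\<gamma>\<^sup>*\<omega>\<close>, computed with the trivialization \<open>triv \<omega>\<close>.\<close>

definition jet_pullback :: "nat \<Rightarrow> nat \<Rightarrow> nat \<Rightarrow> 'a::complete_nonarch_field jet_expression \<Rightarrow>
    ('a \<Rightarrow> 'a ppoint) \<Rightarrow> 'a \<Rightarrow> 'a" where
  "jet_pullback n k m \<omega> \<gamma> \<xi> = (\<Sum>\<nu>\<in>jet_monomials n k m. coeffs \<omega> \<nu> (\<gamma> \<xi>) *
     (\<Prod>(j, i)\<in>Poly_Mapping.keys \<nu>. jet_symbol \<omega> \<gamma> j i \<xi> ^ Poly_Mapping.lookup \<nu> (j, i)))"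

text \<open>
  Global sections of the logarithmic Green--Griffiths bundle of order \<open>k\<close> and weight \<open>m\<close> twisted by
  the inverse of the line bundle \<open>(Vs, g)\<close>: finite families of local expressions over an admissible
  covering that glue. A jet differential is a function on \<open>k\<close>-jets of germs of curves, so two local
  expressions define the same one when they agree along every germ of a curve in
  the complement of \<open>D\<close> (\<open>X\<close> is nonsingular, so every jet comes from a germ; the complement of \<open>D\<close>
  is dense, and over it the logarithmic symbols and the ordinary ones determine each other by the
  formula of Faa di Bruno). The transition functions of the dual bundle are \<open>1 / g\<close>.
\<close>

definition log_jet_section :: "nat \<Rightarrow> 'a::complete_nonarch_field ppoint set \<Rightarrow> 'a ppoint set \<Rightarrow>
    nat \<Rightarrow> nat \<Rightarrow> 'a ppoint set list \<Rightarrow> (nat \<Rightarrow> nat \<Rightarrow> 'a ppoint \<Rightarrow> 'a) \<Rightarrow>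
    'a jet_expression set \<Rightarrow> bool" where
  "log_jet_section N X D k m Vs g \<Omega> \<longleftrightarrow> finite \<Omega> \<and> (\<Union>\<omega>\<in>\<Omega>. fst (dom \<omega>)) = X \<and>
     (\<forall>\<omega>\<in>\<Omega>. log_jet_expression N X D k m \<omega> \<and>
        triv \<omega> < length Vs \<and> fst (dom \<omega>) \<subseteq> Vs ! triv \<omega>) \<and>
     (\<forall>\<omega>\<in>\<Omega>. \<forall>\<omega>'\<in>\<Omega>. \<forall>b \<gamma>. b \<noteq> 0 \<and> rigid_map (disc b) (X - D) \<gamma> \<and>
        \<gamma> 0 \<in> fst (dom \<omega>) \<inter> fst (dom \<omega>') \<longrightarrow>
        jet_pullback (variety_dim X) k m \<omega> \<gamma> 0 =
          inverse (g (triv \<omega>) (triv \<omega>') (\<gamma> 0)) * jet_pullback (variety_dim X) k m \<omega>' \<gamma> 0)"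

definition pullback_nonzero :: "'a::complete_nonarch_field ppoint set \<Rightarrow> nat \<Rightarrow> nat \<Rightarrow>
    'a jet_expression set \<Rightarrow> real \<Rightarrow> ('a \<Rightarrow> 'a ppoint) \<Rightarrow> bool" where
  "pullback_nonzero X k m \<Omega> R f \<longleftrightarrow> (\<exists>\<omega>\<in>\<Omega>. \<exists>\<xi>. 0 < absv \<xi> \<and> absv \<xi> \<le> R \<and>
     f \<xi> \<in> fst (dom \<omega>) \<and> jet_pullback (variety_dim X) k m \<omega> f \<xi> \<noteq> 0)"

end

theory Submission
  imports Defs
begin

text \<open>
  Let \<open>s\<^sub>0, \<dots>, s\<^sub>M\<close> be sections of the \<open>d\<close>-th power of the line bundle that define a closed immersion
  \<open>\<phi>\<close>. The products \<open>G\<^sub>r\<close> of \<open>s\<^sub>r\<close> with the \<open>d\<close>-th power of the pulled back jet differential are scalar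
  functions on the punctured disc, and \<open>\<phi> \<circ> f = [G\<^sub>0 : \<dots> : G\<^sub>M]\<close> wherever the pullback does not vanish.
  On the open residue discs that meet no exceptional point, the ultrametric Cauchy estimates bound the
  \<open>j\<close>-th derivative of a coordinate by a constant times \<open>1 / |z|\<^sup>j\<close>; the same holds for logarithmic
  derivatives, because a function without zeros has constant absolute value on such a disc. Hence
  \<open>z\<^sup>m\<^sup>d G\<^sub>r\<close> is bounded at the generic points of every circle, and by the maximum principle everywhere, so
  it is a power series. Cancelling the common power of \<open>z\<close> extends \<open>\<phi> \<circ> f\<close>, and therefore \<open>f\<close>, over \<open>0\<close>.

  Analytic functions on affinoids are uniform limits of polynomials in the generators, and the
  Nullstellensatz for Tate algebras bounds functions without common zeros from below. Gluing is
  replaced by the maximum principle for functions on an annulus that are analytic on the members of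
  a finite covering.
\<close>


section \<open>The absolute value\<close>

text \<open>A rigid map on a punctured disc may have an essential singularity at 0, so everything
  rests on one growth estimate and on its exponent. A generic \<open>z\<close> is the centre of an
  open disc of radius exactly \<open>|z|\<close> inside one member of the covering. Every point of
  such a disc is again a centre, so iterated derivatives cost a factor \<open>1 / |z|\<close> each,
  with no shrinking of the disc and no factorials, and the weights of a monomial add up to
  \<open>m\<close>. Ampleness is used twice: the inverse twist is cancelled by sections of the
  bundle, and these sections are numerous enough to recover the map. Two obstacles shape the rest.
  The estimate says nothing on finitely many residue discs of each circle, so the maximum principle
  must allow finite exceptional sets on the boundary. And functions are known only on the members of
  finite coverings, where no Laurent series is at hand. The maximum principle is therefore proved
  from the covering itself by following Gauss norms; applied to difference quotients it yields a
  Schwarz lemma on the punctured disc, from which the power series is built one coefficient at a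
  time.\<close>

lemma absv_zero [simp]: "absv (0::'a::complete_nonarch_field) = 0"
  using dist_absv[of 0 "0::'a"] by simp

lemma absv_nonneg [simp]: "0 <= absv (x::'a::complete_nonarch_field)"
  using dist_absv[of x 0] by (metis diff_zero zero_le_dist)

lemma absv_eq_0_iff [simp]: "absv (x::'a::complete_nonarch_field) = 0 \<longleftrightarrow> x = 0"
  using dist_absv[of x 0] by (metis diff_zero dist_eq_0_iff)

lemma absv_pos_iff [simp]: "0 < absv (x::'a::complete_nonarch_field) \<longleftrightarrow> x ~= 0"
  using absv_nonneg[of x] absv_eq_0_iff[of x] by linarith

lemma absv_le_0_iff [simp]: "absv (x::'a::complete_nonarch_field) <= 0 \<longleftrightarrow> x = 0"
  using absv_nonneg[of x] absv_eq_0_iff[of x] by linarith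

lemma absv_one [simp]: "absv (1::'a::complete_nonarch_field) = 1"
  using absv_mult[of 1 "1::'a"] absv_eq_0_iff[of "1::'a"] by simp

lemma absv_commute: "absv (x - y) = absv (y - (x::'a::complete_nonarch_field))"
  by (metis dist_absv dist_commute)

lemma absv_uminus [simp]: "absv (- x) = absv (x::'a::complete_nonarch_field)"
  using absv_commute[of 0 x] by simp

lemma absv_inverse: "absv (inverse x) = inverse (absv (x::'a::complete_nonarch_field))"
proof (cases "x = 0")
  case False
  then have "absv x * absv (inverse x) = 1" by (metis absv_mult absv_one right_inverse)
  then show ?thesis by (metis inverse_unique)
qed simp

lemma absv_divide: "absv (x / y) = absv x / absv (y::'a::complete_nonarch_field)"
  by (simp add: divide_inverse absv_mult absv_inverse)

lemma absv_power: "absv (x ^ n) = absv (x::'a::complete_nonarch_field) ^ n"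
  by (induction n) (auto simp: absv_mult)

lemma absv_prod: "absv (prod f A) = (\<Prod>i\<in>A. absv (f i :: 'a::complete_nonarch_field))"
  by (induction A rule: infinite_finite_induct) (auto simp: absv_mult)

lemma absv_diff_le: "absv (x - y) <= max (absv x) (absv (y::'a::complete_nonarch_field))"
  using absv_add_le[of x "-y"] by simp

lemma absv_add_le': "absv x <= B ==> absv y <= B ==> absv (x + y::'a::complete_nonarch_field) <= B"
  using absv_add_le[of x y] by linarith

lemma absv_diff_le': "absv x <= B ==> absv y <= B ==> absv (x - y::'a::complete_nonarch_field) <= B"
  using absv_diff_le[of x y] by linarith

lemma absv_diff_less': "absv x < B ==> absv y < B ==> absv (x - y::'a::complete_nonarch_field) < B"
  using absv_diff_le[of x y] by linarith

lemma absv_triangle: "absv (x - z) <= max (absv (x - y)) (absv (y - (z::'a::complete_nonarch_field)))"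
  using absv_add_le[of "x - y" "y - z"] by simp

text \<open>Ultrametric triangles are isosceles; approximation arguments transfer absolute values
  through this.\<close>

lemma absv_eq_of_diff_less:
  "absv (x - y) < absv y ==> absv x = absv (y::'a::complete_nonarch_field)"
  using absv_add_le[of "x - y" y] absv_diff_le[of x "x - y"] by auto

lemma absv_eq_of_diff_less':
  "absv (x - y) < absv x ==> absv x = absv (y::'a::complete_nonarch_field)"
  by (metis absv_commute absv_eq_of_diff_less)

lemma absv_sum_le:
  "(!!i. i : A ==> absv (f i :: 'a::complete_nonarch_field) <= B) ==> 0 <= B ==> absv (sum f A) <= B"
  by (induction A rule: infinite_finite_induct) (auto intro: absv_add_le')

text \<open>When \<open>s0\<close> is nearest to \<open>z\<close> among finitely many points, each
  of them sees \<open>z\<close> as a generic point of the disc of radius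
  \<open>absv (z - s0)\<close> around \<open>s0\<close>. In this way an arbitrary point is placed at
  a Gauss point with centre in a finite set.\<close>

lemma absv_ultra_eq:
  assumes "absv (z - s0) <= absv (z - s)"
  shows "absv (z - s) = max (absv (s0 - s)) (absv (z - (s0::'a::complete_nonarch_field)))"
  using assms absv_triangle[of z s s0] absv_triangle[of s0 s z] absv_commute[of s0 z] by linarith

lemma absv_big: "EX t::'a::complete_nonarch_field. absv t > 1"
proof -
  obtain x :: 'a where x: "x ~= 0" "absv x ~= 1" using absv_nontrivial by auto
  show ?thesis
  proof (cases "absv x > 1")
    case False
    with x have "absv (inverse x) > 1" by (simp add: absv_inverse one_less_inverse_iff)
    then show ?thesis by blast
  qed blast
qed

lemma absv_small:
  assumes "0 < (e::real)"
  shows "EX c::'a::complete_nonarch_field. c ~= 0 & absv c < e"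
proof -
  obtain t :: 'a where t: "absv t > 1" using absv_big by blast
  obtain n where "1 / e < absv t ^ n" using real_arch_pow[OF t] by blast
  then have "absv (inverse (t ^ n)) < e"
    using assms t zero_less_power[of "absv t" n] by (simp add: absv_divide absv_inverse absv_power divide_simps mult.commute)
  moreover have "inverse (t ^ n) ~= 0" using t by auto
  ultimately show ?thesis by blast
qed

text \<open>The value group is nontrivial, and it is divisible because the field contains all roots;
  hence it is dense.\<close>

lemma absv_dense:
  assumes "0 <= al" "al < (be::real)"
  shows "EX c::'a::complete_nonarch_field. al < absv c & absv c < be"
proof (cases "al = 0")
  case True
  then show ?thesis using absv_small[of be] assms by (metis absv_pos_iff)
next
  case False
  with assms have al: "al > 0" by simp
  obtain t :: 'a where t: "absv t > 1" using absv_big by blast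
  have "be / al > 1" using al assms by simp
  \<comment> \<open>With \<open>n\<close> this large an \<open>n\<close>-th root \<open>s\<close> of
    \<open>t\<close> satisfies \<open>1 < absv s < be / al\<close>, so multiplication by
    \<open>s\<close> cannot jump over the interval from \<open>al\<close> to
    \<open>be\<close>.\<close>
  then obtain n where n: "absv t < (be / al) ^ n" using real_arch_pow by blast
  have "n > 0" using n t by (cases n) auto
  then obtain s where s: "s ^ n = t" using nth_root_exists[of n t] by blast
  then have sn: "absv s ^ n = absv t" by (metis absv_power)
  have s1: "absv s > 1"
  proof (rule ccontr)
    assume "\<not> absv s > 1"
    then have "absv s ^ n <= 1" by (simp add: power_le_one)
    then show False using sn t by simp
  qed
  have s2: "absv s < be / al"
    using sn n power_less_imp_less_base[of "absv s" n "be / al"] al assms by (simp add: less_imp_le)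
  obtain c0 :: 'a where c0: "c0 ~= 0" "absv c0 < al" using absv_small[OF al] by blast
  obtain k0 where "al / absv c0 < absv s ^ k0" using real_arch_pow[OF s1] by blast
  then have ex: "al < absv c0 * absv s ^ k0" using c0 by (simp add: field_simps)
  define k where "k = (LEAST k. al < absv c0 * absv s ^ k)"
  have k: "al < absv c0 * absv s ^ k" unfolding k_def by (rule LeastI, rule ex)
  have "k ~= 0" using k c0 by (metis mult.right_neutral not_less_iff_gr_or_eq power_0)
  then obtain k' where k': "k = Suc k'" by (cases k) auto
  have "absv c0 * absv s ^ k' <= al"
    using not_less_Least[of k' "%k. al < absv c0 * absv s ^ k"] k' unfolding k_def by simp
  then have "absv c0 * absv s ^ k <= al * absv s"
    using s1 mult_right_mono[of "absv c0 * absv s ^ k'" al "absv s"] unfolding k' by (simp add: mult_ac)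
  also have "\<dots> < be" using s2 al by (simp add: field_simps)
  finally have "absv (c0 * s ^ k) < be" by (simp add: absv_mult absv_power)
  moreover have "al < absv (c0 * s ^ k)" using k by (simp add: absv_mult absv_power)
  ultimately show ?thesis by blast
qed

lemma complete_limit:
  fixes X :: "nat \<Rightarrow> 'a::complete_nonarch_field"
  assumes "!!e. e > 0 ==> EX N. ALL m>=N. ALL n>=N. absv (X m - X n) < e"
  obtains L where "X \<longlonglongrightarrow> L"
proof -
  have "Cauchy X" unfolding Cauchy_def dist_absv using assms by blast
  then have "convergent X" by (rule Cauchy_convergent)
  then show ?thesis using that by (auto simp: convergent_def)
qed

lemma absv_le_of_tendsto:
  fixes X :: "nat \<Rightarrow> 'a::complete_nonarch_field"
  assumes "X \<longlonglongrightarrow> L" "!!n. n \<ge> N ==> absv (X n - a) <= B"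
  shows "absv (L - a) <= B"
proof -
  have B: "0 <= B" using assms(2)[of N] absv_nonneg[of "X N - a"] by linarith
  show ?thesis
  proof (rule field_le_epsilon)
    fix e :: real assume "e > 0"
    then obtain M where "ALL n>=M. dist (X n) L < e" using assms(1) by (meson lim_sequentially)
    then have "absv (X (max M N) - L) < e" by (simp add: dist_absv)
    then show "absv (L - a) <= B + e"
      using assms(2)[of "max M N"] absv_triangle[of L a "X (max M N)"] absv_commute[of L "X (max M N)"] B \<open>e>0\<close>
      by auto
  qed
qed

section \<open>Generic points and Gauss norms of polynomials\<close>

text \<open>At a root \<open>z\<close> of \<open>q + 1\<close>, where \<open>q\<close> is the
  product of the factors \<open>X - s\<close>, the product of all \<open>absv (z - s)\<close> is 1.
  No factor exceeds 1, so none is smaller. This is the infinitude of the residue field, expressed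
  without that field.\<close>

lemma generic_unit:
  fixes S :: "'a::complete_nonarch_field set"
  assumes "finite S"
  shows "EX z. absv z = 1 & (ALL s:S. absv s <= 1 --> absv (z - s) = 1)"
proof -
  \<comment> \<open>The point 0 forces \<open>absv z = 1\<close> and keeps \<open>q\<close> from
    being constant.\<close>
  define S' where "S' = insert 0 {s : S. absv s <= 1}"
  have fin: "finite S'" using assms by (simp add: S'_def)
  have S'1: "absv s <= 1" if "s : S'" for s using that by (auto simp: S'_def)
  define q :: "'a poly" where "q = (\<Prod>s\<in>S'. [:-s, 1:])"
  have dq: "degree q = card S'" unfolding q_def
    by (subst degree_prod_eq_sum_degree) auto
  have "card S' > 0" using fin by (auto simp: card_gt_0_iff S'_def)
  then have "degree (q + 1) > 0"
    using dq by (subst degree_add_eq_left) auto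
  then obtain z where "poly (q + 1) z = 0" using alg_closed_imp_poly_has_root by blast
  then have pz: "(\<Prod>s\<in>S'. z - s) = -1"
    by (simp add: q_def poly_prod eq_neg_iff_add_eq_0)
  then have az: "(\<Prod>s\<in>S'. absv (z - s)) = 1"
    by (metis absv_prod absv_uminus absv_one)
  have z1: "absv z <= 1"
  proof (rule ccontr)
    assume z: "\<not> absv z <= 1"
    have "absv (z - s) = absv z" if "s : S'" for s
      using S'1[OF that] z absv_eq_of_diff_less[of "z - s" z] by simp
    then have "(\<Prod>s\<in>S'. absv (z - s)) = absv z ^ card S'" by simp
    then show False using az z one_less_power[of "absv z" "card S'"] \<open>card S' > 0\<close> by simp
  qed
  have le: "absv (z - s) <= 1" if "s : S'" for s using S'1[OF that] z1 absv_diff_le' by blast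
  have "absv (z - s) = 1" if "s : S'" for s
  proof -
    have "1 = absv (z - s) * (\<Prod>s\<in>S'-{s}. absv (z - s))"
      using az prod.remove[OF fin that, of "%s. absv (z - s)"] by simp
    also have "\<dots> <= absv (z - s) * 1"
      by (intro mult_left_mono prod_le_1) (use le in auto)
    finally show ?thesis using le[OF that] by simp
  qed
  from this[of 0] this show ?thesis by (intro exI[of _ z]) (auto simp: S'_def)
qed

text \<open>At such a \<open>z\<close> every polynomial with zeros in \<open>S\<close> takes the
  absolute value that it has at the Gauss point of the disc of radius \<open>absv c\<close> around
  \<open>w\<close>; statements about Gauss norms are proved by evaluating there.\<close>

lemma generic_point:
  fixes S :: "'a::complete_nonarch_field set"
  assumes "finite S"
  shows "EX z. absv (z - w) = absv (c::'a) & (ALL s:S. absv (z - s) = max (absv (w - s)) (absv c))"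
proof (cases "c = 0")
  case True
  then show ?thesis by (intro exI[of _ w]) auto
next
  case False
  obtain u where u: "absv u = 1" "!!s. s : S ==> absv ((s - w) / c) <= 1 ==> absv (u - (s - w) / c) = 1"
    using generic_unit[of "(%s. (s - w) / c) ` S"] assms by auto
  have "absv (w + c * u - s) = max (absv (w - s)) (absv c)" if s: "s : S" for s
  proof (cases "absv ((s - w) / c) <= 1")
    case True
    have "w + c * u - s = c * (u - (s - w) / c)" using False by (simp add: field_simps)
    then have "absv (w + c * u - s) = absv c" using u(2)[OF s True] by (simp add: absv_mult)
    moreover have "absv (w - s) <= absv c"
      using True False by (simp add: absv_divide absv_commute[of w] field_simps)
    ultimately show ?thesis by simp
  next
    case c: False
    then have "absv c < absv (w - s)"
      using False by (simp add: absv_divide absv_commute[of w] field_simps)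
    moreover have "absv (w + c * u - s) = absv (w - s)"
      using calculation u(1) by (intro absv_eq_of_diff_less) (simp add: absv_mult)
    ultimately show ?thesis by simp
  qed
  then show ?thesis using u(1) by (intro exI[of _ "w + c * u"]) (auto simp: absv_mult)
qed

lemma absv_prod_mset: "absv (\<Prod>x\<in>#A. f x) = (\<Prod>x\<in>#A. absv (f x :: 'a::complete_nonarch_field))"
  by (induction A) (auto simp: absv_mult)

lemma proots_linear_prod: "proots (\<Prod>x\<in>#A. [:-x, 1:]) = (A :: 'a::idom multiset)"
proof (induction A)
  case (add x A)
  have "(\<Prod>x\<in>#A. [:-x, 1:]) ~= (0::'a poly)" by (auto simp: prod_mset_zero_iff)
  then show ?case using add
    by (simp add: proots_mult del: mult_pCons_left)
qed simp

lemma poly_prod_mset': "poly (\<Prod>x\<in>#A. f x) z = (\<Prod>x\<in>#A. poly (f x) (z::'a::comm_ring_1))"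
  by (induction A) auto

lemma poly_roots_prod:
  fixes p :: "'a::alg_closed_field poly"
  shows "poly p z = lead_coeff p * (\<Prod>x\<in>#proots p. z - x)"
proof (cases "p = 0")
  case False
  obtain A where A: "p = smult (lead_coeff p) (\<Prod>x\<in>#A. [:-x, 1:])"
    using alg_closed_imp_factorization[OF False] by blast
  have "proots p = A" using proots_linear_prod[of A] False
    by (subst A) (simp add: proots_smult)
  moreover have "poly p z = lead_coeff p * (\<Prod>x\<in>#A. z - x)"
    by (subst A) (simp add: poly_prod_mset')
  ultimately show ?thesis by simp
qed simp

lemma poly_factor:
  fixes p :: "'a::alg_closed_field poly"
  shows "p = smult (lead_coeff p) (\<Prod>x\<in>#proots p. [:-x, 1:])"
proof (cases "p = 0")
  case False
  obtain A where A: "p = smult (lead_coeff p) (\<Prod>x\<in>#A. [:-x, 1:])"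
    using alg_closed_imp_factorization[OF False] by blast
  have "proots p = A" using proots_linear_prod[of A] False
    by (subst A) (simp add: proots_smult)
  then show ?thesis using A by simp
qed simp

text \<open>The Gauss norm of the disc with centre \<open>w\<close> and radius
  \<open>\<rho>\<close>, expressed through zeros instead of coefficients: it is visibly
  multiplicative, its logarithmic slope in the radius counts zeros, and the radius may lie outside
  the value group.\<close>

definition gnorm :: "'a::complete_nonarch_field poly \<Rightarrow> 'a \<Rightarrow> real \<Rightarrow> real" where
  "gnorm p w \<rho> = absv (lead_coeff p) * (\<Prod>x\<in>#proots p. max (absv (w - x)) \<rho>)"

lemma gnorm_generic:
  assumes "!!s. poly p s = 0 ==> absv (z - s) = max (absv (w - s)) r"
  shows "absv (poly p z) = gnorm p w r"
proof (cases "p = 0")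
  case False
  have "absv (poly p z) = absv (lead_coeff p) * (\<Prod>x\<in>#proots p. absv (z - x))"
    by (subst poly_roots_prod) (simp add: absv_mult absv_prod_mset)
  also have "(\<Prod>x\<in>#proots p. absv (z - x)) = (\<Prod>x\<in>#proots p. max (absv (w - x)) r)"
    by (intro arg_cong[where f = prod_mset] image_mset_cong) (use assms False in auto)
  finally show ?thesis by (simp add: gnorm_def)
qed (simp add: gnorm_def)

lemma coeff_linear_prod_le:
  fixes A :: "'a::complete_nonarch_field multiset"
  shows "absv (coeff (\<Prod>x\<in>#A. [:-x, 1:]) k) <= (\<Prod>x\<in>#A. max (absv (0 - x)) 1)"
proof (induction A arbitrary: k)
  case empty
  then show ?case by (cases k) auto
next
  case (add x A)
  let ?q = "\<Prod>x\<in>#A. [:-x, 1:]" and ?M = "\<Prod>x\<in>#A. max (absv (0 - x)) 1"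
  have M: "0 <= ?M" using add[of 0] absv_nonneg order_trans by blast
  have a: "absv (x * coeff ?q k) <= max (absv (0 - x)) 1 * ?M"
    unfolding absv_mult by (intro mult_mono) (use add M in auto)
  have b: "absv (coeff ?q j) <= max (absv (0 - x)) 1 * ?M" for j
    using mult_mono[of 1 "max (absv (0 - x)) 1" "absv (coeff ?q j)" ?M] add[of j] M by auto
  have "coeff ([:-x, 1:] * ?q) k = (case k of 0 \<Rightarrow> 0 | Suc j \<Rightarrow> coeff ?q j) - x * coeff ?q k"
    by (auto split: nat.split)
  also have "absv \<dots> <= max (absv (0 - x)) 1 * ?M"
    using a b M by (intro absv_diff_le') (auto split: nat.split)
  finally show ?case by simp
qed

text \<open>Gauss's lemma: the coefficients are bounded by the product over the zeros, and a generic
  unit attains this product.\<close>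

lemma poly_max_coeff:
  fixes p :: "'a::complete_nonarch_field poly"
  shows "EX z. absv z = 1 & (ALL k. absv (coeff p k) <= absv (poly p z))"
proof (cases "p = 0")
  case True
  then show ?thesis by (intro exI[of _ 1]) simp
next
  case False
  obtain z :: 'a where z: "absv (z - 0) = absv (1::'a)"
      "ALL s:{s. poly p s = 0}. absv (z - s) = max (absv (0 - s)) (absv (1::'a))"
    using generic_point[OF poly_roots_finite[OF False], of 0 1] by blast
  have "absv (coeff p k) <= absv (poly p z)" for k
  proof -
    have "coeff p k = lead_coeff p * coeff (\<Prod>x\<in>#proots p. [:-x, 1:]) k"
      by (subst poly_factor) simp
    then have "absv (coeff p k) <= gnorm p 0 1"
      unfolding gnorm_def by (simp add: absv_mult mult_left_mono coeff_linear_prod_le[of "proots p" k, simplified])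
    also have "\<dots> = absv (poly p z)" using gnorm_generic[of p z 0 1] z by simp
    finally show ?thesis .
  qed
  with z show ?thesis by (intro exI[of _ z]) simp
qed

lemma coeff_le_sup:
  fixes p :: "'a::complete_nonarch_field poly"
  assumes "!!x. absv x <= 1 ==> absv (poly p x) <= B"
  shows "absv (coeff p k) <= B"
  using poly_max_coeff[of p] assms by (metis order_refl order_trans)

lemma coeff_le_sup_sum:
  fixes g :: "nat \<Rightarrow> 'a::complete_nonarch_field"
  assumes "!!x. absv x <= 1 ==> absv (\<Sum>k\<le>K. g k * x ^ k) <= B" "k <= K"
  shows "absv (g k) <= B"
proof -
  define p where "p = (\<Sum>k\<le>K. monom (g k) k)"
  have "coeff p k = g k" using assms(2) by (simp add: p_def coeff_sum)
  moreover have "poly p x = (\<Sum>k\<le>K. g k * x ^ k)" for x by (simp add: p_def poly_sum poly_monom)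
  ultimately show ?thesis using coeff_le_sup[of p B k] assms(1) by simp
qed

section \<open>Tate algebras as uniform closures\<close>

text \<open>Points carry infinitely many coordinates so that functions of any number of variables
  share one domain; by \<open>tate_cong\<close> a member of \<open>tate n\<close> sees only the
  first \<open>n\<close> of them.\<close>

definition polydisc :: "(nat \<Rightarrow> 'a::complete_nonarch_field) set" where
  "polydisc = {x. ALL i. absv (x i) <= 1}"

inductive_set polyfun :: "nat \<Rightarrow> ((nat \<Rightarrow> 'a::complete_nonarch_field) \<Rightarrow> 'a) set" for n where
  const: "(%x. c) : polyfun n"
| var: "i < n ==> (%x. x i) : polyfun n"
| add: "p : polyfun n ==> q : polyfun n ==> (%x. p x + q x) : polyfun n"
| mult: "p : polyfun n ==> q : polyfun n ==> (%x. p x * q x) : polyfun n"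

text \<open>The Tate algebra, as closure of the polynomials in the supremum norm; by Gauss's lemma
  this norm is the maximum of the coefficients. Values off the polydisc are unconstrained.\<close>

definition tate :: "nat \<Rightarrow> ((nat \<Rightarrow> 'a::complete_nonarch_field) \<Rightarrow> 'a) set" where
  "tate n = {h. ALL e>0. EX p:polyfun n. ALL x:polydisc. absv (h x - p x) <= e}"

lemma polydiscD: "x : polydisc ==> absv (x i) <= 1"
  by (auto simp: polydisc_def)

lemma polydisc_zero [simp]: "(%_. 0) : polydisc"
  by (simp add: polydisc_def)

lemma polydisc_upd: "x : polydisc ==> absv t <= 1 ==> x(i := t) : polydisc"
  by (auto simp: polydisc_def)

lemma polyfun_mono: "p : polyfun n ==> n <= m ==> p : polyfun m"
  by (induction rule: polyfun.induct) (auto intro: polyfun.intros)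

lemma polyfun_cong: "p : polyfun n ==> (!!i. i < n ==> x i = y i) ==> p x = p y"
  by (induction rule: polyfun.induct) auto

lemma polyfun_sum: "(!!i. i : A ==> p i : polyfun n) ==> (%x. \<Sum>i\<in>A. p i x) : polyfun n"
  by (induction A rule: infinite_finite_induct) (auto intro: polyfun.intros)

lemma polyfun_uminus: "p : polyfun n ==> (%x. - p x) : polyfun n"
  using polyfun.mult[OF polyfun.const[of "-1"], of p n] by simp

lemma polyfun_diff: "p : polyfun n ==> q : polyfun n ==> (%x. p x - q x) : polyfun n"
  using polyfun.add[OF _ polyfun_uminus, of p n q] by simp

lemma polyfun_power: "p : polyfun n ==> (%x. p x ^ k) : polyfun n"
  by (induction k) (auto intro: polyfun.intros)

lemma polyfun_prod: "(!!i. i : A ==> p i : polyfun n) ==> (%x. \<Prod>i\<in>A. p i x) : polyfun n"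
  by (induction A rule: infinite_finite_induct) (auto intro: polyfun.intros)

lemma polyfun_bounded: "p : polyfun n ==> EX B. ALL x:polydisc. absv (p x) <= B"
proof (induction rule: polyfun.induct)
  case (add p q)
  then obtain B C where "ALL x:polydisc. absv (p x) <= B" "ALL x:polydisc. absv (q x) <= C" by blast
  then show ?case by (intro exI[of _ "max B C"]) (meson absv_add_le' max.coboundedI1 max.coboundedI2)
next
  case (mult p q)
  then obtain B C where "ALL x:polydisc. absv (p x) <= B" "ALL x:polydisc. absv (q x) <= C" by blast
  then have "ALL x:polydisc. absv (p x * q x) <= B * C"
    by (auto simp: absv_mult intro!: mult_mono order_trans[OF absv_nonneg])
  then show ?case by blast
qed (auto simp: polydisc_def)

lemma polyfun_expand:
  "p : polyfun (Suc n) ==>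
     EX K g. (ALL k. g k : polyfun n) & (ALL k>K. g k = (%_. 0)) & (ALL x. p x = (\<Sum>k\<le>K. g k x * x n ^ k))"
proof (induction rule: polyfun.induct)
  case (const c)
  show ?case
    by (rule exI[of _ 0], rule exI[of _ "%k. if k = 0 then (%_. c) else (%_. 0)"]) (auto intro: polyfun.const)
next
  case (var i)
  show ?case
  proof (cases "i = n")
    case True
    show ?thesis
      by (rule exI[of _ 1], rule exI[of _ "%k. if k = 1 then (%_. 1) else (%_. 0)"])
         (auto intro: polyfun.const simp: True)
  next
    case False
    with var have "i < n" by simp
    then show ?thesis
      by (intro exI[of _ 0] exI[of _ "%k. if k = 0 then (%x. x i) else (%_. 0)"]) (auto intro: polyfun.intros)
  qed
next
  case (add p q)
  then obtain K g L h where g: "ALL k. g k : polyfun n" "ALL k>K. g k = (%_. 0)" "ALL x. p x = (\<Sum>k\<le>K. g k x * x n ^ k)"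
    and h: "ALL k. h k : polyfun n" "ALL k>L. h k = (%_. 0)" "ALL x. q x = (\<Sum>k\<le>L. h k x * x n ^ k)" by blast
  have "(\<Sum>k\<le>K. g k x * x n ^ k) = (\<Sum>k\<le>max K L. g k x * x n ^ k)" for x
    by (rule sum.mono_neutral_left) (use g in auto)
  moreover have "(\<Sum>k\<le>L. h k x * x n ^ k) = (\<Sum>k\<le>max K L. h k x * x n ^ k)" for x
    by (rule sum.mono_neutral_left) (use h in auto)
  ultimately show ?case using g h
    by (intro exI[of _ "max K L"] exI[of _ "%k x. g k x + h k x"])
       (auto intro: polyfun.intros simp: sum.distrib distrib_right)
next
  case (mult p q)
  then obtain K g L h where g: "ALL k. g k : polyfun n" "ALL k>K. g k = (%_. 0)" "ALL x. p x = (\<Sum>k\<le>K. g k x * x n ^ k)"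
    and h: "ALL k. h k : polyfun n" "ALL k>L. h k = (%_. 0)" "ALL x. q x = (\<Sum>k\<le>L. h k x * x n ^ k)" by blast
  have "p x * q x = (\<Sum>r\<le>K + L. (\<Sum>k\<le>r. g k x * h (r - k) x) * x n ^ r)" for x
    using polynomial_product[of K "%k. g k x" L "%k. h k x" "x n"] g h by simp
  moreover have "(%x. \<Sum>k\<le>r. g k x * h (r - k) x) : polyfun n" for r
    using g h by (intro polyfun_sum) (auto intro: polyfun.intros)
  moreover have "(%x. \<Sum>k\<le>r. g k x * h (r - k) x) = (%_. 0)" if "r > K + L" for r
  proof -
    have "g k x * h (r - k) x = 0" if "k <= r" for k x
      using g(2) h(2) \<open>r > K + L\<close> that by (cases "k > K") auto
    then have "(\<Sum>k\<le>r. g k x * h (r - k) x) = 0" for x by (intro sum.neutral) auto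
    then show ?thesis by blast
  qed
  ultimately show ?case
    by (intro exI[of _ "K + L"] exI[of _ "%r x. \<Sum>k\<le>r. g k x * h (r - k) x"]) auto
qed

text \<open>With the first \<open>n\<close> coordinates frozen this is the estimate in one variable,
  since the coefficients do not notice a change of coordinate \<open>n\<close>.\<close>

lemma polyfun_coeff_le:
  assumes g: "!!k. g k : polyfun n" and p: "!!x. p x = (\<Sum>k\<le>K. g k x * x n ^ k)"
    and B: "!!x. x : polydisc ==> absv (p x) <= B" and x: "x : polydisc" and k: "k <= K"
  shows "absv (g k x) <= B"
proof (rule coeff_le_sup_sum[OF _ k])
  fix t assume "absv (t::'a) <= 1"
  then have "x(n := t) : polydisc" using x by (rule polydisc_upd[rotated])
  then have "absv (p (x(n := t))) <= B" by (rule B)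
  moreover have "g k (x(n := t)) = g k x" for k by (rule polyfun_cong[OF g]) auto
  ultimately show "absv (\<Sum>k\<le>K. g k x * t ^ k) <= B" by (simp add: p)
qed

lemma tateI: "(!!e. e > 0 ==> EX p:polyfun n. ALL x:polydisc. absv (h x - p x) <= e) ==> h : tate n"
  by (auto simp: tate_def)

lemma tate_approx:
  assumes "h : tate n" "e > 0"
  obtains p where "p : polyfun n" "!!x. x : polydisc ==> absv (h x - p x) <= e"
  using assms by (auto simp: tate_def)

lemma polyfun_tate: "p : polyfun n ==> p : tate n"
  by (auto simp: tate_def intro!: bexI[of _ p])

lemma tate_const [intro!]: "(%x. c) : tate n"
  by (intro polyfun_tate polyfun.const)

lemma tate_var: "i < n ==> (%x. x i) : tate n"
  by (intro polyfun_tate polyfun.var)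

lemma tate_mono: "h : tate n ==> n <= m ==> h : tate m"
  unfolding tate_def using polyfun_mono by blast

lemma tate_closed:
  assumes "!!e. e > 0 ==> EX k:tate n. ALL x:polydisc. absv (h x - k x) <= e"
  shows "h : tate n"
proof (rule tateI)
  fix e :: real assume e: "e > 0"
  then obtain k where k: "k : tate n" "ALL x:polydisc. absv (h x - k x) <= e" using assms by blast
  obtain p where p: "p : polyfun n" "!!x. x : polydisc ==> absv (k x - p x) <= e"
    using tate_approx[OF k(1) e] by blast
  have "ALL x:polydisc. absv (h x - p x) <= e"
    using k(2) p(2) absv_triangle[of "h _" "p _" "k _"] by (meson max.bounded_iff order_trans)
  with p(1) show "EX p:polyfun n. ALL x:polydisc. absv (h x - p x) <= e" by blast
qed

lemma tate_ext: "h : tate n ==> (!!x. x : polydisc ==> h' x = h x) ==> h' : tate n"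
  by (rule tate_closed, rule bexI[of _ h]) auto

lemma tate_bounded:
  assumes "h : tate n" shows "EX B>0. ALL x:polydisc. absv (h x) <= B"
proof -
  obtain p where p: "p : polyfun n" "!!x. x : polydisc ==> absv (h x - p x) <= 1"
    using tate_approx[OF assms, of 1] by auto
  obtain B where B: "ALL x:polydisc. absv (p x) <= B" using polyfun_bounded[OF p(1)] by blast
  have "absv (h x) <= max B 1" if "x : polydisc" for x
    using absv_add_le[of "h x - p x" "p x"] p(2)[OF that] B that by fastforce
  then show ?thesis by (intro exI[of _ "max B 1"]) auto
qed

lemma tate_cong:
  assumes h: "h : tate n" and "!!i. i < n ==> x i = y i" "x : polydisc" "y : polydisc"
  shows "h x = h y"
proof -
  have "absv (h x - h y) <= 0 + e" if e: "e > 0" for e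
  proof -
    obtain p where p: "p : polyfun n" "!!x. x : polydisc ==> absv (h x - p x) <= e"
      using tate_approx[OF h e] by blast
    have "p x = p y" by (rule polyfun_cong[OF p(1)]) (use assms in auto)
    then show ?thesis using absv_triangle[of "h x" "h y" "p x"] p(2)[of x] p(2)[of y] assms
      by (simp add: absv_commute[of "p y"])
  qed
  then have "absv (h x - h y) <= 0" by (rule field_le_epsilon)
  then show ?thesis by simp
qed

lemma tate_add:
  assumes "h : tate n" "k : tate n" shows "(%x. h x + k x) : tate n"
proof (rule tateI)
  fix e :: real assume e: "e > 0"
  obtain p where p: "p : polyfun n" "!!x. x : polydisc ==> absv (h x - p x) <= e"
    using tate_approx[OF assms(1) e] by blast
  obtain q where q: "q : polyfun n" "!!x. x : polydisc ==> absv (k x - q x) <= e"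
    using tate_approx[OF assms(2) e] by blast
  show "EX p:polyfun n. ALL x:polydisc. absv (h x + k x - p x) <= e"
    using p q by (intro bexI[of _ "%x. p x + q x"]) (auto intro!: polyfun.add absv_add_le' simp: add_diff_add)
qed

lemma absv_mult_diff_le:
  assumes "absv (a - b) <= e" "absv (c - d) <= e'" "absv c <= C" "absv b <= B" "0 <= C" "0 <= B"
  shows "absv (a * c - b * (d::'a::complete_nonarch_field)) <= max (e * C) (B * e')"
proof -
  have "a * c - b * d = (a - b) * c + b * (c - d)" by (simp add: algebra_simps)
  moreover have "absv ((a - b) * c) <= e * C" unfolding absv_mult
    using assms by (intro mult_mono) (auto intro: order_trans[OF absv_nonneg])
  moreover have "absv (b * (c - d)) <= B * e'" unfolding absv_mult
    using assms by (intro mult_mono) (auto intro: order_trans[OF absv_nonneg])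
  ultimately show ?thesis using absv_add_le[of "(a-b)*c" "b*(c-d)"] by auto
qed

lemma tate_mult:
  assumes "h : tate n" "k : tate n" shows "(%x. h x * k x) : tate n"
proof (rule tateI)
  fix e :: real assume e: "e > 0"
  obtain B where B: "B > 0" "!!x. x : polydisc ==> absv (k x) <= B" using tate_bounded[OF assms(2)] by blast
  obtain p where p: "p : polyfun n" "!!x. x : polydisc ==> absv (h x - p x) <= e / B"
    using tate_approx[OF assms(1), of "e / B"] e B(1) by auto
  obtain C where C: "C > 0" "!!x. x : polydisc ==> absv (p x) <= C" using tate_bounded[OF polyfun_tate[OF p(1)]] by blast
  obtain q where q: "q : polyfun n" "!!x. x : polydisc ==> absv (k x - q x) <= e / C"
    using tate_approx[OF assms(2), of "e / C"] e C(1) by auto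
  have "absv (h x * k x - p x * q x) <= e" if x: "x : polydisc" for x
    using absv_mult_diff_le[OF p(2)[OF x] q(2)[OF x] B(2)[OF x] C(2)[OF x]] B(1) C(1) by simp
  then show "EX p:polyfun n. ALL x:polydisc. absv (h x * k x - p x) <= e"
    using p q by (intro bexI[of _ "%x. p x * q x"]) (auto intro!: polyfun.mult)
qed

lemma tate_uminus: "h : tate n ==> (%x. - h x) : tate n"
  using tate_mult[OF tate_const[of "-1"], of h n] by simp

lemma tate_diff: "h : tate n ==> k : tate n ==> (%x. h x - k x) : tate n"
  using tate_add[OF _ tate_uminus, of h n k] by simp

lemma tate_sum: "(!!i. i : A ==> h i : tate n) ==> (%x. \<Sum>i\<in>A. h i x) : tate n"
  by (induction A rule: infinite_finite_induct) (auto intro: tate_add)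

lemma tate_power: "h : tate n ==> (%x. h x ^ k) : tate n"
  by (induction k) (auto intro: tate_mult)

lemma tate_prod: "(!!i. i : A ==> h i : tate n) ==> (%x. \<Prod>i\<in>A. h i x) : tate n"
  by (induction A rule: infinite_finite_induct) (auto intro: tate_mult)

section \<open>Completeness of the Tate algebras\<close>

lemma uniform_limit_exists:
  fixes S :: "nat \<Rightarrow> 'b \<Rightarrow> 'a::complete_nonarch_field" and e :: "nat \<Rightarrow> real"
  assumes c: "!!m n x. x : D ==> n <= m ==> absv (S m x - S n x) <= e n" and e: "e \<longlonglongrightarrow> 0"
  shows "EX H. ALL x:D. ALL n. absv (H x - S n x) <= e n"
proof -
  have "EX L. ALL n. absv (L - S n x) <= e n" if x: "x : D" for x
  proof -
    obtain L where L: "(%n. S n x) \<longlonglongrightarrow> L"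
    proof (rule complete_limit[of "%n. S n x"])
      fix d :: real assume d: "d > 0"
      then obtain N where N: "ALL n>=N. dist (e n) 0 < d" using e unfolding lim_sequentially by blast
      have "absv (S m x - S n x) < d" if "m \<ge> N" "n \<ge> N" for m n
      proof -
        have "e N < d" using N by (auto simp: dist_real_def dest!: spec[of _ N])
        then show ?thesis
          using absv_triangle[of "S m x" "S n x" "S N x"] c[OF x, of N m] c[OF x, of N n] that
          by (simp add: absv_commute[of "S N x"])
      qed
      then show "EX N. ALL m>=N. ALL n>=N. absv (S m x - S n x) < d" by blast
    qed blast
    have "absv (L - S n x) <= e n" for n
      by (rule absv_le_of_tendsto[OF L, of n]) (use c[OF x] in auto)
    then show ?thesis by blast
  qed
  then have "ALL x:D. EX L. ALL n. absv (L - S n x) <= e n" by blast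
  then show ?thesis by (rule bchoice)
qed

lemma tate_limit:
  fixes S :: "nat \<Rightarrow> (nat \<Rightarrow> 'a::complete_nonarch_field) \<Rightarrow> 'a" and e :: "nat \<Rightarrow> real"
  assumes S: "!!k. S k : tate n"
    and c: "!!m k x. x : polydisc ==> k <= m ==> absv (S m x - S k x) <= e k" and e: "e \<longlonglongrightarrow> 0"
  shows "EX H:tate n. ALL x:polydisc. ALL k. absv (H x - S k x) <= e k"
proof -
  have "EX H. ALL x:polydisc. ALL n. absv (H x - S n x) <= e n"
    by (rule uniform_limit_exists[OF _ e]) (rule c)
  then obtain H where H: "ALL x:polydisc. ALL n. absv (H x - S n x) <= e n" by blast
  have "H : tate n"
  proof (rule tate_closed)
    fix d :: real assume "d > 0"
    then obtain N where "ALL n>=N. dist (e n) 0 < d" using e unfolding lim_sequentially by blast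
    then have "e N <= d" by (auto simp: dist_real_def dest!: spec[of _ N])
    then show "EX k:tate n. ALL x:polydisc. absv (H x - k x) <= d"
    proof (intro bexI[of _ "S N"] ballI)
      fix x :: "nat \<Rightarrow> 'a" assume "x : polydisc"
      then show "absv (H x - S N x) <= d" using H \<open>e N \<le> d\<close> by (meson order_trans)
    qed (rule S)
  qed
  with H show ?thesis by blast
qed

lemma tate_series:
  fixes q :: "nat \<Rightarrow> (nat \<Rightarrow> 'a::complete_nonarch_field) \<Rightarrow> 'a"
  assumes q: "!!k. q k : tate n" and B: "!!k x. x : polydisc ==> absv (q k x) <= B * th ^ k"
    and t: "0 <= th" "th < (1::real)"
  shows "EX Q:tate n. ALL x:polydisc. ALL J. absv (Q x - (\<Sum>k<J. q k x)) <= B * th ^ J"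
proof (rule tate_limit[where S="%J x. \<Sum>k<J. q k x" and e="%J. B * th ^ J"])
  have B0: "0 <= B" using order_trans[OF absv_nonneg B[of "%_. 0" 0]] by simp
  show "(%x. \<Sum>k<J. q k x) : tate n" for J by (intro tate_sum q)
  show "(%J. B * th ^ J) \<longlonglongrightarrow> 0" using LIMSEQ_power_zero[of th] t by (intro tendsto_mult_right_zero) auto
  fix m J :: nat and x :: "nat \<Rightarrow> 'a" assume x: "x : polydisc" and "J <= m"
  then have "(\<Sum>k<m. q k x) - (\<Sum>k<J. q k x) = (\<Sum>k\<in>{J..<m}. q k x)"
    using sum_diff_nat_ivl[of 0 J m "%k. q k x"] by (simp add: lessThan_atLeast0)
  moreover have "absv (\<Sum>k\<in>{J..<m}. q k x) <= B * th ^ J"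
  proof (rule absv_sum_le)
    fix k assume "k : {J..<m}"
    then have "th ^ k <= th ^ J" using t by (intro power_decreasing) auto
    then have "B * th ^ k <= B * th ^ J" using B0 by (rule mult_left_mono)
    then show "absv (q k x) <= B * th ^ J" using B[OF x, of k] by linarith
  qed (use B0 t in simp)
  ultimately show "absv ((\<Sum>k<m. q k x) - (\<Sum>k<J. q k x)) <= B * th ^ J" by simp
qed

lemma tate_subst:
  assumes H: "H : tate n" and h: "!!i. i < n ==> h i : tate m"
    and b: "!!i x. i < n ==> x : polydisc ==> absv (h i x) <= 1"
  shows "(%x. H (%i. if i < n then h i x else 0)) : tate m"
proof (rule tate_closed)
  fix e :: real assume "e > 0"
  then obtain p where p: "p : polyfun n" "!!x. x : polydisc ==> absv (H x - p x) <= e"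
    using tate_approx[OF H \<open>e > 0\<close>] by blast
  have "(%x. p (%i. if i < n then h i x else 0)) : tate m"
    using p(1)
  proof (induction rule: polyfun.induct)
    case (add p q)
    then show ?case by (intro tate_add)
  next
    case (mult p q)
    then show ?case by (intro tate_mult)
  next
    case (const c)
    show ?case by (rule tate_const)
  next
    case (var i)
    then show ?case using h[of i] by simp
  qed
  then show "EX k:tate m. ALL x:polydisc. absv (H (%i. if i < n then h i x else 0) - k x) <= e"
  proof (rule bexI[rotated], intro ballI p(2))
    fix x :: "nat \<Rightarrow> 'a" assume "x : polydisc"
    then show "(%i. if i < n then h i x else 0) : polydisc" by (simp add: polydisc_def b)
  qed
qed

lemma tate_geometric:
  assumes "h : tate n" "!!x. x : polydisc ==> absv (h x) <= th" "th < 1"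
  shows "EX k:tate n. ALL x:polydisc. k x * (1 - h x) = 1 & absv (k x) <= 1"
proof -
  have t: "0 <= th" using order_trans[OF absv_nonneg assms(2)[of "%_. 0"]] by simp
  have b: "absv (h x ^ k) <= 1 * th ^ k" if "x : polydisc" for x k
    using assms(2)[OF that] by (simp add: absv_power power_mono)
  obtain Q where Q: "Q : tate n" "!!x J. x : polydisc ==> absv (Q x - (\<Sum>k<J. h x ^ k)) <= 1 * th ^ J"
    using tate_series[of "%k x. h x ^ k" n 1 th, OF tate_power[OF assms(1)] b t assms(3)] by blast
  have "Q x * (1 - h x) = 1" if x: "x : polydisc" for x
  proof -
    have "absv (Q x * (1 - h x) - 1) <= th ^ J" for J
    proof -
      have "(\<Sum>k<J. h x ^ k) * (1 - h x) = 1 - h x ^ J" using one_diff_power_eq[of "h x" J] by (simp add: mult.commute)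
      then have "Q x * (1 - h x) - 1 = (Q x - (\<Sum>k<J. h x ^ k)) * (1 - h x) - h x ^ J"
        by (simp add: algebra_simps)
      moreover have "absv ((Q x - (\<Sum>k<J. h x ^ k)) * (1 - h x)) <= th ^ J * 1" unfolding absv_mult
      proof (intro mult_mono)
        show "absv (1 - h x) <= 1" using assms(2)[OF x] assms(3) by (intro absv_diff_le') auto
      qed (use Q(2)[OF x, of J] t in auto)
      ultimately show ?thesis using b[OF x, of J] by (simp add: absv_diff_le')
    qed
    then have "absv (Q x * (1 - h x) - 1) <= 0"
      by (intro LIMSEQ_le_const[of "%J. th ^ J" 0]) (use LIMSEQ_power_zero[of th] t assms(3) in auto)
    then show ?thesis by simp
  qed
  moreover have "absv (Q x) <= 1" if "x : polydisc" for x using Q(2)[OF that, of 0] by simp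
  ultimately show ?thesis using Q(1) by blast
qed

section \<open>Weierstrass division\<close>

text \<open>Long division, removing one top coefficient at a time. The divisor is monic with
  coefficients of absolute value at most 1, so quotient and remainder inherit the bound of the
  dividend; the convergence of Weierstrass division depends on this.\<close>

lemma monic_division:
  fixes w :: "nat \<Rightarrow> (nat \<Rightarrow> 'a::complete_nonarch_field) \<Rightarrow> 'a"
  assumes w: "!!l. l < D ==> w l : tate n" "!!l x. l < D ==> x : polydisc ==> absv (w l x) <= 1"
    and g: "!!k. g k : tate n" "!!k x. x : polydisc ==> absv (g k x) <= B"
  shows "EX q:tate (Suc n). EX r. (ALL l<D. r l : tate n) & (ALL x:polydisc. absv (q x) <= B &
      (ALL l<D. absv (r l x) <= B) &
      (\<Sum>k<K. g k x * x n ^ k) = q x * (x n ^ D + (\<Sum>l<D. w l x * x n ^ l)) + (\<Sum>l<D. r l x * x n ^ l))"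
  using g
proof (induction K arbitrary: g)
  case 0
  have "0 <= B" using order_trans[OF absv_nonneg 0(2)[of "%_. 0"]] by simp
  then show ?case
    by (intro bexI[of _ "%_. 0"] exI[of _ "%_ _. 0"]) auto
next
  case (Suc K)
  have B: "0 <= B" using order_trans[OF absv_nonneg Suc.prems(2)[of "%_. 0"]] by simp
  show ?case
  proof (cases "K < D")
    case True
    define r where "r = (%l. if l < Suc K then g l else (%_. 0))"
    have "(\<Sum>k<Suc K. g k x * x n ^ k) = (\<Sum>l<D. r l x * x n ^ l)" for x
    proof -
      have "(\<Sum>k<Suc K. g k x * x n ^ k) = (\<Sum>k<Suc K. r k x * x n ^ k)"
        by (intro sum.cong) (auto simp: r_def)
      also have "\<dots> = (\<Sum>l<D. r l x * x n ^ l)"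
        by (intro sum.mono_neutral_left) (use True in \<open>auto simp: r_def\<close>)
      finally show ?thesis .
    qed
    moreover have "ALL l<D. r l : tate n" "ALL x:polydisc. ALL l<D. absv (r l x) <= B"
      using Suc.prems B by (auto simp: r_def)
    ultimately show ?thesis using B by (intro bexI[of _ "%_. 0"] exI[of _ r]) auto
  next
    case False
    \<comment> \<open>The coefficients that remain after subtracting
      \<open>g K * x n ^ (K - D)\<close> times the divisor; only the \<open>D\<close> positions
      below \<open>K\<close> change.\<close>
    define g' where "g' = (%k x. if K - D <= k & k < K then g k x - g K x * w (k - (K - D)) x else g k x)"
    have g'1: "g' k : tate n" for k
      unfolding g'_def using False Suc.prems(1) w(1)
      by (cases "K - D <= k & k < K") (auto intro!: tate_diff tate_mult)
    have g'2: "absv (g' k x) <= B" if x: "x : polydisc" for k x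
    proof (cases "K - D <= k & k < K")
      case True
      then have l: "k - (K - D) < D" using False by auto
      have "absv (g K x * w (k - (K - D)) x) <= B * 1" unfolding absv_mult
        by (intro mult_mono) (use Suc.prems(2)[OF x] w(2)[OF l x] B in auto)
      then show ?thesis using Suc.prems(2)[OF x, of k] True by (simp add: g'_def absv_diff_le')
    qed (use Suc.prems(2)[OF x, of k] in \<open>auto simp: g'_def\<close>)
    have "EX q:tate (Suc n). EX r. (ALL l<D. r l : tate n) & (ALL x:polydisc. absv (q x) <= B &
      (ALL l<D. absv (r l x) <= B) &
      (\<Sum>k<K. g' k x * x n ^ k) = q x * (x n ^ D + (\<Sum>l<D. w l x * x n ^ l)) + (\<Sum>l<D. r l x * x n ^ l))"
      by (rule Suc.IH[OF g'1 g'2])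
    then obtain q r where q: "q : tate (Suc n)" "ALL l<D. r l : tate n" "ALL x:polydisc. absv (q x) <= B &
      (ALL l<D. absv (r l x) <= B) &
      (\<Sum>k<K. g' k x * x n ^ k) = q x * (x n ^ D + (\<Sum>l<D. w l x * x n ^ l)) + (\<Sum>l<D. r l x * x n ^ l)"
      by blast
    have eq: "(\<Sum>k<Suc K. g k x * x n ^ k) = (\<Sum>k<K. g' k x * x n ^ k) +
        g K x * x n ^ (K - D) * (x n ^ D + (\<Sum>l<D. w l x * x n ^ l))" for x
    proof -
      have "(\<Sum>k<K. g' k x * x n ^ k) = (\<Sum>k<K. g k x * x n ^ k -
          (if K - D <= k then g K x * w (k - (K - D)) x * x n ^ k else 0))"
        by (intro sum.cong) (auto simp: g'_def algebra_simps)
      also have "\<dots> = (\<Sum>k<K. g k x * x n ^ k) -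
          (\<Sum>k<K. (if K - D <= k then g K x * w (k - (K - D)) x * x n ^ k else 0))"
        by (rule sum_subtractf)
      also have "(\<Sum>k<K. (if K - D <= k then g K x * w (k - (K - D)) x * x n ^ k else 0)) =
          (\<Sum>k\<in>{K-D..<K}. g K x * w (k - (K - D)) x * x n ^ k)"
        by (intro sum.mono_neutral_cong_right) auto
      also have "\<dots> = (\<Sum>l<D. g K x * w l x * x n ^ (l + (K - D)))"
        by (rule sum.reindex_bij_witness[of _ "%l. l + (K - D)" "%k. k - (K - D)"]) (use False in auto)
      also have "\<dots> = g K x * x n ^ (K - D) * (\<Sum>l<D. w l x * x n ^ l)"
        by (simp add: sum_distrib_left power_add algebra_simps)
      finally have e: "(\<Sum>k<K. g' k x * x n ^ k) = (\<Sum>k<K. g k x * x n ^ k) - g K x * x n ^ (K - D) * (\<Sum>l<D. w l x * x n ^ l)" .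
      have "x n ^ K = x n ^ (K - D) * x n ^ D" using False by (simp add: power_add[symmetric])
      then show ?thesis by (simp add: e algebra_simps)
    qed
    show ?thesis
    proof (intro bexI[of _ "%x. q x + g K x * x n ^ (K - D)"] exI[of _ r] conjI ballI)
      show "(%x. q x + g K x * x n ^ (K - D)) : tate (Suc n)"
        by (intro tate_add tate_mult tate_power tate_var q(1) tate_mono[OF Suc.prems(1)]) auto
      fix x :: "nat \<Rightarrow> 'a" assume x: "x : polydisc"
      have "absv (g K x * x n ^ (K - D)) <= B * 1" unfolding absv_mult absv_power
        by (intro mult_mono power_le_one) (use Suc.prems(2)[OF x] polydiscD[OF x] B in auto)
      then show "absv (q x + g K x * x n ^ (K - D)) <= B" using q(3) x by (intro absv_add_le') auto
      show "(\<Sum>k<Suc K. g k x * x n ^ k) = (q x + g K x * x n ^ (K - D)) *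
          (x n ^ D + (\<Sum>l<D. w l x * x n ^ l)) + (\<Sum>l<D. r l x * x n ^ l)"
        unfolding eq using q(3) x by (simp add: algebra_simps)
    qed (use q in auto)
  qed
qed

text \<open>A divisor that is monic up to an error \<open>e\<close> is treated as if it were monic.
  The price is the term \<open>q * e\<close>, which is smaller than the bound of the dividend by the
  factor \<open>th\<close>.\<close>

lemma weierstrass_step:
  fixes w :: "nat \<Rightarrow> (nat \<Rightarrow> 'a::complete_nonarch_field) \<Rightarrow> 'a"
  assumes w: "!!l. l < D ==> w l : tate n" "!!l x. l < D ==> x : polydisc ==> absv (w l x) <= 1"
    and e: "e : tate (Suc n)" "!!x. x : polydisc ==> absv (e x) <= th" "0 < th"
    and f: "!!x. x : polydisc ==> f x = x n ^ D + (\<Sum>l<D. w l x * x n ^ l) + e x"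
    and g: "g : tate (Suc n)" "ALL x:polydisc. absv (g x) <= B"
  shows "EX q r. q : tate (Suc n) & (ALL l<D. r l : tate n) & (ALL x:polydisc. absv (q x) <= B &
      (ALL l<D. absv (r l x) <= B) & absv (g x - (q x * f x + (\<Sum>l<D. r l x * x n ^ l))) <= B * th)"
proof (cases "B = 0")
  case True
  then show ?thesis using g by (intro exI[of _ "%_. 0"] exI[of _ "%_ _. 0"]) auto
next
  case False
  have "0 <= B" using order_trans[OF absv_nonneg g(2)[rule_format, of "%_. 0"]] by simp
  with False have B: "0 < B" by simp
  \<comment> \<open>Accuracy \<open>B\<close> keeps the polynomial \<open>p\<close> within the bound
    of \<open>g\<close>; accuracy \<open>B * th\<close> keeps the approximation error within the
    claim.\<close>
  define y where "y = min B (B * th)"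
  have y: "y > 0" using B e(3) by (simp add: y_def)
  obtain p where p: "p : polyfun (Suc n)" "!!x. x : polydisc ==> absv (g x - p x) <= y"
    using tate_approx[OF g(1) y] by blast
  have pB: "absv (p x) <= B" if "x : polydisc" for x
    using absv_diff_le'[of "g x" B "g x - p x"] g(2) p(2)[OF that] that by (simp add: y_def)
  obtain K c where c: "ALL k. c k : polyfun n" "ALL k>K. c k = (%_. 0)" "ALL x. p x = (\<Sum>k\<le>K. c k x * x n ^ k)"
    using polyfun_expand[OF p(1)] by blast
  have cB: "absv (c k x) <= B" if "x : polydisc" for k x
  proof (cases "k <= K")
    case True
    show ?thesis by (rule polyfun_coeff_le[of c n p K B]) (use c pB that True in auto)
  qed (use c B in simp)
  have "EX q:tate (Suc n). EX r. (ALL l<D. r l : tate n) & (ALL x:polydisc. absv (q x) <= B &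
      (ALL l<D. absv (r l x) <= B) &
      (\<Sum>k<Suc K. c k x * x n ^ k) = q x * (x n ^ D + (\<Sum>l<D. w l x * x n ^ l)) + (\<Sum>l<D. r l x * x n ^ l))"
    by (rule monic_division[OF w polyfun_tate[OF c(1)[rule_format]] cB])
  then obtain q r where q: "q : tate (Suc n)" "ALL l<D. r l : tate n" "ALL x:polydisc. absv (q x) <= B &
      (ALL l<D. absv (r l x) <= B) &
      (\<Sum>k<Suc K. c k x * x n ^ k) = q x * (x n ^ D + (\<Sum>l<D. w l x * x n ^ l)) + (\<Sum>l<D. r l x * x n ^ l)"
    by blast
  have "absv (g x - (q x * f x + (\<Sum>l<D. r l x * x n ^ l))) <= B * th" if x: "x : polydisc" for x
  proof -
    have eq: "g x - (q x * f x + (\<Sum>l<D. r l x * x n ^ l)) = (g x - p x) - q x * e x"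
      using q(3) x c(3) f[OF x] by (simp add: lessThan_Suc_atMost algebra_simps)
    moreover have "absv (q x * e x) <= B * th" unfolding absv_mult
      by (intro mult_mono) (use q(3) e(2) x B in auto)
    ultimately show ?thesis unfolding eq using p(2)[OF x] by (simp add: absv_diff_le' y_def)
  qed
  with q show ?thesis by blast
qed

text \<open>The error of one step is divided again; it decreases geometrically, so the partial
  quotients and remainders are convergent series.\<close>

lemma weierstrass_division:
  fixes w :: "nat \<Rightarrow> (nat \<Rightarrow> 'a::complete_nonarch_field) \<Rightarrow> 'a"
  assumes w: "!!l. l < D ==> w l : tate n" "!!l x. l < D ==> x : polydisc ==> absv (w l x) <= 1"
    and e: "e : tate (Suc n)" "!!x. x : polydisc ==> absv (e x) <= th" "0 < th" "th < 1"
    and f: "!!x. x : polydisc ==> f x = x n ^ D + (\<Sum>l<D. w l x * x n ^ l) + e x"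
    and g: "g : tate (Suc n)" "ALL x:polydisc. absv (g x) <= B"
  shows "EX q r. q : tate (Suc n) & (ALL l<D. r l : tate n) & (ALL x:polydisc. (ALL l<D. absv (r l x) <= B) &
      g x = q x * f x + (\<Sum>l<D. r l x * x n ^ l))"
proof -
  have B: "0 <= B" using order_trans[OF absv_nonneg g(2)[rule_format, of "%_. 0"]] by simp
  have f1: "absv (f x) <= 1" if x: "x : polydisc" for x
  proof -
    have "absv (w l x * x n ^ l) <= 1" if "l < D" for l unfolding absv_mult absv_power
      by (intro mult_le_one power_le_one) (use w(2)[OF that x] polydiscD[OF x] in auto)
    then show ?thesis unfolding f[OF x] using e(2)[OF x] e(4) polydiscD[OF x, of n]
      by (intro absv_add_le' absv_sum_le) (auto simp: absv_power power_le_one)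
  qed
  have f2: "f : tate (Suc n)"
    by (rule tate_ext[OF _ f], intro tate_add tate_power tate_var tate_sum tate_mult e(1) tate_mono[OF w(1)]) auto
  define P where "P = (%g C q r. q : tate (Suc n) & (ALL l<D. r l : tate n) & (ALL x:polydisc. absv (q x) <= C &
      (ALL l<D. absv (r l x) <= C) & absv (g x - (q x * f x + (\<Sum>l<D. r l x * x n ^ l))) <= C * th))"
  have ex: "EX qr. P g C (fst qr) (snd qr)" if "g : tate (Suc n)" "ALL x:polydisc. absv (g x) <= C" for g C
  proof -
    have "EX q r. P g C q r" unfolding P_def by (rule weierstrass_step[OF w e(1-3) f that])
    then show ?thesis by auto
  qed
  define qr where "qr = (%g C. SOME qr. P g C (fst qr) (snd qr))"
  have qr: "P g C (fst (qr g C)) (snd (qr g C))" if "g : tate (Suc n)" "ALL x:polydisc. absv (g x) <= C" for g C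
    unfolding qr_def by (rule someI_ex, rule ex) (use that in auto)
  \<comment> \<open>\<open>G j\<close> is the part of \<open>g\<close> still undivided after
    \<open>j\<close> steps, bounded by \<open>B * th ^ j\<close>.\<close>
  define G where "G = rec_nat g (%j h x. h x - (fst (qr h (B * th ^ j)) x * f x +
      (\<Sum>l<D. snd (qr h (B * th ^ j)) l x * x n ^ l)))"
  define q r where "q j = fst (qr (G j) (B * th ^ j))" and "r j = snd (qr (G j) (B * th ^ j))" for j
  have GS: "G (Suc j) x = G j x - (q j x * f x + (\<Sum>l<D. r j l x * x n ^ l))" for j x
    by (simp add: G_def q_def r_def)
  have G: "G j : tate (Suc n) & (ALL x:polydisc. absv (G j x) <= B * th ^ j)" for j
  proof (induction j)
    case 0
    show ?case using g by (simp add: G_def)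
  next
    case (Suc j)
    have PP: "P (G j) (B * th ^ j) (q j) (r j)" unfolding q_def r_def using Suc by (intro qr) auto
    have "G (Suc j) = (%x. G j x - (q j x * f x + (\<Sum>l<D. r j l x * x n ^ l)))" by (rule ext) (rule GS)
    moreover have "(%x. G j x - (q j x * f x + (\<Sum>l<D. r j l x * x n ^ l))) : tate (Suc n)"
      using PP Suc f2 unfolding P_def
      by (intro tate_diff tate_add tate_mult tate_sum tate_power tate_var) (auto intro: tate_mono[of _ n])
    ultimately show ?case using PP unfolding P_def by (simp add: mult.assoc mult.commute[of th])
  qed
  have PP: "P (G j) (B * th ^ j) (q j) (r j)" for j unfolding q_def r_def using G[of j] by (intro qr) auto
  have "EX Q:tate (Suc n). ALL x:polydisc. ALL J. absv (Q x - (\<Sum>k<J. q k x)) <= B * th ^ J"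
    by (rule tate_series) (use PP e(3,4) in \<open>auto simp: P_def\<close>)
  then obtain Q where Q: "Q : tate (Suc n)" "!!x J. x : polydisc ==> absv (Q x - (\<Sum>k<J. q k x)) <= B * th ^ J"
    by blast
  have "EX R:tate n. ALL x:polydisc. ALL J. absv (R x - (\<Sum>k<J. r k l x)) <= B * th ^ J" if "l < D" for l
    by (rule tate_series) (use PP e(3,4) that in \<open>auto simp: P_def\<close>)
  then have "ALL l. EX R. l < D --> R : tate n & (ALL x:polydisc. ALL J. absv (R x - (\<Sum>k<J. r k l x)) <= B * th ^ J)"
    by blast
  then obtain R where "ALL l. l < D --> R l : tate n & (ALL x:polydisc. ALL J. absv (R l x - (\<Sum>k<J. r k l x)) <= B * th ^ J)"
    by (rule choice[THEN exE])
  then have R: "!!l. l < D ==> R l : tate n"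
      "!!l x J. l < D ==> x : polydisc ==> absv (R l x - (\<Sum>k<J. r k l x)) <= B * th ^ J"
    by auto
  have sumG: "g x = (\<Sum>k<J. q k x) * f x + (\<Sum>l<D. (\<Sum>k<J. r k l x) * x n ^ l) + G J x" for J x
  proof (induction J)
    case 0
    show ?case by (simp add: G_def)
  next
    case (Suc J)
    then show ?case by (simp add: GS algebra_simps sum.distrib)
  qed
  have "g x = Q x * f x + (\<Sum>l<D. R l x * x n ^ l)" if x: "x : polydisc" for x
  proof -
    have "absv (g x - (Q x * f x + (\<Sum>l<D. R l x * x n ^ l))) <= B * th ^ J" for J
    proof -
      have "g x - (Q x * f x + (\<Sum>l<D. R l x * x n ^ l)) =
          G J x - ((Q x - (\<Sum>k<J. q k x)) * f x + (\<Sum>l<D. (R l x - (\<Sum>k<J. r k l x)) * x n ^ l))"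
        by (subst sumG[of x J]) (simp add: algebra_simps sum_subtractf)
      also have "absv \<dots> <= B * th ^ J"
      proof (intro absv_diff_le' absv_add_le' absv_sum_le)
        show "absv ((Q x - (\<Sum>k<J. q k x)) * f x) <= B * th ^ J"
          using mult_mono[OF Q(2)[OF x, of J] f1[OF x]] B e(3) by (simp add: absv_mult)
        fix l assume "l : {..<D}"
        then show "absv ((R l x - (\<Sum>k<J. r k l x)) * x n ^ l) <= B * th ^ J"
          using mult_mono[OF R(2)[OF _ x, of l J] power_le_one[OF absv_nonneg polydiscD[OF x, of n], of l]] B e(3)
          by (simp add: absv_mult absv_power)
      qed (use G[of J] x B e(3) in auto)
      finally show ?thesis .
    qed
    moreover have "(%J. B * th ^ J) \<longlonglongrightarrow> 0" using LIMSEQ_power_zero[of th] e by (intro tendsto_mult_right_zero) auto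
    ultimately have "absv (g x - (Q x * f x + (\<Sum>l<D. R l x * x n ^ l))) <= 0"
      by (intro LIMSEQ_le_const[of "%J. B * th ^ J" 0]) auto
    then show ?thesis by simp
  qed
  moreover have "absv (R l x) <= B" if "l < D" "x : polydisc" for l x using R(2)[OF that, of 0] by simp
  ultimately show ?thesis using Q(1) R(1) by blast
qed

section \<open>Nullstellensatz for Tate algebras\<close>

text \<open>Ideals of the Tate algebra; the last clause identifies functions that differ only off
  the polydisc.\<close>

definition tideal :: "nat \<Rightarrow> ((nat \<Rightarrow> 'a::complete_nonarch_field) \<Rightarrow> 'a) set \<Rightarrow> bool" where
  "tideal n I \<longleftrightarrow> I \<subseteq> tate n & (%_. 0) : I & (ALL h:I. ALL k:I. (%x. h x + k x) : I) &
     (ALL h:I. ALL k:tate n. (%x. k x * h x) : I) & (ALL h:I. ALL k. (ALL x:polydisc. k x = h x) --> k : I)"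

lemma tideal_tate: "tideal n I ==> h : I ==> h : tate n"
  by (auto simp: tideal_def)

lemma tideal_zero: "tideal n I ==> (%_. 0) : I"
  by (auto simp: tideal_def)

lemma tideal_add: "tideal n I ==> h : I ==> k : I ==> (%x. h x + k x) : I"
  by (auto simp: tideal_def)

lemma tideal_mult: "tideal n I ==> h : I ==> k : tate n ==> (%x. k x * h x) : I"
  by (auto simp: tideal_def)

lemma tideal_ext: "tideal n I ==> h : I ==> (!!x. x : polydisc ==> k x = h x) ==> k : I"
  by (auto simp: tideal_def)

lemma tideal_diff:
  assumes "tideal n I" "h : I" "k : I" shows "(%x. h x - k x) : I"
proof -
  have "(%x. (-1) * k x) : I" by (rule tideal_mult) (use assms in auto)
  from tideal_add[OF assms(1,2) this] show ?thesis by simp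
qed

lemma tideal_sum:
  assumes "tideal n I" "!!i. i : A ==> h i : I" shows "(%x. \<Sum>i\<in>A. h i x) : I"
  using assms(2)
proof (induction A rule: infinite_finite_induct)
  case (insert a A)
  then show ?case using tideal_add[OF assms(1), of "h a" "%x. \<Sum>i\<in>A. h i x"] by simp
qed (use tideal_zero[OF assms(1)] in auto)

text \<open>The determinant trick of Nakayama's lemma, done by elimination. As the
  \<open>c l\<close> vanish at \<open>a\<close>, the factor \<open>al - c d\<close> in front of the
  last unknown is nonzero at \<open>a\<close>; solving for this unknown and substituting leaves
  relations of the same form.\<close>

lemma nakayama_elimination:
  fixes E :: "nat \<Rightarrow> (nat \<Rightarrow> 'a::complete_nonarch_field) \<Rightarrow> 'a"
  assumes I: "tideal m I" and nm: "n <= m"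
    and rel: "!!k. k < d ==> EX al:tate n. al a ~= 0 & (EX c. (ALL l<d. c l : tate n & c l a = 0) &
        (%x. al x * E k x - (\<Sum>l<d. c l x * E l x)) : I)"
  shows "EX al:tate n. al a ~= 0 & (ALL k<d. (%x. al x * E k x) : I)"
  using rel
proof (induction d)
  case 0
  show ?case by (intro bexI[of _ "%_. 1"]) auto
next
  case (Suc d)
  obtain al c where al: "al : tate n" "al a ~= 0" "ALL l<Suc d. c l : tate n & c l a = 0"
      "(%x. al x * E d x - (\<Sum>l<Suc d. c l x * E l x)) : I"
    using Suc.prems[of d] by blast
  define be where "be = (%x. al x - c d x)"
  have be: "be : tate n" "be a ~= 0" using al by (auto simp: be_def intro!: tate_diff)
  have \<beta>E: "(%x. be x * E d x - (\<Sum>l<d. c l x * E l x)) : I"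
    by (rule tideal_ext[OF I al(4)]) (simp add: be_def algebra_simps)
  have mono: "h : tate n ==> h : tate m" for h :: "(nat \<Rightarrow> 'a) \<Rightarrow> 'a" using nm tate_mono by blast
  have "EX al:tate n. al a ~= 0 & (EX c. (ALL l<d. c l : tate n & c l a = 0) &
        (%x. al x * E k x - (\<Sum>l<d. c l x * E l x)) : I)" if k: "k < d" for k
  proof -
    obtain al' c' where al': "al' : tate n" "al' a ~= 0" "ALL l<Suc d. c' l : tate n & c' l a = 0"
        "(%x. al' x * E k x - (\<Sum>l<Suc d. c' l x * E l x)) : I"
      using Suc.prems[of k] k by auto
    have m1: "(%x. be x * (al' x * E k x - (\<Sum>l<Suc d. c' l x * E l x))) : I"
      by (rule tideal_mult[OF I al'(4) mono[OF be(1)]])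
    have cd: "c' d : tate n" using al'(3) by simp
    have m2: "(%x. c' d x * (be x * E d x - (\<Sum>l<d. c l x * E l x))) : I"
      by (rule tideal_mult[OF I \<beta>E mono[OF cd]])
    have "(%x. be x * al' x * E k x - (\<Sum>l<d. (be x * c' l x + c' d x * c l x) * E l x)) : I"
      by (rule tideal_ext[OF I tideal_add[OF I m1 m2]])
         (simp add: algebra_simps sum_distrib_left sum.distrib)
    moreover have "ALL l<d. (%x. be x * c' l x + c' d x * c l x) : tate n & be a * c' l a + c' d a * c l a = 0"
      using al' al be by (auto intro!: tate_add tate_mult)
    ultimately show ?thesis using be al' 
      by (intro bexI[of _ "%x. be x * al' x"] conjI exI[of _ "%l x. be x * c' l x + c' d x * c l x"])
         (auto intro!: tate_mult)
  qed
  then obtain al' where al': "al' : tate n" "al' a ~= 0" "ALL k<d. (%x. al' x * E k x) : I"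
    using Suc.IH by blast
  have "(%x. be x * al' x * E k x) : I" if k: "k < Suc d" for k
  proof (cases "k = d")
    case True
    have m1: "(%x. al' x * (be x * E d x - (\<Sum>l<d. c l x * E l x))) : I"
      by (rule tideal_mult[OF I \<beta>E mono[OF al'(1)]])
    have m2: "(%x. \<Sum>l<d. c l x * (al' x * E l x)) : I"
    proof (rule tideal_sum[OF I])
      fix l assume "l : {..<d}"
      then show "(%x. c l x * (al' x * E l x)) : I"
        using al(3) al'(3) by (intro tideal_mult[OF I, of "%x. al' x * E l x"] mono) auto
    qed
    show ?thesis
      by (rule tideal_ext[OF I tideal_add[OF I m1 m2]]) (simp add: True algebra_simps sum_distrib_left)
  next
    case False
    with k have "(%x. al' x * E k x) : I" using al' by simp
    from tideal_mult[OF I this mono[OF be(1)]] show ?thesis by (simp add: mult.assoc)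
  qed
  then show ?case using be al' by (intro bexI[of _ "%x. be x * al' x"]) (auto intro!: tate_mult)
qed

text \<open>A nonzero element of least degree generates the ideal; it is not constant, hence has a
  root.\<close>

lemma poly_ideal_root:
  fixes J :: "'a::alg_closed_field poly set"
  assumes add: "!!p q. p : J ==> q : J ==> p + q : J" and mult: "!!p q. p : J ==> q * p : J"
    and one: "1 \<notin> J" and ne: "p0 : J"
  obtains t where "!!p. p : J ==> poly p t = 0"
proof (cases "ALL p:J. p = 0")
  case True
  have "poly p 0 = 0" if "p : J" for p using bspec[OF True that] by simp
  then show ?thesis by (rule that)
next
  case False
  define P where "P = (%d. EX p:J. p ~= 0 & degree p = d)"
  have "EX d. P d" using False by (auto simp: P_def)
  then obtain d where d: "P d" "ALL d'<d. \<not> P d'" using exists_least_iff[of P] by auto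
  then obtain m where m: "m : J" "m ~= 0" "degree m = d" by (auto simp: P_def)
  have dvd: "m dvd p" if "p : J" for p
  proof -
    have "p mod m = p + (- (p div m)) * m" by (simp add: minus_div_mult_eq_mod[symmetric])
    moreover have "p + (- (p div m)) * m : J" by (intro add mult m(1) that)
    ultimately have "p mod m : J" by metis
    then have "p mod m = 0" using degree_mod_less[of m p] d(2) m by (auto simp: P_def)
    then show ?thesis by (rule mod_0_imp_dvd)
  qed
  have "d > 0"
  proof (rule ccontr)
    assume "\<not> d > 0"
    then obtain c where c: "m = [:c:]" "c ~= 0" using m by (metis degree_eq_zeroE gr0I pCons_eq_0_iff)
    then have "[:inverse c:] * m = 1" by simp
    then show False using mult[OF m(1)] one by metis
  qed
  then obtain t where "poly m t = 0" using alg_closed_imp_poly_has_root m(3) by blast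
  then show ?thesis using that[of t] dvd by (metis dvd_trans poly_eq_0_iff_dvd)
qed

text \<open>
  If the ideal had no zero over the zero \<open>a\<close> of its contraction, the fibre of the ideal over \<open>a\<close>
  would be the unit ideal, and Nakayama's lemma would yield an element of the contraction that does
  not vanish at \<open>a\<close>.
\<close>

lemma nullstellensatz_step:
  fixes I :: "((nat \<Rightarrow> 'a::complete_nonarch_field) \<Rightarrow> 'a) set"
  assumes I: "tideal (Suc n) I"
    and IH: "!!I :: ((nat \<Rightarrow> 'a) \<Rightarrow> 'a) set. tideal n I ==> ALL x:polydisc. EX h:I. h x ~= 0 ==> (%_. 1) : I"
    and w: "!!l. l < D ==> w l : tate n" "!!l x. l < D ==> x : polydisc ==> absv (w l x) <= 1"
    and e: "e : tate (Suc n)" "!!x. x : polydisc ==> absv (e x) <= th" "0 < th" "th < 1"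
    and f: "!!x. x : polydisc ==> f x = x n ^ D + (\<Sum>l<D. w l x * x n ^ l) + e x" "f : I"
    and nz: "ALL x:polydisc. EX h:I. h x ~= 0"
  shows "(%_. 1) : I"
proof (rule ccontr)
  assume one: "(%_. 1) \<notin> I"
  have mono: "h : tate n ==> h : tate (Suc n)" for h :: "(nat \<Rightarrow> 'a) \<Rightarrow> 'a" by (rule tate_mono[of _ n]) simp_all
  have varn: "(%x. x n ^ k) : tate (Suc n)" for k :: nat by (intro tate_power tate_var) simp
  have "ALL x:polydisc. absv (x n ^ D :: 'a) <= 1"
    by (auto simp: absv_power intro!: power_le_one polydiscD)
  then have "EX q r. q : tate (Suc n) & (ALL l<D. r l : tate n) & (ALL x:polydisc. (ALL l<D. absv (r l x) <= 1) &
      x n ^ D = q x * f x + (\<Sum>l<D. r l x * x n ^ l))"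
    by (intro weierstrass_division[where w = w and e = e and th = th and f = f and g = "%x. x n ^ D"] w e f(1) varn)
  then obtain q r where q: "q : tate (Suc n)" and r: "!!l. l < D ==> r l : tate n"
     "!!l x. l < D ==> x : polydisc ==> absv (r l x) <= 1"
     "!!x. x : polydisc ==> x n ^ D = q x * f x + (\<Sum>l<D. r l x * x n ^ l)" by blast
  \<comment> \<open>Dividing \<open>x n ^ D\<close> by \<open>f\<close> trades \<open>f\<close> for
    an exact Weierstrass polynomial in the ideal, with lower coefficients bounded by 1 and no error
    term.\<close>
  define m where "m = (%x. x n ^ D - (\<Sum>l<D. r l x * x n ^ l))"
  have mI: "m : I"
    by (rule tideal_ext[OF I tideal_mult[OF I f(2) q]]) (simp add: m_def r(3))
  have div_m: "EX q r. q : tate (Suc n) & (ALL l<D. r l : tate n) & (ALL x:polydisc.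
      g x = q x * m x + (\<Sum>l<D. r l x * x n ^ l))" if g: "g : tate (Suc n)" for g
  proof -
    obtain B where B: "ALL x:polydisc. absv (g x) <= B" using tate_bounded[OF g] by blast
    have "EX q r'. q : tate (Suc n) & (ALL l<D. r' l : tate n) & (ALL x:polydisc. (ALL l<D. absv (r' l x) <= B) &
      g x = q x * m x + (\<Sum>l<D. r' l x * x n ^ l))"
      by (rule weierstrass_division[where w = "%l x. - r l x" and e = "%_. 0" and th = "1/2", OF _ _ _ _ _ _ _ g B])
         (use r in \<open>auto intro: tate_uminus simp: m_def sum_negf\<close>)
    then show ?thesis by blast
  qed
  define I0 where "I0 = I \<inter> tate n"
  have I0: "tideal n I0" unfolding tideal_def I0_def
    using tideal_zero[OF I] tideal_add[OF I] tideal_mult[OF I] tideal_ext[OF I] mono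
    by (auto intro: tate_add tate_mult tate_ext)
  have "\<not> (ALL x:polydisc. EX h:I0. h x ~= 0)" using IH[OF I0] one by (auto simp: I0_def)
  then obtain a where a: "a : polydisc" "!!h. h : I ==> h : tate n ==> h a = 0" by (auto simp: I0_def)
  \<comment> \<open>\<open>R h p\<close> says that \<open>h\<close> is a polynomial in the last
    variable over the Tate algebra and that \<open>p\<close> is its specialization at
    \<open>a\<close>. As a relation it requires no choice of an expansion.\<close>
  define R where "R = (%(h::(nat \<Rightarrow> 'a) \<Rightarrow> 'a) (p::'a poly). EX K g. (ALL k. g k : tate n) & (ALL k>K. g k = (%_. 0)) &
      (ALL x. h x = (\<Sum>k\<le>K. g k x * x n ^ k)) & (ALL k. coeff p k = g k a))"
  have R_tate: "h : tate (Suc n)" if Rh: "R h p" for h p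
  proof -
    obtain K g where g: "ALL k. g k : tate n" "ALL x. h x = (\<Sum>k\<le>K. g k x * x n ^ k)" using Rh unfolding R_def by blast
    have "(%x. \<Sum>k\<le>K. g k x * x n ^ k) : tate (Suc n)" using g(1) by (intro tate_sum tate_mult mono varn) auto
    moreover have "h = (%x. \<Sum>k\<le>K. g k x * x n ^ k)" using g(2) by (intro ext) simp
    ultimately show ?thesis by simp
  qed
  have R_eval: "h (a(n := t)) = poly p t" if Rh: "R h p" and t: "absv t <= 1" for h p t
  proof -
    obtain K g where g: "ALL k. g k : tate n" "ALL k>K. g k = (%_. 0)" "ALL x. h x = (\<Sum>k\<le>K. g k x * x n ^ k)"
        "ALL k. coeff p k = g k a" using Rh unfolding R_def by blast
    have "g k (a(n := t)) = g k a" for k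
      by (rule tate_cong[OF g(1)[rule_format]]) (use a t in \<open>auto intro: polydisc_upd\<close>)
    then have "h (a(n := t)) = (\<Sum>k\<le>K. coeff p k * t ^ k)" using g(3,4) by simp
    also have "\<dots> = poly p t"
    proof -
      have "degree p <= K" by (rule degree_le) (use g in auto)
      then have "(\<Sum>k\<le>degree p. coeff p k * t ^ k) = (\<Sum>k\<le>K. coeff p k * t ^ k)"
        by (intro sum.mono_neutral_left) (auto simp: coeff_eq_0)
      then show ?thesis by (simp add: poly_altdef)
    qed
    finally show ?thesis .
  qed
  have R_const: "R h [:h a:]" if "h : tate n" for h
    unfolding R_def using that
    by (intro exI[of _ 0] exI[of _ "%k. if k = 0 then h else (%_. 0)"]) (auto simp: coeff_pCons split: nat.split)
  have R_X: "R (%x. x n) [:0, 1:]"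
    unfolding R_def
    by (intro exI[of _ 1] exI[of _ "%k. if k = 1 then (%_. 1) else (%_. 0)"]) (auto simp: coeff_pCons split: nat.split)
  have R_add: "R (%x. h x + h' x) (p + p')" if Rh: "R h p" "R h' p'" for h h' p p'
  proof -
    obtain K g where g: "ALL k. g k : tate n" "ALL k>K. g k = (%_. 0)" "ALL x. h x = (\<Sum>k\<le>K. g k x * x n ^ k)"
        "ALL k. coeff p k = g k a" using Rh(1) unfolding R_def by blast
    obtain L g' where g': "ALL k. g' k : tate n" "ALL k>L. g' k = (%_. 0)" "ALL x. h' x = (\<Sum>k\<le>L. g' k x * x n ^ k)"
        "ALL k. coeff p' k = g' k a" using Rh(2) unfolding R_def by blast
    have "(\<Sum>k\<le>K. g k x * x n ^ k) = (\<Sum>k\<le>max K L. g k x * x n ^ k)" for x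
      by (rule sum.mono_neutral_left) (use g in auto)
    moreover have "(\<Sum>k\<le>L. g' k x * x n ^ k) = (\<Sum>k\<le>max K L. g' k x * x n ^ k)" for x
      by (rule sum.mono_neutral_left) (use g' in auto)
    ultimately show ?thesis unfolding R_def using g g'
      by (intro exI[of _ "max K L"] exI[of _ "%k x. g k x + g' k x"])
         (auto intro: tate_add simp: sum.distrib distrib_right)
  qed
  have R_mult: "R (%x. h x * h' x) (p * p')" if Rh: "R h p" "R h' p'" for h h' p p'
  proof -
    obtain K g where g: "ALL k. g k : tate n" "ALL k>K. g k = (%_. 0)" "ALL x. h x = (\<Sum>k\<le>K. g k x * x n ^ k)"
        "ALL k. coeff p k = g k a" using Rh(1) unfolding R_def by blast
    obtain L g' where g': "ALL k. g' k : tate n" "ALL k>L. g' k = (%_. 0)" "ALL x. h' x = (\<Sum>k\<le>L. g' k x * x n ^ k)"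
        "ALL k. coeff p' k = g' k a" using Rh(2) unfolding R_def by blast
    have "h x * h' x = (\<Sum>r\<le>K + L. (\<Sum>k\<le>r. g k x * g' (r - k) x) * x n ^ r)" for x
      using polynomial_product[of K "%k. g k x" L "%k. g' k x" "x n"] g g' by simp
    moreover have "(%x. \<Sum>k\<le>r. g k x * g' (r - k) x) : tate n" for r
      using g g' by (intro tate_sum tate_mult) auto
    moreover have "(%x. \<Sum>k\<le>r. g k x * g' (r - k) x) = (%_. 0)" if "r > K + L" for r
    proof -
      have "g k x * g' (r - k) x = 0" if "k <= r" for k x
        using g(2) g'(2) \<open>r > K + L\<close> that by (cases "k > K") auto
      then have "(\<Sum>k\<le>r. g k x * g' (r - k) x) = 0" for x by (intro sum.neutral) auto
      then show ?thesis by blast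
    qed
    ultimately show ?thesis unfolding R_def using g(4) g'(4)
      by (intro exI[of _ "K + L"] exI[of _ "%r x. \<Sum>k\<le>r. g k x * g' (r - k) x"]) (auto simp: coeff_mult)
  qed
  have R_poly: "EX h. R h u" for u :: "'a poly"
  proof (induction u)
    case 0
    show ?case using R_const[of "%_. 0"] by (intro exI[of _ "%_. 0"]) auto
  next
    case (pCons c u)
    then obtain h where "R h u" by blast
    then have "R (%x. c + x n * h x) ([:c:] + [:0, 1:] * u)"
      by (intro R_add R_mult R_X R_const[of "%_. c"]) auto
    then show ?case by auto
  qed
  have R_sum: "R (%x. \<Sum>l<d. g l x * x n ^ l) (\<Sum>l<d. monom (g l a) l)" if g: "!!l. l < d ==> g l : tate n" for d g
  proof -
    have Rp: "R (%x. x n ^ k) (monom 1 k)" for k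
    proof (induction k)
      case 0
      show ?case using R_const[of "%_. 1"] by (auto simp: one_pCons)
    next
      case (Suc k)
      from R_mult[OF R_X Suc] show ?case by (simp add: monom_Suc)
    qed
    show ?thesis using g
    proof (induction d)
      case 0
      show ?case using R_const[of "%_. 0"] by auto
    next
      case (Suc d)
      have "R (%x. g d x * x n ^ d) ([:g d a:] * monom 1 d)" by (intro R_mult Rp R_const Suc.prems) simp
      then have "R (%x. g d x * x n ^ d) (monom (g d a) d)" by (simp add: smult_monom)
      from R_add[OF Suc.IH this] Suc.prems show ?case by simp
    qed
  qed
  define J where "J = {p. EX h:I. R h p}"
  have J_add: "p + q : J" if "p : J" "q : J" for p q
    using that R_add tideal_add[OF I] unfolding J_def by blast
  have J_mult: "u * p : J" if "p : J" for p u
  proof -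
    obtain h where "h : I" "R h p" using \<open>p \<in> J\<close> unfolding J_def by blast
    moreover obtain k where "R k u" using R_poly by blast
    ultimately show ?thesis using R_mult R_tate tideal_mult[OF I] unfolding J_def by blast
  qed
  define pm where "pm = monom 1 D + [:-1:] * (\<Sum>l<D. monom (r l a) l)"
  have "R (%x. (\<Sum>l<Suc D. (if l = D then 1 else 0) * x n ^ l) + (-1) * (\<Sum>l<D. r l x * x n ^ l))
          ((\<Sum>l<Suc D. monom (if l = D then 1 else 0) l) + [:-1:] * (\<Sum>l<D. monom (r l a) l))"
    by (intro R_add R_mult R_sum r(1) R_const[of "%_. -1"] R_sum[of _ "%l x. if l = D then 1 else 0"]) auto
  moreover have "(\<Sum>l<D. monom (if l = D then 1 else 0) l) = (0 :: 'a poly)"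
    by (intro sum.neutral) auto
  moreover have "(\<Sum>l<D. (if l = D then 1 else 0) * x n ^ l) = 0" for x :: "nat \<Rightarrow> 'a"
    by (intro sum.neutral) auto
  ultimately have Rm: "R m pm" by (simp add: m_def pm_def)
  have pmJ: "pm : J" using Rm mI by (auto simp: J_def)
  show False
  proof (cases "1 : J")
    case True
    then obtain h where h: "h : I" "R h 1" unfolding J_def by blast
    have "R (%x. 1 + (-1) * h x) ([:1:] + [:-1:] * 1)"
      by (intro R_add R_mult h R_const[of "%_. 1"] R_const[of "%_. -1"]) auto
    then have "R (%x. 1 - h x) 0" by simp
    then obtain K b where b: "ALL k. b k : tate n" "ALL x. 1 - h x = (\<Sum>k\<le>K. b k x * x n ^ k)" "ALL k. b k a = 0"
      unfolding R_def by auto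
    \<comment> \<open>Here the fibre over \<open>a\<close> is the unit ideal: the coefficients
      \<open>b k\<close> of \<open>1 - h\<close> vanish at \<open>a\<close>. Multiplying
      \<open>1 - h\<close> by \<open>x n ^ k\<close> and reducing modulo \<open>m\<close> expresses
      \<open>x n ^ k\<close>, modulo \<open>I\<close>, through the powers below
      \<open>x n ^ D\<close> with coefficients that vanish at \<open>a\<close>, which is the input
      of Nakayama's lemma.\<close>
    have "EX al:tate n. al a ~= 0 & (ALL k<D. (%x. al x * x n ^ k) : I)"
    proof (rule nakayama_elimination[OF I])
      fix k assume "k < D"
      have "ALL j. EX qr. fst qr : tate (Suc n) & (ALL l<D. snd qr l : tate n) & (ALL x:polydisc.
        x n ^ (k + j) = fst qr x * m x + (\<Sum>l<D. snd qr l x * x n ^ l))"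
      proof
        fix j
        obtain q r where "q : tate (Suc n) & (ALL l<D. r l : tate n) & (ALL x:polydisc.
           x n ^ (k + j) = q x * m x + (\<Sum>l<D. r l x * x n ^ l))" using div_m[OF varn[of "k + j"]] by blast
        then show "EX qr. fst qr : tate (Suc n) & (ALL l<D. snd qr l : tate n) & (ALL x:polydisc.
          x n ^ (k + j) = fst qr x * m x + (\<Sum>l<D. snd qr l x * x n ^ l))"
          by (intro exI[of _ "(q, r)"]) simp
      qed
      then obtain qr where qr: "ALL j. fst (qr j) : tate (Suc n) & (ALL l<D. snd (qr j) l : tate n) & (ALL x:polydisc.
        x n ^ (k + j) = fst (qr j) x * m x + (\<Sum>l<D. snd (qr j) l x * x n ^ l))"
        by (rule choice[THEN exE])
      define c where "c = (%l x. \<Sum>j\<le>K. b j x * snd (qr j) l x)"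
      have "(%x. x n ^ k * h x + (\<Sum>j\<le>K. (b j x * fst (qr j) x) * m x)) : I"
        using qr b mono
        by (intro tideal_add[OF I] tideal_mult[OF I h(1) varn] tideal_sum[OF I] tideal_mult[OF I mI] tate_mult) auto
      moreover have "1 * x n ^ k - (\<Sum>l<D. c l x * x n ^ l) =
          x n ^ k * h x + (\<Sum>j\<le>K. (b j x * fst (qr j) x) * m x)" if x: "x : polydisc" for x
      proof -
        have "x n ^ k - x n ^ k * h x = x n ^ k * (1 - h x)" by (simp add: algebra_simps)
        also have "\<dots> = (\<Sum>j\<le>K. b j x * x n ^ (k + j))"
          unfolding b(2)[rule_format] by (simp add: sum_distrib_left power_add algebra_simps)
        also have "\<dots> = (\<Sum>j\<le>K. (b j x * fst (qr j) x) * m x + (\<Sum>l<D. b j x * snd (qr j) l x * x n ^ l))"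
          by (intro sum.cong refl, subst qr[rule_format, THEN conjunct2, THEN conjunct2, rule_format, OF x])
             (simp add: algebra_simps sum_distrib_left)
        also have "\<dots> = (\<Sum>j\<le>K. (b j x * fst (qr j) x) * m x) + (\<Sum>l<D. c l x * x n ^ l)"
          unfolding sum.distrib c_def sum_distrib_right by (subst sum.swap) simp
        finally show ?thesis by (simp add: algebra_simps)
      qed
      ultimately have "(%x. 1 * x n ^ k - (\<Sum>l<D. c l x * x n ^ l)) : I" by (rule tideal_ext[OF I])
      moreover have "ALL l<D. c l : tate n & c l a = 0"
        unfolding c_def using qr b by (auto intro!: tate_sum tate_mult)
      ultimately show "EX al:tate n. al a ~= 0 & (EX c. (ALL l<D. c l : tate n & c l a = 0) &
        (%x. al x * x n ^ k - (\<Sum>l<D. c l x * x n ^ l)) : I)"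
        by (intro bexI[of _ "%_. 1"] conjI exI[of _ c]) auto
    qed simp
    then obtain al where al: "al : tate n" "al a ~= 0" "ALL k<D. (%x. al x * x n ^ k) : I" by blast
    show False
    proof (cases "D = 0")
      case True
      then show False using mI one by (simp add: m_def)
    next
      case False
      then have "al : I" using al(3) by (auto dest!: spec[of _ 0])
      then show False using a(2) al by blast
    qed
  next
    case False
    obtain t where t: "!!p. p : J ==> poly p t = 0"
      using poly_ideal_root[OF J_add J_mult False pmJ] by blast
    have "poly pm t = t ^ D - (\<Sum>l<D. r l a * t ^ l)"
      by (simp add: pm_def poly_monom poly_sum)
    then have tD: "t ^ D = (\<Sum>l<D. r l a * t ^ l)" using t[OF pmJ] by simp
    \<comment> \<open>\<open>t\<close> is a root of a monic polynomial whose other coefficients have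
      absolute value at most 1; if \<open>t\<close> were larger, the leading term would
      dominate.\<close>
    have t1: "absv t <= 1"
    proof (rule ccontr)
      assume tt: "\<not> absv t <= 1"
      have "D ~= 0" using tD by (cases D) auto
      have "absv (\<Sum>l<D. r l a * t ^ l) <= absv t ^ (D - 1)"
      proof (rule absv_sum_le)
        fix l assume l: "l : {..<D}"
        have "absv t ^ l <= absv t ^ (D - 1)" using l tt by (intro power_increasing) auto
        then show "absv (r l a * t ^ l) <= absv t ^ (D - 1)"
          using mult_mono[of "absv (r l a)" 1 "absv t ^ l" "absv t ^ (D - 1)"] r(2)[OF _ a(1)] l
          by (simp add: absv_mult absv_power)
      qed simp
      moreover have "absv t ^ (D - 1) < absv t ^ D" using tt \<open>D \<noteq> 0\<close> by (intro power_strict_increasing) auto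
      ultimately show False using tD by (metis absv_power not_le)
    qed
    define z where "z = a(n := t)"
    have z: "z : polydisc" unfolding z_def by (rule polydisc_upd[OF a(1) t1])
    \<comment> \<open>Modulo \<open>m\<close> every member of \<open>I\<close> becomes a polynomial
      in the last variable that still lies in \<open>I\<close>. Its specialization belongs to
      \<open>J\<close> and so vanishes at \<open>t\<close>.\<close>
    have "h z = 0" if h: "h : I" for h
    proof -
      obtain q s where q: "q : tate (Suc n)" "ALL l<D. s l : tate n"
         "ALL x:polydisc. h x = q x * m x + (\<Sum>l<D. s l x * x n ^ l)"
        using div_m[OF tideal_tate[OF I h]] by blast
      have "(%x. \<Sum>l<D. s l x * x n ^ l) : I"
        by (rule tideal_ext[OF I tideal_diff[OF I h tideal_mult[OF I mI q(1)]]]) (use q(3) in simp)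
      moreover have Rs: "R (%x. \<Sum>l<D. s l x * x n ^ l) (\<Sum>l<D. monom (s l a) l)" using q(2) by (intro R_sum) auto
      ultimately have "poly (\<Sum>l<D. monom (s l a) l) t = 0" using t unfolding J_def by blast
      then have "(\<Sum>l<D. s l z * z n ^ l) = 0" using R_eval[OF Rs t1] unfolding z_def by simp
      moreover have "m z = 0" using R_eval[OF Rm t1] t[OF pmJ] unfolding z_def by simp
      ultimately show "h z = 0" using q(3) z by simp
    qed
    then show False using nz z by blast
  qed
qed

section \<open>Homogeneous parts and the normalizing shear\<close>

inductive hpoly :: "nat \<Rightarrow> nat \<Rightarrow> ((nat \<Rightarrow> 'a::complete_nonarch_field) \<Rightarrow> 'a) \<Rightarrow> bool" for n where
  const: "hpoly n 0 (%_. c)"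
| zero: "hpoly n d (%_. 0)"
| var: "i < n ==> hpoly n 1 (%x. x i)"
| add: "hpoly n d p ==> hpoly n d q ==> hpoly n d (%x. p x + q x)"
| mult: "hpoly n d p ==> hpoly n d' q ==> hpoly n (d + d') (%x. p x * q x)"

lemma hpoly_polyfun: "hpoly n d p ==> p : polyfun n"
  by (induction rule: hpoly.induct) (auto intro: polyfun.intros)

lemma hpoly_homogeneous: "hpoly n d p ==> p (%i. t * x i) = t ^ d * p x"
  by (induction rule: hpoly.induct) (auto simp: algebra_simps power_add)

lemma hpoly_sum: "(!!i. i : A ==> hpoly n d (p i)) ==> hpoly n d (%x. \<Sum>i\<in>A. p i x)"
  by (induction A rule: infinite_finite_induct) (simp_all add: hpoly.zero hpoly.add)

lemma polyfun_homogeneous_parts: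
  "p : polyfun n ==> EX K P. (ALL d. hpoly n d (P d)) & (ALL d>K. P d = (%_. 0)) & (ALL x. p x = (\<Sum>d\<le>K. P d x))"
proof (induction rule: polyfun.induct)
  case (const c)
  show ?case
    by (intro exI[of _ 0] exI[of _ "%d. if d = 0 then (%_. c) else (%_. 0)"]) (auto intro: hpoly.const hpoly.zero)
next
  case (var i)
  have "hpoly n d (if d = 1 then (%x. x i) else (%_. 0))" for d
    using hpoly.var[OF var] by (cases "d = 1") (simp_all add: hpoly.zero)
  note * = this
  then show ?case
    by (intro exI[of _ 1] exI[of _ "%d. if d = 1 then (%x. x i) else (%_. 0)"] conjI allI *) simp_all
next
  case (add p q)
  then obtain K P L Q where P: "ALL d. hpoly n d (P d)" "ALL d>K. P d = (%_. 0)" "ALL x. p x = (\<Sum>d\<le>K. P d x)"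
    and Q: "ALL d. hpoly n d (Q d)" "ALL d>L. Q d = (%_. 0)" "ALL x. q x = (\<Sum>d\<le>L. Q d x)" by blast
  have "(\<Sum>k\<le>K. P k x) = (\<Sum>k\<le>max K L. P k x)" for x
    by (rule sum.mono_neutral_left) (use P in auto)
  moreover have "(\<Sum>k\<le>L. Q k x) = (\<Sum>k\<le>max K L. Q k x)" for x
    by (rule sum.mono_neutral_left) (use Q in auto)
  ultimately show ?case using P Q
    by (intro exI[of _ "max K L"] exI[of _ "%k x. P k x + Q k x"])
       (simp add: sum.distrib hpoly.add)
next
  case (mult p q)
  then obtain K P L Q where P: "ALL d. hpoly n d (P d)" "ALL d>K. P d = (%_. 0)" "ALL x. p x = (\<Sum>d\<le>K. P d x)"
    and Q: "ALL d. hpoly n d (Q d)" "ALL d>L. Q d = (%_. 0)" "ALL x. q x = (\<Sum>d\<le>L. Q d x)" by blast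
  have "p x * q x = (\<Sum>r\<le>K + L. \<Sum>k\<le>r. P k x * Q (r - k) x)" for x
    using polynomial_product[of K "%k. P k x" L "%k. Q k x" 1] P Q by simp
  moreover have "hpoly n r (%x. \<Sum>k\<le>r. P k x * Q (r - k) x)" for r
  proof (rule hpoly_sum)
    fix k assume "k : {..r}"
    then show "hpoly n r (%x. P k x * Q (r - k) x)"
      using hpoly.mult[of n k "P k" "r - k" "Q (r - k)"] P(1) Q(1) by simp
  qed
  moreover have "(%x. \<Sum>k\<le>r. P k x * Q (r - k) x) = (%_. 0)" if "r > K + L" for r
  proof -
    have "P k x * Q (r - k) x = 0" if "k <= r" for k x
      using P(2) Q(2) \<open>r > K + L\<close> that by (cases "k > K") auto
    then have "(\<Sum>k\<le>r. P k x * Q (r - k) x) = 0" for x by (intro sum.neutral) auto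
    then show ?thesis by blast
  qed
  ultimately show ?case
    by (intro exI[of _ "K + L"] exI[of _ "%r x. \<Sum>k\<le>r. P k x * Q (r - k) x"]) auto
qed

text \<open>All coordinates must have absolute value exactly 1 because the shear divides by the last
  one. The induction picks the coefficient with the largest maximum and then a last coordinate
  supplied by Gauss's lemma.\<close>

lemma polyfun_max_point:
  fixes p :: "(nat \<Rightarrow> 'a::complete_nonarch_field) \<Rightarrow> 'a"
  shows "p : polyfun n ==> EX y. (ALL i. absv (y i) = 1) & (ALL x:polydisc. absv (p x) <= absv (p y))"
proof (induction n arbitrary: p)
  case 0
  have "p x = p (%_. 1)" for x by (rule polyfun_cong[OF 0]) simp
  then have "absv (p x) <= absv (p (%_. 1))" for x by (metis order_refl)
  then show ?case by (intro exI[of _ "%_. 1"]) auto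
next
  case (Suc n)
  obtain K g where g: "ALL k. g k : polyfun n" "ALL x. p x = (\<Sum>k\<le>K. g k x * x n ^ k)"
    using polyfun_expand[OF Suc.prems] by blast
  have "ALL k. EX y. (ALL i. absv (y i) = 1) & (ALL x:polydisc. absv (g k x) <= absv (g k y))"
    using Suc.IH g(1) by blast
  then obtain y where y: "ALL k. (ALL i. absv (y k i) = 1) & (ALL x:polydisc. absv (g k x) <= absv (g k (y k)))"
    by (rule choice[THEN exE])
  define M where "M = Max ((%k. absv (g k (y k))) ` {..K})"
  have "M : (%k. absv (g k (y k))) ` {..K}" unfolding M_def by (rule Max_in) auto
  then obtain j where j: "j <= K" "M = absv (g j (y j))" by auto
  have M: "absv (g k x) <= M" if "k <= K" "x : polydisc" for k x
  proof -
    have "absv (g k x) <= absv (g k (y k))" using y that by blast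
    also have "\<dots> <= M" unfolding M_def using that by (intro Max_ge) auto
    finally show ?thesis .
  qed
  define P where "P = (\<Sum>k\<le>K. monom (g k (y j)) k)"
  obtain z where z: "absv z = 1" "!!k. absv (coeff P k) <= absv (poly P z)" using poly_max_coeff by blast
  define v where "v = (y j)(n := z)"
  have "g k v = g k (y j)" for k by (rule polyfun_cong[OF g(1)[rule_format]]) (simp add: v_def)
  then have "p v = poly P z" using g(2) by (simp add: v_def P_def poly_sum poly_monom)
  moreover have "coeff P j = g j (y j)" using j by (simp add: P_def coeff_sum)
  ultimately have Mv: "M <= absv (p v)" using z(2)[of j] j(2) by simp
  have "absv (p x) <= absv (p v)" if x: "x : polydisc" for x
  proof -
    have "absv (g k x * x n ^ k) <= M" if "k <= K" for k
      using mult_mono[OF M[OF that x] power_le_one[OF absv_nonneg polydiscD[OF x, of n], of k]]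
        order_trans[OF absv_nonneg M[OF that x]] by (simp add: absv_mult absv_power)
    then have "absv (p x) <= M" unfolding g(2)[rule_format] using j(2) by (intro absv_sum_le) auto
    with Mv show ?thesis by simp
  qed
  moreover have "ALL i. absv (v i) = 1" using y z by (simp add: v_def)
  ultimately show ?case by blast
qed

definition shear :: "nat \<Rightarrow> (nat \<Rightarrow> 'a::complete_nonarch_field) \<Rightarrow> (nat \<Rightarrow> 'a) \<Rightarrow> nat \<Rightarrow> 'a" where
  "shear n b x = (%i. if i < Suc n then (if i < n then x i + b i * x n else x n) else 0)"

lemma shear_polydisc:
  assumes "x : polydisc" "!!i. absv (b i) <= 1" shows "shear n b x : polydisc"
  using assms by (auto simp: shear_def polydisc_def absv_mult intro!: absv_add_le' mult_le_one)

lemma tate_shear: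
  assumes "h : tate (Suc n)" "!!i. absv (b i) <= 1" shows "(%x. h (shear n b x)) : tate (Suc n)"
proof -
  have "(%x. h (%i. if i < Suc n then (%x. if i < n then x i + b i * x n else x n) x else 0)) : tate (Suc n)"
  proof (rule tate_subst[OF assms(1)])
    fix i assume i: "i < Suc n"
    show "(%x. if i < n then x i + b i * x n else x n) : tate (Suc n)"
    proof (cases "i < n")
      case True
      have "(%x. x i + b i * x n) : tate (Suc n)"
        by (intro tate_add tate_mult tate_const tate_var) (use i in auto)
      with True show ?thesis by simp
    next
      case False
      have "(%x. x n) : tate (Suc n)" by (intro tate_var) simp
      with False show ?thesis by simp
    qed
    fix x :: "nat \<Rightarrow> 'a" assume "x : polydisc"
    then show "absv (if i < n then x i + b i * x n else x n) <= 1"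
      using assms(2) by (auto simp: polydisc_def absv_mult intro!: absv_add_le' mult_le_one)
  qed
  then show ?thesis by (simp add: shear_def)
qed

text \<open>The top power of \<open>x n\<close> arises only by choosing \<open>b i * x n\<close> for
  each \<open>i < n\<close>, and \<open>x n\<close> itself, in every factor; its coefficient is
  therefore the value of the form at the point with coordinates \<open>b i\<close> and last
  coordinate 1.\<close>

lemma hpoly_shear:
  "hpoly (Suc n) d p ==> EX g. (ALL k. g k : polyfun n) & (ALL k>d. g k = (%_. 0)) &
     (ALL x. p (shear n b x) = (\<Sum>k\<le>d. g k x * x n ^ k)) & (ALL x. g d x = p (%i. if i < n then b i else 1))"
proof (induction rule: hpoly.induct)
  case (const c)
  show ?case by (intro exI[of _ "%k. if k = 0 then (%_. c) else (%_. 0)"]) (auto intro: polyfun.const)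
next
  case (zero d)
  show ?case by (intro exI[of _ "%k. (%_. 0)"]) (auto intro: polyfun.const)
next
  case (var i)
  define g :: "nat \<Rightarrow> (nat \<Rightarrow> 'a) \<Rightarrow> 'a" where
    "g = (%k. if k = 0 then (%x. if i < n then x i else 0) else if k = 1 then (%_. if i < n then b i else 1) else (%_. 0))"
  have "(%x. if i < n then x i else (0::'a)) : polyfun n"
    by (cases "i < n") (auto intro: polyfun.intros)
  then have "g k : polyfun n" for k by (auto simp: g_def intro: polyfun.const)
  then show ?case using var by (intro exI[of _ g]) (auto simp: g_def shear_def)
next
  case (add d p q)
  then obtain g h where g: "ALL k. g k : polyfun n" "ALL k>d. g k = (%_. 0)"
     "ALL x. p (shear n b x) = (\<Sum>k\<le>d. g k x * x n ^ k)" "ALL x. g d x = p (%i. if i < n then b i else 1)"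
    and h: "ALL k. h k : polyfun n" "ALL k>d. h k = (%_. 0)"
     "ALL x. q (shear n b x) = (\<Sum>k\<le>d. h k x * x n ^ k)" "ALL x. h d x = q (%i. if i < n then b i else 1)" by blast
  then show ?case
    by (intro exI[of _ "%k x. g k x + h k x"]) (auto intro: polyfun.intros simp: sum.distrib distrib_right)
next
  case (mult d p d' q)
  then obtain g h where g: "ALL k. g k : polyfun n" "ALL k>d. g k = (%_. 0)"
     "ALL x. p (shear n b x) = (\<Sum>k\<le>d. g k x * x n ^ k)" "ALL x. g d x = p (%i. if i < n then b i else 1)"
    and h: "ALL k. h k : polyfun n" "ALL k>d'. h k = (%_. 0)"
     "ALL x. q (shear n b x) = (\<Sum>k\<le>d'. h k x * x n ^ k)" "ALL x. h d' x = q (%i. if i < n then b i else 1)" by blast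
  define r where "r = (%r x. \<Sum>k\<le>r. g k x * h (r - k) x)"
  have "p (shear n b x) * q (shear n b x) = (\<Sum>k\<le>d + d'. r k x * x n ^ k)" for x
    using polynomial_product[of d "%k. g k x" d' "%k. h k x" "x n"] g h by (simp add: r_def)
  moreover have "ALL k. r k : polyfun n" unfolding r_def using g h
    by (intro allI polyfun_sum) (auto intro: polyfun.intros)
  moreover have "r k = (%_. 0)" if "k > d + d'" for k
  proof -
    have "g j x * h (k - j) x = 0" if "j <= k" for j x
      using g(2) h(2) \<open>k > d + d'\<close> that by (cases "j > d") auto
    then have "(\<Sum>j\<le>k. g j x * h (k - j) x) = 0" for x by (intro sum.neutral) auto
    then show ?thesis unfolding r_def by blast
  qed
  moreover have "r (d + d') x = g d x * h d' x" for x
  proof -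
    have "g j x * h (d + d' - j) x = 0" if "j ~= d" for j
      using g(2) h(2) that by (cases "j > d") auto
    then have "(\<Sum>j\<le>d + d'. g j x * h (d + d' - j) x) = (\<Sum>j\<in>{d}. g j x * h (d + d' - j) x)"
      by (intro sum.mono_neutral_right) auto
    then show ?thesis by (simp add: r_def)
  qed
  ultimately show ?case using g(4) h(4) by (intro exI[of _ r]) auto
qed

text \<open>
  Noether normalization: the shear is chosen so that the dominant homogeneous part of highest degree
  acquires a power of the last coordinate whose coefficient has maximal absolute value.
\<close>

lemma noether_shear:
  fixes f :: "(nat \<Rightarrow> 'a::complete_nonarch_field) \<Rightarrow> 'a"
  assumes f: "f : tate (Suc n)" and x0: "x0 : polydisc" "f x0 ~= 0"
  shows "EX b c D w e th. (ALL i. absv (b i) <= 1) & c ~= 0 & (ALL l<D. w l : tate n & (ALL x:polydisc. absv (w l x) <= 1)) &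
     e : tate (Suc n) & (ALL x:polydisc. absv (e x) <= th) & 0 < th & th < 1 &
     (ALL x:polydisc. f (shear n b x) = c * (x n ^ D + (\<Sum>l<D. w l x * x n ^ l) + e x))"
proof -
  \<comment> \<open>The approximation error has to stay below the supremum of \<open>f\<close>; half
    of a nonzero value achieves this.\<close>
  define et where "et = absv (f x0) / 2"
  have et: "0 < et" "et < absv (f x0)" using x0 by (auto simp: et_def)
  obtain p where p: "p : polyfun (Suc n)" "!!x. x : polydisc ==> absv (f x - p x) <= et"
    using tate_approx[OF f et(1)] by blast
  have px0: "absv (p x0) = absv (f x0)"
    using p(2)[OF x0(1)] et absv_eq_of_diff_less'[of "f x0" "p x0"] by simp
  obtain K P where P: "ALL d. hpoly (Suc n) d (P d)" "ALL x. p x = (\<Sum>d\<le>K. P d x)"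
    using polyfun_homogeneous_parts[OF p(1)] by blast
  have "ALL d. EX y. (ALL i. absv (y i) = 1) & (ALL x:polydisc. absv (P d x) <= absv (P d y))"
    using polyfun_max_point[OF hpoly_polyfun[OF P(1)[rule_format]]] by (rule allI)
  then obtain y where y: "ALL d. (ALL i. absv (y d i) = 1) & (ALL x:polydisc. absv (P d x) <= absv (P d (y d)))"
    by (rule choice[THEN exE])
  define m where "m d = absv (P d (y d))" for d
  define M where "M = Max (m ` {..K})"
  have mM: "m d <= M" if "d <= K" for d unfolding M_def using that by (intro Max_ge) auto
  have Pm: "absv (P d x) <= m d" if "x : polydisc" for d x using y that by (simp add: m_def)
  have "absv (p x0) <= M" unfolding P(2)[rule_format]
  proof (rule absv_sum_le)
    show "0 <= M" using order_trans[OF _ mM[of 0], of 0] by (simp add: m_def)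
    fix d assume "d : {..K}"
    then show "absv (P d x0) <= M" using Pm[OF x0(1), of d] mM[of d] by simp
  qed
  then have M\<eta>: "et < M" using px0 et by simp
  have "M : m ` {..K}" unfolding M_def by (rule Max_in) auto
  then have exD: "EX d. d <= K & m d = M" by auto
  \<comment> \<open>The largest degree attaining the maximum: parts of higher degree are strictly
    smaller and go into the error \<open>e\<close>, parts of lower degree cannot reach
    \<open>x n ^ D\<close>.\<close>
  define D where "D = (GREATEST d. d <= K & m d = M)"
  have D: "D <= K" "m D = M"
    using GreatestI_ex_nat[of "%d. d <= K & m d = M" K] exD by (auto simp: D_def)
  have Dmax: "m d < M" if "D < d" "d <= K" for d
  proof -
    have "m d ~= M"
      using Greatest_le_nat[of "%d. d <= K & m d = M" d K] that by (auto simp: D_def)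
    then show ?thesis using mM[OF that(2)] by simp
  qed
  \<comment> \<open>Scaling the maximal point to last coordinate 1 does not change the absolute
    value of the form, so the leading coefficient \<open>c\<close> has absolute value
    \<open>M\<close>.\<close>
  define b where "b i = y D i / y D n" for i
  have yn: "absv (y D i) = 1" for i using y by blast
  have yn0: "y D n ~= 0" using yn[of n] by auto
  have b: "absv (b i) <= 1" for i using yn by (simp add: b_def absv_divide)
  define c where "c = P D (%i. if i < n then b i else 1)"
  have "P D (y D) = P D (%i. y D n * (if i < n then b i else 1))"
    by (rule polyfun_cong[OF hpoly_polyfun[OF P(1)[rule_format]]]) (auto simp: b_def yn0 less_Suc_eq)
  also have "\<dots> = y D n ^ D * c" unfolding c_def by (rule hpoly_homogeneous[OF P(1)[rule_format]])
  finally have cM: "absv c = M" using D(2) yn[of n] by (simp add: m_def absv_mult absv_power)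
  have M0: "0 < M" using M\<eta> et by simp
  have c0: "c ~= 0" using cM M0 by auto
  have "ALL d. EX g. (ALL k. g k : polyfun n) & (ALL k>d. g k = (%_. 0)) &
     (ALL x. P d (shear n b x) = (\<Sum>k\<le>d. g k x * x n ^ k)) & (ALL x. g d x = P d (%i. if i < n then b i else 1))"
    by (rule allI, rule hpoly_shear, rule P(1)[rule_format])
  then obtain g where g: "ALL d. (ALL k. g d k : polyfun n) & (ALL k>d. g d k = (%_. 0)) &
     (ALL x. P d (shear n b x) = (\<Sum>k\<le>d. g d k x * x n ^ k)) & (ALL x. g d d x = P d (%i. if i < n then b i else 1))"
    by (rule choice[THEN exE])
  have gm: "absv (g d k x) <= m d" if x: "x : polydisc" for d k x
  proof (cases "k <= d")
    case True
    show ?thesis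
    proof (rule polyfun_coeff_le[of "g d" n "%x. P d (shear n b x)" d "m d"])
      fix x :: "nat \<Rightarrow> 'a" assume "x : polydisc"
      then show "absv (P d (shear n b x)) <= m d" by (intro Pm shear_polydisc b)
    qed (use g x True in auto)
  next
    case False
    then show ?thesis using g by (auto simp: m_def)
  qed
  define w where "w = (%l x. (\<Sum>d\<le>D. g d l x) / c)"
  define e where "e = (%x. ((\<Sum>d\<in>{D<..K}. P d (shear n b x)) + (f (shear n b x) - p (shear n b x))) / c)"
  define th where "th = Max (insert (et / M) ((%d. m d / M) ` {D<..K}))"
  have th1: "th < 1" unfolding th_def using Dmax M\<eta> M0 by (subst Max_less_iff) auto
  have th\<eta>: "et / M <= th" unfolding th_def by (intro Max_ge) auto
  have \<theta>m: "m d / M <= th" if "D < d" "d <= K" for d unfolding th_def using that by (intro Max_ge) auto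
  have th0: "0 < th" using th\<eta> et M0 by (meson divide_pos_pos less_le_trans)
  have w1: "w l : tate n" for l
    unfolding w_def divide_inverse using g by (intro tate_mult tate_sum tate_const polyfun_tate) auto
  have w2: "absv (w l x) <= 1" if "x : polydisc" for l x
  proof -
    have "absv (\<Sum>d\<le>D. g d l x) <= M"
    proof (rule absv_sum_le)
      fix d assume "d : {..D}"
      then show "absv (g d l x) <= M" using gm[OF that, of d l] mM[of d] D(1) by auto
    qed (use M0 in simp)
    then show ?thesis using M0 cM by (simp add: w_def absv_divide)
  qed
  have e1: "e : tate (Suc n)"
  proof -
    have t: "(%x. h (shear n b x)) : tate (Suc n)" if "h : tate (Suc n)" for h
      by (rule tate_shear[OF that b])
    have tP: "(%x. P d (shear n b x)) : tate (Suc n)" for d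
      by (rule t[OF polyfun_tate[OF hpoly_polyfun[OF P(1)[rule_format]]]])
    show ?thesis unfolding e_def divide_inverse
      by (rule tate_mult[OF tate_add[OF tate_sum[OF tP] tate_diff[OF t[OF f] t[OF polyfun_tate[OF p(1)]]]] tate_const])
  qed
  have e2: "absv (e x) <= th" if x: "x : polydisc" for x
  proof -
    have sx: "shear n b x : polydisc" by (rule shear_polydisc[OF x b])
    have "absv ((\<Sum>d\<in>{D<..K}. P d (shear n b x)) + (f (shear n b x) - p (shear n b x))) <= th * M"
    proof (intro absv_add_le' absv_sum_le)
      fix d assume "d : {D<..K}"
      then show "absv (P d (shear n b x)) <= th * M"
        using Pm[OF sx, of d] \<theta>m[of d] M0 by (auto simp: field_simps)
    next
      show "absv (f (shear n b x) - p (shear n b x)) <= th * M"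
        using p(2)[OF sx] th\<eta> M0 by (simp add: field_simps)
    qed (use th0 M0 in simp)
    then show ?thesis using M0 cM by (simp add: e_def absv_divide field_simps)
  qed
  have "f (shear n b x) = c * (x n ^ D + (\<Sum>l<D. w l x * x n ^ l) + e x)" for x
  proof -
    have "(\<Sum>d\<le>D. P d (shear n b x)) = (\<Sum>d\<le>D. \<Sum>k\<le>D. g d k x * x n ^ k)"
    proof (rule sum.cong[OF refl])
      fix d assume d: "d : {..D}"
      have "P d (shear n b x) = (\<Sum>k\<le>d. g d k x * x n ^ k)" using g by blast
      also have "\<dots> = (\<Sum>k\<le>D. g d k x * x n ^ k)"
        by (rule sum.mono_neutral_left) (use d g in auto)
      finally show "P d (shear n b x) = (\<Sum>k\<le>D. g d k x * x n ^ k)" .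
    qed
    also have "\<dots> = (\<Sum>k\<le>D. (\<Sum>d\<le>D. g d k x) * x n ^ k)"
      by (subst sum.swap) (simp add: sum_distrib_right)
    also have "\<dots> = (\<Sum>k<D. (\<Sum>d\<le>D. g d k x) * x n ^ k) + (\<Sum>d\<le>D. g d D x) * x n ^ D"
      by (simp add: lessThan_Suc_atMost[symmetric])
    also have "(\<Sum>d\<le>D. g d D x) = (\<Sum>d\<in>{D}. g d D x)"
      by (rule sum.mono_neutral_right) (use g in auto)
    also have "\<dots> = c" using g by (simp add: c_def)
    also have "(\<Sum>k<D. (\<Sum>d\<le>D. g d k x) * x n ^ k) = c * (\<Sum>l<D. w l x * x n ^ l)"
      using c0 by (simp add: w_def sum_distrib_left)
    finally have "(\<Sum>d\<le>D. P d (shear n b x)) = c * (x n ^ D + (\<Sum>l<D. w l x * x n ^ l))" by (simp add: algebra_simps)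
    moreover have "p (shear n b x) = (\<Sum>d\<le>D. P d (shear n b x)) + (\<Sum>d\<in>{D<..K}. P d (shear n b x))"
    proof -
      have "{..K} = {..D} \<union> {D<..K}" using D(1) by auto
      then show ?thesis unfolding P(2)[rule_format] by (simp add: sum.union_disjoint ivl_disj_int)
    qed
    moreover have "c * e x = (\<Sum>d\<in>{D<..K}. P d (shear n b x)) + (f (shear n b x) - p (shear n b x))"
      using c0 by (simp add: e_def)
    ultimately show ?thesis by (simp add: distrib_left)
  qed
  then show ?thesis using b c0 w1 w2 e1 e2 th0 th1
    by (intro exI[of _ b] exI[of _ c] exI[of _ D] exI[of _ w] exI[of _ e] exI[of _ th]) auto
qed

theorem tate_nullstellensatz:
  fixes I :: "((nat \<Rightarrow> 'a::complete_nonarch_field) \<Rightarrow> 'a) set"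
  shows "tideal n I ==> ALL x:polydisc. EX h:I. h x ~= 0 ==> (%_. 1) : I"
proof (induction n arbitrary: I)
  case 0
  obtain h where h: "h : I" "h (%_. 0) ~= 0" using 0(2) polydisc_zero by blast
  have hx: "h x = h (%_. 0)" if "x : polydisc" for x
    by (rule tate_cong[OF tideal_tate[OF 0(1) h(1)]]) (use that in auto)
  show ?case
  proof (rule tideal_ext[OF 0(1) tideal_mult[OF 0(1) h(1) tate_const[of "inverse (h (%_. 0))"]]])
    fix x :: "nat \<Rightarrow> 'a" assume "x : polydisc"
    from hx[OF this] show "1 = inverse (h (%_. 0)) * h x" using h(2) by (metis left_inverse)
  qed
next
  case (Suc n)
  note I = Suc.prems(1)
  obtain f where f: "f : I" "f (%_. 0) ~= 0" using Suc.prems(2) polydisc_zero by blast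
  obtain b c D w e th where b: "ALL i. absv (b i) <= 1" and c: "c ~= 0"
    and w: "ALL l<D. w l : tate n & (ALL x:polydisc. absv (w l x) <= 1)"
    and e: "e : tate (Suc n)" "ALL x:polydisc. absv (e x) <= th" "0 < th" "th < 1"
    and fe: "ALL x:polydisc. f (shear n b x) = c * (x n ^ D + (\<Sum>l<D. w l x * x n ^ l) + e x)"
    using noether_shear[OF tideal_tate[OF I f(1)] polydisc_zero f(2)] by blast
  \<comment> \<open>The shear with \<open>- b i\<close> inverts the shear with \<open>b\<close> up
    to coordinates beyond \<open>n\<close>, which functions of \<open>Suc n\<close> variables
    ignore; it transports the ideal to one that contains a Weierstrass divisor.\<close>
  define J where "J = {k : tate (Suc n). (%x. k (shear n (%i. - b i) x)) : I}"
  have b': "absv (- b i) <= 1" for i using b by simp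
  have J: "tideal (Suc n) J"
    unfolding tideal_def
  proof (intro conjI ballI allI impI)
    show "J \<subseteq> tate (Suc n)" by (auto simp: J_def)
    show "(%_. 0) : J" using tideal_zero[OF I] by (auto simp: J_def)
    fix h assume h: "h : J"
    show "(%x. h x + k x) : J" if "k : J" for k
      using h that tideal_add[OF I] by (auto simp: J_def intro: tate_add)
    show "(%x. k x * h x) : J" if "k : tate (Suc n)" for k
      using h that tideal_mult[OF I] tate_shear[OF that b'] by (auto simp: J_def intro: tate_mult)
    show "k : J" if k: "ALL x:polydisc. k x = h x" for k
    proof -
      have "k : tate (Suc n)" by (rule tate_ext[of h]) (use h k in \<open>auto simp: J_def\<close>)
      moreover have "(%x. k (shear n (%i. - b i) x)) : I"
        by (rule tideal_ext[OF I, of "%x. h (shear n (%i. - b i) x)"])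
           (use h k shear_polydisc[OF _ b'] in \<open>auto simp: J_def\<close>)
      ultimately show ?thesis by (simp add: J_def)
    qed
  qed
  have inv: "(%x. h (shear n b x)) : J" if h: "h : I" for h
  proof -
    have "(%x. h (shear n b (shear n (%i. - b i) x))) : I"
    proof (rule tideal_ext[OF I h])
      fix x :: "nat \<Rightarrow> 'a" assume x: "x : polydisc"
      show "h (shear n b (shear n (%i. - b i) x)) = h x"
      proof (rule tate_cong[OF tideal_tate[OF I h] _ _ x])
        show "shear n b (shear n (%i. - b i) x) : polydisc"
          by (intro shear_polydisc x b' b[rule_format])
      qed (auto simp: shear_def less_Suc_eq)
    qed
    then show ?thesis using tate_shear[OF tideal_tate[OF I h]] b by (simp add: J_def)
  qed
  define f1 where "f1 = (%x. inverse c * f (shear n b x))"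
  have "(%_. 1) : J"
  proof (rule nullstellensatz_step[where f = f1 and w = w and D = D and e = e and th = th, OF J Suc.IH])
    show "f1 : J" unfolding f1_def by (rule tideal_mult[OF J inv[OF f(1)] tate_const])
    show "ALL x:polydisc. EX h:J. h x ~= 0"
    proof
      fix x :: "nat \<Rightarrow> 'a" assume "x : polydisc"
      then have "shear n b x : polydisc" using b by (intro shear_polydisc) auto
      then obtain h where h: "h : I" "h (shear n b x) ~= 0" using Suc.prems(2) by blast
      from h(2) show "EX h:J. h x ~= 0" by (rule bexI[OF _ inv[OF h(1)]])
    qed
    show "f1 x = x n ^ D + (\<Sum>l<D. w l x * x n ^ l) + e x" if "x : polydisc" for x
      using fe that c by (simp add: f1_def)
  qed (use w e in auto)
  then show ?case by (simp add: J_def)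
qed

section \<open>Analytic functions on presented affinoids\<close>

definition ev :: "('p \<Rightarrow> 'a::complete_nonarch_field) list \<Rightarrow> 'p \<Rightarrow> nat \<Rightarrow> 'a" where
  "ev gs p = (%i. if i < length gs then (gs ! i) p else 0)"

text \<open>The working form of \<open>analytic_functions\<close>; the two agree on
  \<open>sound\<close> spaces by \<open>analytic_functions_eq\<close>.\<close>

definition an :: "('p, 'a::complete_nonarch_field) affinoid \<Rightarrow> ('p \<Rightarrow> 'a) set" where
  "an W = {h. EX H:tate (length (snd W)). ALL p:fst W. h p = H (ev (snd W) p)}"

definition sound :: "('p, 'a::complete_nonarch_field) affinoid \<Rightarrow> bool" where
  "sound W \<longleftrightarrow> (ALL p:fst W. ALL g:set (snd W). absv (g p) <= 1)"

lemma soundD: "sound W ==> p : fst W ==> ev (snd W) p : polydisc"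
  by (auto simp: sound_def polydisc_def ev_def)

lemma polyfun_coeffs:
  fixes p :: "(nat \<Rightarrow> 'a::complete_nonarch_field) \<Rightarrow> 'a"
  shows "p : polyfun n ==> ALL x:polydisc. absv (p x) <= B ==>
     EX c :: (nat \<Rightarrow>\<^sub>0 nat) \<Rightarrow> 'a. finite {v. c v ~= 0} & (ALL v. \<not> Poly_Mapping.keys v \<subseteq> {..<n} --> c v = 0) &
       (ALL v. absv (c v) <= B) &
       (ALL x. p x = (\<Sum>v | c v ~= 0. c v * (\<Prod>i<n. x i ^ Poly_Mapping.lookup v i)))"
proof (induction n arbitrary: p)
  case 0
  have B: "absv (p (%_. 0)) <= B" using 0 by simp
  have p: "p x = p (%_. 0)" for x by (rule polyfun_cong[OF 0(1)]) simp
  define c where "c = (%v :: nat \<Rightarrow>\<^sub>0 nat. if v = 0 then p (%_. 0) else 0)"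
  have "(\<Sum>v | c v ~= 0. c v * (\<Prod>i<0. x i ^ Poly_Mapping.lookup v i)) = p x" for x
  proof -
    have "(\<Sum>v | c v ~= 0. c v * (\<Prod>i<0. x i ^ Poly_Mapping.lookup v i)) = (\<Sum>v\<in>{0}. c v)"
      by (rule sum.mono_neutral_cong_left) (auto simp: c_def)
    then show ?thesis using p[of x] by (simp add: c_def)
  qed
  note eq = this
  have "finite {v. c v ~= 0}" by (rule finite_subset[of _ "{0}"]) (auto simp: c_def)
  moreover have "ALL v. \<not> Poly_Mapping.keys v \<subseteq> {..<0} --> c v = 0" by (auto simp: c_def)
  moreover have "ALL v. absv (c v) <= B" using B order_trans[OF absv_nonneg B] by (simp add: c_def)
  ultimately show ?case using eq by (intro exI[of _ c] conjI allI) (blast | metis)+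
next
  case (Suc n)
  obtain K g where g: "ALL k. g k : polyfun n" "ALL k>K. g k = (%_. 0)" "ALL x. p x = (\<Sum>k\<le>K. g k x * x n ^ k)"
    using polyfun_expand[OF Suc.prems(1)] by blast
  have B: "0 <= B" using Suc.prems(2) order_trans[OF absv_nonneg] polydisc_zero by blast
  have gB: "ALL x:polydisc. absv (g k x) <= B" for k
  proof (cases "k <= K")
    case True
    then show ?thesis using Suc.prems(2) g
      by (intro ballI polyfun_coeff_le[of g n p K B]) auto
  qed (use g B in simp)
  have "ALL k. EX c :: (nat \<Rightarrow>\<^sub>0 nat) \<Rightarrow> 'a. finite {v. c v ~= 0} & (ALL v. \<not> Poly_Mapping.keys v \<subseteq> {..<n} --> c v = 0) &
       (ALL v. absv (c v) <= B) &
       (ALL x. g k x = (\<Sum>v | c v ~= 0. c v * (\<Prod>i<n. x i ^ Poly_Mapping.lookup v i)))"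
    using Suc.IH g(1) gB by blast
  then obtain c where c: "ALL k. finite {v :: nat \<Rightarrow>\<^sub>0 nat. c k v ~= 0} & (ALL v. \<not> Poly_Mapping.keys v \<subseteq> {..<n} --> c k v = 0) &
       (ALL v. absv (c k v) <= B) &
       (ALL x. g k x = (\<Sum>v | c k v ~= 0. c k v * (\<Prod>i<n. x i ^ Poly_Mapping.lookup v i)))"
    by (rule choice[THEN exE])
  \<comment> \<open>The exponent of variable \<open>n\<close> selects the coefficient family, which
    is then read at the monomial with that variable deleted.\<close>
  define d where "d = (%v. if Poly_Mapping.lookup v n <= K then c (Poly_Mapping.lookup v n) (Poly_Mapping.update n 0 v) else 0)"
  let ?S = "SIGMA k:{..K}. {\<mu>. c k \<mu> ~= 0}"
  have lu: "Poly_Mapping.lookup (Poly_Mapping.update a b v) j = (if j = a then b else Poly_Mapping.lookup v j)"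
    for a j b :: nat and v :: "nat \<Rightarrow>\<^sub>0 nat" by (simp add: lookup_update)
  have notin: "Poly_Mapping.lookup \<mu> n = 0" if "c k \<mu> ~= 0" for k \<mu>
    using c that by (metis in_keys_iff lessThan_iff less_irrefl subset_iff)
  have up: "Poly_Mapping.update n 0 (Poly_Mapping.update n k \<mu>) = \<mu>" if "Poly_Mapping.lookup \<mu> n = 0" for k and \<mu> :: "nat \<Rightarrow>\<^sub>0 nat"
    using that by (intro poly_mapping_eqI) (auto simp: lu)
  have up2: "Poly_Mapping.update n (Poly_Mapping.lookup v n) (Poly_Mapping.update n 0 v) = v" for v :: "nat \<Rightarrow>\<^sub>0 nat"
    by (intro poly_mapping_eqI) (auto simp: lu)
  have bij: "bij_betw (%(k, \<mu>). Poly_Mapping.update n k \<mu>) ?S {v. d v ~= 0}"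
    by (rule bij_betw_byWitness[of _ "%v. (Poly_Mapping.lookup v n, Poly_Mapping.update n 0 v)"])
       (auto simp: d_def lu up up2 notin split: if_splits)
  have finS: "finite ?S" using c by auto
  show ?case
  proof (intro exI[of _ d] conjI allI impI)
    show "finite {v. d v ~= 0}" using bij_betw_finite[OF bij] finS by simp
    fix v :: "nat \<Rightarrow>\<^sub>0 nat"
    show "absv (d v) <= B" using c B by (simp add: d_def)
    assume "\<not> Poly_Mapping.keys v \<subseteq> {..<Suc n}"
    then obtain j where "j : Poly_Mapping.keys v" "j \<ge> Suc n" by (meson lessThan_iff not_less subsetI)
    then have "j : Poly_Mapping.keys (Poly_Mapping.update n 0 v)" "j \<notin> {..<n}"
      by (auto simp: in_keys_iff lu)
    then have "\<not> Poly_Mapping.keys (Poly_Mapping.update n 0 v) \<subseteq> {..<n}" by blast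
    then have "c k (Poly_Mapping.update n 0 v) = 0" for k using c by blast
    then show "d v = 0" by (simp add: d_def)
  next
    fix x :: "nat \<Rightarrow> 'a"
    have "(\<Sum>v | d v ~= 0. d v * (\<Prod>i<Suc n. x i ^ Poly_Mapping.lookup v i)) =
       (\<Sum>(k, \<mu>)\<in>?S. d (Poly_Mapping.update n k \<mu>) * (\<Prod>i<Suc n. x i ^ Poly_Mapping.lookup (Poly_Mapping.update n k \<mu>) i))"
      by (subst sum.reindex_bij_betw[OF bij, symmetric]) (simp add: case_prod_unfold)
    also have "\<dots> = (\<Sum>(k, \<mu>)\<in>?S. c k \<mu> * (\<Prod>i<n. x i ^ Poly_Mapping.lookup \<mu> i) * x n ^ k)"
    proof (rule sum.cong[OF refl], safe)
      fix k \<mu> assume "k <= K" "c k \<mu> ~= 0"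
      moreover have "(\<Prod>i<n. x i ^ Poly_Mapping.lookup (Poly_Mapping.update n k \<mu>) i) = (\<Prod>i<n. x i ^ Poly_Mapping.lookup \<mu> i)"
        by (intro prod.cong) (auto simp: lu)
      ultimately show "d (Poly_Mapping.update n k \<mu>) * (\<Prod>i<Suc n. x i ^ Poly_Mapping.lookup (Poly_Mapping.update n k \<mu>) i) =
          c k \<mu> * (\<Prod>i<n. x i ^ Poly_Mapping.lookup \<mu> i) * x n ^ k"
        using notin[of k \<mu>] by (simp add: d_def lu up)
    qed
    also have "\<dots> = (\<Sum>k\<le>K. \<Sum>\<mu> | c k \<mu> ~= 0. c k \<mu> * (\<Prod>i<n. x i ^ Poly_Mapping.lookup \<mu> i) * x n ^ k)"
      by (rule sum.Sigma[symmetric]) (use c in auto)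
    also have "\<dots> = p x" unfolding g(3)[rule_format]
      using c by (intro sum.cong refl) (simp add: sum_distrib_right)
    finally show "p x = (\<Sum>v | d v ~= 0. d v * (\<Prod>i<Suc n. x i ^ Poly_Mapping.lookup v i))" by simp
  qed
qed

lemma absv_monomial_le:
  fixes x :: "nat \<Rightarrow> 'a::complete_nonarch_field"
  assumes "x : polydisc" shows "absv (c * (\<Prod>i<n. x i ^ k i)) <= absv c"
proof -
  have "(\<Prod>i<n. absv (x i) ^ k i) <= 1" by (intro prod_le_1 conjI power_le_one) (auto intro: polydiscD[OF assms])
  then show ?thesis using mult_left_mono[of _ 1 "absv c"] by (simp add: absv_mult absv_prod absv_power)
qed

text \<open>The function is a telescoping series of polynomials with geometrically decreasing norms.
  By Gauss's lemma their coefficients decrease as well, so the partial sums \<open>C j\<close>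
  converge uniformly over all monomials.\<close>

lemma tate_coeffs:
  fixes H :: "(nat \<Rightarrow> 'a::complete_nonarch_field) \<Rightarrow> 'a"
  assumes H: "H : tate n"
  shows "EX c :: (nat \<Rightarrow>\<^sub>0 nat) \<Rightarrow> 'a. (ALL v. \<not> Poly_Mapping.keys v \<subseteq> {..<n} --> c v = 0) &
     (ALL ep>0. finite {v. absv (c v) \<ge> ep}) &
     (ALL x:polydisc. ((%v. c v * (\<Prod>i<n. x i ^ Poly_Mapping.lookup v i)) has_sum H x) UNIV)"
proof -
  define ep where "ep j = (1/2 :: real) ^ j" for j
  have ep0: "ep j > 0" for j by (simp add: ep_def)
  have \<epsilon>dec: "ep m <= ep j" if "j <= m" for j m unfolding ep_def using that by (intro power_decreasing) auto
  have \<epsilon>lim: "ep \<longlonglongrightarrow> 0" unfolding ep_def by (rule LIMSEQ_power_zero) simp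
  have "ALL j. EX p. p : polyfun n & (ALL x:polydisc. absv (H x - p x) <= ep j)"
    using H ep0 unfolding tate_def by blast
  then obtain p where p: "ALL j. p j : polyfun n & (ALL x:polydisc. absv (H x - p j x) <= ep j)"
    by (rule choice[THEN exE])
  obtain B where B: "ALL x:polydisc. absv (p 0 x) <= B" using polyfun_bounded[of "p 0"] p by blast
  define d where "d j = (case j of 0 \<Rightarrow> p 0 | Suc i \<Rightarrow> (%x. p (Suc i) x - p i x))" for j
  define b where "b j = (case j of 0 \<Rightarrow> B | Suc i \<Rightarrow> ep i)" for j
  have d: "d j : polyfun n" "ALL x:polydisc. absv (d j x) <= b j" for j
  proof -
    show "d j : polyfun n" using p by (cases j) (auto simp: d_def intro: polyfun_diff)
    show "ALL x:polydisc. absv (d j x) <= b j"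
    proof (cases j)
      case (Suc i)
      have "absv (p (Suc i) x - p i x) <= ep i" if x: "x : polydisc" for x
      proof -
        have "absv (H x - p (Suc i) x) <= ep (Suc i)" "absv (H x - p i x) <= ep i" using p x by auto
        then show ?thesis using absv_triangle[of "p (Suc i) x" "p i x" "H x"] \<epsilon>dec[of i "Suc i"]
          by (simp add: absv_commute[of "p (Suc i) x"])
      qed
      then show ?thesis by (simp add: Suc d_def b_def)
    qed (use B in \<open>simp add: d_def b_def\<close>)
  qed
  have dsum: "(\<Sum>i\<le>j. d i x) = p j x" for j x by (induction j) (auto simp: d_def)
  have "ALL j. EX c :: (nat \<Rightarrow>\<^sub>0 nat) \<Rightarrow> 'a. finite {v. c v ~= 0} & (ALL v. \<not> Poly_Mapping.keys v \<subseteq> {..<n} --> c v = 0) &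
       (ALL v. absv (c v) <= b j) &
       (ALL x. d j x = (\<Sum>v | c v ~= 0. c v * (\<Prod>i<n. x i ^ Poly_Mapping.lookup v i)))"
    using polyfun_coeffs[OF d] by (rule allI)
  then obtain e where e: "ALL j. finite {v :: nat \<Rightarrow>\<^sub>0 nat. e j v ~= 0} & (ALL v. \<not> Poly_Mapping.keys v \<subseteq> {..<n} --> e j v = 0) &
       (ALL v. absv (e j v) <= b j) &
       (ALL x. d j x = (\<Sum>v | e j v ~= 0. e j v * (\<Prod>i<n. x i ^ Poly_Mapping.lookup v i)))"
    by (rule choice[THEN exE])
  define C where "C j v = (\<Sum>i\<le>j. e i v)" for j v
  define S where "S j = (\<Union>i\<le>j. {v. e i v ~= 0})" for j
  have finS: "finite (S j)" for j using e by (auto simp: S_def)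
  have CS: "C j v = 0" if "v \<notin> S j" for j v using that by (auto simp: C_def S_def intro!: sum.neutral)
  have "absv (C m v - C j v) <= ep j" if "j <= m" for m j v using that
  proof (induction m rule: dec_induct)
    case base
    show ?case using ep0[of j] by simp
  next
    case (step m)
    have eq: "C (Suc m) v - C j v = (C m v - C j v) + e (Suc m) v" by (simp add: C_def)
    moreover have "absv (e (Suc m) v) <= b (Suc m)" using e by blast
    ultimately show ?case using step \<epsilon>dec[of j m] unfolding eq by (intro absv_add_le') (auto simp: b_def)
  qed
  then have "EX c. ALL v:UNIV. ALL j. absv (c v - C j v) <= ep j"
    by (intro uniform_limit_exists \<epsilon>lim) auto
  then obtain c where c: "absv (c v - C j v) <= ep j" for v j by blast
  have small: "EX j. ep j < r" if "r > 0" for r :: real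
    using order_tendstoD(2)[OF \<epsilon>lim that] by (auto simp: eventually_sequentially)
  have pC: "p j x = (\<Sum>v\<in>F. C j v * (\<Prod>i<n. x i ^ Poly_Mapping.lookup v i))" if "finite F" "S j \<subseteq> F" for F j x
  proof -
    have "(\<Sum>v\<in>F. C j v * (\<Prod>i<n. x i ^ Poly_Mapping.lookup v i)) =
        (\<Sum>k\<le>j. \<Sum>v\<in>F. e k v * (\<Prod>i<n. x i ^ Poly_Mapping.lookup v i))"
      unfolding C_def sum_distrib_right by (rule sum.swap)
    also have "\<dots> = (\<Sum>k\<le>j. d k x)"
    proof (rule sum.cong[OF refl])
      fix k assume "k : {..j}"
      then have "{v. e k v ~= 0} \<subseteq> F" using that(2) by (auto simp: S_def)
      then have "(\<Sum>v\<in>F. e k v * (\<Prod>i<n. x i ^ Poly_Mapping.lookup v i)) = (\<Sum>v | e k v ~= 0. e k v * (\<Prod>i<n. x i ^ Poly_Mapping.lookup v i))"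
        by (intro sum.mono_neutral_right that(1)) auto
      then show "(\<Sum>v\<in>F. e k v * (\<Prod>i<n. x i ^ Poly_Mapping.lookup v i)) = d k x" using e by simp
    qed
    finally show ?thesis by (simp add: dsum)
  qed
  show ?thesis
  proof (intro exI[of _ c] conjI allI impI ballI)
    fix v :: "nat \<Rightarrow>\<^sub>0 nat" assume "\<not> Poly_Mapping.keys v \<subseteq> {..<n}"
    then have "C j v = 0" for j using e by (auto simp: C_def)
    then have "absv (c v) <= ep j" for j using c[of v j] by simp
    then show "c v = 0" using small[of "absv (c v)"] by (metis absv_pos_iff not_le)
  next
    fix r :: real assume "r > 0"
    then obtain j where j: "ep j < r" using small by blast
    have "v : S j" if "absv (c v) \<ge> r" for v
      using c[of v j] CS[of v j] that j by (cases "v : S j") auto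
    then have "{v. r <= absv (c v)} \<subseteq> S j" by auto
    then show "finite {v. r <= absv (c v)}" using finS finite_subset by blast
  next
    fix x :: "nat \<Rightarrow> 'a" assume x: "x : polydisc"
    let ?m = "%v. (\<Prod>i<n. x i ^ Poly_Mapping.lookup v i)"
    show "((%v. c v * ?m v) has_sum H x) UNIV"
      unfolding has_sum_def tendsto_iff
    proof (intro allI impI)
      fix r :: real assume "r > 0"
      then obtain j where j: "ep j < r" using small by blast
      have "dist (\<Sum>v\<in>F. c v * ?m v) (H x) < r" if F: "finite F" "S j \<subseteq> F" for F
      proof -
        have "absv ((\<Sum>v\<in>F. c v * ?m v) - p j x) <= ep j"
          unfolding pC[OF F] sum_subtractf[symmetric] left_diff_distrib[symmetric]
          using ep0[of j] by (intro absv_sum_le order_trans[OF absv_monomial_le[OF x] c]) auto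
        moreover have "absv (p j x - H x) <= ep j" using p x by (simp add: absv_commute[of "p j x"])
        ultimately show ?thesis using absv_triangle[of "\<Sum>v\<in>F. c v * ?m v" "H x" "p j x"] j
          by (simp add: dist_absv)
      qed
      then show "\<forall>\<^sub>F F in finite_subsets_at_top UNIV. dist (\<Sum>v\<in>F. c v * ?m v) (H x) < r"
        unfolding eventually_finite_subsets_at_top using finS[of j] by (intro exI[of _ "S j"]) auto
    qed
  qed
qed

text \<open>Only finitely many coefficients reach \<open>ep k\<close>, and the ultrametric
  inequality bounds all the others at once; so a power series is a uniform limit of polynomials. The
  converse is \<open>tate_coeffs\<close>.\<close>

lemma analytic_functions_eq:
  assumes W: "sound W" shows "analytic_functions W = an W"
proof (intro equalityI subsetI)
  let ?n = "length (snd W)"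
  have evp: "(\<Prod>i<?n. (snd W ! i) p ^ Poly_Mapping.lookup v i) = (\<Prod>i<?n. ev (snd W) p i ^ Poly_Mapping.lookup v i)" for p and v :: "nat \<Rightarrow>\<^sub>0 nat"
    by (intro prod.cong) (auto simp: ev_def)
  show "h : analytic_functions W" if h: "h : an W" for h
  proof -
    obtain H where H: "H : tate ?n" "ALL p:fst W. h p = H (ev (snd W) p)" using h by (auto simp: an_def)
    obtain c :: "(nat \<Rightarrow>\<^sub>0 nat) \<Rightarrow> 'b" where c: "ALL v. \<not> Poly_Mapping.keys v \<subseteq> {..<?n} --> c v = 0"
     "ALL ep>0. finite {v. absv (c v) \<ge> ep}"
     "ALL x:polydisc. ((%v. c v * (\<Prod>i<?n. x i ^ Poly_Mapping.lookup v i)) has_sum H x) UNIV"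
      using tate_coeffs[OF H(1)] by blast
    show ?thesis unfolding analytic_functions_def mem_Collect_eq
    proof (intro exI[of _ c] conjI ballI)
      fix p assume p: "p : fst W"
      show "((%v. c v * (\<Prod>i<?n. (snd W ! i) p ^ Poly_Mapping.lookup v i)) has_sum h p) UNIV"
        using c(3)[rule_format, OF soundD[OF W p]] H(2) p by (simp add: evp)
    qed (use c in auto)
  qed
  show "h : an W" if h: "h : analytic_functions W" for h
  proof -
    obtain c :: "(nat \<Rightarrow>\<^sub>0 nat) \<Rightarrow> 'b" where c: "ALL v. \<not> Poly_Mapping.keys v \<subseteq> {..<?n} --> c v = 0"
     "ALL ep>0. finite {v. absv (c v) \<ge> ep}"
     "ALL p:fst W. ((%v. c v * (\<Prod>i<?n. (snd W ! i) p ^ Poly_Mapping.lookup v i)) has_sum h p) UNIV"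
      using h unfolding analytic_functions_def mem_Collect_eq by blast
    define ep where "ep k = inverse (real (Suc k))" for k
    have ep0: "ep k > 0" for k by (simp add: ep_def)
    have \<epsilon>dec: "ep m <= ep k" if "k <= m" for k m using that by (simp add: ep_def)
    have \<epsilon>lim: "ep \<longlonglongrightarrow> 0" unfolding ep_def by (rule LIMSEQ_inverse_real_of_nat)
    define F where "F k = {v. absv (c v) \<ge> ep k}" for k
    have finF: "finite (F k)" for k using c(2) ep0 by (simp add: F_def)
    define S where "S k x = (\<Sum>v\<in>F k. c v * (\<Prod>i<?n. x i ^ Poly_Mapping.lookup v i))" for k x
    have tail: "absv ((\<Sum>v\<in>G. c v * (\<Prod>i<?n. x i ^ Poly_Mapping.lookup v i)) - S k x) <= ep k"
      if "finite G" "F k \<subseteq> G" "x : polydisc" for G k x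
    proof -
      have "(\<Sum>v\<in>G. c v * (\<Prod>i<?n. x i ^ Poly_Mapping.lookup v i)) - S k x =
          (\<Sum>v\<in>G - F k. c v * (\<Prod>i<?n. x i ^ Poly_Mapping.lookup v i))"
        unfolding S_def by (rule sum_diff[symmetric]) (use that in auto)
      also have "absv \<dots> <= ep k"
      proof (rule absv_sum_le)
        fix v assume "v : G - F k"
        then have "absv (c v) <= ep k" by (simp add: F_def)
        then show "absv (c v * (\<Prod>i<?n. x i ^ Poly_Mapping.lookup v i)) <= ep k"
          using absv_monomial_le[OF that(3), of "c v"] order_trans by blast
      qed (use ep0[of k] in simp)
      finally show ?thesis .
    qed
    have "EX H:tate ?n. ALL x:polydisc. ALL k. absv (H x - S k x) <= ep k"
    proof (rule tate_limit[where S = S and e = ep, OF _ _ \<epsilon>lim])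
      show "S k : tate ?n" for k unfolding S_def
        by (intro tate_sum tate_mult tate_const tate_prod tate_power tate_var) simp
      fix m k :: nat and x :: "nat \<Rightarrow> 'b" assume x: "x : polydisc" and "k <= m"
      then have "F k \<subseteq> F m" using \<epsilon>dec[of k m] by (auto simp: F_def)
      then show "absv (S m x - S k x) <= ep k" using tail[OF finF _ x] by (simp add: S_def)
    qed
    then obtain H where H: "H : tate ?n" "ALL x:polydisc. ALL k. absv (H x - S k x) <= ep k" by blast
    have "h p = H (ev (snd W) p)" if p: "p : fst W" for p
    proof -
      let ?x = "ev (snd W) p"
      have x: "?x : polydisc" by (rule soundD[OF W p])
      have "absv (h p - H ?x) <= ep k" for k
      proof -
        have "\<forall>\<^sub>F G in finite_subsets_at_top UNIV. dist (\<Sum>v\<in>G. c v * (\<Prod>i<?n. ?x i ^ Poly_Mapping.lookup v i)) (h p) < ep k"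
          using c(3)[rule_format, OF p] ep0[of k] unfolding has_sum_def tendsto_iff evp by blast
        then obtain Y where Y: "finite Y" "ALL G. finite G & Y \<subseteq> G & G \<subseteq> UNIV -->
            dist (\<Sum>v\<in>G. c v * (\<Prod>i<?n. ?x i ^ Poly_Mapping.lookup v i)) (h p) < ep k"
          unfolding eventually_finite_subsets_at_top by blast
        let ?G = "Y \<union> F k"
        let ?s = "\<Sum>v\<in>?G. c v * (\<Prod>i<?n. ?x i ^ Poly_Mapping.lookup v i)"
        have "absv (?s - h p) < ep k" using Y finF[of k] by (simp add: dist_absv[symmetric])
        moreover have "absv (?s - S k ?x) <= ep k" using tail[of ?G k ?x] Y finF x by simp
        moreover have "absv (H ?x - S k ?x) <= ep k" using H(2) x by blast
        ultimately show ?thesis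
          using absv_triangle[of "h p" "H ?x" "S k ?x"] absv_triangle[of "h p" "S k ?x" ?s]
          by (simp add: absv_commute[of "h p" ?s] absv_commute[of "S k ?x" "H ?x"])
      qed
      then have "absv (h p - H ?x) <= 0" by (intro LIMSEQ_le_const[OF \<epsilon>lim]) auto
      then show ?thesis by simp
    qed
    then show ?thesis using H(1) by (auto simp: an_def)
  qed
qed

lemma anI: "H : tate (length (snd W)) ==> (!!p. p : fst W ==> h p = H (ev (snd W) p)) ==> h : an W"
  unfolding an_def by blast

lemma anE:
  assumes "h : an W"
  obtains H where "H : tate (length (snd W))" "!!p. p : fst W ==> h p = H (ev (snd W) p)"
  using assms unfolding an_def by blast

lemma an_const: "(%_. c) : an W"
  by (rule anI[OF tate_const]) simp

lemma an_add:
  assumes "h : an W" "k : an W" shows "(%p. h p + k p) : an W"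
proof -
  obtain H where H: "H : tate (length (snd W))" "!!p. p : fst W ==> h p = H (ev (snd W) p)" by (rule anE[OF assms(1)]) blast
  obtain K where K: "K : tate (length (snd W))" "!!p. p : fst W ==> k p = K (ev (snd W) p)" by (rule anE[OF assms(2)]) blast
  show ?thesis by (rule anI[OF tate_add[OF H(1) K(1)]]) (simp add: H(2) K(2))
qed

lemma an_mult:
  assumes "h : an W" "k : an W" shows "(%p. h p * k p) : an W"
proof -
  obtain H where H: "H : tate (length (snd W))" "!!p. p : fst W ==> h p = H (ev (snd W) p)" by (rule anE[OF assms(1)]) blast
  obtain K where K: "K : tate (length (snd W))" "!!p. p : fst W ==> k p = K (ev (snd W) p)" by (rule anE[OF assms(2)]) blast
  show ?thesis by (rule anI[OF tate_mult[OF H(1) K(1)]]) (simp add: H(2) K(2))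
qed

lemma an_sum: "(!!i. i : A ==> h i : an W) ==> (%p. \<Sum>i\<in>A. h i p) : an W"
  by (induction A rule: infinite_finite_induct) (simp_all add: an_const an_add)

lemma an_power: "h : an W ==> (%p. h p ^ k) : an W"
  by (induction k) (simp_all add: an_const an_mult)

lemma an_prod: "(!!i. i : A ==> h i : an W) ==> (%p. \<Prod>i\<in>A. h i p) : an W"
  by (induction A rule: infinite_finite_induct) (simp_all add: an_const an_mult)

lemma an_cong: "h : an W ==> (!!p. p : fst W ==> k p = h p) ==> k : an W"
  by (auto simp: an_def)

lemma an_gen:
  assumes "g : set (snd W)" shows "g : an W"
proof -
  obtain i where i: "i < length (snd W)" "snd W ! i = g" using assms by (auto simp: in_set_conv_nth)
  show ?thesis by (rule anI[OF tate_var[OF i(1)]]) (use i in \<open>simp add: ev_def\<close>)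
qed

lemma an_bounded:
  assumes "sound W" "h : an W" shows "EX B>0. ALL p:fst W. absv (h p) <= B"
proof -
  obtain H where H: "H : tate (length (snd W))" "!!p. p : fst W ==> h p = H (ev (snd W) p)" by (rule anE[OF assms(2)]) blast
  then show ?thesis using tate_bounded[OF H(1)] soundD[OF assms(1)] by metis
qed

text \<open>Evaluation of the generators maps the points onto the zero set in the polydisc of some
  functions \<open>E\<close>, with coordinates past the generators equal to 0. This is what allows
  the Nullstellensatz of the Tate algebra to speak about points of \<open>W\<close>.\<close>

definition presented :: "('p, 'a::complete_nonarch_field) affinoid \<Rightarrow> bool" where
  "presented W \<longleftrightarrow> sound W & (\<exists>E \<subseteq> tate (length (snd W)). (ALL p:fst W. ALL e:E. e (ev (snd W) p) = 0) &
     (ALL x:polydisc. (ALL i>=length (snd W). x i = 0) & (ALL e:E. e x = 0) --> (EX p:fst W. x = ev (snd W) p)))"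

text \<open>The ideal of \<open>an W\<close> generated by \<open>Hs\<close>, set up so that bounds
  and products can be proved by induction.\<close>

inductive_set comb :: "('p, 'a::complete_nonarch_field) affinoid \<Rightarrow> ('p \<Rightarrow> 'a) set \<Rightarrow> ('p \<Rightarrow> 'a) set"
  for W Hs where
  zero: "(%_. 0) : comb W Hs"
| step: "k : comb W Hs ==> h : Hs ==> a : an W ==> (%p. k p + a p * h p) : comb W Hs"

lemma comb_add: "l : comb W Hs ==> k : comb W Hs ==> (%p. k p + l p) : comb W Hs"
proof (induction rule: comb.induct)
  case (step l h a)
  from comb.step[OF step.IH[OF step.prems] step.hyps(2,3)] show ?case by (simp add: add.assoc)
qed simp

lemma comb_mult: "k : comb W Hs ==> a : an W ==> (%p. a p * k p) : comb W Hs"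
proof (induction rule: comb.induct)
  case (step l h b)
  from comb.step[OF step.IH[OF step.prems] step.hyps(2) an_mult[OF step.prems step.hyps(3)]]
  show ?case by (simp add: algebra_simps)
qed (simp add: comb.zero)

text \<open>The functions on the polydisc that restrict to combinations of \<open>Hs\<close> form an
  ideal containing the equations \<open>E\<close>. A common zero of this ideal would be a point of
  \<open>W\<close> at which all of \<open>Hs\<close> vanish.\<close>

theorem affinoid_nullstellensatz:
  fixes W :: "('p, 'a::complete_nonarch_field) affinoid"
  assumes W: "presented W" and Hs: "Hs \<subseteq> an W" and nz: "!!p. p : fst W ==> EX h:Hs. h p ~= 0"
  shows "EX k:comb W Hs. ALL p:fst W. k p = 1"
proof -
  let ?n = "length (snd W)" and ?ev = "ev (snd W)"
  have snd: "sound W" using W by (simp add: presented_def)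
  obtain E where E: "E \<subseteq> tate ?n" "!!p e. p : fst W ==> e : E ==> e (?ev p) = 0"
     "!!x. x : polydisc ==> (!!i. i \<ge> ?n ==> x i = 0) ==> (!!e. e : E ==> e x = 0) ==> EX p:fst W. x = ?ev p"
    using W unfolding presented_def by metis
  define I where "I = {k : tate ?n. EX l:comb W Hs. ALL p:fst W. k (?ev p) = l p}"
  have I: "tideal ?n I"
    unfolding tideal_def
  proof (intro conjI ballI allI impI)
    show "I \<subseteq> tate ?n" by (auto simp: I_def)
    show "(%_. 0) : I" unfolding I_def by (intro CollectI conjI bexI[OF _ comb.zero]) auto
    fix h assume h: "h : I"
    then obtain l where l: "l : comb W Hs" "ALL p:fst W. h (?ev p) = l p" by (auto simp: I_def)
    show "(%x. h x + k x) : I" if k: "k : I" for k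
    proof -
      obtain l' where l': "l' : comb W Hs" "ALL p:fst W. k (?ev p) = l' p" using k by (auto simp: I_def)
      show ?thesis unfolding I_def mem_Collect_eq
      proof (intro conjI bexI[of _ "%p. l p + l' p"])
        show "(%x. h x + k x) : tate ?n" using h k by (intro tate_add) (auto simp: I_def)
        show "(%p. l p + l' p) : comb W Hs" by (rule comb_add[OF l'(1) l(1)])
      qed (use l l' in auto)
    qed
    show "(%x. k x * h x) : I" if k: "k : tate ?n" for k
      unfolding I_def mem_Collect_eq
    proof (intro conjI bexI[of _ "%p. k (?ev p) * l p"])
      show "(%x. k x * h x) : tate ?n" using h k by (intro tate_mult) (auto simp: I_def)
      have "(%p. k (?ev p)) : an W" by (rule anI[OF k]) simp
      then show "(%p. k (?ev p) * l p) : comb W Hs" by (rule comb_mult[OF l(1)])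
    qed (use l in auto)
    show "k : I" if k: "ALL x:polydisc. k x = h x" for k
    proof -
      have "k : tate ?n" by (rule tate_ext[of h]) (use h k in \<open>auto simp: I_def\<close>)
      then show ?thesis unfolding I_def using l k soundD[OF snd] by auto
    qed
  qed
  have "ALL x:polydisc. EX h:I. h x ~= 0"
  proof (rule ballI, rule ccontr)
    fix x :: "nat \<Rightarrow> 'a" assume x: "x : polydisc" and none: "\<not> (EX h:I. h x ~= 0)"
    define y where "y = (%i. if i < ?n then x i else 0)"
    have y: "y : polydisc" using x by (auto simp: y_def polydisc_def)
    have eq: "h x = h y" if "h : tate ?n" for h by (rule tate_cong[OF that _ x y]) (simp add: y_def)
    have "e y = 0" if e: "e : E" for e
    proof -
      have "e : tate ?n" using E(1) e by auto
      moreover have "e : I" unfolding I_def using calculation E(2) e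
        by (intro CollectI conjI bexI[OF _ comb.zero]) auto
      ultimately show ?thesis using none eq by metis
    qed
    then obtain p where p: "p : fst W" "y = ?ev p" using E(3)[OF y] by (auto simp: y_def)
    obtain h where h: "h : Hs" "h p ~= 0" using nz[OF p(1)] by blast
    then have "h : an W" using Hs by auto
    then obtain H where H: "H : tate ?n" "!!p. p : fst W ==> h p = H (?ev p)" by (rule anE) blast
    have "(%p. 0 + 1 * h p) : comb W Hs" by (rule comb.step[OF comb.zero h(1) an_const])
    then have "H : I" unfolding I_def using H by (intro CollectI conjI bexI[of _ "%p. 0 + 1 * h p"]) auto
    moreover have "H x ~= 0" using eq[OF H(1)] p h(2) H(2) by simp
    ultimately show False using none by blast
  qed
  from tate_nullstellensatz[OF I this] have "(%_. 1) : I" .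
  then show ?thesis unfolding I_def by auto
qed

text \<open>In an identity \<open>1 = a1 * h1 + ... + an * hn\<close> the coefficients are bounded
  on \<open>W\<close>, so the \<open>h\<close> cannot all be small at the same point.\<close>

lemma presented_lower_bound:
  assumes W: "presented W" and Hs: "Hs \<subseteq> an W" and nz: "!!p. p : fst W ==> EX h:Hs. h p ~= 0"
  shows "EX d>0. ALL p:fst W. EX h:Hs. absv (h p) \<ge> d"
proof -
  have snd: "sound W" using W by (simp add: presented_def)
  have bd: "EX C>0. ALL p:fst W. ALL be. (ALL h:Hs. absv (h p) <= be) --> 0 <= be --> absv (k p) <= C * be" if "k : comb W Hs" for k
    using that
  proof (induction rule: comb.induct)
    case zero
    show ?case by (intro exI[of _ 1]) auto
  next
    case (step k h a)
    obtain C where C: "C > 0" "ALL p:fst W. ALL be. (ALL h:Hs. absv (h p) <= be) --> 0 <= be --> absv (k p) <= C * be"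
      using step.IH by blast
    obtain B where B: "B > 0" "ALL p:fst W. absv (a p) <= B" using an_bounded[OF snd step.hyps(3)] by blast
    have "absv (k p + a p * h p) <= max C B * be" if p: "p : fst W" "ALL h:Hs. absv (h p) <= be" "0 <= be" for p be
    proof (rule absv_add_le')
      have "absv (k p) <= C * be" using C(2) p by blast
      also have "\<dots> <= max C B * be" using p(3) by (intro mult_right_mono) auto
      finally show "absv (k p) <= max C B * be" .
      have "absv (a p) * absv (h p) <= max C B * be"
        using B p step.hyps(2) by (intro mult_mono) (auto simp: le_max_iff_disj)
      then show "absv (a p * h p) <= max C B * be" by (simp add: absv_mult)
    qed
    then show ?case using C(1) by (intro exI[of _ "max C B"]) auto
  qed
  obtain k where k: "k : comb W Hs" "ALL p:fst W. k p = 1" using affinoid_nullstellensatz[OF W Hs nz] by blast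
  obtain C where C: "C > 0" "ALL p:fst W. ALL be. (ALL h:Hs. absv (h p) <= be) --> 0 <= be --> absv (k p) <= C * be"
    using bd[OF k(1)] by blast
  have "EX h:Hs. absv (h p) \<ge> 1 / (2 * C)" if p: "p : fst W" for p
  proof (rule ccontr)
    assume "\<not> ?thesis"
    then have "ALL h:Hs. absv (h p) <= 1 / (2 * C)" by (auto simp: not_le less_imp_le)
    then have "absv (k p) <= C * (1 / (2 * C))" using C(1) C(2)[rule_format, OF p, of "1 / (2 * C)"] by auto
    then show False using k(2) p C(1) by simp
  qed
  then show ?thesis using C(1) by (intro exI[of _ "1 / (2 * C)"]) auto
qed

text \<open>Multiplying a representation of 1 by \<open>s\<close> leaves only the analytic products
  \<open>s * h\<close>. In this way a function is glued from local fractions by pure ideal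
  theory.\<close>

lemma presented_div:
  assumes W: "presented W" and Hs: "Hs \<subseteq> an W" and nz: "!!p. p : fst W ==> EX h:Hs. h p ~= 0"
    and s: "!!h. h : Hs ==> (%p. s p * h p) : an W"
  shows "s : an W"
proof -
  have sk: "(%p. s p * k p) : an W" if "k : comb W Hs" for k
    using that
  proof (induction rule: comb.induct)
    case zero
    show ?case by (simp add: an_const)
  next
    case (step k h a)
    from an_add[OF step.IH an_mult[OF step.hyps(3) s[OF step.hyps(2)]]] show ?case by (simp add: algebra_simps)
  qed
  obtain k where k: "k : comb W Hs" "ALL p:fst W. k p = 1" using affinoid_nullstellensatz[OF W Hs nz] by blast
  show ?thesis by (rule an_cong[OF sk[OF k(1)]]) (use k(2) in simp)
qed

lemma ev_append: "i < length gs ==> ev (gs @ hs) p i = ev gs p i"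
  by (simp add: ev_def nth_append)

lemma rational_subdomain_subset: "rational_subdomain W W' ==> fst W' \<subseteq> fst W"
  unfolding rational_subdomain_def by auto

lemma rational_subdomain_sound:
  assumes "sound W" "rational_subdomain W W'" shows "sound W'"
proof -
  obtain g fs where g: "fst W' = {p : fst W. ALL f:set fs. absv (f p) <= absv (g p)}"
     "snd W' = snd W @ map (%f p. f p / g p) fs"
    using assms(2) unfolding rational_subdomain_def by blast
  have "absv (f p / g p) <= 1" if "f : set fs" "p : fst W'" for f p
    using that g by (cases "g p = 0") (auto simp: absv_divide divide_le_eq_1)
  then show ?thesis using assms(1) g unfolding sound_def by auto
qed

lemma an_mono:
  assumes W: "sound W" "rational_subdomain W W'" and h: "h : an W" shows "h : an W'"
proof -
  obtain H where H: "H : tate (length (snd W))" "!!p. p : fst W ==> h p = H (ev (snd W) p)" by (rule anE[OF h]) blast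
  obtain gs where gs: "snd W' = snd W @ gs" using W(2) unfolding rational_subdomain_def by blast
  show ?thesis
  proof (rule anI)
    show "H : tate (length (snd W'))" by (rule tate_mono[OF H(1)]) (simp add: gs)
    fix p assume p: "p : fst W'"
    then have "p : fst W" using rational_subdomain_subset[OF W(2)] by auto
    moreover have "H (ev (snd W') p) = H (ev (snd W) p)"
      by (rule tate_cong[OF H(1)])
         (use soundD[OF W(1) calculation] soundD[OF rational_subdomain_sound[OF W] p] in \<open>auto simp: gs ev_append\<close>)
    ultimately show "h p = H (ev (snd W') p)" using H(2) by simp
  qed
qed

text \<open>The new coordinates obey \<open>x (n + j) * G = F j\<close>. If \<open>G\<close>
  vanished at a solution, all \<open>F j\<close> would vanish too, against the absence of common
  zeros; so the solutions are exactly the points of the subdomain.\<close>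

lemma rational_subdomain_presented:
  assumes W: "presented W" and sub: "rational_subdomain W W'"
  shows "presented W'"
proof -
  let ?n = "length (snd W)" and ?ev = "ev (snd W)" and ?m = "length (snd W')" and ?ev' = "ev (snd W')"
  have snd: "sound W" using W by (simp add: presented_def)
  have snd': "sound W'" by (rule rational_subdomain_sound[OF snd sub])
  obtain E where E: "E \<subseteq> tate ?n" "!!p e. p : fst W ==> e : E ==> e (?ev p) = 0"
     "!!x. x : polydisc ==> (!!i. i \<ge> ?n ==> x i = 0) ==> (!!e. e : E ==> e x = 0) ==> EX p:fst W. x = ?ev p"
    using W unfolding presented_def by metis
  obtain g fs where g: "g : an W" "set fs \<subseteq> an W" and nz: "ALL p:fst W. EX f:set (g # fs). f p ~= 0"
     and pts: "fst W' = {p : fst W. ALL f:set fs. absv (f p) <= absv (g p)}"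
     and gens: "snd W' = snd W @ map (%f p. f p / g p) fs"
    using sub unfolding rational_subdomain_def analytic_functions_eq[OF snd] by blast
  have m: "?m = ?n + length fs" by (simp add: gens)
  obtain G where G: "G : tate ?n" "!!p. p : fst W ==> g p = G (?ev p)" by (rule anE[OF g(1)]) blast
  have "ALL j. EX F. j < length fs --> F : tate ?n & (ALL p:fst W. (fs ! j) p = F (?ev p))"
    using g(2) unfolding an_def by (auto dest!: nth_mem)
  then obtain F where F': "ALL j. j < length fs --> F j : tate ?n & (ALL p:fst W. (fs ! j) p = F j (?ev p))"
    by (rule choice[THEN exE])
  then have F: "!!j. j < length fs ==> F j : tate ?n" "!!j p. j < length fs ==> p : fst W ==> (fs ! j) p = F j (?ev p)"
    by auto
  define E' where "E' = E \<union> (%j x. x (?n + j) * G x - F j x) ` {..<length fs}"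
  have gnz: "g p ~= 0" if "p : fst W'" for p using nz pts that by auto
  have mono: "h : tate ?n ==> h : tate ?m" for h :: "(nat \<Rightarrow> 'b) \<Rightarrow> 'b" by (rule tate_mono[of _ ?n]) (simp_all add: m)
  have restr: "h (?ev' p) = h (?ev p)" if "h : tate ?n" "p : fst W'" for h p
    by (rule tate_cong[OF that(1)])
       (use that(2) soundD[OF snd] soundD[OF snd' that(2)] in \<open>auto simp: gens ev_append pts\<close>)
  show ?thesis unfolding presented_def
  proof (intro conjI exI[of _ E'] ballI impI)
    show "sound W'" by (rule snd')
    show "E' \<subseteq> tate ?m" unfolding E'_def
      using E(1) mono F(1) G(1) m by (auto intro!: tate_diff tate_mult tate_var)
    fix p e assume p: "p : fst W'" and e: "e : E'"
    have pW: "p : fst W" using p pts by auto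
    show "e (?ev' p) = 0"
    proof (cases "e : E")
      case True
      then show ?thesis using restr[OF subsetD[OF E(1) True] p] E(2)[OF pW True] by simp
    next
      case False
      then obtain j where j: "j < length fs" "e = (%x. x (?n + j) * G x - F j x)" using e by (auto simp: E'_def)
      have "?ev' p (?n + j) = (fs ! j) p / g p" using j by (simp add: ev_def gens nth_append)
      then show ?thesis using j gnz[OF p] restr[OF G(1) p] restr[OF F(1)[OF j(1)] p] G(2)[OF pW] F(2)[OF j(1) pW]
        by simp
    qed
  next
    fix x :: "nat \<Rightarrow> 'b" assume x: "x : polydisc" and xx: "(ALL i>=?m. x i = 0) & (ALL e:E'. e x = 0)"
    define y where "y = (%i. if i < ?n then x i else 0)"
    have y: "y : polydisc" using x by (auto simp: y_def polydisc_def)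
    have eq: "h x = h y" if "h : tate ?n" for h by (rule tate_cong[OF that _ x y]) (simp add: y_def)
    have "e y = 0" if e: "e : E" for e
    proof -
      have "e : E'" using e by (simp add: E'_def)
      then have "e x = 0" using xx by blast
      then show ?thesis using eq[OF subsetD[OF E(1) e]] by simp
    qed
    then obtain p where p: "p : fst W" "y = ?ev p" using E(3)[OF y] by (auto simp: y_def)
    have fj: "x (?n + j) * g p = (fs ! j) p" if j: "j < length fs" for j
    proof -
      have "(%x. x (?n + j) * G x - F j x) : E'" using j by (auto simp: E'_def)
      then have "x (?n + j) * G x - F j x = 0" using xx by fast
      then show ?thesis using eq[OF G(1)] eq[OF F(1)[OF j]] p G(2) F(2)[OF j] by simp
    qed
    have pW': "p : fst W'"
    proof -
      have "absv (f p) <= absv (g p)" if f: "f : set fs" for f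
      proof -
        obtain j where j: "j < length fs" "f = fs ! j" using f by (auto simp: in_set_conv_nth)
        have "absv (x (?n + j)) * absv (g p) <= 1 * absv (g p)"
          by (intro mult_right_mono polydiscD[OF x]) simp
        then show ?thesis using fj[OF j(1)] j by (metis absv_mult mult_1)
      qed
      then show ?thesis using p by (simp add: pts)
    qed
    have "x i = ?ev' p i" for i
    proof -
      consider "i < ?n" | j where "j < length fs" "i = ?n + j" | "i \<ge> ?m"
        using m by (metis add_diff_inverse_nat add_less_cancel_left not_less)
      then show ?thesis
      proof cases
        case 1
        then have "x i = y i" by (simp add: y_def)
        then show ?thesis using 1 p by (simp add: gens ev_append)
      next
        case 2
        then show ?thesis using fj[OF 2(1)] gnz[OF pW'] by (simp add: ev_def gens nth_append field_simps)
      next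
        case 3
        then show ?thesis using xx by (simp add: ev_def)
      qed
    qed
    then show "EX p:fst W'. x = ?ev' p" using pW' by blast
  qed
qed

text \<open>The two generators embed the annulus in the bidisc as the curve
  \<open>x * y = a / b\<close>.\<close>

lemma presented_annulus:
  assumes "a ~= (0::'a::complete_nonarch_field)" "absv a <= absv b"
  shows "presented (annulus a b)"
proof -
  have b: "b ~= 0" using assms by auto
  have snd: "sound (annulus a b)"
    using assms b by (auto simp: sound_def annulus_def absv_divide divide_le_eq_1)
  show ?thesis unfolding presented_def
  proof (intro conjI snd exI[of _ "{%x. x 0 * x 1 - a / b}"] ballI impI)
    show "{%x. x 0 * x 1 - a / b} \<subseteq> tate (length (snd (annulus a b)))"
      by (auto simp: annulus_def intro!: tate_diff tate_mult tate_var)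
    fix p and e :: "(nat \<Rightarrow> 'a) \<Rightarrow> 'a" assume "p : fst (annulus a b)" "e : {%x. x 0 * x 1 - a / b}"
    then show "e (ev (snd (annulus a b)) p) = 0" using assms by (auto simp: annulus_def ev_def)
  next
    fix x :: "nat \<Rightarrow> 'a" assume x: "x : polydisc" and
      xx: "(ALL i>=length (snd (annulus a b)). x i = 0) & (ALL e:{%x. x 0 * x 1 - a / b}. e x = 0)"
    have x2: "x i = 0" if "i \<ge> 2" for i using xx that by (simp add: annulus_def)
    have xy: "x 0 * x 1 = a / b" using xx by simp
    have x0: "x 0 ~= 0" using xy assms b by auto
    have x1: "x 1 = a / (b * x 0)"
      using xy x0 by (metis divide_divide_eq_left nonzero_mult_div_cancel_left)
    then have "absv a = absv (b * x 0) * absv (x 1)" using b x0 by (simp add: absv_mult[symmetric])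
    then have "absv a <= absv (b * x 0)" using mult_left_mono[OF polydiscD[OF x, of 1], of "absv (b * x 0)"] by simp
    then have mem: "b * x 0 : fst (annulus a b)"
      using mult_left_mono[OF polydiscD[OF x, of 0], of "absv b"] by (simp add: annulus_def absv_mult)
    have "x i = ev (snd (annulus a b)) (b * x 0) i" for i
    proof (cases "i < 2")
      case True
      then have "i = 0 \<or> i = 1" by auto
      then show ?thesis using x1 b by (auto simp: ev_def annulus_def)
    qed (use x2 in \<open>simp add: ev_def annulus_def\<close>)
    then have "x = ev (snd (annulus a b)) (b * x 0)" by (rule ext)
    then show "EX p:fst (annulus a b). x = ev (snd (annulus a b)) p" using mem by (rule bexI)
  qed
qed

section \<open>Affinoids of projective varieties\<close>

lemma hcoord_nonzero: "EX j. hcoord p j ~= 0"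
  using Quotient3_rep_reflp[OF Quotient3_ppoint, of p] by (auto simp: proportional_def hcoord_def)

lemma hcoord_abs:
  assumes "x j ~= (0::'a::field)"
  shows "EX c. c ~= 0 & hcoord (abs_ppoint x) = (%i. c * x i)"
proof -
  have "proportional x x" using assms unfolding proportional_def by (intro conjI exI[of _ j] exI[of _ 1]) auto
  then have "proportional (hcoord (abs_ppoint x)) x"
    unfolding hcoord_def by (rule Quotient3_rep_abs[OF Quotient3_ppoint])
  then obtain c where "c ~= 0" "x = (%i. c * hcoord (abs_ppoint x) i)" by (auto simp: proportional_def)
  then show ?thesis by (intro exI[of _ "inverse c"]) (auto simp: fun_eq_iff field_simps)
qed

lemma abs_ppoint_eqI:
  assumes "x j ~= (0::'a::field)" "c ~= 0" "!!i. y i = c * x i"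
  shows "abs_ppoint x = abs_ppoint y"
proof (rule Quotient3_rel_abs[OF Quotient3_ppoint])
  show "proportional x y" using assms by (auto simp: proportional_def fun_eq_iff)
qed

lemma ratio_abs:
  assumes "x i ~= (0::'a::field)"
  shows "ratio j i (abs_ppoint x) = x j / x i" "hcoord (abs_ppoint x) i ~= 0"
proof -
  obtain c where c: "c ~= 0" "hcoord (abs_ppoint x) = (%i. c * x i)" using hcoord_abs[of x i] assms by blast
  then show "ratio j i (abs_ppoint x) = x j / x i" "hcoord (abs_ppoint x) i ~= 0" using assms by (auto simp: ratio_def)
qed

text \<open>Evaluation at a coordinate vector rather than at a point, so that scaling, and vectors
  of analytic functions, can be inserted.\<close>

definition ins :: "'a::field mpoly \<Rightarrow> (nat \<Rightarrow> 'a) \<Rightarrow> 'a" where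
  "ins P x = (\<Sum>\<nu>\<in>Poly_Mapping.keys P. Poly_Mapping.lookup P \<nu> * (\<Prod>i\<in>Poly_Mapping.keys \<nu>. x i ^ Poly_Mapping.lookup \<nu> i))"

lemma peval_ins: "peval P p = ins P (hcoord p)"
  by (simp add: peval_def ins_def)

lemma ins_homogeneous:
  assumes "homogeneous d P" shows "ins P (%i. c * x i) = c ^ d * ins P x"
proof -
  have "(\<Prod>i\<in>Poly_Mapping.keys v. (c * x i) ^ Poly_Mapping.lookup v i) =
        c ^ d * (\<Prod>i\<in>Poly_Mapping.keys v. x i ^ Poly_Mapping.lookup v i)" if "v : Poly_Mapping.keys P" for v
  proof -
    have "(\<Prod>i\<in>Poly_Mapping.keys v. c ^ Poly_Mapping.lookup v i) = c ^ d"
      using assms that by (auto simp: homogeneous_def power_sum)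
    then show ?thesis by (simp add: power_mult_distrib prod.distrib)
  qed
  then show ?thesis unfolding ins_def sum_distrib_left by (intro sum.cong) auto
qed

lemma ins_ratio:
  assumes "homogeneous d P" "hcoord p i ~= 0"
  shows "ins P (%j. ratio j i p) = peval P p / hcoord p i ^ d"
  using ins_homogeneous[OF assms(1), of "inverse (hcoord p i)" "hcoord p"] assms(2)
  by (simp add: ratio_def peval_ins field_simps)

lemma peval_abs:
  assumes "homogeneous d P" "x j ~= 0"
  shows "EX c. c ~= 0 & peval P (abs_ppoint x) = c * ins P x"
proof -
  obtain c where c: "c ~= 0" "hcoord (abs_ppoint x) = (%i. c * x i)" using hcoord_abs[of x j] assms by blast
  then show ?thesis using ins_homogeneous[OF assms(1), of c x] by (intro exI[of _ "c ^ d"]) (simp add: peval_ins)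
qed

lemma ins_an:
  assumes "!!j. r j : an W" shows "(%p. ins P (%j. r j p)) : an W"
  unfolding ins_def by (intro an_sum an_mult an_const an_prod an_power assms)

lemma ratio_pspace: "p : pspace N ==> j > N ==> ratio j i p = 0"
  by (simp add: pspace_def ratio_def)

lemma unit_chart_ratio: "p : unit_chart i ==> absv (ratio j i p) <= 1"
  by (auto simp: unit_chart_def ratio_def absv_divide divide_le_eq_1)

lemma unit_chart_hcoord: "p : unit_chart i ==> hcoord p i ~= 0"
  by (auto simp: unit_chart_def)

lemma unit_chartI: "hcoord p i ~= 0 ==> (!!j. absv (ratio j i p) <= 1) ==> p : unit_chart i"
  unfolding unit_chart_def ratio_def by (simp add: absv_divide)

lemma unit_chart_exists:
  assumes "p : pspace N" shows "EX i<=N. p : unit_chart i"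
proof -
  define M where "M = Max ((%i. absv (hcoord p i)) ` {..N})"
  have "M : (%i. absv (hcoord p i)) ` {..N}" unfolding M_def by (rule Max_in) auto
  then obtain i where i: "i <= N" "absv (hcoord p i) = M" by auto
  have le: "absv (hcoord p j) <= absv (hcoord p i)" for j
  proof (cases "j <= N")
    case True
    then show ?thesis unfolding i(2) M_def by (intro Max_ge) auto
  next
    case False
    then show ?thesis using assms by (simp add: pspace_def)
  qed
  obtain j where "hcoord p j ~= 0" using hcoord_nonzero by blast
  then have "hcoord p i ~= 0" using le[of j] by auto
  then show ?thesis using i le by (auto simp: unit_chart_def)
qed

text \<open>The equations are \<open>x i = 1\<close> and the dehomogenized equations of
  \<open>X\<close>. A solution in the polydisc is itself a homogeneous coordinate vector whose entry
  \<open>i\<close> is dominant.\<close>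

lemma presented_standard:
  fixes X :: "'a::complete_nonarch_field ppoint set"
  assumes X: "projective_variety N X" and iN: "i <= N"
  shows "presented (standard_affinoid N X i)"
proof -
  let ?W = "standard_affinoid N X i"
  have XN: "X \<subseteq> pspace N" using X by (simp add: projective_variety_def)
  obtain T where T: "ALL P:T. EX d. homogeneous d P" "X = {p. ALL P:T. peval P p = 0}"
    using X unfolding projective_variety_def irreducible_closed_def pclosed_def by blast
  have len: "length (snd ?W) = Suc N" by (simp add: standard_affinoid_def)
  have gen: "snd ?W ! j = ratio j i" if "j < Suc N" for j
    using that by (simp add: standard_affinoid_def nth_append nth_Cons' del: upt_Suc)
  have evW: "ev (snd ?W) p j = (if j < Suc N then ratio j i p else 0)" for p j
    by (simp add: ev_def len gen)
  have pts: "fst ?W = X \<inter> unit_chart i" by (simp add: standard_affinoid_def)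
  have snd: "sound ?W" unfolding sound_def
    using unit_chart_ratio by (auto simp: standard_affinoid_def)
  define F where "F P x = ins P (%j. if j < Suc N then x j else 0)" for P and x :: "nat \<Rightarrow> 'a"
  have F: "F P : polyfun (Suc N)" for P
  proof -
    have "(%x. if j < Suc N then x j else 0) : polyfun (Suc N)" for j
      by (cases "j < Suc N") (simp_all add: polyfun.var polyfun.const)
    then show ?thesis unfolding F_def ins_def
      by (intro polyfun_sum polyfun.mult polyfun.const polyfun_prod polyfun_power) auto
  qed
  define E where "E = insert (%x. x i - 1) (F ` T)"
  show ?thesis unfolding presented_def
  proof (intro conjI snd exI[of _ E] ballI impI)
    show "E \<subseteq> tate (length (snd ?W))" unfolding E_def len
      using F iN by (auto intro: polyfun_tate intro!: tate_diff tate_var)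
    fix p and e :: "(nat \<Rightarrow> 'a) \<Rightarrow> 'a" assume p: "p : fst ?W" and e: "e : E"
    have hp: "hcoord p i ~= 0" using p unit_chart_hcoord by (auto simp: pts)
    show "e (ev (snd ?W) p) = 0"
    proof (cases "e = (%x. x i - 1)")
      case True
      then show ?thesis using hp iN by (simp add: evW ratio_def)
    next
      case False
      then obtain P where P: "P : T" "e = F P" using e by (auto simp: E_def)
      then obtain d where d: "homogeneous d P" using T by blast
      have "(%j. if j < Suc N then ev (snd ?W) p j else 0) = (%j. ratio j i p)"
        using p XN ratio_pspace[of p N] by (auto simp: evW pts fun_eq_iff)
      then have "e (ev (snd ?W) p) = peval P p / hcoord p i ^ d"
        using ins_ratio[OF d hp] by (simp add: P F_def)
      moreover have "peval P p = 0" using P(1) p T(2) pts by blast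
      ultimately show ?thesis by simp
    qed
  next
    fix x :: "nat \<Rightarrow> 'a" assume x: "x : polydisc" and
      xx: "(ALL j>=length (snd ?W). x j = 0) & (ALL e:E. e x = 0)"
    have xi: "x i = 1" using xx by (auto simp: E_def)
    have xr: "(%j. if j < Suc N then x j else 0) = x" using xx by (auto simp: len fun_eq_iff)
    define p where "p = abs_ppoint x"
    have r: "ratio j i p = x j" for j using ratio_abs(1)[of x i j] xi by (simp add: p_def)
    have hp: "hcoord p i ~= 0" using ratio_abs(2)[of x i] xi by (simp add: p_def)
    have "p : X" unfolding T(2)
    proof (intro CollectI ballI)
      fix P assume P: "P : T"
      then obtain d where d: "homogeneous d P" using T by blast
      have "F P x = 0" using xx P by (auto simp: E_def)
      then have "ins P x = 0" by (simp add: F_def xr)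
      then show "peval P p = 0" using peval_abs[OF d, of x i] xi by (auto simp: p_def)
    qed
    moreover have "p : unit_chart i" by (rule unit_chartI[OF hp]) (simp add: r polydiscD[OF x])
    moreover have "x = ev (snd ?W) p"
    proof (rule ext)
      show "x j = ev (snd ?W) p j" for j using xx by (simp add: evW r len)
    qed
    ultimately show "EX p:fst ?W. x = ev (snd ?W) p" by (auto simp: pts)
  qed
qed

lemma affinoids_presented:
  assumes "projective_variety N X" "W : affinoids N X" shows "presented W"
  using assms presented_standard rational_subdomain_presented unfolding affinoids_def by blast

lemma affinoidsE:
  assumes X: "projective_variety N X" and W: "W : affinoids N X"
  obtains i where "i <= N" "fst W \<subseteq> X \<inter> unit_chart i" "!!j. ratio j i : an W"
     "rational_subdomain (standard_affinoid N X i) W"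
proof -
  obtain i where i: "i <= N" "rational_subdomain (standard_affinoid N X i) W" using W by (auto simp: affinoids_def)
  have snd: "sound (standard_affinoid N X i)" using presented_standard[OF X i(1)] by (simp add: presented_def)
  have pts: "fst W \<subseteq> X \<inter> unit_chart i"
    using rational_subdomain_subset[OF i(2)] by (simp add: standard_affinoid_def)
  have "ratio j i : an W" for j
  proof (cases "j <= N")
    case True
    have "ratio j i : set (snd (standard_affinoid N X i))" using True by (simp add: standard_affinoid_def del: upt_Suc)
    from an_mono[OF snd i(2) an_gen[OF this]] show ?thesis .
  next
    case False
    have "ratio j i p = 0" if "p : fst W" for p
      using pts that X False by (intro ratio_pspace[of p N]) (auto simp: projective_variety_def)
    then show ?thesis by (intro an_cong[OF an_const[of 0]])
  qed
  with i pts show ?thesis using that by blast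
qed

text \<open>A regular function is locally a fraction. Suitable denominators, defined on the whole
  affinoid, have no common zero, so \<open>presented_div\<close> applies.\<close>

lemma regular_function_analytic:
  assumes X: "projective_variety N X" and W: "W : affinoids N X"
    and s: "s : regular_functions X U" and WU: "fst W \<subseteq> U"
  shows "s : an W"
proof -
  obtain i where i: "fst W \<subseteq> X \<inter> unit_chart i" "!!j. ratio j i : an W" using affinoidsE[OF X W] by blast
  have hi: "hcoord p i ~= 0" if "p : fst W" for p using i(1) that unit_chart_hcoord by blast
  show ?thesis
  proof (rule presented_div[OF affinoids_presented[OF X W], of "{h : an W. (%p. s p * h p) : an W}"])
    fix p assume p: "p : fst W"
    then obtain V P Q d where V: "zopen X V" "p : V" and P: "homogeneous d P" "homogeneous d Q"
      and sPQ: "ALL q:V. peval Q q ~= 0 & s q = peval P q / peval Q q"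
      using s WU unfolding regular_functions_def by blast
    obtain T where T: "ALL P:T. EX d. homogeneous d P" "V = X - {p. ALL P:T. peval P p = 0}"
      using V(1) unfolding zopen_def pclosed_def by blast
    obtain P' where P': "P' : T" "peval P' p ~= 0" using V(2) T(2) by auto
    obtain d' where d': "homogeneous d' P'" using P' T by blast
    \<comment> \<open>The factor \<open>P'\<close> vanishes on \<open>X\<close> outside
      \<open>V\<close>, so \<open>s * h = k\<close> persists where the fraction no longer represents
      \<open>s\<close>.\<close>
    define h where "h q = ins Q (%j. ratio j i q) * ins P' (%j. ratio j i q)" for q
    define k where "k q = ins P (%j. ratio j i q) * ins P' (%j. ratio j i q)" for q
    have h: "h : an W" unfolding h_def by (intro an_mult ins_an i(2))
    have k: "k : an W" unfolding k_def by (intro an_mult ins_an i(2))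
    have "s q * h q = k q" if q: "q : fst W" for q
    proof (cases "q : V")
      case True
      then show ?thesis using sPQ hi[OF q] by (simp add: h_def k_def ins_ratio[OF P(1)] ins_ratio[OF P(2)])
    next
      case False
      then have "peval P' q = 0" using T(2) P'(1) i(1) q by auto
      then show ?thesis using hi[OF q] by (simp add: h_def k_def ins_ratio[OF d'])
    qed
    then have "(%p. s p * h p) : an W" by (intro an_cong[OF k])
    moreover have "h p ~= 0"
      using hi[OF p] sPQ V(2) P'(2) by (simp add: h_def ins_ratio[OF P(2)] ins_ratio[OF d'])
    ultimately show "EX h:{h : an W. (%p. s p * h p) : an W}. h p ~= 0" using h by blast
  qed auto
qed

section \<open>The maximum principle on annuli\<close>

lemma gnorm_zero [simp]: "gnorm 0 w r = 0"
  by (simp add: gnorm_def)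

lemma prod_mset_max_nonneg: "0 <= (\<Prod>x\<in>#A. max (absv (w - x)) r)"
  by (induction A) (auto simp: le_max_iff_disj)

lemma gnorm_nonneg: "0 <= gnorm p w r"
  unfolding gnorm_def by (intro mult_nonneg_nonneg prod_mset_max_nonneg) auto

lemma gnorm_pos:
  assumes "p ~= 0" "r > 0" shows "gnorm p w r > 0"
proof -
  have "0 < (\<Prod>x\<in>#A. max (absv (w - x)) r)" for A by (induction A) (use assms in auto)
  then show ?thesis using assms by (simp add: gnorm_def)
qed

lemma gnorm_mult: "gnorm (p * q) w r = gnorm p w r * gnorm q w r"
proof (cases "p = 0 \<or> q = 0")
  case False
  then show ?thesis by (simp add: gnorm_def proots_mult lead_coeff_mult absv_mult)
qed auto

lemma gnorm_at_0: "gnorm p w 0 = absv (poly p w)"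
  by (rule gnorm_generic[symmetric]) simp

lemma gnorm_continuous: "continuous_on UNIV (%r. gnorm p w r)"
proof -
  have "continuous_on UNIV (%r. \<Prod>x\<in>#A. max (absv (w - x)) r)" for A
    by (induction A) (auto intro!: continuous_intros)
  then show ?thesis unfolding gnorm_def by (intro continuous_intros)
qed

lemma gnorm_center:
  assumes "absv (w - w') <= r" shows "gnorm p w r = gnorm p w' r"
proof -
  have "max (absv (w - x)) r = max (absv (w' - x)) r" for x
    using absv_triangle[of w x w'] absv_triangle[of w' x w] assms absv_commute[of w w'] by linarith
  then show ?thesis by (simp add: gnorm_def)
qed

text \<open>Until the next zero is met, exactly the zeros at distance at most \<open>r\<close>
  contribute a factor proportional to the radius: the outward logarithmic slope counts zeros in the
  closed disc.\<close>

lemma gnorm_outward: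
  assumes "0 < r"
  shows "EX dl>0. ALL r'. r <= r' & r' < r + dl -->
     gnorm p w r' = gnorm p w r * (r' / r) ^ size {#x \<in># proots p. absv (w - x) <= r#}"
proof -
  have "EX dl>0. ALL r'. r <= r' & r' < r + dl --> (\<Prod>x\<in>#A. max (absv (w - x)) r') =
      (\<Prod>x\<in>#A. max (absv (w - x)) r) * (r' / r) ^ size {#x \<in># A. absv (w - x) <= r#}" for A
  proof (induction A)
    case empty
    show ?case by (intro exI[of _ 1]) simp
  next
    case (add x A)
    then obtain dl where dl: "dl > 0" "ALL r'. r <= r' & r' < r + dl --> (\<Prod>x\<in>#A. max (absv (w - x)) r') =
      (\<Prod>x\<in>#A. max (absv (w - x)) r) * (r' / r) ^ size {#x \<in># A. absv (w - x) <= r#}" by blast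
    show ?case
    proof (cases "absv (w - x) <= r")
      case True
      have "(\<Prod>x\<in>#add_mset x A. max (absv (w - x)) r') = (\<Prod>x\<in>#add_mset x A. max (absv (w - x)) r) *
          (r' / r) ^ size {#x \<in># add_mset x A. absv (w - x) <= r#}" if "r <= r'" "r' < r + dl" for r'
      proof -
        have "max (absv (w - x)) r' = r'" "max (absv (w - x)) r = r" using True that by auto
        then show ?thesis using dl(2)[rule_format, of r'] that True assms by simp
      qed
      with dl(1) show ?thesis by blast
    next
      case False
      have "(\<Prod>x\<in>#add_mset x A. max (absv (w - x)) r') = (\<Prod>x\<in>#add_mset x A. max (absv (w - x)) r) *
          (r' / r) ^ size {#x \<in># add_mset x A. absv (w - x) <= r#}"
        if "r <= r'" "r' < r + min dl (absv (w - x) - r)" for r'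
      proof -
        have "max (absv (w - x)) r' = absv (w - x)" "max (absv (w - x)) r = absv (w - x)" using False that by auto
        then show ?thesis using dl(2)[rule_format, of r'] that False by simp
      qed
      moreover have "min dl (absv (w - x) - r) > 0" using False dl(1) by simp
      ultimately show ?thesis by blast
    qed
  qed
  then obtain dl where "dl > 0" "ALL r'. r <= r' & r' < r + dl --> (\<Prod>x\<in>#proots p. max (absv (w - x)) r') =
      (\<Prod>x\<in>#proots p. max (absv (w - x)) r) * (r' / r) ^ size {#x \<in># proots p. absv (w - x) <= r#}" by blast
  note d = this
  have "gnorm p w r' = gnorm p w r * (r' / r) ^ size {#x \<in># proots p. absv (w - x) <= r#}"
    if "r <= r'" "r' < r + dl" for r'
    using d(2)[rule_format, of r'] that unfolding gnorm_def by simp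
  with d(1) show ?thesis by blast
qed

text \<open>Zeros at distance exactly \<open>r\<close> contribute a constant factor when the radius
  decreases, so the inward slope counts zeros in the open disc only. The maximum principle exploits
  the discrepancy with \<open>gnorm_outward\<close>.\<close>

lemma gnorm_inward:
  assumes "0 < r"
  shows "EX dl>0. ALL r'. r - dl < r' & r' <= r -->
     gnorm p w r' = gnorm p w r * (r' / r) ^ size {#x \<in># proots p. absv (w - x) < r#}"
proof -
  have "EX dl>0. ALL r'. r - dl < r' & r' <= r --> (\<Prod>x\<in>#A. max (absv (w - x)) r') =
      (\<Prod>x\<in>#A. max (absv (w - x)) r) * (r' / r) ^ size {#x \<in># A. absv (w - x) < r#}" for A
  proof (induction A)
    case empty
    show ?case by (intro exI[of _ 1]) simp
  next
    case (add x A)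
    then obtain dl where dl: "dl > 0" "ALL r'. r - dl < r' & r' <= r --> (\<Prod>x\<in>#A. max (absv (w - x)) r') =
      (\<Prod>x\<in>#A. max (absv (w - x)) r) * (r' / r) ^ size {#x \<in># A. absv (w - x) < r#}" by blast
    show ?case
    proof (cases "absv (w - x) < r")
      case True
      have "(\<Prod>x\<in>#add_mset x A. max (absv (w - x)) r') = (\<Prod>x\<in>#add_mset x A. max (absv (w - x)) r) *
          (r' / r) ^ size {#x \<in># add_mset x A. absv (w - x) < r#}"
        if "r - min dl (r - absv (w - x)) < r'" "r' <= r" for r'
      proof -
        have "max (absv (w - x)) r' = r'" "max (absv (w - x)) r = r" using True that by auto
        then show ?thesis using dl(2)[rule_format, of r'] that True assms by simp
      qed
      moreover have "min dl (r - absv (w - x)) > 0" using True dl(1) by simp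
      ultimately show ?thesis by blast
    next
      case False
      have "(\<Prod>x\<in>#add_mset x A. max (absv (w - x)) r') = (\<Prod>x\<in>#add_mset x A. max (absv (w - x)) r) *
          (r' / r) ^ size {#x \<in># add_mset x A. absv (w - x) < r#}" if "r - dl < r'" "r' <= r" for r'
      proof -
        have "max (absv (w - x)) r' = absv (w - x)" "max (absv (w - x)) r = absv (w - x)" using False that by auto
        then show ?thesis using dl(2)[rule_format, of r'] that False by simp
      qed
      with dl(1) show ?thesis by blast
    qed
  qed
  then obtain dl where "dl > 0" "ALL r'. r - dl < r' & r' <= r --> (\<Prod>x\<in>#proots p. max (absv (w - x)) r') =
      (\<Prod>x\<in>#proots p. max (absv (w - x)) r) * (r' / r) ^ size {#x \<in># proots p. absv (w - x) < r#}" by blast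
  note d = this
  have "gnorm p w r' = gnorm p w r * (r' / r) ^ size {#x \<in># proots p. absv (w - x) < r#}"
    if "r - dl < r'" "r' <= r" for r'
    using d(2)[rule_format, of r'] that unfolding gnorm_def by simp
  with d(1) show ?thesis by blast
qed

text \<open>Each zero contributes either \<open>r\<close> or the absolute value of a field element.
  This is applied at radii outside the value group, which no zero has as its distance.\<close>

lemma gnorm_eq_monomial:
  fixes w :: "'a::complete_nonarch_field"
  assumes "\<forall>x\<in>#proots p. absv (w - x) ~= r"
  shows "EX al::'a. gnorm p w r = absv al * r ^ size {#x \<in># proots p. absv (w - x) <= r#}"
proof -
  have "\<forall>x\<in>#A. absv (w - x) ~= r ==>
      EX al::'a. (\<Prod>x\<in>#A. max (absv (w - x)) r) = absv al * r ^ size {#x \<in># A. absv (w - x) <= r#}" for A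
  proof (induction A)
    case empty
    show ?case by (intro exI[of _ 1]) simp
  next
    case (add x A)
    have "\<forall>x\<in>#A. absv (w - x) ~= r" using add.prems by auto
    from add.IH[OF this]
    obtain al :: 'a where al: "(\<Prod>x\<in>#A. max (absv (w - x)) r) = absv al * r ^ size {#x \<in># A. absv (w - x) <= r#}" by blast
    show ?case
    proof (cases "absv (w - x) <= r")
      case True
      then show ?thesis using al by (intro exI[of _ al]) (auto simp: max_def)
    next
      case False
      then show ?thesis using al by (intro exI[of _ "(w - x) * al"]) (auto simp: max_def absv_mult)
    qed
  qed
  then obtain al :: 'a where "(\<Prod>x\<in>#proots p. max (absv (w - x)) r) = absv al * r ^ size {#x \<in># proots p. absv (w - x) <= r#}"
    using assms by blast
  then show ?thesis by (intro exI[of _ "lead_coeff p * al"]) (simp add: gnorm_def absv_mult)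
qed

section \<open>Counting zeros in residue discs\<close>

lemma size_filter_class:
  assumes R: "!!x. R x x" "!!x y. R x y ==> R y x" "!!x y z. R x y ==> R y z ==> R x z"
  shows "size A < size B ==> \<exists>s\<in>#B. size {#x \<in># A. R s x#} < size {#x \<in># B. R s x#}"
proof (induction "size B" arbitrary: A B rule: less_induct)
  case less
  then obtain s where s: "s \<in># B" by (metis multiset_nonemptyE not_less_zero size_empty)
  show ?case
  proof (cases "size {#x \<in># A. R s x#} < size {#x \<in># B. R s x#}")
    case True
    then show ?thesis using s by blast
  next
    case False
    let ?A = "{#x \<in># A. \<not> R s x#}" and ?B = "{#x \<in># B. \<not> R s x#}"
    have "size A = size {#x \<in># A. R s x#} + size ?A" "size B = size {#x \<in># B. R s x#} + size ?B"
      by (metis multiset_partition size_union)+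
    moreover have "s \<in># {#x \<in># B. R s x#}" using s R(1) by simp
    then have "0 < size {#x \<in># B. R s x#}" by (metis gr0I empty_iff set_mset_empty size_eq_0_iff_empty)
    ultimately have "size ?A < size ?B" "size ?B < size B" using False less.prems by auto
    then obtain t where t: "t \<in># ?B" "size {#x \<in># ?A. R t x#} < size {#x \<in># ?B. R t x#}"
      using less.hyps by blast
    have "\<not> R s t" using t by simp
    then have "R t x ==> \<not> R s x" for x using R by blast
    then have "{#x \<in># {#x \<in># C. \<not> R s x#}. R t x#} = {#x \<in># C. R t x#}" for C
      by (auto simp: filter_filter_mset intro!: filter_mset_cong)
    then show ?thesis using t by auto
  qed
qed

text \<open>The closed disc is a disjoint union of open discs of the same radius, so a surplus of
  zeros in the closed disc is a surplus in one of the open ones.\<close>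

lemma size_open_disc_less:
  fixes w :: "'a::complete_nonarch_field"
  assumes "0 < r" "size {#x \<in># A. absv (w - x) <= r#} < size {#x \<in># B. absv (w - x) <= r#}"
  shows "\<exists>s\<in>#B. absv (w - s) <= r & size {#x \<in># A. absv (s - x) < r#} < size {#x \<in># B. absv (s - x) < r#}"
proof -
  have tr: "absv (x - z) < r" if "absv (x - y) < r" "absv (y - z) < r" for x y z :: 'a
    using absv_triangle[of x z y] that by linarith
  have "\<exists>s\<in>#{#x \<in># B. absv (w - x) <= r#}.
    size {#x \<in># {#x \<in># A. absv (w - x) <= r#}. absv (s - x) < r#} < size {#x \<in># {#x \<in># B. absv (w - x) <= r#}. absv (s - x) < r#}"
  proof (rule size_filter_class[where R = "%x y. absv (x - y) < r", OF _ _ _ assms(2)])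
    show "absv (x - z) < r" if "absv (x - y) < r" "absv (y - z) < r" for x y z :: 'a by (rule tr[OF that])
  qed (use assms(1) in \<open>simp_all add: absv_commute\<close>)
  then obtain s where s: "s \<in># {#x \<in># B. absv (w - x) <= r#}"
    "size {#x \<in># {#x \<in># A. absv (w - x) <= r#}. absv (s - x) < r#} < size {#x \<in># {#x \<in># B. absv (w - x) <= r#}. absv (s - x) < r#}"
    by blast
  have "absv (w - x) <= r" if "absv (s - x) < r" for x
    using absv_triangle[of w x s] s(1) that by auto
  then have "{#x \<in># {#x \<in># C. absv (w - x) <= r#}. absv (s - x) < r#} = {#x \<in># C. absv (s - x) < r#}" for C
    by (auto simp: filter_filter_mset intro!: filter_mset_cong)
  then show ?thesis using s by auto
qed

lemma power_ratio_ge: "1 <= t ==> n <= m ==> 1 <= t ^ m / (t::real) ^ n"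
  using power_increasing[of n m t] zero_less_power[of t n] by (simp add: le_divide_eq)

lemma power_ratio_gt: "0 < t ==> t < 1 ==> m < n ==> 1 < t ^ m / (t::real) ^ n"
  using power_strict_decreasing[of m n t] zero_less_power[of t n] by (simp add: less_divide_eq)

lemma gnorm_limit_le:
  assumes "!!d. d > 0 ==> EX r'. R r' d & gnorm P w r' <= gnorm Q w r'"
    and "!!r' d. R r' d ==> \<bar>r' - r\<bar> < d"
  shows "gnorm P w r <= gnorm Q w r"
proof (rule ccontr)
  assume "\<not> ?thesis"
  then have neg: "gnorm Q w r - gnorm P w r < 0" by simp
  have "continuous_on UNIV (%r. gnorm Q w r - gnorm P w r)"
    by (intro continuous_intros gnorm_continuous)
  then have "isCont (%r. gnorm Q w r - gnorm P w r) r"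
    using continuous_on_eq_continuous_at[OF open_UNIV] by blast
  then have "EX s>0. ALL x. x ~= r & dist x r < s -->
      dist (gnorm Q w x - gnorm P w x) (gnorm Q w r - gnorm P w r) < gnorm P w r - gnorm Q w r"
    unfolding isCont_def LIM_def using neg by simp
  then obtain d where d: "d > 0" "!!x. x ~= r ==> dist x r < d ==>
      dist (gnorm Q w x - gnorm P w x) (gnorm Q w r - gnorm P w r) < gnorm P w r - gnorm Q w r"
    by blast
  obtain r' where r': "R r' d" "gnorm P w r' <= gnorm Q w r'" using assms(1)[OF d(1)] by blast
  then have "r' ~= r" using neg by auto
  then show False using d(2)[of r'] assms(2)[OF r'(1)] r'(2) by (simp add: dist_real_def)
qed

lemma gnorm_mono:
  assumes "r <= r'" shows "gnorm p w r <= gnorm p w r'"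
proof -
  have "(\<Prod>x\<in>#A. max (absv (w - x)) r) <= (\<Prod>x\<in>#A. max (absv (w - x)) r')" for A
    by (induction A) (use assms in \<open>auto intro!: mult_mono prod_mset_max_nonneg simp: le_max_iff_disj\<close>)
  then show ?thesis unfolding gnorm_def by (intro mult_left_mono) auto
qed

lemma gnorm_small:
  assumes "poly p w ~= 0" shows "EX d>0. ALL r. 0 <= r & r < d --> gnorm p w r = absv (poly p w)"
proof -
  have "w \<notin># A ==> EX d>0. ALL r. 0 <= r & r < d --> (\<Prod>x\<in>#A. max (absv (w - x)) r) = (\<Prod>x\<in>#A. max (absv (w - x)) 0)" for A
  proof (induction A)
    case empty
    show ?case by (intro exI[of _ 1]) simp
  next
    case (add x A)
    then have wx: "w ~= x" "w \<notin># A" by auto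
    obtain d where d: "d > 0" "ALL r. 0 <= r & r < d --> (\<Prod>x\<in>#A. max (absv (w - x)) r) = (\<Prod>x\<in>#A. max (absv (w - x)) 0)"
      using add.IH[OF wx(2)] by blast
    have "(\<Prod>x\<in>#add_mset x A. max (absv (w - x)) r) = (\<Prod>x\<in>#add_mset x A. max (absv (w - x)) 0)"
      if "0 <= r" "r < min d (absv (w - x))" for r
      using d(2)[rule_format, of r] that by (simp add: max_def)
    moreover have "min d (absv (w - x)) > 0" using d(1) wx by simp
    ultimately show ?case by blast
  qed
  moreover have "p ~= 0" using assms by auto
  then have "w \<notin># proots p" using assms by simp
  ultimately obtain d where d: "d > 0" "ALL r. 0 <= r & r < d -->
      (\<Prod>x\<in>#proots p. max (absv (w - x)) r) = (\<Prod>x\<in>#proots p. max (absv (w - x)) 0)" by blast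
  have "gnorm p w r = absv (poly p w)" if "0 <= r" "r < d" for r
    using d(2)[rule_format, of r] that gnorm_at_0[of p w] unfolding gnorm_def by simp
  with d(1) show ?thesis by blast
qed

lemma finite_roots: "finite {z. p ~= 0 & poly p z = (0::'a::idom)}"
  using poly_roots_finite[of p] by (cases "p = 0") auto

lemma gnorm_generic':
  assumes "!!s. p ~= 0 ==> poly p s = 0 ==> absv (z - s) = max (absv (w - s)) r"
  shows "absv (poly p z) = gnorm p w r"
proof (cases "p = 0")
  case False
  then show ?thesis using assms by (intro gnorm_generic) auto
qed simp

text \<open>The isosceles principle for Gauss norms, read off at a point that is generic for
  \<open>A\<close>, \<open>B\<close> and \<open>A - B\<close> together; this is why the radius is of
  the form \<open>absv c\<close>.\<close>

lemma gnorm_ultra_eq: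
  fixes c w :: "'a::complete_nonarch_field"
  assumes "gnorm (A - B) w (absv c) < gnorm A w (absv c)"
  shows "gnorm A w (absv c) = gnorm B w (absv c)"
proof -
  define S where "S = (\<Union>P\<in>{A, B, A - B}. {z. P ~= 0 & poly P z = 0})"
  have "finite S" unfolding S_def by (intro finite_UN_I finite_roots) simp
  then obtain z where z: "ALL s:S. absv (z - s) = max (absv (w - s)) (absv c)"
    using generic_point[of S w c] by blast
  have "absv (poly P z) = gnorm P w (absv c)" if "P : {A, B, A - B}" for P
    by (rule gnorm_generic') (use z that in \<open>auto simp: S_def\<close>)
  from this[of A] this[of B] this[of "A - B"]
  have "absv (poly A z) = gnorm A w (absv c)" "absv (poly B z) = gnorm B w (absv c)"
    "absv (poly A z - poly B z) = gnorm (A - B) w (absv c)" by simp_all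
  then show ?thesis using absv_eq_of_diff_less'[of "poly A z" "poly B z"] assms by simp
qed

lemma finite_compact_max:
  fixes f :: "'i \<Rightarrow> real \<Rightarrow> real"
  assumes J: "finite J" and K: "!!j. j : J ==> compact (K j)" "!!j. j : J ==> continuous_on (K j) (f j)"
    and ne: "j0 : J" "x0 : K j0"
  shows "EX j:J. EX x:K j. ALL j':J. ALL y:K j'. f j' y <= f j x"
proof -
  define J' where "J' = {j : J. K j ~= {}}"
  have "ALL j. EX x. j : J' --> x : K j & (ALL y:K j. f j y <= f j x)"
  proof
    fix j
    show "EX x. j : J' --> x : K j & (ALL y:K j. f j y <= f j x)"
      using continuous_attains_sup[of "K j" "f j"] K by (cases "j : J'") (auto simp: J'_def)
  qed
  then obtain x where "ALL j. j : J' --> x j : K j & (ALL y:K j. f j y <= f j (x j))" by (rule choice[THEN exE])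
  then have x: "!!j. j : J' ==> x j : K j" "!!j y. j : J' ==> y : K j ==> f j y <= f j (x j)" by auto
  have J': "finite J'" "J' ~= {}" using J ne by (auto simp: J'_def)
  define M where "M = Max ((%j. f j (x j)) ` J')"
  have "M : (%j. f j (x j)) ` J'" unfolding M_def using J' by (intro Max_in) auto
  then obtain j where j: "j : J'" "M = f j (x j)" by auto
  have "f j' y <= f j (x j)" if "j' : J" "y : K j'" for j' y
  proof -
    have j': "j' : J'" using that by (auto simp: J'_def)
    have "f j' (x j') <= M" unfolding M_def using J' j' by (intro Max_ge) auto
    then show ?thesis using x(2)[OF j' that(2)] j(2) by simp
  qed
  moreover have "j : J" using j(1) by (simp add: J'_def)
  ultimately show ?thesis using x(1)[OF j(1)] by blast
qed

text \<open>
  A pair \<open>(w, \<rho>)\<close> stands for the Gauss point of the closed disc of radius \<open>\<rho>\<close> around \<open>w\<close>. The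
  approximations \<open>p i / q i\<close> of the function \<open>h\<close> agree in absolute value wherever they exceed \<open>C\<close>.
  At a Gauss point where the maximum is attained with the largest possible radius, the slopes of the
  absolute value in all directions sum to zero, so it would increase in some direction.
\<close>

locale annulus_cover =
  fixes a b :: "'a::complete_nonarch_field" and n :: nat
    and L :: "nat \<Rightarrow> ('a poly \<times> 'a poly) set" and p q :: "nat \<Rightarrow> 'a poly"
    and h :: "'a \<Rightarrow> 'a" and C :: real and S0 :: "'a set"
  assumes a0: "a ~= 0" and ab: "absv a <= absv b" and finL: "!!i. finite (L i)" and C0: "C > 0"
    and finS0: "finite S0"
    and cover: "!!z. absv a <= absv z ==> absv z <= absv b ==>
      EX i<n. ALL PQ:L i. absv (poly (fst PQ) z) <= absv (poly (snd PQ) z)"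
    and approx: "!!i z. i < n ==> absv a <= absv z ==> absv z <= absv b ==>
      ALL PQ:L i. absv (poly (fst PQ) z) <= absv (poly (snd PQ) z) ==>
      poly (q i) z ~= 0 & absv (h z - poly (p i) z / poly (q i) z) <= C"
    and bdry: "!!z. absv z = absv a \<or> absv z = absv b ==> ALL s:S0. absv z <= absv (z - s) ==> absv (h z) <= C"
begin

text \<open>The cross differences belong to the list so that the difference of two approximations,
  too, can be evaluated at generic points.\<close>

definition polys :: "'a poly set" where
  "polys = (\<Union>i<n. fst ` L i \<union> snd ` L i) \<union> p ` {..<n} \<union> q ` {..<n} \<union>
     (%(i, j). p i * q j - p j * q i) ` ({..<n} \<times> {..<n})"

definition S :: "'a set" where
  "S = insert 0 (S0 \<union> (\<Union>P\<in>polys. {z. P ~= 0 & poly P z = 0}))"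

definition inU :: "nat \<Rightarrow> 'a \<Rightarrow> real \<Rightarrow> bool" where
  "inU i w \<rho> \<longleftrightarrow> (ALL PQ:L i. gnorm (fst PQ) w \<rho> <= gnorm (snd PQ) w \<rho>)"

text \<open>A generic point for \<open>(w, \<rho>)\<close> has absolute value
  \<open>max (absv w) \<rho>\<close>; the conditions place it in the annulus. The case
  \<open>w = 0\<close> admits discs that fill the hole.\<close>

definition pt :: "'a \<Rightarrow> real \<Rightarrow> bool" where
  "pt w \<rho> \<longleftrightarrow> 0 <= \<rho> & \<rho> <= absv b & (absv a <= absv w & absv w <= absv b \<or> w = 0 & absv a <= \<rho>)"

definition val :: "nat \<Rightarrow> 'a \<Rightarrow> real \<Rightarrow> real" where
  "val i w \<rho> = gnorm (p i) w \<rho> / gnorm (q i) w \<rho>"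

lemma finS: "finite S"
proof -
  have "finite polys" unfolding polys_def using finL by auto
  then show ?thesis unfolding S_def by (intro finite.insertI finite_UnI finS0 finite_UN_I finite_roots)
qed

lemma polys_mem:
  "i < n ==> PQ : L i ==> fst PQ : polys" "i < n ==> PQ : L i ==> snd PQ : polys"
  "i < n ==> p i : polys" "i < n ==> q i : polys"
  "i < n ==> j < n ==> p i * q j - p j * q i : polys"
  unfolding polys_def by auto

lemma generic_eval:
  assumes "ALL s:S. absv (z - s) = max (absv (w - s)) r" "P : polys"
  shows "absv (poly P z) = gnorm P w r"
  by (rule gnorm_generic') (use assms in \<open>auto simp: S_def\<close>)

lemma generic:
  fixes c :: 'a
  assumes "pt w (absv c)"
  obtains z where "absv a <= absv z" "absv z <= absv b" "ALL s:S. absv (z - s) = max (absv (w - s)) (absv c)"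
proof -
  obtain z where z: "ALL s:S. absv (z - s) = max (absv (w - s)) (absv c)"
    using generic_point[OF finS, of w c] by blast
  have "0 : S" by (simp add: S_def)
  then have "absv (z - 0) = max (absv (w - 0)) (absv c)" using z by blast
  then have "absv z = max (absv w) (absv c)" by simp
  then have "absv a <= absv z" "absv z <= absv b" using assms by (auto simp: pt_def)
  then show ?thesis using z by (rule that)
qed

lemma inU_iff:
  assumes "ALL s:S. absv (z - s) = max (absv (w - s)) r" "i < n"
  shows "inU i w r \<longleftrightarrow> (ALL PQ:L i. absv (poly (fst PQ) z) <= absv (poly (snd PQ) z))"
  unfolding inU_def using generic_eval[OF assms(1)] polys_mem(1,2)[OF assms(2)] by simp

lemma inU_exists:
  fixes c :: 'a
  assumes "pt w (absv c)" shows "EX i<n. inU i w (absv c)"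
proof -
  obtain z where z: "absv a <= absv z" "absv z <= absv b" "ALL s:S. absv (z - s) = max (absv (w - s)) (absv c)"
    using generic[OF assms] .
  show ?thesis using cover[OF z(1,2)] inU_iff[OF z(3)] by blast
qed

lemma q_pos:
  fixes c :: 'a
  assumes "pt w (absv c)" "i < n" "inU i w (absv c)" shows "gnorm (q i) w (absv c) > 0"
proof -
  obtain z where z: "absv a <= absv z" "absv z <= absv b" "ALL s:S. absv (z - s) = max (absv (w - s)) (absv c)"
    using generic[OF assms(1)] .
  have "poly (q i) z ~= 0" using approx[OF assms(2) z(1,2)] inU_iff[OF z(3) assms(2)] assms(3) by blast
  then show ?thesis using generic_eval[OF z(3) polys_mem(4)[OF assms(2)]] by (metis absv_pos_iff)
qed

text \<open>Both fractions approximate the same \<open>h\<close> within \<open>C\<close>, hence they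
  differ by at most \<open>C\<close>, and a value exceeding \<open>C\<close> is common to
  both.\<close>

lemma compare:
  fixes c :: 'a
  assumes "pt w (absv c)" "i < n" "inU i w (absv c)" "j < n" "inU j w (absv c)"
  shows "gnorm (p i * q j - p j * q i) w (absv c) <= C * (gnorm (q i) w (absv c) * gnorm (q j) w (absv c))"
    and "val i w (absv c) > C ==> val j w (absv c) = val i w (absv c)"
proof -
  obtain z where z: "absv a <= absv z" "absv z <= absv b" "ALL s:S. absv (z - s) = max (absv (w - s)) (absv c)"
    using generic[OF assms(1)] .
  have i: "poly (q i) z ~= 0" "absv (h z - poly (p i) z / poly (q i) z) <= C"
    using approx[OF assms(2) z(1,2)] inU_iff[OF z(3) assms(2)] assms(3) by blast+
  have j: "poly (q j) z ~= 0" "absv (h z - poly (p j) z / poly (q j) z) <= C"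
    using approx[OF assms(4) z(1,2)] inU_iff[OF z(3) assms(4)] assms(5) by blast+
  note g = generic_eval[OF z(3)]
  have d: "absv (poly (p i) z / poly (q i) z - poly (p j) z / poly (q j) z) <= C"
    using absv_triangle[of "poly (p i) z / poly (q i) z" "poly (p j) z / poly (q j) z" "h z"] i j
    by (simp add: absv_commute)
  have "poly (p i * q j - p j * q i) z = (poly (p i) z / poly (q i) z - poly (p j) z / poly (q j) z) * (poly (q i) z * poly (q j) z)"
    using i j by (simp add: field_simps)
  then have "absv (poly (p i * q j - p j * q i) z) \<le> C * (absv (poly (q i) z) * absv (poly (q j) z))"
    using mult_right_mono[OF d, of "absv (poly (q i) z) * absv (poly (q j) z)"] by (simp add: absv_mult)
  then show "gnorm (p i * q j - p j * q i) w (absv c) <= C * (gnorm (q i) w (absv c) * gnorm (q j) w (absv c))"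
    using g[OF polys_mem(5)[OF assms(2,4)]] g[OF polys_mem(4)[OF assms(2)]] g[OF polys_mem(4)[OF assms(4)]] by simp
  have v: "val k w (absv c) = absv (poly (p k) z / poly (q k) z)" if "k < n" for k
    using g[OF polys_mem(3)[OF that]] g[OF polys_mem(4)[OF that]] by (simp add: val_def absv_divide)
  show "val j w (absv c) = val i w (absv c)" if "val i w (absv c) > C"
    using absv_eq_of_diff_less'[of "poly (p i) z / poly (q i) z" "poly (p j) z / poly (q j) z"] d that
    by (simp add: v assms(2,4))
qed

text \<open>The generic points of such a disc lie on a boundary circle and keep away from
  \<open>S0\<close>, so the hypothesis \<open>bdry\<close> applies to them.\<close>

lemma boundary_val:
  fixes c :: 'a
  assumes w: "pt w (absv c)" "i < n" "inU i w (absv c)"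
    and b: "absv c = absv b \<or> absv c = absv a & absv w <= absv a"
  shows "val i w (absv c) <= C"
proof -
  obtain z where z: "absv a <= absv z" "absv z <= absv b" "ALL s:S. absv (z - s) = max (absv (w - s)) (absv c)"
    using generic[OF assms(1)] .
  have "0 : S" by (simp add: S_def)
  then have "absv (z - 0) = max (absv (w - 0)) (absv c)" using z by blast
  then have zc: "absv z = absv c" using b w(1) ab by (auto simp: pt_def)
  have "ALL s:S0. absv z <= absv (z - s)" using z(3) zc by (auto simp: S_def)
  then have "absv (h z) <= C" using b zc by (intro bdry) auto
  moreover have i: "poly (q i) z ~= 0" "absv (h z - poly (p i) z / poly (q i) z) <= C"
    using approx[OF assms(2) z(1,2)] inU_iff[OF z(3) assms(2)] assms(3) by blast+
  ultimately have "absv (poly (p i) z / poly (q i) z) <= C"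
    using absv_diff_le'[of "h z" C "h z - poly (p i) z / poly (q i) z"] by simp
  then show ?thesis
    using generic_eval[OF z(3) polys_mem(3)[OF assms(2)]] generic_eval[OF z(3) polys_mem(4)[OF assms(2)]]
    by (simp add: val_def absv_divide)
qed

text \<open>Radii from the value group accumulate at \<open>r\<close> from above, and at each of
  them some member of the finite covering applies. One member occurs arbitrarily close to
  \<open>r\<close>; its inequalities are closed, so it also contains the limit.\<close>

lemma inU_outward:
  assumes "pt w r" "r < absv b"
  shows "EX i<n. inU i w r & q i ~= 0 & (ALL dl>0. EX r'. r < r' & r' < r + dl & pt w r' & inU i w r')"
proof -
  have "EX i<n. ALL dl>0. EX c. r < absv (c::'a) & absv c < r + dl & pt w (absv c) & inU i w (absv c)"
  proof (rule ccontr)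
    assume "\<not> ?thesis"
    then have "ALL i. EX dl. i < n --> dl > 0 & (ALL c. r < absv (c::'a) & absv c < r + dl & pt w (absv c) --> \<not> inU i w (absv c))"
      by blast
    then obtain dl where dl: "ALL i. i < n --> dl i > 0 & (ALL c. r < absv (c::'a) & absv c < r + dl i & pt w (absv c) --> \<not> inU i w (absv c))"
      by (rule choice[THEN exE])
    define d where "d = Min (insert (absv b - r) (dl ` {..<n}))"
    have "d > 0" unfolding d_def using dl assms(2) by (subst Min_gr_iff) auto
    moreover have "0 <= r" using assms(1) by (simp add: pt_def)
    ultimately obtain c :: 'a where c: "r < absv c" "absv c < r + d" using absv_dense[of r "r + d"] by auto
    have "d <= absv b - r" unfolding d_def by (intro Min_le) auto
    then have pc: "pt w (absv c)" using c assms(1) by (auto simp: pt_def)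
    obtain i where i: "i < n" "inU i w (absv c)" using inU_exists[OF pc] by blast
    have "d <= dl i" unfolding d_def using i by (intro Min_le) auto
    then show False using dl i pc c by (meson add_left_mono less_le_trans)
  qed
  then obtain i where i: "i < n" "ALL dl>0. EX c. r < absv (c::'a) & absv c < r + dl & pt w (absv c) & inU i w (absv c)" by blast
  have "inU i w r" unfolding inU_def
  proof
    fix PQ assume PQ: "PQ : L i"
    show "gnorm (fst PQ) w r <= gnorm (snd PQ) w r"
    proof (rule gnorm_limit_le[where R = "%r' dl. r < r' & r' < r + dl"])
      show "EX r'. (r < r' & r' < r + dl) & gnorm (fst PQ) w r' <= gnorm (snd PQ) w r'" if "dl > 0" for dl
        using i(2) that PQ unfolding inU_def by blast
    qed auto
  qed
  moreover have "q i ~= 0"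
  proof -
    obtain c :: 'a where "pt w (absv c)" "inU i w (absv c)" using i(2) zero_less_one by blast
    then show ?thesis using q_pos[of w c i] i(1) by auto
  qed
  moreover have "ALL dl>0. EX r'. r < r' & r' < r + dl & pt w r' & inU i w r'" using i(2) by blast
  ultimately show ?thesis using i(1) by blast
qed

lemma inU_inward:
  assumes lo: "0 <= lo" "lo < r" and w: "!!r'. lo < r' ==> r' <= r ==> pt w r'"
  shows "EX i<n. inU i w r & q i ~= 0 &
     (ALL dl>0. EX c::'a. r - dl < absv c & lo < absv c & absv c < r & inU i w (absv c))"
proof -
  have "EX i<n. ALL dl>0. EX c::'a. r - dl < absv c & lo < absv c & absv c < r & inU i w (absv c)"
  proof (rule ccontr)
    assume "\<not> ?thesis"
    then have "ALL i. EX dl. i < n --> dl > 0 & (ALL c::'a. r - dl < absv c & lo < absv c & absv c < r --> \<not> inU i w (absv c))"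
      by blast
    then obtain dl where dl: "ALL i. i < n --> dl i > 0 & (ALL c::'a. r - dl i < absv c & lo < absv c & absv c < r --> \<not> inU i w (absv c))"
      by (rule choice[THEN exE])
    define d where "d = Min (insert (r - lo) (dl ` {..<n}))"
    have d: "d > 0" unfolding d_def using dl lo by (subst Min_gr_iff) auto
    have dlo: "d <= r - lo" unfolding d_def by (intro Min_le) auto
    obtain c :: 'a where c: "r - d < absv c" "absv c < r" using absv_dense[of "r - d" r] d dlo lo by auto
    then have pc: "pt w (absv c)" using dlo by (intro w) auto
    obtain i where i: "i < n" "inU i w (absv c)" using inU_exists[OF pc] by blast
    have "d <= dl i" unfolding d_def using i by (intro Min_le) auto
    then have "r - dl i < absv c" "lo < absv c" using c dlo by auto
    then show False using dl i c by blast
  qed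
  then obtain i where i: "i < n" "ALL dl>0. EX c::'a. r - dl < absv c & lo < absv c & absv c < r & inU i w (absv c)" by blast
  have "inU i w r" unfolding inU_def
  proof
    fix PQ assume PQ: "PQ : L i"
    show "gnorm (fst PQ) w r <= gnorm (snd PQ) w r"
    proof (rule gnorm_limit_le[where R = "%r' dl. r - dl < r' & r' < r"])
      show "EX r'. (r - dl < r' & r' < r) & gnorm (fst PQ) w r' <= gnorm (snd PQ) w r'" if "dl > 0" for dl
        using i(2) that PQ unfolding inU_def by blast
    qed auto
  qed
  moreover have "q i ~= 0"
  proof -
    obtain c :: 'a where c: "lo < absv c" "absv c < r" "inU i w (absv c)" using i(2) zero_less_one by blast
    then have "pt w (absv c)" by (intro w) auto
    then show ?thesis using q_pos[of w c i] i(1) c by auto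
  qed
  ultimately show ?thesis using i by blast
qed

end

section \<open>Radii outside the value group\<close>

lemma gnorm_near:
  fixes w :: "'a::complete_nonarch_field"
  assumes "0 < r" "\<forall>x\<in>#proots p. absv (w - x) ~= r"
  shows "\<forall>\<^sub>F r' in nhds r. gnorm p w r' = gnorm p w r * (r' / r) ^ size {#x \<in># proots p. absv (w - x) <= r#}"
proof -
  have eq: "{#x \<in># proots p. absv (w - x) < r#} = {#x \<in># proots p. absv (w - x) <= r#}"
    using assms(2) by (intro filter_mset_cong) auto
  obtain d where d: "d > 0" "ALL r'. r <= r' & r' < r + d -->
     gnorm p w r' = gnorm p w r * (r' / r) ^ size {#x \<in># proots p. absv (w - x) <= r#}"
    using gnorm_outward[OF assms(1)] by blast
  obtain e where e: "e > 0" "ALL r'. r - e < r' & r' <= r -->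
     gnorm p w r' = gnorm p w r * (r' / r) ^ size {#x \<in># proots p. absv (w - x) <= r#}"
    using gnorm_inward[OF assms(1), of p w] unfolding eq by blast
  have "gnorm p w r' = gnorm p w r * (r' / r) ^ size {#x \<in># proots p. absv (w - x) <= r#}"
    if "dist r' r < min d e" for r'
    using d(2)[rule_format, of r'] e(2)[rule_format, of r'] that by (cases "r <= r'") (auto simp: dist_real_def)
  moreover have "min d e > 0" using d(1) e(1) by simp
  ultimately show ?thesis unfolding eventually_nhds_metric by blast
qed

text \<open>Equality of monomials with different exponents puts a power of \<open>r\<close> into the
  value group, and then \<open>r\<close> itself because roots exist.\<close>

lemma value_group_root:
  fixes al be :: "'a::complete_nonarch_field"
  assumes "absv al * r ^ N = absv be * r ^ M" "N < M" "0 < r" "al ~= 0"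
  shows "EX e::'a. absv e = r"
proof -
  have be: "be ~= 0" using assms by auto
  have "r ^ M = r ^ N * r ^ (M - N)" using assms(2) by (simp add: power_add[symmetric])
  then have "r ^ N * absv al = r ^ N * (absv be * r ^ (M - N))" using assms(1) by (simp add: mult_ac)
  then have "absv al = absv be * r ^ (M - N)" using assms(3) by simp
  then have k: "absv (al / be) = r ^ (M - N)" using be by (simp add: absv_divide)
  obtain e where e: "e ^ (M - N) = al / be" using nth_root_exists[of "M - N" "al / be"] assms(2) by auto
  then have "absv e ^ (M - N) = r ^ (M - N)" using k by (metis absv_power)
  then have "absv e = r" using assms(2,3) by (intro power_eq_imp_eq_base[of "absv e" "M - N" r]) auto
  then show ?thesis by blast
qed

lemma gnorm_tendsto: "((%r'. gnorm p w r') \<longlongrightarrow> gnorm p w r) (nhds r)"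
  using gnorm_continuous[of p w] continuous_on_eq_continuous_at[OF open_UNIV]
  unfolding isCont_def tendsto_at_iff_tendsto_nhds by blast

text \<open>A strict inequality persists by continuity. Equality at a radius outside the value group
  forces equal exponents, by \<open>value_group_root\<close>, and then it persists as well.\<close>

lemma gnorm_le_near:
  fixes w :: "'a::complete_nonarch_field"
  assumes r: "0 < r" "!!e::'a. absv e ~= r" and le: "gnorm P w r <= gnorm Q w r"
  shows "\<forall>\<^sub>F r' in nhds r. gnorm P w r' <= gnorm Q w r'"
proof -
  have noP: "\<forall>x\<in>#proots R. absv (w - x) ~= r" for R using r(2) by blast
  consider "P = 0" | "Q = 0" "P ~= 0" | "P ~= 0" "Q ~= 0" "gnorm P w r < gnorm Q w r" | "P ~= 0" "Q ~= 0" "gnorm P w r = gnorm Q w r"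
    using le by fastforce
  then show ?thesis
  proof cases
    case 1
    then show ?thesis by (simp add: gnorm_nonneg)
  next
    case 2
    then show ?thesis using le gnorm_pos[of P r w] r(1) by simp
  next
    case 3
    have "((%r. gnorm Q w r - gnorm P w r) \<longlongrightarrow> gnorm Q w r - gnorm P w r) (nhds r)"
      by (intro tendsto_diff gnorm_tendsto)
    then have "\<forall>\<^sub>F r' in nhds r. 0 < gnorm Q w r' - gnorm P w r'"
      by (rule order_tendstoD(1)) (use 3 in simp)
    then show ?thesis by eventually_elim simp
  next
    case 4
    define N where "N = size {#x \<in># proots P. absv (w - x) <= r#}"
    define M where "M = size {#x \<in># proots Q. absv (w - x) <= r#}"
    obtain al :: 'a where al: "gnorm P w r = absv al * r ^ N"
      using gnorm_eq_monomial[OF noP, of P] unfolding N_def by blast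
    obtain be :: 'a where be: "gnorm Q w r = absv be * r ^ M"
      using gnorm_eq_monomial[OF noP, of Q] unfolding M_def by blast
    have "al ~= 0" "be ~= 0" using al be gnorm_pos[OF 4(1) r(1), of w] gnorm_pos[OF 4(2) r(1), of w] by auto
    then have NM: "N = M"
      using value_group_root[of al r N be M] value_group_root[of be r M al N] al be 4(3) r
      by (metis linorder_neqE_nat)
    show ?thesis using gnorm_near[OF r(1) noP, of P] gnorm_near[OF r(1) noP, of Q]
      by eventually_elim (use 4(3) NM in \<open>simp add: N_def M_def\<close>)
  qed
qed

context annulus_cover
begin

text \<open>Centres are confined to the finite set \<open>S\<close>, so that the admissible radii
  form finitely many compact sets and a maximum exists.\<close>

definition good :: "'a \<Rightarrow> nat \<Rightarrow> real \<Rightarrow> bool" where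
  "good s i \<rho> \<longleftrightarrow> s : S & i < n & q i ~= 0 & pt s \<rho> & inU i s \<rho>"

lemma good_q_pos:
  assumes "good s i r" shows "gnorm (q i) s r > 0"
proof (cases "r = 0")
  case True
  then show ?thesis using assms q_pos[of s 0 i] by (simp add: good_def)
next
  case False
  then show ?thesis using assms by (intro gnorm_pos) (auto simp: good_def pt_def)
qed

lemma compact_good: "compact {r. good s i r}"
proof (cases "s : S & i < n & q i ~= 0")
  case True
  define lo where "lo = (if absv a <= absv s & absv s <= absv b then 0 else absv a)"
  have pt: "pt s r \<longleftrightarrow> r : {lo..absv b} & (s = 0 \<or> absv a <= absv s & absv s <= absv b)" for r
    using order_trans[OF absv_nonneg[of a]] by (auto simp: pt_def lo_def)
  have c: "closed {r. gnorm P s r <= gnorm Q s r}" for P Q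
    by (intro closed_Collect_le gnorm_continuous)
  have "closed (\<Inter>PQ\<in>L i. {r. gnorm (fst PQ) s r <= gnorm (snd PQ) s r})" by (intro closed_INT ballI c)
  then have "compact ({lo..absv b} \<inter> (\<Inter>PQ\<in>L i. {r. gnorm (fst PQ) s r <= gnorm (snd PQ) s r}))"
    by (intro compact_Int_closed compact_Icc)
  moreover have "{r. good s i r} = (if s = 0 \<or> absv a <= absv s & absv s <= absv b then
      {lo..absv b} \<inter> (\<Inter>PQ\<in>L i. {r. gnorm (fst PQ) s r <= gnorm (snd PQ) s r}) else {})"
    using True by (auto simp: good_def pt inU_def)
  ultimately show ?thesis by simp
next
  case False
  then have "{r. good s i r} = {}" by (auto simp: good_def)
  then show ?thesis by simp
qed

lemma val_continuous: "continuous_on {r. good s i r} (val i s)"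
proof -
  have "continuous_on {r. good s i r} (%r. gnorm (p i) s r / gnorm (q i) s r)"
  proof (intro continuous_on_divide)
    show "continuous_on {r. good s i r} (%r. gnorm P s r)" for P
      by (rule continuous_on_subset[OF gnorm_continuous]) simp
    then show "continuous_on {r. good s i r} (%r. gnorm P s r)" for P .
  qed (use good_q_pos in force)
  then show ?thesis by (simp add: val_def[abs_def])
qed

text \<open>The centre is a nearest point among 0 and the points of \<open>S\<close> in the annulus.
  The other points of \<open>S\<close> are at least as far from \<open>z\<close> as 0 is, so
  \<open>absv_ultra_eq\<close> makes \<open>z\<close> generic.\<close>

lemma good_of_point:
  assumes z: "absv a <= absv z" "absv z <= absv b" and big: "absv (h z) > C"
  shows "EX s i r. good s i r & val i s r = absv (h z)"
proof -
  define SA where "SA = {s : S. s = 0 \<or> absv a <= absv s & absv s <= absv b}"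
  have "0 : SA" by (simp add: SA_def S_def)
  moreover have "finite SA" using finS by (simp add: SA_def)
  ultimately obtain s where s: "s : SA" "ALL t:SA. absv (z - s) <= absv (z - t)"
    using ex_is_arg_min_if_finite[of SA "%t. absv (z - t)"] by (auto simp: is_arg_min_linorder)
  have s0: "absv (z - s) <= absv z" using s(2) \<open>0 \<in> SA\<close> by force
  have "absv (z - s) <= absv (z - t)" if t: "t : S" for t
  proof (cases "t : SA")
    case False
    then have "absv t < absv a \<or> absv b < absv t" using t by (auto simp: SA_def)
    then have "absv z <= absv (z - t)"
      using absv_triangle[of z 0 t] absv_triangle[of t 0 z] absv_commute[of z t] z by auto
    then show ?thesis using s0 by simp
  qed (use s in simp)
  then have gen: "ALL t:S. absv (z - t) = max (absv (s - t)) (absv (z - s))" using absv_ultra_eq by blast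
  obtain i where i: "i < n" "ALL PQ:L i. absv (poly (fst PQ) z) <= absv (poly (snd PQ) z)"
    using cover[OF z] by blast
  have "inU i s (absv (z - s))" using inU_iff[OF gen i(1)] i(2) by simp
  moreover have "pt s (absv (z - s))" using s(1) s0 z by (auto simp: pt_def SA_def)
  moreover have ap: "poly (q i) z ~= 0" "absv (h z - poly (p i) z / poly (q i) z) <= C" using approx[OF i(1) z i(2)] by auto
  ultimately have "good s i (absv (z - s))" using i(1) s(1) by (auto simp: good_def SA_def)
  moreover have "val i s (absv (z - s)) = absv (poly (p i) z / poly (q i) z)"
    using generic_eval[OF gen polys_mem(3)[OF i(1)]] generic_eval[OF gen polys_mem(4)[OF i(1)]]
    by (simp add: val_def absv_divide)
  moreover have "absv (h z) = absv (poly (p i) z / poly (q i) z)"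
    using absv_eq_of_diff_less'[of "h z"] ap(2) big by auto
  ultimately show ?thesis by metis
qed

text \<open>Compactness is used twice: for the largest value and then, among the places attaining
  it, for the largest radius. The second choice rules out stretches on which the value is
  constant.\<close>

lemma max_exists:
  assumes "absv a <= absv z" "absv z <= absv b" "absv (h z) > C"
  shows "EX s i t. good s i t & val i s t > C &
     (ALL s' i' t'. good s' i' t' --> val i' s' t' <= val i s t) &
     (ALL s' i' t'. good s' i' t' & val i' s' t' = val i s t --> t' <= t)"
proof -
  obtain s0 i0 t0 where g0: "good s0 i0 t0" "val i0 s0 t0 = absv (h z)" using good_of_point[OF assms] by blast
  define J where "J = S \<times> {..<n}"
  define K where "K j = {t. good (fst j) (snd j) t}" for j
  define v where "v j = val (snd j) (fst j)" for j
  have J: "finite J" using finS by (simp add: J_def)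
  have mem: "good s i t \<longleftrightarrow> (s, i) : J & t : K (s, i)" for s i t
    by (auto simp: J_def K_def good_def)
  have cK: "compact (K j)" "continuous_on (K j) (v j)" for j
    unfolding K_def v_def by (rule compact_good, rule val_continuous)
  have "(s0, i0) : J" "t0 : K (s0, i0)" using g0(1) mem by auto
  then have "EX j:J. EX x:K j. ALL j':J. ALL y:K j'. v j' y <= v j x"
    by (intro finite_compact_max[OF J, of K v] cK)
  then obtain j t where j: "j : J" "t : K j" "ALL j':J. ALL y:K j'. v j' y <= v j t" by blast
  define M where "M = v j t"
  define K' where "K' j = {t : K j. v j t = M}" for j
  have cK': "compact (K' j)" for j
  proof -
    have "closed (v j -` {M} \<inter> K j)"
      using continuous_on_closed_vimage[OF compact_imp_closed[OF cK(1)]] cK(2) by blast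
    then have "compact (K j \<inter> (v j -` {M} \<inter> K j))" by (rule compact_Int_closed[OF cK(1)])
    moreover have "K j \<inter> (v j -` {M} \<inter> K j) = K' j" by (auto simp: K'_def)
    ultimately show ?thesis by simp
  qed
  have "t : K' j" using j by (simp add: K'_def M_def)
  with j(1) have "EX j:J. EX x:K' j. ALL j':J. ALL y:K' j'. y <= x"
    by (intro finite_compact_max[OF J, of K' "%_ t. t"] cK' continuous_on_id)
  then obtain j' t' where j': "j' : J" "t' : K' j'" "ALL j:J. ALL y:K' j. y <= t'" by blast
  obtain s i where si: "j' = (s, i)" by (cases j')
  have "good s i t'" using j' si mem by (auto simp: K'_def)
  moreover have vM: "val i s t' = M" using j' si by (auto simp: K'_def v_def)
  moreover have le: "val i' s' r <= M" if "good s' i' r" for s' i' r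
    using j(3) that mem unfolding M_def v_def by fastforce
  moreover have "M > C" using le[OF g0(1)] g0(2) assms(3) by simp
  moreover have "r <= t'" if "good s' i' r" "val i' s' r = M" for s' i' r
    using j'(3) that mem unfolding K'_def v_def by fastforce
  ultimately show ?thesis by metis
qed

text \<open>The slope is the number of zeros of the numerator minus that of the denominator. A
  nonnegative outward slope contradicts the choice of the largest radius; a negative one provides an
  inward direction in which the value grows.\<close>

lemma no_max:
  assumes g: "good s i u" and big: "val i s u > C"
    and mx: "!!s' i' u'. good s' i' u' ==> val i' s' u' <= val i s u"
    and mxr: "!!s' i' u'. good s' i' u' ==> val i' s' u' = val i s u ==> u' <= u"
  shows False
proof -
  define M where "M = val i s u"
  have M: "M > C" "M > 0" using big C0 by (auto simp: M_def)
  have ge: "M <= M * x" if "1 <= x" for x using mult_left_mono[OF that, of M] M(2) by simp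
  have gt: "M < M * x" if "1 < x" for x using mult_strict_left_mono[OF that M(2)] by simp
  have pts\<rho>: "pt s u" and i: "i < n" "inU i s u" "s : S" using g by (auto simp: good_def)
  have u0: "0 <= u" "u <= absv b" using pts\<rho> by (auto simp: pt_def)
  consider "u = 0" | "u > 0" "ALL e::'a. absv e ~= u" | c :: 'a where "u > 0" "u = absv c"
    using u0 by fastforce
  then show False
  proof cases
    case 1
    \<comment> \<open>At radius 0 numerator and denominator are nonzero at the centre, so the value
      stays constant for small radii, against the choice of the largest radius.\<close>
    then have "u < absv b" using a0 ab by (metis absv_pos_iff less_le_trans)
    then obtain j where j: "j < n" "inU j s 0" "q j ~= 0" "ALL dl>0. EX u'. 0 < u' & u' < 0 + dl & pt s u' & inU j s u'"
      using inU_outward[OF pts\<rho>] 1 by auto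
    have cj: "val j s 0 = M"
      using compare(2)[of s 0 i j] pts\<rho> i j big 1 by (simp add: M_def)
    then have pq: "poly (p j) s ~= 0" "poly (q j) s ~= 0" using M(2) by (auto simp: val_def gnorm_at_0)
    obtain d where d: "d > 0" "ALL u. 0 <= u & u < d --> gnorm (p j) s u = absv (poly (p j) s)" using gnorm_small[OF pq(1)] by blast
    obtain e where e: "e > 0" "ALL u. 0 <= u & u < e --> gnorm (q j) s u = absv (poly (q j) s)" using gnorm_small[OF pq(2)] by blast
    obtain u' where u': "0 < u'" "u' < min d e" "pt s u'" "inU j s u'" using j(4)[rule_format, of "min d e"] d e by auto
    have "val j s u' = M" using d(2)[rule_format, of u'] e(2)[rule_format, of u'] u' cj by (simp add: val_def gnorm_at_0)
    moreover have "good s j u'" using u' j i by (simp add: good_def)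
    ultimately show False using mxr[of s j u'] u' 1 by (simp add: M_def)
  next
    case 2
    \<comment> \<open>At a radius outside the value group membership is an open condition and no
      zero has distance \<open>u\<close>: the inward and outward slopes agree, and one member serves
      both sides.\<close>
    have lt: "u < absv b" using 2(2) u0 by (metis order_le_imp_less_or_eq)
    have la: "s = 0 --> absv a < u" if "\<not> (absv a <= absv s & absv s <= absv b)"
      using pts\<rho> 2(2) that unfolding pt_def by (metis order_le_imp_less_or_eq)
    have "\<forall>\<^sub>F u' in nhds u. ALL PQ:L i. gnorm (fst PQ) s u' <= gnorm (snd PQ) s u'"
      using i(2) 2 by (intro eventually_ball_finite finL ballI gnorm_le_near) (auto simp: inU_def)
    then obtain d where d: "d > 0" "ALL u'. dist u' u < d --> inU i s u'"
      unfolding inU_def eventually_nhds_metric by blast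
    have no: "\<forall>x\<in>#proots R. absv (s - x) ~= u" for R using 2(2) by blast
    define Np where "Np = size {#x \<in># proots (p i). absv (s - x) <= u#}"
    define Nq where "Nq = size {#x \<in># proots (q i). absv (s - x) <= u#}"
    have "\<forall>\<^sub>F u' in nhds u. val i s u' = M * ((u' / u) ^ Np / (u' / u) ^ Nq)"
      using gnorm_near[OF 2(1) no, of "p i"] gnorm_near[OF 2(1) no, of "q i"]
      by eventually_elim (simp add: val_def M_def Np_def Nq_def)
    then obtain e where e: "e > 0" "ALL u'. dist u' u < e --> val i s u' = M * ((u' / u) ^ Np / (u' / u) ^ Nq)"
      unfolding eventually_nhds_metric by blast
    define m where "m = (if s = 0 & \<not> absv a <= absv s then u - absv a else u)"
    have m: "m > 0" "s = 0 & \<not> absv a <= absv s ==> m <= u - absv a" using la 2(1) by (auto simp: m_def)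
    define r0 where "r0 = min (min d e) (min (min u m) (absv b - u))"
    have r0: "r0 > 0" "r0 <= d" "r0 <= e" "r0 <= absv b - u" "r0 <= u" "r0 <= m"
      using d e lt 2(1) m by (simp_all add: r0_def)
    define r where "r = r0 / 2"
    have r: "r > 0" "r < d" "r < e" "r < absv b - u" "r < u" "r < m"
      using r0 by (simp_all add: r_def)
    have ra: "s = 0 & \<not> absv a <= absv s ==> r < u - absv a" using r(6) m(2) by linarith
    have gd: "good s i u'" if "\<bar>u' - u\<bar> <= r" for u'
    proof -
      have "pt s u'" using that r ra pts\<rho> a0 unfolding pt_def by (auto simp: abs_if split: if_splits)
      moreover have "inU i s u'" using that r d by (simp add: dist_real_def)
      ultimately show ?thesis using g by (simp add: good_def)
    qed
    show False
    proof (cases "Nq <= Np")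
      case True
      have "1 <= ((u + r) / u) ^ Np / ((u + r) / u) ^ Nq" using r 2(1) True by (intro power_ratio_ge) auto
      moreover have "val i s (u + r) = M * (((u + r) / u) ^ Np / ((u + r) / u) ^ Nq)" using e r by (simp add: dist_real_def)
      ultimately have "val i s (u + r) \<ge> M" using ge by metis
      then have "val i s (u + r) = M" using mx[OF gd[of "u + r"]] r by (simp add: M_def)
      then show False using mxr[OF gd[of "u + r"]] r by (simp add: M_def)
    next
      case False
      have "1 < ((u - r) / u) ^ Np / ((u - r) / u) ^ Nq" using r 2(1) False by (intro power_ratio_gt) auto
      moreover have "val i s (u - r) = M * (((u - r) / u) ^ Np / ((u - r) / u) ^ Nq)" using e r by (simp add: dist_real_def)
      ultimately have "val i s (u - r) > M" using gt by metis
      then show False using mx[OF gd[of "u - r"]] r by (simp add: M_def)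
    qed
  next
    case 3
    have "\<not> (absv c = absv b \<or> absv c = absv a & absv s <= absv a)"
      using boundary_val[of s c i] pts\<rho> i big unfolding 3(2) by linarith
    then have bd: "u ~= absv b" "u = absv a ==> absv s > absv a" unfolding 3(2) by linarith+
    then have lt: "u < absv b" using u0 by simp
    \<comment> \<open>The member \<open>i\<close> may end here, so a member \<open>j\<close> that
      continues outward is taken; since the value exceeds \<open>C\<close>, it is the same for
      \<open>j\<close>.\<close>
    obtain j where j: "j < n" "inU j s u" "q j ~= 0" "ALL dl>0. EX u'. u < u' & u' < u + dl & pt s u' & inU j s u'"
      using inU_outward[OF pts\<rho> lt] by blast
    have cj: "val j s u = M" using compare(2)[of s c i j] pts\<rho> i j big 3 by (simp add: M_def)
    define Np where "Np = size {#x \<in># proots (p j). absv (s - x) <= u#}"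
    define Nq where "Nq = size {#x \<in># proots (q j). absv (s - x) <= u#}"
    obtain d where d: "d > 0" "ALL u'. u <= u' & u' < u + d --> gnorm (p j) s u' = gnorm (p j) s u * (u' / u) ^ Np"
      using gnorm_outward[OF 3(1)] unfolding Np_def by blast
    obtain e where e: "e > 0" "ALL u'. u <= u' & u' < u + e --> gnorm (q j) s u' = gnorm (q j) s u * (u' / u) ^ Nq"
      using gnorm_outward[OF 3(1)] unfolding Nq_def by blast
    show False
    proof (cases "Nq <= Np")
      case True
      obtain u' where u': "u < u'" "u' < u + min d e" "pt s u'" "inU j s u'" using j(4)[rule_format, of "min d e"] d e by auto
      have gd: "good s j u'" using u' j i by (simp add: good_def)
      have "val j s u' = val j s u * ((u' / u) ^ Np / (u' / u) ^ Nq)"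
        using d(2)[rule_format, of u'] e(2)[rule_format, of u'] u' by (simp add: val_def)
      moreover have "1 <= (u' / u) ^ Np / (u' / u) ^ Nq" using u' 3(1) True by (intro power_ratio_ge) auto
      ultimately have "val j s u' \<ge> M" using ge cj by metis
      then have "val j s u' = M" using mx[OF gd] by (simp add: M_def)
      then show False using mxr[OF gd] u' by (simp add: M_def)
    next
      case False
      \<comment> \<open>The denominator has a surplus of zeros in the closed disc, hence in some
        residue disc; moving into that residue disc the value increases.\<close>
      then have "size {#x \<in># proots (p j). absv (s - x) <= u#} < size {#x \<in># proots (q j). absv (s - x) <= u#}"
        by (simp add: Np_def Nq_def)
      then obtain s' where s': "s' \<in># proots (q j)" "absv (s - s') <= u"
         "size {#x \<in># proots (p j). absv (s' - x) < u#} < size {#x \<in># proots (q j). absv (s' - x) < u#}"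
        using size_open_disc_less[OF 3(1)] by blast
      have s'S: "s' : S" using s'(1) j(1,3) polys_mem(4) by (auto simp: S_def)
      have s'b: "absv s' <= absv b"
        using absv_triangle[of s' 0 s] s'(2) absv_commute[of s s'] pts\<rho> a0 ab by (auto simp: pt_def)
      \<comment> \<open>A zero \<open>s'\<close> in the hole of the annulus is no admissible centre.
        It is replaced by 0, which lies in the same residue disc, and \<open>lo\<close> keeps the
        radii above \<open>absv a\<close>.\<close>
      define t where "t = (if absv a <= absv s' then s' else 0)"
      define lo where "lo = (if absv a <= absv s' then 0 else absv a)"
      have lo: "0 <= lo" "lo < u" "absv (s' - t) < u"
      proof -
        have a\<rho>: "absv a < u" if s'a: "\<not> absv a <= absv s'"
        proof -
          have "absv a <= u" if "absv a <= absv s"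
            using absv_triangle[of s 0 s'] s'(2) s'a that by auto
          moreover have "absv a <= u" if "s = 0" "\<not> absv a <= absv s" using pts\<rho> that by (simp add: pt_def)
          ultimately have "absv a <= u" using pts\<rho> by (auto simp: pt_def)
          moreover have "absv a ~= u"
          proof
            assume eq: "absv a = u"
            then have "absv s > absv a" using bd(2) by simp
            then show False using absv_triangle[of s 0 s'] s'(2) s'a eq by auto
          qed
          ultimately show ?thesis by simp
        qed
        show "0 <= lo" "lo < u" using a\<rho> 3(1) by (auto simp: lo_def)
        show "absv (s' - t) < u" using a\<rho> 3(1) by (auto simp: t_def)
      qed
      have ptt: "pt t u'" if "lo < u'" "u' <= u" for u'
        using that u0 lo s'b by (auto simp: pt_def t_def lo_def split: if_splits)
      have st: "absv (s - t) <= u" using absv_triangle[of s t s'] s'(2) lo(3) by simp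
      have tS: "t : S" using s'S by (simp add: t_def S_def)
      have cls: "{#x \<in># B. absv (s' - x) < u#} = {#x \<in># B. absv (t - x) < u#}" for B
        using absv_triangle[of s' _ t] absv_triangle[of t _ s'] lo(3) absv_commute[of s' t]
        by (intro filter_mset_cong refl) (metis le_less_trans max_less_iff_conj)
      have gn: "gnorm P s u = gnorm P t u" for P by (rule gnorm_center[OF st])
      obtain k where k: "k < n" "inU k t u" "q k ~= 0"
         "ALL dl>0. EX c::'a. u - dl < absv c & lo < absv c & absv c < u & inU k t (absv c)"
        using inU_inward[OF lo(1,2) ptt] by blast
      have ks: "inU k s u" using k(2) by (simp add: inU_def gn)
      define Mp where "Mp = size {#x \<in># proots (p j). absv (t - x) < u#}"
      define Mq where "Mq = size {#x \<in># proots (q j). absv (t - x) < u#}"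
      have MM: "Mp < Mq" using s'(3) unfolding Mp_def Mq_def cls .
      have qjk: "gnorm (q j) t u > 0" "gnorm (q k) t u > 0"
        using gnorm_pos[OF j(3) 3(1)] gnorm_pos[OF k(3) 3(1)] by auto
      \<comment> \<open>Inward a member \<open>k\<close> takes over, while the slope is known for
        \<open>j\<close>. The two are compared through \<open>D\<close>: it is dominated at radius
        \<open>u\<close> because the value exceeds \<open>C\<close>, and it remains so slightly
        inward because \<open>gnorm D\<close> is monotone and the other side is continuous.\<close>
      define D where "D = p j * q k - p k * q j"
      have Dle: "gnorm D t u <= C * (gnorm (q j) t u * gnorm (q k) t u)"
        using compare(1)[of s c j k] pts\<rho> j k ks 3 unfolding D_def by (simp add: gn[unfolded 3(2)])
      have pj: "gnorm (p j) t u = M * gnorm (q j) t u" using cj qjk by (simp add: val_def gn field_simps)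
      have "gnorm D t u < gnorm (p j * q k) t u"
        using Dle M(1) qjk by (simp add: gnorm_mult pj mult.assoc) (metis le_less_trans mult_less_cancel_right_pos mult_pos_pos)
      then have neg: "gnorm D t u - gnorm (p j * q k) t u < 0" by simp
      have "((%u'. gnorm D t u - gnorm (p j * q k) t u') \<longlongrightarrow> gnorm D t u - gnorm (p j * q k) t u) (nhds u)"
        by (intro tendsto_diff tendsto_const gnorm_tendsto)
      then have "\<forall>\<^sub>F u' in nhds u. gnorm D t u - gnorm (p j * q k) t u' < 0"
        by (rule order_tendstoD(2)[OF _ neg])
      then obtain dl where dl: "dl > 0" "ALL u'. dist u' u < dl --> gnorm D t u - gnorm (p j * q k) t u' < 0"
        unfolding eventually_nhds_metric by blast
      obtain d where d: "d > 0" "ALL u'. u - d < u' & u' <= u --> gnorm (p j) t u' = gnorm (p j) t u * (u' / u) ^ Mp"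
        using gnorm_inward[OF 3(1)] unfolding Mp_def by blast
      obtain e where e: "e > 0" "ALL u'. u - e < u' & u' <= u --> gnorm (q j) t u' = gnorm (q j) t u * (u' / u) ^ Mq"
        using gnorm_inward[OF 3(1)] unfolding Mq_def by blast
      obtain x :: 'a where x: "u - min dl (min d e) < absv x" "lo < absv x" "absv x < u" "inU k t (absv x)"
        using k(4)[rule_format, of "min dl (min d e)"] d e dl by auto
      have x1: "u - absv x < dl" "u - d < absv x" "u - e < absv x"
        using x(1) min.cobounded1[of dl "min d e"] min.cobounded2[of dl "min d e"] min.cobounded1[of d e] min.cobounded2[of d e]
        by linarith+
      have gk: "good t k (absv x)" using x k tS ptt[of "absv x"] by (simp add: good_def)
      have x0: "absv x > 0" using x(2) lo(1) by linarith
      have "gnorm D t (absv x) < gnorm (p j * q k) t (absv x)"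
        using gnorm_mono[of "absv x" u D t] dl(2)[rule_format, of "absv x"] x x1 by (simp add: dist_real_def)
      then have "gnorm (p j * q k) t (absv x) = gnorm (p k * q j) t (absv x)"
        unfolding D_def by (rule gnorm_ultra_eq)
      then have "val k t (absv x) = val j t (absv x)"
        using gnorm_pos[OF j(3) x0, of t] gnorm_pos[OF k(3) x0, of t] by (simp add: val_def gnorm_mult field_simps)
      also have "\<dots> = M * ((absv x / u) ^ Mp / (absv x / u) ^ Mq)"
        using d(2)[rule_format, of "absv x"] e(2)[rule_format, of "absv x"] x x1 qjk by (simp add: val_def pj)
      also have "\<dots> > M"
        by (rule gt[OF power_ratio_gt]) (use MM x0 x(3) 3(1) in auto)
      finally show False using mx[OF gk] by (simp add: M_def)
    qed
  qed
qed

theorem maximum_principle: "absv a <= absv z ==> absv z <= absv b ==> absv (h z) <= C"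
  using max_exists[of z] no_max by (metis not_le)

end

section \<open>Uniform limits of rational functions\<close>

text \<open>Poles are excluded on \<open>U\<close> only, and approximations on different domains are
  unrelated. This is the kind of datum that the maximum principle takes.\<close>

definition RA :: "'a::complete_nonarch_field set \<Rightarrow> ('a \<Rightarrow> 'a) set" where
  "RA U = {h. ALL e>0. EX p q. ALL z:U. poly q z ~= 0 & absv (h z - poly p z / poly q z) <= e}"

text \<open>The uniform radius of discs contained in \<open>U\<close> replaces compactness: it keeps
  poles away from \<open>U\<close> and makes Cauchy estimates uniform.\<close>

definition rdom :: "'a::complete_nonarch_field set \<Rightarrow> bool" where
  "rdom U \<longleftrightarrow> (EX L. finite L & U = {z. ALL PQ:L. absv (poly (fst PQ) z) <= absv (poly (snd PQ) z)}) &
     (EX B. ALL z:U. absv z <= B) & (EX c::'a. c ~= 0 & (ALL z:U. ALL w. absv (w - z) <= absv c --> w : U))"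

lemma rdom_semialgebraic:
  fixes U :: "'a::complete_nonarch_field set"
  assumes "rdom U" obtains L where "finite L" "U = {z. ALL PQ:L. absv (poly (fst PQ) z) <= absv (poly (snd PQ) z)}"
  using assms unfolding rdom_def by blast

lemma rdom_bounded:
  fixes U :: "'a::complete_nonarch_field set"
  assumes "rdom U" obtains B where "B > 0" "!!z. z : U ==> absv z <= B"
proof -
  obtain B where "ALL z:U. absv z <= B" using assms unfolding rdom_def by blast
  then show ?thesis by (intro that[of "max B 1"]) auto
qed

lemma rdom_radius:
  fixes U :: "'a::complete_nonarch_field set"
  assumes "rdom U" obtains c :: 'a where "c ~= 0" "!!z w. z : U ==> absv (w - z) <= absv c ==> w : U"
  using assms unfolding rdom_def by blast

lemma rdomI:
  fixes c :: "'a::complete_nonarch_field" and U :: "'a set"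
  assumes "finite L" "U = {z. ALL PQ:L. absv (poly (fst PQ) z) <= absv (poly (snd PQ) z)}"
    "!!z. z : U ==> absv z <= B" "c ~= 0" "!!z w. z : U ==> absv (w - z) <= absv c ==> w : U"
  shows "rdom U"
  unfolding rdom_def
proof (intro conjI)
  show "EX L. finite L & U = {z. ALL PQ:L. absv (poly (fst PQ) z) <= absv (poly (snd PQ) z)}"
    using assms(1,2) by (intro exI[of _ L] conjI)
  show "EX B. ALL z:U. absv z <= B" using assms(3) by blast
  show "EX c::'a. c ~= 0 & (ALL z:U. ALL w. absv (w - z) <= absv c --> w : U)" using assms(4,5) by blast
qed

lemma rdom_ball:
  fixes c w :: "'a::complete_nonarch_field"
  assumes "c ~= 0" shows "rdom {z. absv (z - w) <= absv c}"
proof (rule rdomI[of "{([:-w, 1:], [:c:])}" _ "max (absv c) (absv w)" c])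
  show "absv z <= max (absv c) (absv w)" if "z : {z. absv (z - w) <= absv c}" for z
    using absv_add_le[of "z - w" w] that by auto
  show "v : {z. absv (z - w) <= absv c}" if "z : {z. absv (z - w) <= absv c}" "absv (v - z) <= absv c" for z v
    using absv_triangle[of v w z] that by auto
qed (use assms in auto)

lemma rdom_annulus:
  fixes a b :: "'a::complete_nonarch_field"
  assumes "a ~= 0" shows "rdom {z :: 'a. absv a <= absv z & absv z <= absv b}"
proof -
  obtain c :: 'a where c: "c ~= 0" "absv c < absv a" using absv_small[of "absv a"] assms by auto
  show ?thesis
  proof (rule rdomI[of "{([:a:], [:0, 1:]), ([:0, 1:], [:b:])}" _ "absv b" c])
    show "w : {z. absv a <= absv z & absv z <= absv b}"
      if "z : {z. absv a <= absv z & absv z <= absv b}" "absv (w - z) <= absv c" for z w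
      using absv_eq_of_diff_less[of w z] that c by auto
  qed (use c in auto)
qed

lemma rdom_Int:
  fixes U V :: "'a::complete_nonarch_field set"
  assumes "rdom U" "rdom V" shows "rdom (U \<inter> V)"
proof -
  obtain L where L: "finite L" "U = {z. ALL PQ:L. absv (poly (fst PQ) z) <= absv (poly (snd PQ) z)}"
    using rdom_semialgebraic[OF assms(1)] .
  obtain L' where L': "finite L'" "V = {z. ALL PQ:L'. absv (poly (fst PQ) z) <= absv (poly (snd PQ) z)}"
    using rdom_semialgebraic[OF assms(2)] .
  obtain B where B: "B > 0" "!!z. z : U ==> absv z <= B" by (rule rdom_bounded[OF assms(1)]) blast
  obtain c :: 'a where c: "c ~= 0" "!!z w. z : U ==> absv (w - z) <= absv c ==> w : U" by (rule rdom_radius[OF assms(1)]) blast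
  obtain c' :: 'a where c': "c' ~= 0" "!!z w. z : V ==> absv (w - z) <= absv c' ==> w : V" by (rule rdom_radius[OF assms(2)]) blast
  define e where "e = (if absv c <= absv c' then c else c')"
  have e: "e ~= 0" "absv e <= absv c" "absv e <= absv c'" using c(1) c'(1) by (auto simp: e_def)
  show ?thesis
  proof (rule rdomI[of "L \<union> L'" _ B e])
    show "w : U \<inter> V" if "z : U \<inter> V" "absv (w - z) <= absv e" for z w
      using c(2)[of z w] c'(2)[of z w] that e by auto
  qed (use L L' B e in auto)
qed

lemma poly_bounded_on:
  assumes "!!z. z : U ==> absv z <= B" "0 <= B"
  shows "EX K>0. ALL z:U. absv (poly p z) <= K"
proof (induction p)
  case 0
  show ?case by (intro exI[of _ 1]) simp
next
  case (pCons a p)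
  then obtain K where K: "K > 0" "ALL z:U. absv (poly p z) <= K" by blast
  have "absv (a + z * poly p z) <= max (absv a + 1) (B * K)" if "z : U" for z
  proof (rule absv_add_le')
    have "absv z * absv (poly p z) <= B * K" using K assms that by (intro mult_mono) auto
    then show "absv (z * poly p z) <= max (absv a + 1) (B * K)" by (simp add: absv_mult)
  qed simp
  moreover have "max (absv a + 1) (B * K) > 0" using absv_nonneg[of a] by linarith
  ultimately show ?case by (intro exI[of _ "max (absv a + 1) (B * K)"]) auto
qed

lemma poly_lipschitz_on:
  assumes "!!z. z : U ==> absv z <= B" "0 <= B"
  shows "EX K>0. ALL z:U. ALL w:U. absv (poly p z - poly p w) <= K * absv (z - w)"
proof (induction p)
  case 0
  show ?case by (intro exI[of _ 1]) simp
next
  case (pCons a p)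
  then obtain K where K: "K > 0" "ALL z:U. ALL w:U. absv (poly p z - poly p w) <= K * absv (z - w)" by blast
  obtain M where M: "M > 0" "ALL z:U. absv (poly p z) <= M" using poly_bounded_on[OF assms] by blast
  have "absv (poly (pCons a p) z - poly (pCons a p) w) <= max (B * K) M * absv (z - w)" if zw: "z : U" "w : U" for z w
  proof -
    have "poly (pCons a p) z - poly (pCons a p) w = z * (poly p z - poly p w) + (z - w) * poly p w"
      by (simp add: algebra_simps)
    also have "absv \<dots> <= max (B * K) M * absv (z - w)"
    proof (rule absv_add_le')
      have "absv z * absv (poly p z - poly p w) <= B * (K * absv (z - w))"
        using assms K zw by (intro mult_mono) auto
      also have "\<dots> <= max (B * K) M * absv (z - w)"
        by (simp add: mult.assoc[symmetric] mult_right_mono)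
      finally show "absv (z * (poly p z - poly p w)) <= max (B * K) M * absv (z - w)" by (simp add: absv_mult)
      have "absv (z - w) * absv (poly p w) <= absv (z - w) * max (B * K) M"
        using M zw by (intro mult_left_mono) (auto simp: le_max_iff_disj)
      then show "absv ((z - w) * poly p w) <= max (B * K) M * absv (z - w)" by (simp add: absv_mult mult.commute)
    qed
    finally show ?thesis .
  qed
  moreover have "max (B * K) M > 0" using M(1) by linarith
  ultimately show ?case by blast
qed

text \<open>A root nearer to \<open>U\<close> than the uniform radius would lie in \<open>U\<close>;
  so every linear factor is bounded below.\<close>

lemma poly_lower_bound_on:
  assumes U: "rdom U" and q: "!!z. z : U ==> poly q z ~= 0"
  shows "EX d>0. ALL z:U. d <= absv (poly q z)"
proof (cases "q = 0")
  case True
  then have "U = {}" using q by auto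
  then show ?thesis by (intro exI[of _ 1]) auto
next
  case False
  obtain c :: 'a where c: "c ~= 0" "!!z w. z : U ==> absv (w - z) <= absv c ==> w : U" by (rule rdom_radius[OF U]) blast
  have "absv c <= absv (z - x)" if "z : U" "x \<in># proots q" for z x
  proof (rule ccontr)
    assume "\<not> absv c <= absv (z - x)"
    then have "x : U" using c(2)[OF that(1), of x] by (simp add: absv_commute)
    then show False using q that(2) False by auto
  qed
  then have far: "\<forall>x\<in>#proots q. absv c <= absv (z - x)" if "z : U" for z using that by blast
  have "(\<forall>x\<in>#A. absv c <= absv (z - x)) ==> absv c ^ size A <= (\<Prod>x\<in>#A. absv (z - x))" for A z
    by (induction A) (auto intro!: mult_mono)
  from this[OF far] have "absv (lead_coeff q) * absv c ^ size (proots q) <= absv (poly q z)" if "z : U" for z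
    unfolding poly_roots_prod[of q z] absv_mult absv_prod_mset using that by (intro mult_left_mono) auto
  moreover have "absv (lead_coeff q) * absv c ^ size (proots q) > 0" using False c by simp
  ultimately show ?thesis by blast
qed

lemma rational_lipschitz_on:
  assumes U: "rdom U" and q: "!!z. z : U ==> poly q z ~= 0"
  shows "EX K>0. ALL z:U. ALL w:U. absv (poly p z / poly q z - poly p w / poly q w) <= K * absv (z - w)"
    and "EX K>0. ALL z:U. absv (poly p z / poly q z) <= K"
proof -
  obtain B where B: "B > 0" "!!z. z : U ==> absv z <= B" by (rule rdom_bounded[OF U]) blast
  then have B0: "0 <= B" by simp
  obtain d where d: "d > 0" "ALL z:U. d <= absv (poly q z)" using poly_lower_bound_on[OF U q] by blast
  obtain Mp where Mp: "Mp > 0" "ALL z:U. absv (poly p z) <= Mp" using poly_bounded_on[OF B(2) B0] by blast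
  obtain Mq where Mq: "Mq > 0" "ALL z:U. absv (poly q z) <= Mq" using poly_bounded_on[OF B(2) B0] by blast
  obtain Kp where Kp: "Kp > 0" "ALL z:U. ALL w:U. absv (poly p z - poly p w) <= Kp * absv (z - w)"
    using poly_lipschitz_on[OF B(2) B0] by blast
  obtain Kq where Kq: "Kq > 0" "ALL z:U. ALL w:U. absv (poly q z - poly q w) <= Kq * absv (z - w)"
    using poly_lipschitz_on[OF B(2) B0] by blast
  show "EX K>0. ALL z:U. absv (poly p z / poly q z) <= K"
    using Mp d by (intro exI[of _ "Mp / d"]) (auto simp: absv_divide intro!: frac_le)
  have "absv (poly p z / poly q z - poly p w / poly q w) <= max (Kp * Mq) (Mp * Kq) / (d * d) * absv (z - w)"
    if zw: "z : U" "w : U" for z w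
  proof -
    have eq: "poly p z / poly q z - poly p w / poly q w =
        ((poly p z - poly p w) * poly q w - poly p w * (poly q z - poly q w)) / (poly q z * poly q w)"
      using q zw by (simp add: field_simps)
    have n1: "absv ((poly p z - poly p w) * poly q w) <= Kp * absv (z - w) * Mq" unfolding absv_mult
      using Kp Mq zw by (intro mult_mono) auto
    have n2: "absv (poly p w * (poly q z - poly q w)) <= Mp * (Kq * absv (z - w))" unfolding absv_mult
      using Kq Mp zw by (intro mult_mono) auto
    have m: "Kp * absv (z - w) * Mq <= max (Kp * Mq) (Mp * Kq) * absv (z - w)"
       "Mp * (Kq * absv (z - w)) <= max (Kp * Mq) (Mp * Kq) * absv (z - w)"
      using mult_right_mono[of "Kp * Mq" "max (Kp * Mq) (Mp * Kq)" "absv (z - w)"]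
        mult_right_mono[of "Mp * Kq" "max (Kp * Mq) (Mp * Kq)" "absv (z - w)"] by (simp_all add: mult_ac)
    have num: "absv ((poly p z - poly p w) * poly q w - poly p w * (poly q z - poly q w)) <= max (Kp * Mq) (Mp * Kq) * absv (z - w)"
      by (rule absv_diff_le') (use n1 n2 m in linarith)+
    have den: "d * d <= absv (poly q z * poly q w)" unfolding absv_mult using d zw by (intro mult_mono) auto
    show ?thesis unfolding eq absv_divide
      using frac_le[OF _ num _ den] order_trans[OF absv_nonneg num] d(1) by simp
  qed
  moreover have "max (Kp * Mq) (Mp * Kq) / (d * d) > 0"
    using mult_pos_pos[OF Kp(1) Mq(1)] d by (intro divide_pos_pos) auto
  ultimately show "EX K>0. ALL z:U. ALL w:U. absv (poly p z / poly q z - poly p w / poly q w) <= K * absv (z - w)"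
    by blast
qed

section \<open>The ring of uniform limits of rational functions\<close>

lemma RA_approx:
  assumes "h : RA U" "e > 0"
  obtains p q where "!!z. z : U ==> poly q z ~= 0" "!!z. z : U ==> absv (h z - poly p z / poly q z) <= e"
  using assms unfolding RA_def by blast

lemma RA_I:
  assumes "!!e. e > 0 ==> EX p q. ALL z:U. poly q z ~= 0 & absv (h z - poly p z / poly q z) <= e"
  shows "h : RA U"
  using assms unfolding RA_def by blast

lemma RA_rational:
  assumes "!!z. z : U ==> poly q z ~= 0" shows "(%z. poly p z / poly q z) : RA U"
proof (rule RA_I)
  show "EX p' q'. ALL z:U. poly q' z ~= 0 & absv (poly p z / poly q z - poly p' z / poly q' z) <= e" if "e > 0" for e
    by (intro exI[of _ p] exI[of _ q]) (use assms that in auto)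
qed

lemma RA_const: "(%_. c) : RA U"
  using RA_rational[of U 1 "[:c:]"] by simp

lemma RA_id: "(%z. z) : RA U"
  using RA_rational[of U 1 "[:0, 1:]"] by simp

lemma RA_limit:
  assumes "!!e. e > 0 ==> EX k:RA U. ALL z:U. absv (h z - k z) <= e"
  shows "h : RA U"
proof (rule RA_I)
  fix e :: real assume e: "e > 0"
  then obtain k where k: "k : RA U" "ALL z:U. absv (h z - k z) <= e" using assms by blast
  obtain p q where pq: "!!z. z : U ==> poly q z ~= 0" "!!z. z : U ==> absv (k z - poly p z / poly q z) <= e"
    by (rule RA_approx[OF k(1) e]) blast
  have "absv (h z - poly p z / poly q z) <= e" if "z : U" for z
    using absv_triangle[of "h z" "poly p z / poly q z" "k z"] k(2) pq(2)[OF that] that by fastforce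
  then show "EX p q. ALL z:U. poly q z ~= 0 & absv (h z - poly p z / poly q z) <= e" using pq(1) by blast
qed

lemma RA_cong: "h : RA U ==> (!!z. z : U ==> k z = h z) ==> k : RA U"
  by (rule RA_limit) (auto intro!: bexI[of _ h])

lemma RA_subset: "h : RA U ==> V \<subseteq> U ==> h : RA V"
  unfolding RA_def by blast

lemma RA_bounded:
  assumes "rdom U" "h : RA U" shows "EX K>0. ALL z:U. absv (h z) <= K"
proof -
  obtain p q where pq: "!!z. z : U ==> poly q z ~= 0" "!!z. z : U ==> absv (h z - poly p z / poly q z) <= 1"
    by (rule RA_approx[OF assms(2), of 1]) auto
  obtain K where K: "K > 0" "ALL z:U. absv (poly p z / poly q z) <= K"
    using rational_lipschitz_on(2)[OF assms(1) pq(1)] by blast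
  have "absv (h z) <= max K 1" if "z : U" for z
    using absv_add_le[of "h z - poly p z / poly q z" "poly p z / poly q z"] pq(2)[OF that] K(2) that by fastforce
  then show ?thesis by (intro exI[of _ "max K 1"]) auto
qed

lemma RA_add:
  assumes "h : RA U" "k : RA U" shows "(%z. h z + k z) : RA U"
proof (rule RA_I)
  fix e :: real assume e: "e > 0"
  obtain p q where pq: "!!z. z : U ==> poly q z ~= 0" "!!z. z : U ==> absv (h z - poly p z / poly q z) <= e"
    by (rule RA_approx[OF assms(1) e]) blast
  obtain r s where rs: "!!z. z : U ==> poly s z ~= 0" "!!z. z : U ==> absv (k z - poly r z / poly s z) <= e"
    by (rule RA_approx[OF assms(2) e]) blast
  have "absv (h z + k z - poly (p * s + r * q) z / poly (q * s) z) <= e" if z: "z : U" for z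
  proof -
    have "h z + k z - poly (p * s + r * q) z / poly (q * s) z =
        (h z - poly p z / poly q z) + (k z - poly r z / poly s z)"
      using pq(1)[OF z] rs(1)[OF z] by (simp add: field_simps)
    then show ?thesis using absv_add_le'[OF pq(2)[OF z] rs(2)[OF z]] by metis
  qed
  then show "EX p q. ALL z:U. poly q z ~= 0 & absv (h z + k z - poly p z / poly q z) <= e"
    using pq(1) rs(1) by (intro exI[of _ "p * s + r * q"] exI[of _ "q * s"]) auto
qed

lemma RA_mult:
  assumes U: "rdom U" and "h : RA U" "k : RA U" shows "(%z. h z * k z) : RA U"
proof (rule RA_I)
  fix e :: real assume e: "e > 0"
  obtain B where B: "B > 0" "ALL z:U. absv (k z) <= B" using RA_bounded[OF U assms(3)] by blast
  have "e / B > 0" using e B by simp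
  obtain p q where pq: "!!z. z : U ==> poly q z ~= 0" "!!z. z : U ==> absv (h z - poly p z / poly q z) <= e / B"
    by (rule RA_approx[OF assms(2) \<open>e / B > 0\<close>]) blast
  obtain C where C: "C > 0" "ALL z:U. absv (poly p z / poly q z) <= C"
    using rational_lipschitz_on(2)[OF U pq(1)] by blast
  have "e / C > 0" using e C by simp
  obtain r s where rs: "!!z. z : U ==> poly s z ~= 0" "!!z. z : U ==> absv (k z - poly r z / poly s z) <= e / C"
    by (rule RA_approx[OF assms(3) \<open>e / C > 0\<close>]) blast
  have "absv (h z * k z - poly (p * r) z / poly (q * s) z) <= e" if z: "z : U" for z
    using absv_mult_diff_le[OF pq(2)[OF z] rs(2)[OF z] B(2)[rule_format, OF z] C(2)[rule_format, OF z]] B(1) C(1)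
    by simp
  then show "EX p q. ALL z:U. poly q z ~= 0 & absv (h z * k z - poly p z / poly q z) <= e"
    using pq(1) rs(1) by (intro exI[of _ "p * r"] exI[of _ "q * s"]) auto
qed

lemma RA_uminus: "rdom U ==> h : RA U ==> (%z. - h z) : RA U"
  using RA_mult[OF _ RA_const[of "-1"], of U h] by simp

lemma RA_diff: "rdom U ==> h : RA U ==> k : RA U ==> (%z. h z - k z) : RA U"
  using RA_add[OF _ RA_uminus, of h U k] by simp

lemma RA_sum: "(!!i. i : A ==> h i : RA U) ==> (%z. \<Sum>i\<in>A. h i z) : RA U"
  by (induction A rule: infinite_finite_induct) (simp_all add: RA_const RA_add)

lemma RA_power: "rdom U ==> h : RA U ==> (%z. h z ^ k) : RA U"
  by (induction k) (simp_all add: RA_const RA_mult)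

lemma RA_prod: "rdom U ==> (!!i. i : A ==> h i : RA U) ==> (%z. \<Prod>i\<in>A. h i z) : RA U"
  by (induction A rule: infinite_finite_induct) (simp_all add: RA_const RA_mult)

lemma RA_inverse:
  assumes U: "rdom U" and h: "h : RA U" and dl: "dl > 0" "!!z. z : U ==> dl <= absv (h z)"
  shows "(%z. inverse (h z)) : RA U"
proof (rule RA_I)
  fix e :: real assume e: "e > 0"
  define d where "d = min (dl / 2) (e * (dl * dl))"
  have d: "d > 0" using e dl by (simp add: d_def)
  obtain p q where pq: "!!z. z : U ==> poly q z ~= 0" "!!z. z : U ==> absv (h z - poly p z / poly q z) <= d"
    by (rule RA_approx[OF h d]) blast
  have *: "poly p z ~= 0 & absv (inverse (h z) - poly q z / poly p z) <= e" if z: "z : U" for z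
  proof -
    let ?u = "poly p z / poly q z"
    have "absv (h z - ?u) < absv (h z)" using pq(2)[OF z] dl(1) dl(2)[OF z] by (simp add: d_def)
    then have eq: "absv (h z) = absv ?u" by (rule absv_eq_of_diff_less')
    then have u0: "absv ?u \<ge> dl" using dl(2)[OF z] by simp
    then have p0: "poly p z ~= 0" using dl(1) by auto
    have h0: "h z ~= 0" using dl(2)[OF z] dl(1) by auto
    have "inverse (h z) - poly q z / poly p z = (?u - h z) / (h z * ?u)"
      using p0 pq(1)[OF z] h0 by (simp add: field_simps)
    then have "absv (inverse (h z) - poly q z / poly p z) = absv (h z - ?u) / (absv (h z) * absv ?u)"
      by (simp only: absv_divide absv_mult absv_commute[of ?u])
    also have "\<dots> <= (e * (dl * dl)) / (dl * dl)"
    proof (rule frac_le)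
      show "absv (h z - ?u) <= e * (dl * dl)" using pq(2)[OF z] by (simp add: d_def)
      show "dl * dl <= absv (h z) * absv ?u" using dl(1) dl(2)[OF z] u0 by (intro mult_mono) auto
    qed (use e dl in auto)
    finally show ?thesis using p0 dl(1) by simp
  qed
  then show "EX p q. ALL z:U. poly q z ~= 0 & absv (inverse (h z) - poly p z / poly q z) <= e" by blast
qed

lemma RA_uniformly_continuous:
  fixes h :: "'a::complete_nonarch_field \<Rightarrow> 'a"
  assumes U: "rdom U" and h: "h : RA U" and e: "e > 0"
  shows "EX c::'a. c ~= 0 & (ALL z:U. ALL w. absv (w - z) <= absv c --> w : U & absv (h w - h z) <= e)"
proof -
  obtain p q where pq: "!!z. z : U ==> poly q z ~= 0" "!!z. z : U ==> absv (h z - poly p z / poly q z) <= e"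
    by (rule RA_approx[OF h e]) blast
  obtain K where K: "K > 0" "ALL z:U. ALL w:U. absv (poly p z / poly q z - poly p w / poly q w) <= K * absv (z - w)"
    using rational_lipschitz_on(1)[OF U pq(1)] by blast
  obtain c0 :: 'a where c0: "c0 ~= 0" "!!z w. z : U ==> absv (w - z) <= absv c0 ==> w : U" by (rule rdom_radius[OF U]) blast
  have "min (absv c0) (e / K) > 0" using c0 e K by simp
  then obtain c :: 'a where c: "c ~= 0" "absv c < min (absv c0) (e / K)" using absv_small by blast
  have "w : U & absv (h w - h z) <= e" if z: "z : U" and wz: "absv (w - z) <= absv c" for z w
  proof -
    have w: "w : U" using c0(2)[OF z, of w] wz c by simp
    have "absv (poly p w / poly q w - poly p z / poly q z) <= K * absv (w - z)" using K(2) z w by blast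
    also have "\<dots> <= K * (e / K)" using wz c K(1) by (intro mult_left_mono) auto
    finally have 1: "absv (poly p w / poly q w - poly p z / poly q z) <= e" using K(1) by simp
    have "absv (h w - poly p z / poly q z) <= e"
      using absv_triangle[of "h w" "poly p z / poly q z" "poly p w / poly q w"] 1 pq(2)[OF w] by linarith
    then have "absv (h w - h z) <= e"
      using absv_triangle[of "h w" "h z" "poly p z / poly q z"] pq(2)[OF z] absv_commute[of "h z"] by simp
    with w show ?thesis by blast
  qed
  then show ?thesis using c(1) by blast
qed

lemma RA_tate:
  assumes U: "rdom U" and H: "H : tate n" and h: "!!i. i < n ==> h i : RA U"
    and b: "!!i z. i < n ==> z : U ==> absv (h i z) <= 1"
  shows "(%z. H (%i. if i < n then h i z else 0)) : RA U"
proof (rule RA_limit)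
  fix e :: real assume e: "e > 0"
  obtain p where p: "p : polyfun n" "!!x. x : polydisc ==> absv (H x - p x) <= e"
    using tate_approx[OF H e] by blast
  have "(%z. p (%i. if i < n then h i z else 0)) : RA U"
    using p(1)
  proof (induction rule: polyfun.induct)
    case (const c)
    show ?case by (rule RA_const)
  next
    case (var i)
    then show ?case using h[of i] by simp
  next
    case (add p q)
    then show ?case by (intro RA_add)
  next
    case (mult p q)
    then show ?case by (intro RA_mult U)
  qed
  then show "EX k:RA U. ALL z:U. absv (H (%i. if i < n then h i z else 0) - k z) <= e"
  proof (rule bexI[rotated], intro ballI p(2))
    fix z assume "z : U"
    then show "(%i. if i < n then h i z else 0) : polydisc" by (simp add: polydisc_def b)
  qed
qed

text \<open>The lower bound on \<open>k\<close> leaves room to replace all functions by rational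
  approximations without changing the set, and to move points by a uniform amount without leaving
  it.\<close>

lemma rdom_rational_subset:
  fixes U :: "'a::complete_nonarch_field set"
  assumes U: "rdom U" and k: "k : RA U" and fs: "finite F" "!!f. f : F ==> f : RA U"
    and dl: "dl > 0" "!!z. z : U ==> ALL f:F. absv (f z) <= absv (k z) ==> dl <= absv (k z)"
  shows "rdom {z : U. ALL f:F. absv (f z) <= absv (k z)}"
proof -
  \<comment> \<open>The constant \<open>d\<close> turns the lower bound into a polynomial
    inequality; the approximation error \<open>absv e\<close> stays below it.\<close>
  obtain d :: 'a where d: "d ~= 0" "absv d < dl" using absv_small[OF dl(1)] by blast
  obtain e :: 'a where e: "e ~= 0" "absv e < absv d" using absv_small[of "absv d"] d by auto
  then have e0: "absv e > 0" by simp
  obtain p q where pq: "!!z. z : U ==> poly q z ~= 0" "!!z. z : U ==> absv (k z - poly p z / poly q z) <= absv e"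
    by (rule RA_approx[OF k e0]) blast
  have "ALL f. EX rs. f : F --> (ALL z:U. poly (snd rs) z ~= 0 & absv (f z - poly (fst rs) z / poly (snd rs) z) <= absv e)"
  proof
    fix f
    show "EX rs. f : F --> (ALL z:U. poly (snd rs) z ~= 0 & absv (f z - poly (fst rs) z / poly (snd rs) z) <= absv e)"
    proof (cases "f : F")
      case True
      obtain r s where "ALL z:U. poly s z ~= 0 & absv (f z - poly r z / poly s z) <= absv e"
        using fs(2)[OF True] e0 unfolding RA_def by blast
      then show ?thesis by (intro exI[of _ "(r, s)"]) simp
    qed simp
  qed
  then obtain rs where "ALL f. f : F --> (ALL z:U. poly (snd (rs f)) z ~= 0 & absv (f z - poly (fst (rs f)) z / poly (snd (rs f)) z) <= absv e)"
    by (rule choice[THEN exE])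
  then have rs: "!!f z. f : F ==> z : U ==> poly (snd (rs f)) z ~= 0"
    "!!f z. f : F ==> z : U ==> absv (f z - poly (fst (rs f)) z / poly (snd (rs f)) z) <= absv e" by auto
  obtain L where L: "finite L" "U = {z. ALL PQ:L. absv (poly (fst PQ) z) <= absv (poly (snd PQ) z)}"
    using rdom_semialgebraic[OF U] .
  obtain B where B: "B > 0" "!!z. z : U ==> absv z <= B" by (rule rdom_bounded[OF U]) blast
  let ?V = "{z : U. ALL f:F. absv (f z) <= absv (k z)}"
  define L' where "L' = insert (smult d q, p) ((%f. (fst (rs f) * q, p * snd (rs f))) ` F)"
  have iff: "z : ?V \<longleftrightarrow> (ALL PQ:L'. absv (poly (fst PQ) z) <= absv (poly (snd PQ) z))" if z: "z : U" for z
  proof -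
    let ?u = "poly p z / poly q z"
    have l1: "absv (poly (smult d q) z) <= absv (poly p z) \<longleftrightarrow> absv d <= absv ?u"
      using pq(1)[OF z] by (simp add: absv_mult absv_divide le_divide_eq)
    have l2: "absv (poly (fst (rs f) * q) z) <= absv (poly (p * snd (rs f)) z) \<longleftrightarrow>
        absv (poly (fst (rs f)) z / poly (snd (rs f)) z) <= absv ?u" if "f : F" for f
      using pq(1)[OF z] rs(1)[OF that z] by (simp add: absv_mult absv_divide divide_simps mult.commute)
    have "(ALL PQ:L'. absv (poly (fst PQ) z) <= absv (poly (snd PQ) z)) \<longleftrightarrow>
        absv d <= absv ?u & (ALL f:F. absv (poly (fst (rs f)) z / poly (snd (rs f)) z) <= absv ?u)"
      using l1 l2 by (simp add: L'_def)
    also have "\<dots> \<longleftrightarrow> (ALL f:F. absv (f z) <= absv (k z))"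
    proof
      assume *: "absv d <= absv ?u & (ALL f:F. absv (poly (fst (rs f)) z / poly (snd (rs f)) z) <= absv ?u)"
      have ku: "absv (k z) = absv ?u" using pq(2)[OF z] * e by (intro absv_eq_of_diff_less) simp
      show "ALL f:F. absv (f z) <= absv (k z)"
      proof
        fix f assume f: "f : F"
        let ?v = "poly (fst (rs f)) z / poly (snd (rs f)) z"
        have "absv ?v <= absv ?u" using * f by blast
        moreover have "absv (f z - ?v) <= absv ?u" using rs(2)[OF f z] * e by linarith
        ultimately show "absv (f z) <= absv (k z)" unfolding ku
          using absv_add_le'[of "f z - ?v" "absv ?u" ?v] by simp
      qed
    next
      assume *: "ALL f:F. absv (f z) <= absv (k z)"
      have kd: "dl <= absv (k z)" by (rule dl(2)[OF z *])
      then have ku: "absv (k z) = absv ?u" using pq(2)[OF z] e d by (intro absv_eq_of_diff_less') linarith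
      have "absv (poly (fst (rs f)) z / poly (snd (rs f)) z) <= absv ?u" if f: "f : F" for f
      proof -
        let ?v = "poly (fst (rs f)) z / poly (snd (rs f)) z"
        have "absv (f z - ?v) <= absv (k z)" using rs(2)[OF f z] e d kd by linarith
        then show ?thesis using absv_diff_le'[of "f z" "absv (k z)" "f z - ?v"] * f ku by simp
      qed
      then show "absv d <= absv ?u & (ALL f:F. absv (poly (fst (rs f)) z / poly (snd (rs f)) z) <= absv ?u)"
        using kd d ku by auto
    qed
    finally show ?thesis using z by blast
  qed
  have uc: "ALL f. EX c. f : insert k F --> c ~= 0 & (ALL z:U. ALL w. absv (w - z) <= absv (c::'a) --> w : U & absv (f w - f z) <= absv e)"
    using RA_uniformly_continuous[OF U _ e0] k fs(2) by blast
  then obtain c where c: "ALL f. f : insert k F --> c f ~= 0 & (ALL z:U. ALL w. absv (w - z) <= absv (c f::'a) --> w : U & absv (f w - f z) <= absv e)"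
    by (rule choice[THEN exE])
  define m where "m = Min ((%f. absv (c f)) ` insert k F)"
  have "m > 0" unfolding m_def using fs(1) c by (subst Min_gr_iff) auto
  then obtain c' :: 'a where c': "c' ~= 0" "absv c' < m" using absv_small by blast
  have mle: "m <= absv (c f)" if "f : insert k F" for f unfolding m_def using fs(1) that by (intro Min_le) auto
  show ?thesis
  proof (rule rdomI[of "L \<union> L'" _ B c'])
    show "finite (L \<union> L')" using L fs(1) by (simp add: L'_def)
    show "?V = {z. ALL PQ:L \<union> L'. absv (poly (fst PQ) z) <= absv (poly (snd PQ) z)}"
      using iff L(2) by blast
    show "absv z <= B" if "z : ?V" for z using B that by blast
    show "c' ~= 0" by (rule c')
    fix z w assume z: "z : ?V" and w: "absv (w - z) <= absv c'"
    have f: "w : U & absv (f w - f z) <= absv e" if "f : insert k F" for f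
    proof -
      have "absv (w - z) <= absv (c f)" using w c'(2) mle[OF that] by linarith
      moreover have "z : U" using z by blast
      ultimately show ?thesis using c[rule_format, OF that] by blast
    qed
    have kd: "dl <= absv (k z)" using dl(2) z by blast
    have kw: "absv (k w) = absv (k z)" using f[of k] kd e d by (intro absv_eq_of_diff_less) auto
    have "absv (g w) <= absv (k w)" if "g : F" for g
      using absv_add_le'[of "g w - g z" "absv (k z)" "g z"] f[of g] that z kd e d kw by simp
    then show "w : ?V" using f[of k] by simp
  qed
qed

text \<open>Affinoids in the line to which both ideal theory (\<open>presented\<close>) and
  approximation by rational functions (\<open>rdom\<close>, \<open>RA\<close>) apply.\<close>

definition goodaff :: "('a::complete_nonarch_field, 'a) affinoid \<Rightarrow> bool" where
  "goodaff W \<longleftrightarrow> presented W & rdom (fst W) & set (snd W) \<subseteq> RA (fst W)"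

lemma an_RA:
  assumes W: "goodaff W" and h: "h : an W" shows "h : RA (fst W)"
proof -
  have snd: "sound W" and U: "rdom (fst W)" and gens: "set (snd W) \<subseteq> RA (fst W)"
    using W by (auto simp: goodaff_def presented_def)
  obtain H where H: "H : tate (length (snd W))" "!!p. p : fst W ==> h p = H (ev (snd W) p)" by (rule anE[OF h]) blast
  have "(%z. H (%i. if i < length (snd W) then (snd W ! i) z else 0)) : RA (fst W)"
    by (rule RA_tate[OF U H(1)]) (use gens snd in \<open>auto simp: sound_def\<close>)
  then show ?thesis by (rule RA_cong) (simp add: H(2) ev_def)
qed

lemma goodaff_annulus:
  fixes a b :: "'a::complete_nonarch_field"
  assumes "a ~= 0" "absv a <= absv b" shows "goodaff (annulus a b)"
proof -
  have U: "rdom {z :: 'a. absv a <= absv z & absv z <= absv b}" by (rule rdom_annulus[OF assms(1)])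
  have "(%z. inverse z) : RA {z :: 'a. absv a <= absv z & absv z <= absv b}"
    by (rule RA_inverse[OF U RA_id, of "absv a"]) (use assms in auto)
  from RA_mult[OF U RA_const[of a] this] RA_mult[OF U RA_id RA_const[of "inverse b"]]
  show ?thesis unfolding goodaff_def using presented_annulus[OF assms] U
    by (simp add: annulus_def divide_inverse)
qed

text \<open>By the Nullstellensatz \<open>g\<close> is bounded below on the subdomain; this makes
  the domain semialgebraic and the new generators \<open>f / g\<close> approximable.\<close>

lemma goodaff_rational:
  assumes W: "goodaff W" and sub: "rational_subdomain W W'"
  shows "goodaff W'"
proof -
  have pr: "presented W" and snd: "sound W" and U: "rdom (fst W)" and gens: "set (snd W) \<subseteq> RA (fst W)"
    using W by (auto simp: goodaff_def presented_def)
  obtain g fs where g: "g : an W" "set fs \<subseteq> an W" and nz: "ALL p:fst W. EX f:set (g # fs). f p ~= 0"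
     and pts: "fst W' = {p : fst W. ALL f:set fs. absv (f p) <= absv (g p)}"
     and gens': "snd W' = snd W @ map (%f p. f p / g p) fs"
    using sub unfolding rational_subdomain_def analytic_functions_eq[OF snd] by blast
  have gRA: "g : RA (fst W)" and fRA: "!!f. f : set fs ==> f : RA (fst W)" using g an_RA[OF W] by auto
  obtain d where d: "d > 0" "ALL p:fst W. EX h:insert g (set fs). d <= absv (h p)"
    using presented_lower_bound[OF pr, of "insert g (set fs)"] g nz by auto
  have g\<delta>: "d <= absv (g p)" if p: "p : fst W" "ALL f:set fs. absv (f p) <= absv (g p)" for p
  proof -
    obtain h where "h : insert g (set fs)" "d <= absv (h p)" using d(2) p(1) by blast
    then show ?thesis using p(2) by (cases "h = g") (auto intro: order_trans)
  qed
  have U': "rdom (fst W')" unfolding pts by (rule rdom_rational_subset[OF U gRA _ fRA d(1) g\<delta>]) auto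
  have sub': "fst W' \<subseteq> fst W" by (auto simp: pts)
  have inv: "(%z. inverse (g z)) : RA (fst W')"
    by (rule RA_inverse[OF U' RA_subset[OF gRA sub'] d(1)]) (use g\<delta> pts in auto)
  have "(%z. f z / g z) : RA (fst W')" if "f : set fs" for f
    using RA_mult[OF U' RA_subset[OF fRA[OF that] sub'] inv] by (simp add: divide_inverse)
  then have "set (snd W') \<subseteq> RA (fst W')" using gens RA_subset[OF _ sub'] by (auto simp: gens')
  then show ?thesis using U' rational_subdomain_presented[OF pr sub] by (simp add: goodaff_def)
qed

section \<open>Difference quotients and derivatives\<close>

lemma poly_le_gnorm:
  fixes z w :: "'a::complete_nonarch_field"
  assumes "absv (z - w) <= r" shows "absv (poly p z) <= gnorm p w r"
  using gnorm_mono[of 0 r p z] gnorm_center[of z w r p] order_trans[OF absv_nonneg assms] assms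
  by (simp add: gnorm_at_0)

text \<open>All zeros are farther than \<open>r\<close> from the centre, hence equally far from
  every point of the disc.\<close>

lemma absv_poly_no_roots:
  fixes z w :: "'a::complete_nonarch_field"
  assumes "absv (z - w) <= r" "!!x. absv (x - w) <= r ==> poly q x ~= 0"
  shows "absv (poly q z) = gnorm q w r"
proof (rule gnorm_generic)
  fix s assume "poly q s = 0"
  then have s: "\<not> absv (s - w) <= r" using assms(2) by blast
  then have "absv (z - s) = absv (w - s)"
    using assms(1) absv_eq_of_diff_less[of "z - s" "w - s"] by (simp add: absv_commute[of w s])
  then show "absv (z - s) = max (absv (w - s)) r" using s by (simp add: absv_commute[of w s])
qed

lemma rational_quotient:
  fixes p q :: "'a::field poly"
  assumes "poly q w ~= 0"
  shows "EX P1. (ALL z. poly q z ~= 0 --> poly p z / poly q z - poly p w / poly q w = (z - w) * (poly P1 z / (poly q z * poly q w))) &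
     poly P1 w = poly (pderiv p * q - p * pderiv q) w"
proof -
  define P where "P = smult (poly q w) p - smult (poly p w) q"
  have "poly P w = 0" by (simp add: P_def)
  then obtain P1 where P1: "P = [:-w, 1:] * P1" by (metis dvdE poly_eq_0_iff_dvd)
  have "poly p z / poly q z - poly p w / poly q w = (z - w) * (poly P1 z / (poly q z * poly q w))" if "poly q z ~= 0" for z
  proof -
    have "(z - w) * poly P1 z = poly P z" by (simp add: P1 algebra_simps)
    also have "\<dots> = poly q w * poly p z - poly p w * poly q z" by (simp add: P_def)
    finally show ?thesis using that assms by (simp add: field_simps)
  qed
  moreover have "poly P1 w = poly (pderiv P) w" unfolding P1 pderiv_mult by (simp add: pderiv_pCons)
  then have "poly P1 w = poly (pderiv p * q - p * pderiv q) w"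
    by (simp add: P_def pderiv_diff pderiv_smult algebra_simps)
  ultimately show ?thesis by blast
qed

text \<open>The Schwarz lemma. The numerator of the difference quotient is nowhere in the disc
  larger than at a generic boundary point \<open>y\<close>, where
  \<open>absv (y - w) = absv c\<close>, and the denominator, having no zeros, has constant absolute
  value.\<close>

lemma ball_quotient:
  fixes w c :: "'a::complete_nonarch_field"
  assumes c: "c ~= 0" and h: "h : RA {z. absv (z - w) <= absv c}"
    and B: "!!z. absv (z - w) <= absv c ==> absv (h z) <= B" and z: "absv (z - w) <= absv c"
  shows "absv (h z - h w) <= B / absv c * absv (z - w)"
proof (rule field_le_epsilon)
  fix e :: real assume e: "e > 0"
  have B0: "0 <= B" using order_trans[OF absv_nonneg B[OF z]] .
  show "absv (h z - h w) <= B / absv c * absv (z - w) + e"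
  proof (cases "B = 0")
    case True
    then have "h z = 0" "h w = 0" using B[OF z] B[of w] by auto
    then show ?thesis using True e by simp
  next
    case False
    \<comment> \<open>An error of at most \<open>B\<close> keeps the rational approximation within
      the bound of \<open>h\<close>; an error of at most \<open>e\<close> is absorbed by the
      slack.\<close>
    define d where "d = min B e"
    have d: "d > 0" using False B0 e by (simp add: d_def)
    obtain p q where "!!z. z : {z. absv (z - w) <= absv c} ==> poly q z ~= 0"
       "!!z. z : {z. absv (z - w) <= absv c} ==> absv (h z - poly p z / poly q z) <= d"
      by (rule RA_approx[OF h d]) blast
    then have q: "!!z. absv (z - w) <= absv c ==> poly q z ~= 0"
      and ap: "!!z. absv (z - w) <= absv c ==> absv (h z - poly p z / poly q z) <= d" by auto
    have uB: "absv (poly p z / poly q z) <= B" if "absv (z - w) <= absv c" for z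
      using absv_diff_le'[of "h z" B "h z - poly p z / poly q z"] B[OF that] ap[OF that] by (simp add: d_def)
    have qw: "poly q w ~= 0" by (rule q) simp
    obtain P1 where P1: "ALL z. poly q z ~= 0 --> poly p z / poly q z - poly p w / poly q w = (z - w) * (poly P1 z / (poly q z * poly q w))"
      using rational_quotient[OF qw] by blast
    define S where "S = {w} \<union> {z. P1 ~= 0 & poly P1 z = 0}"
    have "finite S" unfolding S_def using finite_roots[of P1] by auto
    then obtain y where y: "absv (y - w) = absv c" "ALL s:S. absv (y - s) = max (absv (w - s)) (absv c)"
      using generic_point[of S w c] by blast
    have yP: "absv (poly P1 y) = gnorm P1 w (absv c)" by (rule gnorm_generic') (use y in \<open>auto simp: S_def\<close>)
    have yw: "absv (y - w) <= absv c" using y by simp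
    have qq: "absv (poly q z) = absv (poly q y)"
      using absv_poly_no_roots[OF z q] absv_poly_no_roots[OF yw q] by simp
    have "absv c * (absv (poly P1 y) / (absv (poly q y) * absv (poly q w))) = absv (poly p y / poly q y - poly p w / poly q w)"
      using P1[rule_format, OF q[OF yw]] y by (simp add: absv_mult absv_divide)
    also have "\<dots> <= B" using uB[OF yw] uB[of w] by (simp add: absv_diff_le')
    finally have k: "absv (poly P1 y) / (absv (poly q y) * absv (poly q w)) <= B / absv c"
      using c by (simp add: field_simps)
    have "absv (poly p z / poly q z - poly p w / poly q w) = absv (z - w) * (absv (poly P1 z) / (absv (poly q y) * absv (poly q w)))"
      using P1[rule_format, OF q[OF z]] qq by (simp add: absv_mult absv_divide)
    also have "\<dots> <= absv (z - w) * (absv (poly P1 y) / (absv (poly q y) * absv (poly q w)))"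
      using poly_le_gnorm[OF z, of P1] unfolding yP by (intro mult_left_mono divide_right_mono) auto
    also have "\<dots> <= absv (z - w) * (B / absv c)" by (intro mult_left_mono k) auto
    finally have 1: "absv (poly p z / poly q z - poly p w / poly q w) <= B / absv c * absv (z - w)"
      by (simp add: mult.commute)
    have eq: "h z - h w = (poly p z / poly q z - poly p w / poly q w) + ((h z - poly p z / poly q z) - (h w - poly p w / poly q w))"
      by simp
    have 2: "absv ((h z - poly p z / poly q z) - (h w - poly p w / poly q w)) <= e"
      by (rule absv_diff_le') (use ap[OF z] ap[of w] in \<open>auto simp: d_def\<close>)
    have "absv (h z - h w) <= max (B / absv c * absv (z - w)) e"
      unfolding eq by (rule absv_add_le') (use 1 2 in auto)
    moreover have "0 <= B / absv c * absv (z - w)" using B0 by simp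
    ultimately show ?thesis using e by linarith
  qed
qed

text \<open>The limit behind \<open>nonarch_deriv\<close> in terms of closed discs and non-strict
  bounds, which pass through the ultrametric inequality unchanged.\<close>

definition Dq :: "('a::complete_nonarch_field \<Rightarrow> 'a) \<Rightarrow> 'a \<Rightarrow> 'a \<Rightarrow> bool" where
  "Dq h w l \<longleftrightarrow> (ALL e>0. EX c::'a. c ~= 0 & (ALL z. z ~= w & absv (z - w) <= absv c --> absv ((h z - h w) / (z - w) - l) <= e))"

lemma not_trivial_limit_at: "at (w::'a::complete_nonarch_field) ~= bot"
proof
  assume "at w = bot"
  then have "open {w}" by (simp add: at_eq_bot_iff)
  then obtain e where e: "e > 0" "ALL y. dist y w < e --> y : {w}" unfolding open_dist by blast
  obtain c :: 'a where c: "c ~= 0" "absv c < e" using absv_small[OF e(1)] by blast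
  then show False using e(2)[rule_format, of "w + c"] by (simp add: dist_absv)
qed

lemma nonarch_deriv_eq:
  assumes "Dq h w l" shows "nonarch_deriv h w = l"
proof -
  have "(%z. (h z - h w) / (z - w)) \<midarrow>w\<rightarrow> l"
    unfolding LIM_def
  proof (intro allI impI)
    fix r :: real assume r: "r > 0"
    then obtain c :: 'a where c: "c ~= 0" "ALL z. z ~= w & absv (z - w) <= absv c --> absv ((h z - h w) / (z - w) - l) <= r / 2"
      using assms unfolding Dq_def by (meson half_gt_zero)
    have "dist ((h z - h w) / (z - w)) l < r" if "z ~= w & dist z w < absv c" for z
      using c(2)[rule_format, of z] that r by (simp add: dist_absv)
    then show "EX s>0. ALL x. x ~= w & dist x w < s --> dist ((h x - h w) / (x - w)) l < r" using c(1) by (intro exI[of _ "absv c"]) auto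
  qed
  then show ?thesis unfolding nonarch_deriv_def using not_trivial_limit_at by (intro tendsto_Lim)
qed

lemma Dq_bound:
  fixes w c :: "'a::complete_nonarch_field"
  assumes D: "Dq h w l" and c: "c ~= 0" and M: "!!z. absv (z - w) <= absv c ==> absv (h z - h w) <= M * absv (z - w)"
  shows "absv l <= M"
proof (rule field_le_epsilon)
  fix e :: real assume e: "e > 0"
  obtain d :: 'a where d: "d ~= 0" "ALL z. z ~= w & absv (z - w) <= absv d --> absv ((h z - h w) / (z - w) - l) <= e"
    using D e unfolding Dq_def by blast
  have "min (absv c) (absv d) > 0" using c d by simp
  then obtain x :: 'a where x: "x ~= 0" "absv x < min (absv c) (absv d)" using absv_small by blast
  have 1: "absv ((h (w + x) - h w) / x) <= M" using M[of "w + x"] x by (simp add: absv_divide field_simps)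
  have 2: "absv ((h (w + x) - h w) / x - l) <= e" using d(2)[rule_format, of "w + x"] x by simp
  have "absv l <= max M e" using absv_diff_le[of "(h (w + x) - h w) / x" "(h (w + x) - h w) / x - l"] 1 2 by auto
  moreover have "0 <= M" using order_trans[OF absv_nonneg 1] .
  ultimately show "absv l <= M + e" using e by linarith
qed

lemma Dq_diff:
  assumes "Dq h w l" "Dq k w m" shows "Dq (%z. h z - k z) w (l - m)"
  unfolding Dq_def
proof (intro allI impI)
  fix e :: real assume e: "e > 0"
  obtain c :: 'a where c: "c ~= 0" "ALL z. z ~= w & absv (z - w) <= absv c --> absv ((h z - h w) / (z - w) - l) <= e"
    using assms(1) e unfolding Dq_def by blast
  obtain d :: 'a where d: "d ~= 0" "ALL z. z ~= w & absv (z - w) <= absv d --> absv ((k z - k w) / (z - w) - m) <= e"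
    using assms(2) e unfolding Dq_def by blast
  define x where "x = (if absv c <= absv d then c else d)"
  have x: "x ~= 0" "absv x <= absv c" "absv x <= absv d" using c(1) d(1) by (auto simp: x_def)
  have "absv ((h z - k z - (h w - k w)) / (z - w) - (l - m)) <= e" if z: "z ~= w" "absv (z - w) <= absv x" for z
  proof -
    have "(h z - k z - (h w - k w)) / (z - w) - (l - m) = ((h z - h w) / (z - w) - l) - ((k z - k w) / (z - w) - m)"
      by (simp add: diff_divide_distrib)
    also have "absv \<dots> <= e"
      by (rule absv_diff_le') (use c(2)[rule_format, of z] d(2)[rule_format, of z] z x in auto)
    finally show ?thesis .
  qed
  then show "EX c::'a. c ~= 0 & (ALL z. z ~= w & absv (z - w) <= absv c --> absv ((h z - k z - (h w - k w)) / (z - w) - (l - m)) <= e)"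
    using x(1) by blast
qed

lemma Dq_rational:
  fixes U :: "'a::complete_nonarch_field set"
  assumes U: "rdom U" and q: "!!z. z : U ==> poly q z ~= 0" and w: "w : U"
  shows "Dq (%z. poly p z / poly q z) w (poly (pderiv p * q - p * pderiv q) w / (poly q w * poly q w))"
  unfolding Dq_def
proof (intro allI impI)
  fix e :: real assume e: "e > 0"
  obtain P1 where P1: "ALL z. poly q z ~= 0 --> poly p z / poly q z - poly p w / poly q w = (z - w) * (poly P1 z / (poly q z * poly q w))"
     "poly P1 w = poly (pderiv p * q - p * pderiv q) w"
    using rational_quotient[OF q[OF w]] by blast
  have Q: "poly (smult (poly q w) q) z ~= 0" if "z : U" for z using q[OF that] q[OF w] by simp
  have "(%z. poly P1 z / poly (smult (poly q w) q) z) : RA U" by (rule RA_rational[OF Q])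
  then obtain c :: 'a where c: "c ~= 0" "ALL z:U. ALL v. absv (v - z) <= absv c --> v : U &
      absv (poly P1 v / poly (smult (poly q w) q) v - poly P1 z / poly (smult (poly q w) q) z) <= e"
    using RA_uniformly_continuous[OF U _ e] by blast
  have "absv ((poly p z / poly q z - poly p w / poly q w) / (z - w) - poly (pderiv p * q - p * pderiv q) w / (poly q w * poly q w)) <= e"
    if z: "z ~= w" "absv (z - w) <= absv c" for z
  proof -
    have zU: "z : U" "absv (poly P1 z / poly (smult (poly q w) q) z - poly P1 w / poly (smult (poly q w) q) w) <= e"
      using c(2) w z(2) by blast+
    have "(poly p z / poly q z - poly p w / poly q w) / (z - w) = poly P1 z / (poly q z * poly q w)"
      using P1(1)[rule_format, OF q[OF zU(1)]] z(1) by simp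
    then show ?thesis using zU(2) P1(2) by (simp add: mult.commute)
  qed
  then show "EX c::'a. c ~= 0 & (ALL z. z ~= w & absv (z - w) <= absv c -->
      absv ((poly p z / poly q z - poly p w / poly q w) / (z - w) - poly (pderiv p * q - p * pderiv q) w / (poly q w * poly q w)) <= e)"
    using c(1) by blast
qed

text \<open>By the Schwarz lemma at the uniform radius the difference quotients of
  \<open>h - u n\<close> are at most \<open>ep n / absv c\<close>. Hence the derivatives of the
  approximations converge uniformly, and their limit is the derivative of \<open>h\<close>.\<close>

lemma RA_deriv_exists:
  fixes U :: "'a::complete_nonarch_field set"
  assumes U: "rdom U" and h: "h : RA U"
  shows "EX k:RA U. ALL w:U. Dq h w (k w)"
proof -
  obtain c :: 'a where c: "c ~= 0" "!!z w. z : U ==> absv (w - z) <= absv c ==> w : U" by (rule rdom_radius[OF U]) blast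
  define ep where "ep n = (1/2 :: real) ^ n" for n
  have ep0: "ep n > 0" for n by (simp add: ep_def)
  have \<epsilon>dec: "ep m <= ep j" if "j <= m" for j m unfolding ep_def using that by (intro power_decreasing) auto
  have \<epsilon>lim: "(%n. ep n / absv c) \<longlonglongrightarrow> 0" unfolding ep_def by (intro tendsto_divide_zero LIMSEQ_power_zero) simp
  have "ALL n. EX pq. ALL z:U. poly (snd pq) z ~= 0 & absv (h z - poly (fst pq) z / poly (snd pq) z) <= ep n"
  proof
    fix n
    obtain p q where "ALL z:U. poly q z ~= 0 & absv (h z - poly p z / poly q z) <= ep n"
      using h ep0[of n] unfolding RA_def by blast
    then show "EX pq. ALL z:U. poly (snd pq) z ~= 0 & absv (h z - poly (fst pq) z / poly (snd pq) z) <= ep n"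
      by (intro exI[of _ "(p, q)"]) simp
  qed
  then obtain pq where "ALL n. ALL z:U. poly (snd (pq n)) z ~= 0 & absv (h z - poly (fst (pq n)) z / poly (snd (pq n)) z) <= ep n"
    by (rule choice[THEN exE])
  then have q: "!!n z. z : U ==> poly (snd (pq n)) z ~= 0"
    and ap: "!!n z. z : U ==> absv (h z - poly (fst (pq n)) z / poly (snd (pq n)) z) <= ep n" by auto
  define u where "u n z = poly (fst (pq n)) z / poly (snd (pq n)) z" for n z
  define Q where "Q n = pderiv (fst (pq n)) * snd (pq n) - fst (pq n) * pderiv (snd (pq n))" for n
  define d where "d n z = poly (Q n) z / poly (snd (pq n) * snd (pq n)) z" for n z
  have uRA: "u n : RA U" for n unfolding u_def[abs_def] by (rule RA_rational[OF q])
  have dRA: "d n : RA U" for n unfolding d_def[abs_def] by (rule RA_rational) (use q in simp)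
  have Du: "Dq (u n) w (d n w)" if "w : U" for n w
    using Dq_rational[OF U q[of _ n] that, of "fst (pq n)"] unfolding u_def[abs_def] d_def Q_def by simp
  have ball: "absv (g z - g w) <= B / absv c * absv (z - w)"
    if "w : U" "g : RA U" "!!z. z : U ==> absv (g z) <= B" "absv (z - w) <= absv c" for g w z B
  proof (rule ball_quotient[OF c(1) _ _ that(4)])
    have s: "{z. absv (z - w) <= absv c} \<subseteq> U" using c(2)[OF that(1)] by blast
    then show "g : RA {z. absv (z - w) <= absv c}" using RA_subset[OF that(2)] by blast
    show "absv (g z) <= B" if "absv (z - w) <= absv c" for z using s that by (intro \<open>\<And>z. z \<in> U \<Longrightarrow> absv (g z) \<le> B\<close>) blast
  qed
  have dd: "absv (d m w - d n w) <= ep n / absv c" if w: "w : U" and mn: "n <= m" for m n w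
  proof (rule Dq_bound[OF Dq_diff[OF Du[OF w] Du[OF w]] c(1)])
    fix z assume z: "absv (z - w) <= absv c"
    show "absv (u m z - u n z - (u m w - u n w)) <= ep n / absv c * absv (z - w)"
    proof (rule ball[OF w RA_diff[OF U uRA uRA] _ z])
      fix x assume x: "x : U"
      show "absv (u m x - u n x) <= ep n"
        using absv_triangle[of "u m x" "u n x" "h x"] ap[OF x, of m] ap[OF x, of n] \<epsilon>dec[OF mn]
        by (simp add: u_def absv_commute[of _ "h x"])
    qed
  qed
  have "EX k. ALL w:U. ALL n. absv (k w - d n w) <= ep n / absv c"
    by (rule uniform_limit_exists[OF _ \<epsilon>lim]) (rule dd)
  then obtain k where k: "ALL w:U. ALL n. absv (k w - d n w) <= ep n / absv c" by blast
  have small: "EX n. ep n / absv c < r" if "r > 0" for r :: real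
    using order_tendstoD(2)[OF \<epsilon>lim that] by (auto simp: eventually_sequentially)
  have "k : RA U"
  proof (rule RA_limit)
    fix e :: real assume "e > 0"
    then obtain n where "ep n / absv c < e" using small by blast
    then show "EX k':RA U. ALL z:U. absv (k z - k' z) <= e"
      using k by (intro bexI[OF _ dRA[of n]]) (meson less_imp_le order_trans)
  qed
  moreover have "Dq h w (k w)" if w: "w : U" for w
    unfolding Dq_def
  proof (intro allI impI)
    fix e :: real assume e: "e > 0"
    then obtain n where n: "ep n / absv c < e" using small by blast
    obtain b :: 'a where b: "b ~= 0" "ALL z. z ~= w & absv (z - w) <= absv b --> absv ((u n z - u n w) / (z - w) - d n w) <= e"
      using Du[OF w, of n] e unfolding Dq_def by blast
    define x where "x = (if absv c <= absv b then c else b)"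
    have x: "x ~= 0" "absv x <= absv c" "absv x <= absv b" using c(1) b(1) by (auto simp: x_def)
    have "absv ((h z - h w) / (z - w) - k w) <= e" if z: "z ~= w" "absv (z - w) <= absv x" for z
    proof -
      have "absv ((h z - u n z) - (h w - u n w)) <= ep n / absv c * absv (z - w)"
        by (rule ball[OF w RA_diff[OF U h uRA]]) (use ap z x in \<open>auto simp: u_def\<close>)
      also have "\<dots> <= e * absv (z - w)" using n by (intro mult_right_mono) auto
      finally have 1: "absv (((h z - u n z) - (h w - u n w)) / (z - w)) <= e"
        using z(1) by (simp add: absv_divide divide_le_eq)
      have 2: "absv ((u n z - u n w) / (z - w) - d n w) <= e" using b(2)[rule_format, of z] z x by simp
      have 3: "absv (k w - d n w) <= e" using k[rule_format, OF w, of n] n by linarith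
      have "(h z - h w) / (z - w) - k w = (((h z - u n z) - (h w - u n w)) / (z - w) + ((u n z - u n w) / (z - w) - d n w)) - (k w - d n w)"
        by (simp add: diff_divide_distrib)
      then show ?thesis using absv_diff_le'[OF absv_add_le'[OF 1 2] 3] by metis
    qed
    then show "EX c::'a. c ~= 0 & (ALL z. z ~= w & absv (z - w) <= absv c --> absv ((h z - h w) / (z - w) - k w) <= e)"
      using x(1) by blast
  qed
  ultimately show ?thesis by blast
qed

lemma RA_deriv:
  assumes "rdom U" "h : RA U"
  shows "nonarch_deriv h : RA U" "w : U ==> Dq h w (nonarch_deriv h w)"
proof -
  obtain k where k: "k : RA U" "ALL w:U. Dq h w (k w)" using RA_deriv_exists[OF assms] by blast
  then have eq: "nonarch_deriv h w = k w" if "w : U" for w using nonarch_deriv_eq that by blast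
  show "nonarch_deriv h : RA U" by (rule RA_cong[OF k(1) eq])
  show "w : U ==> Dq h w (nonarch_deriv h w)" using k eq by simp
qed

text \<open>Let the approximation error be \<open>e * absv c\<close>. Near \<open>w\<close> its
  quotient is at most \<open>e\<close> by the Schwarz lemma, and away from \<open>w\<close> because
  \<open>absv (z - w) > absv c\<close>.\<close>

lemma RA_quotient:
  fixes U :: "'a::complete_nonarch_field set"
  assumes U: "rdom U" and h: "h : RA U" and w: "w : U"
  shows "(%z. if z = w then nonarch_deriv h w else (h z - h w) / (z - w)) : RA U"
proof (rule RA_limit)
  fix e :: real assume e: "e > 0"
  obtain c :: 'a where c: "c ~= 0" "!!z w. z : U ==> absv (w - z) <= absv c ==> w : U" by (rule rdom_radius[OF U]) blast
  have ec: "e * absv c > 0" using e c by simp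
  obtain p q where q: "!!z. z : U ==> poly q z ~= 0" and ap: "!!z. z : U ==> absv (h z - poly p z / poly q z) <= e * absv c"
    by (rule RA_approx[OF h ec]) blast
  obtain P1 where P1: "ALL z. poly q z ~= 0 --> poly p z / poly q z - poly p w / poly q w = (z - w) * (poly P1 z / (poly q z * poly q w))"
     "poly P1 w = poly (pderiv p * q - p * pderiv q) w"
    using rational_quotient[OF q[OF w]] by blast
  let ?u = "%z. poly p z / poly q z"
  define v where "v z = poly P1 z / poly (smult (poly q w) q) z" for z
  have vRA: "v : RA U" unfolding v_def[abs_def] by (rule RA_rational) (use q w in simp)
  have uRA: "?u : RA U" by (rule RA_rational[OF q])
  have s: "{z. absv (z - w) <= absv c} \<subseteq> U" using c(2)[OF w] by blast
  have quot: "absv ((h z - ?u z) - (h w - ?u w)) <= e * absv (z - w)" if z: "z : U" for z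
  proof (cases "absv (z - w) <= absv c")
    case True
    have "absv ((h z - ?u z) - (h w - ?u w)) <= e * absv c / absv c * absv (z - w)"
      by (rule ball_quotient[OF c(1) RA_subset[OF RA_diff[OF U h uRA] s] _ True]) (use ap s in auto)
    then show ?thesis using c(1) by simp
  next
    case False
    have "absv ((h z - ?u z) - (h w - ?u w)) <= e * absv c" by (rule absv_diff_le'[OF ap[OF z] ap[OF w]])
    also have "\<dots> <= e * absv (z - w)" using False e by (intro mult_left_mono) auto
    finally show ?thesis .
  qed
  have "absv ((if z = w then nonarch_deriv h w else (h z - h w) / (z - w)) - v z) <= e" if z: "z : U" for z
  proof (cases "z = w")
    case True
    have "Dq (%z. h z - ?u z) w (nonarch_deriv h w - poly (pderiv p * q - p * pderiv q) w / (poly q w * poly q w))"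
      by (rule Dq_diff[OF RA_deriv(2)[OF U h w] Dq_rational[OF U q w]])
    then have "absv (nonarch_deriv h w - poly (pderiv p * q - p * pderiv q) w / (poly q w * poly q w)) <= e"
      by (rule Dq_bound[OF _ c(1)]) (use quot s in blast)
    then show ?thesis using True P1(2) by (simp add: v_def)
  next
    case False
    have "(?u z - ?u w) / (z - w) = v z" using P1(1)[rule_format, OF q[OF z]] False by (simp add: v_def mult.commute)
    then have "(h z - h w) / (z - w) - v z = ((h z - h w) - (?u z - ?u w)) / (z - w)" by (metis diff_divide_distrib)
    also have "(h z - h w) - (?u z - ?u w) = (h z - ?u z) - (h w - ?u w)" by simp
    finally have "(h z - h w) / (z - w) - v z = ((h z - ?u z) - (h w - ?u w)) / (z - w)" .
    then show ?thesis using quot[OF z] False by (simp add: absv_divide divide_le_eq)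
  qed
  then show "EX k:RA U. ALL z:U. absv ((if z = w then nonarch_deriv h w else (h z - h w) / (z - w)) - k z) <= e"
    using vRA by blast
qed

text \<open>Since \<open>w\<close> is also a centre of the open disc, closed discs around
  \<open>w\<close> with radii \<open>absv c\<close> tending to \<open>r\<close> stay inside it. So
  \<open>r\<close> may lie outside the value group.\<close>

lemma RA_deriv_bound:
  fixes U :: "'a::complete_nonarch_field set"
  assumes U: "rdom U" and h: "h : RA U" and r: "0 < r" and sub: "!!z. absv (z - x) < r ==> z : U"
    and B: "!!z. absv (z - x) < r ==> absv (h z) <= B" and w: "absv (w - x) < r"
  shows "absv (nonarch_deriv h w) <= B / r"
proof (rule ccontr)
  assume "\<not> ?thesis"
  then have gt: "B / r < absv (nonarch_deriv h w)" by simp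
  have B0: "0 <= B" using order_trans[OF absv_nonneg B[OF w]] .
  then have n0: "0 < absv (nonarch_deriv h w)" using gt r by (meson divide_nonneg_pos le_less_trans)
  then have "B / absv (nonarch_deriv h w) < r" using gt r by (simp add: field_simps)
  moreover have "0 <= B / absv (nonarch_deriv h w)" using B0 by simp
  ultimately obtain c :: 'a where c: "B / absv (nonarch_deriv h w) < absv c" "absv c < r" using absv_dense by blast
  have c0: "c ~= 0" using c(1) \<open>0 \<le> B / absv (nonarch_deriv h w)\<close> by auto
  have in_disc: "absv (z - x) < r" if "absv (z - w) <= absv c" for z
    using absv_triangle[of z x w] that w c(2) by linarith
  have s: "{z. absv (z - w) <= absv c} \<subseteq> U" using in_disc sub by blast
  have "w : U" using sub w by blast
  from RA_deriv(2)[OF U h this] have "absv (nonarch_deriv h w) <= B / absv c"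
  proof (rule Dq_bound[OF _ c0])
    show "absv (h z - h w) <= B / absv c * absv (z - w)" if "absv (z - w) <= absv c" for z
      by (rule ball_quotient[OF c0 RA_subset[OF h s] _ that]) (use B in_disc in blast)
  qed
  then show False using c(1) c0 n0 by (simp add: field_simps)
qed

section \<open>Rigid functions on annuli and on the punctured disc\<close>

text \<open>Approximability is recorded on the members of a covering only; no global expansion on
  the annulus is formed.\<close>

definition rigidA :: "'a::complete_nonarch_field \<Rightarrow> 'a \<Rightarrow> ('a \<Rightarrow> 'a) \<Rightarrow> bool" where
  "rigidA a b h \<longleftrightarrow> (EX Vs. finite Vs & \<Union>Vs = {z. absv a <= absv z & absv z <= absv b} & (ALL U:Vs. rdom U & h : RA U))"

lemma rigidA_RA:
  assumes "a ~= 0" "h : RA {z. absv a <= absv z & absv z <= absv b}" shows "rigidA a b h"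
  unfolding rigidA_def using assms rdom_annulus[OF assms(1)]
  by (intro exI[of _ "{{z. absv a <= absv z & absv z <= absv b}}"]) auto

lemma rigidA_refine:
  assumes h: "rigidA a b h" and k: "rigidA a b k"
    and step: "!!U. rdom U ==> h : RA U ==> k : RA U ==> l : RA U"
  shows "rigidA a b l"
proof -
  obtain Vs where Vs: "finite Vs" "\<Union>Vs = {z. absv a <= absv z & absv z <= absv b}" "ALL U:Vs. rdom U & h : RA U"
    using h unfolding rigidA_def by blast
  obtain Ws where Ws: "finite Ws" "\<Union>Ws = {z. absv a <= absv z & absv z <= absv b}" "ALL U:Ws. rdom U & k : RA U"
    using k unfolding rigidA_def by blast
  let ?X = "(%(U, V). U \<inter> V) ` (Vs \<times> Ws)"
  have "finite ?X" using Vs Ws by auto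
  moreover have "\<Union>?X = \<Union>Vs \<inter> \<Union>Ws" by auto
  then have "\<Union>?X = {z. absv a <= absv z & absv z <= absv b}" using Vs(2) Ws(2) by simp
  moreover have "rdom U & l : RA U" if UX: "U : ?X" for U
  proof -
    obtain x where x: "U = (%(U, V). U \<inter> V) x" "x : Vs \<times> Ws" using UX by (rule imageE)
    define V W where "V = fst x" and "W = snd x"
    have VW: "V : Vs" "W : Ws" "U = V \<inter> W" using x by (auto simp: V_def W_def case_prod_unfold)
    then have "rdom U" using rdom_Int Vs(3) Ws(3) by blast
    moreover have "h : RA U" using RA_subset[of h V U] Vs(3) VW by blast
    moreover have "k : RA U" using RA_subset[of k W U] Ws(3) VW by blast
    ultimately show ?thesis using step by blast
  qed
  ultimately show ?thesis unfolding rigidA_def by (intro exI[of _ ?X]) simp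
qed

lemma rigidA_mult: "rigidA a b h ==> rigidA a b k ==> rigidA a b (%z. h z * k z)"
  by (rule rigidA_refine[of a b h k]) (auto intro: RA_mult)

lemma rigidA_add: "rigidA a b h ==> rigidA a b k ==> rigidA a b (%z. h z + k z)"
  by (rule rigidA_refine[of a b h k]) (auto intro: RA_add)

lemma rigidA_const: "a ~= 0 ==> rigidA a b (%_. c)"
  by (rule rigidA_RA[OF _ RA_const])

lemma rigidA_id: "a ~= 0 ==> rigidA a b (%z. z)"
  by (rule rigidA_RA[OF _ RA_id])

lemma rigidA_power: "a ~= 0 ==> rigidA a b h ==> rigidA a b (%z. h z ^ n)"
  by (induction n) (simp_all add: rigidA_const rigidA_mult)

lemma rigidA_inverse:
  fixes a :: "'a::complete_nonarch_field"
  assumes "a ~= 0" shows "rigidA a b (%z. inverse z)"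
proof (rule rigidA_RA[OF assms])
  show "inverse : RA {z :: 'a. absv a <= absv z & absv z <= absv b}"
    by (rule RA_inverse[OF rdom_annulus[OF assms] RA_id, of "absv a"]) (use assms in auto)
qed

lemma rigidA_quotient:
  fixes w :: "'a::complete_nonarch_field"
  assumes "rigidA a b h"
  shows "rigidA a b (%z. if z = w then nonarch_deriv h w else (h z - h w) / (z - w))"
proof (rule rigidA_refine[OF assms assms])
  fix U :: "'a set" assume U: "rdom U" and h: "h : RA U"
  show "(%z. if z = w then nonarch_deriv h w else (h z - h w) / (z - w)) : RA U"
  proof (cases "w : U")
    case True
    then show ?thesis by (rule RA_quotient[OF U h])
  next
    case False
    obtain c :: 'a where c: "c ~= 0" "!!z w. z : U ==> absv (w - z) <= absv c ==> w : U" by (rule rdom_radius[OF U]) blast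
    have "absv c <= absv (z - w)" if z: "z : U" for z
      using c(2)[OF z, of w] False absv_commute[of z w] by (metis linear)
    then have "(%z. inverse (z - w)) : RA U"
      using c(1) by (intro RA_inverse[OF U _, of _ "absv c"] RA_diff[OF U RA_id RA_const]) auto
    then have "(%z. (h z - h w) * inverse (z - w)) : RA U" by (intro RA_mult[OF U] RA_diff[OF U h RA_const])
    then show ?thesis by (rule RA_cong) (use False in \<open>auto simp: divide_inverse\<close>)
  qed
qed

lemma rigidA_bounded:
  fixes a b :: "'a::complete_nonarch_field"
  assumes "rigidA a b h"
  shows "EX K>0. ALL z. absv a <= absv z & absv z <= absv b --> absv (h z) <= K"
proof -
  obtain Vs where Vs: "finite Vs" "\<Union>Vs = {z. absv a <= absv z & absv z <= absv b}" "ALL U:Vs. rdom U & h : RA U"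
    using assms unfolding rigidA_def by blast
  have "ALL U. EX K. U : Vs --> (ALL z:U. absv (h z) <= K)" using RA_bounded Vs(3) by blast
  then obtain K where K: "ALL U. U : Vs --> (ALL z:U. absv (h z) <= K U)" by (rule choice[THEN exE])
  define M where "M = Max (insert 1 (K ` Vs))"
  have M: "K U <= M" if "U : Vs" for U unfolding M_def using Vs(1) that by (intro Max_ge) auto
  have "absv (h z) <= M" if z: "absv a <= absv z & absv z <= absv b" for z
  proof -
    have "z : \<Union>Vs" unfolding Vs(2) using z by simp
    then obtain U where U: "U : Vs" "z : U" by (rule UnionE)
    then have "absv (h z) <= K U" using K by blast
    with M[OF U(1)] show ?thesis by simp
  qed
  moreover have "M \<ge> 1" unfolding M_def using Vs(1) by (intro Max_ge) auto
  ultimately show ?thesis by (intro exI[of _ M]) auto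
qed

text \<open>Approximations within \<open>C + e\<close> on the members of the covering are the data
  of \<open>annulus_cover\<close>; the summand \<open>e\<close> makes the constant positive. The set
  \<open>S0\<close> admits bounds known only at generic boundary points.\<close>

lemma rigidA_maximum_principle:
  fixes a b :: "'a::complete_nonarch_field" and S0 :: "'a set"
  assumes a: "a ~= 0" and ab: "absv a <= absv b" and h: "rigidA a b h" and C: "0 <= C" and S0: "finite S0"
    and bdry: "!!z. absv z = absv a \<or> absv z = absv b ==> ALL s:S0. absv z <= absv (z - s) ==> absv (h z) <= C"
    and z: "absv a <= absv z" "absv z <= absv b"
  shows "absv (h z) <= C"
proof (rule field_le_epsilon)
  fix e :: real assume e: "e > 0"
  define C' where "C' = C + e"
  have C': "C' > 0" using C e by (simp add: C'_def)
  obtain Vs where Vs: "finite Vs" "\<Union>Vs = {z. absv a <= absv z & absv z <= absv b}" "ALL U:Vs. rdom U & h : RA U"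
    using h unfolding rigidA_def by blast
  obtain us where us: "set us = Vs" using finite_list[OF Vs(1)] by blast
  have usU: "us ! i : Vs" if "i < length us" for i using that us by auto
  have "ALL i. EX L. finite L & (i < length us --> us ! i = {z. ALL PQ:L. absv (poly (fst PQ) z) <= absv (poly (snd PQ) z)})"
  proof
    fix i
    show "EX L. finite L & (i < length us --> us ! i = {z. ALL PQ:L. absv (poly (fst PQ) z) <= absv (poly (snd PQ) z)})"
    proof (cases "i < length us")
      case True
      then have "rdom (us ! i)" using Vs(3) usU by blast
      then obtain L where "finite L" "us ! i = {z. ALL PQ:L. absv (poly (fst PQ) z) <= absv (poly (snd PQ) z)}"
        by (rule rdom_semialgebraic) blast
      then show ?thesis by blast
    qed auto
  qed
  then obtain L where L: "ALL i. finite (L i) & (i < length us --> us ! i = {z. ALL PQ:L i. absv (poly (fst PQ) z) <= absv (poly (snd PQ) z)})"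
    by (rule choice[THEN exE])
  have "ALL i. EX pq. i < length us --> (ALL z:us ! i. poly (snd pq) z ~= 0 & absv (h z - poly (fst pq) z / poly (snd pq) z) <= C')"
  proof
    fix i
    show "EX pq. i < length us --> (ALL z:us ! i. poly (snd pq) z ~= 0 & absv (h z - poly (fst pq) z / poly (snd pq) z) <= C')"
    proof (cases "i < length us")
      case True
      then have "h : RA (us ! i)" using Vs(3) usU by blast
      then obtain p q where "ALL z:us ! i. poly q z ~= 0 & absv (h z - poly p z / poly q z) <= C'"
        using C' unfolding RA_def by blast
      then show ?thesis by (intro exI[of _ "(p, q)"]) simp
    qed auto
  qed
  then obtain pq where pq: "ALL i. i < length us --> (ALL z:us ! i. poly (snd (pq i)) z ~= 0 & absv (h z - poly (fst (pq i)) z / poly (snd (pq i)) z) <= C')"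
    by (rule choice[THEN exE])
  interpret annulus_cover a b "length us" L "%i. fst (pq i)" "%i. snd (pq i)" h C' S0
  proof
    show "a ~= 0" by (rule a)
    show "absv a <= absv b" by (rule ab)
    show "C' > 0" by (rule C')
    show "finite S0" by (rule S0)
    show "finite (L i)" for i using L by blast
    show "EX i<length us. ALL PQ:L i. absv (poly (fst PQ) z) <= absv (poly (snd PQ) z)" if "absv a <= absv z" "absv z <= absv b" for z
    proof -
      have "z : \<Union>Vs" unfolding Vs(2) using that by simp
      then obtain i where i: "i < length us" "z : us ! i" using us by (auto simp: in_set_conv_nth)
      then show ?thesis using L by blast
    qed
    show "poly (snd (pq i)) z ~= 0 & absv (h z - poly (fst (pq i)) z / poly (snd (pq i)) z) <= C'"
      if "i < length us" "ALL PQ:L i. absv (poly (fst PQ) z) <= absv (poly (snd PQ) z)" for i z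
      using L pq that by blast
    show "absv (h z) <= C'" if "absv z = absv a \<or> absv z = absv b" "ALL s:S0. absv z <= absv (z - s)" for z
      using bdry[OF that] e by (simp add: C'_def)
  qed
  show "absv (h z) <= C + e" using maximum_principle[OF z] by (simp add: C'_def)
qed

text \<open>The crude bound \<open>K\<close> near 0 is improved by applying the annulus principle to
  \<open>z * v z ^ N\<close>: the factor \<open>z\<close> makes a small inner circle harmless, and
  its effect disappears as \<open>N\<close> grows.\<close>

lemma pd_maximum_principle:
  fixes c :: "'a::complete_nonarch_field" and S0 :: "'a set"
  assumes c: "c ~= 0" and v: "!!a. a ~= 0 ==> absv a <= absv c ==> rigidA a c v"
    and K: "!!z. z ~= 0 ==> absv z <= absv c ==> absv (v z) <= K" and C: "0 <= C" and S0: "finite S0"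
    and bdry: "!!z. absv z = absv c ==> ALL s:S0. absv z <= absv (z - s) ==> absv (v z) <= C"
    and z: "z ~= 0" "absv z <= absv c"
  shows "absv (v z) <= C"
proof (rule ccontr)
  assume "\<not> absv (v z) <= C"
  then obtain D where D: "C < D" "D < absv (v z)" using dense[of C "absv (v z)"] by auto
  have D0: "D > 0" using D C by simp
  have K0: "0 <= K" using order_trans[OF absv_nonneg K[OF z]] .
  have le: "absv z * absv (v z) ^ N <= absv c * D ^ N" for N
  proof -
    have "min (absv z) (absv c * D ^ N / (K ^ N + 1)) > 0" using z c D0 K0 by (simp add: add_nonneg_pos)
    \<comment> \<open>The inner radius is so small that even the crude bound \<open>K ^ N\<close>
      stays below the target there.\<close>
    then obtain a :: 'a where a: "a ~= 0" "absv a < min (absv z) (absv c * D ^ N / (K ^ N + 1))" using absv_small by blast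
    have ac: "absv a <= absv c" using a z by simp
    have aK: "absv a * K ^ N <= absv c * D ^ N"
    proof -
      have "absv a * (K ^ N + 1) <= absv c * D ^ N" using a(2) K0 by (simp add: less_divide_eq add_nonneg_pos less_imp_le)
      moreover have "absv a * K ^ N <= absv a * (K ^ N + 1)" by (intro mult_left_mono) auto
      ultimately show ?thesis by linarith
    qed
    have "absv (z * v z ^ N) <= absv c * D ^ N"
    proof (rule rigidA_maximum_principle[where h = "%z. z * v z ^ N" and z = z, OF a(1) ac _ _ S0])
      show "rigidA a c (%z. z * v z ^ N)"
        by (intro rigidA_mult rigidA_id rigidA_power v a(1) ac)
      show "0 <= absv c * D ^ N" using D0 by simp
      fix y :: 'a assume y: "absv y = absv a \<or> absv y = absv c" "ALL s:S0. absv y <= absv (y - s)"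
      have y0: "y ~= 0" "absv y <= absv c" using y(1) a(1) c ac by auto
      show "absv (y * v y ^ N) <= absv c * D ^ N"
      proof (cases "absv y = absv c")
        case True
        then have "absv (v y) <= D" using bdry[OF True] y(2) D by simp
        then have "absv (v y) ^ N <= D ^ N" by (intro power_mono) auto
        then show ?thesis using True by (simp add: absv_mult absv_power mult_left_mono)
      next
        case False
        then have "absv y = absv a" using y by simp
        moreover have "absv (v y) ^ N <= K ^ N" using K[OF y0] by (intro power_mono) auto
        ultimately have "absv (y * v y ^ N) <= absv a * K ^ N" by (simp add: absv_mult absv_power mult_left_mono)
        then show ?thesis using aK by linarith
      qed
    qed (use a z in auto)
    then show ?thesis by (simp add: absv_mult absv_power)
  qed
  have "absv (v z) / D > 1" using D D0 by simp
  then obtain N where N: "absv c / absv z < (absv (v z) / D) ^ N" using real_arch_pow by blast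
  then have "absv c * D ^ N < absv z * absv (v z) ^ N"
    using z(1) D0 by (simp add: power_divide field_simps)
  then show False using le[of N] by simp
qed

definition pd :: "'a::complete_nonarch_field \<Rightarrow> real \<Rightarrow> ('a \<Rightarrow> 'a) \<Rightarrow> bool" where
  "pd c B h \<longleftrightarrow> (ALL a. a ~= 0 & absv a <= absv c --> rigidA a c h) & (ALL z. z ~= 0 & absv z <= absv c --> absv (h z) <= B)"

text \<open>The Schwarz lemma on the punctured disc: on the outer circle
  \<open>absv (z - w) = absv c\<close>, so the difference quotient is at most
  \<open>B / absv c\<close> there, and the maximum principle carries this inward.\<close>

lemma pd_lipschitz:
  fixes c :: "'a::complete_nonarch_field"
  assumes c: "c ~= 0" and h: "pd c B h" and w: "w ~= 0" "absv w < absv c" and z: "z ~= 0" "absv z <= absv c"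
  shows "absv (h z - h w) <= B / absv c * absv (z - w)"
proof (cases "z = w")
  case False
  have rg: "!!a. a ~= 0 ==> absv a <= absv c ==> rigidA a c h" and B: "!!z. z ~= 0 ==> absv z <= absv c ==> absv (h z) <= B"
    using h by (auto simp: pd_def)
  have B0: "0 <= B" using order_trans[OF absv_nonneg B[OF z]] .
  define v where "v z = (if z = w then nonarch_deriv h w else (h z - h w) / (z - w))" for z
  have v: "rigidA a c v" if "a ~= 0" "absv a <= absv c" for a
    using rigidA_quotient[OF rg[OF that], of w] by (simp add: v_def[abs_def])
  have wc: "absv w <= absv c" using w by simp
  obtain K where K: "K > 0" "ALL z. absv w <= absv z & absv z <= absv c --> absv (v z) <= K"
    using rigidA_bounded[OF v[OF w(1) wc]] by blast
  have vq: "absv (v y) <= B / absv (y - w)" if "y ~= w" "y ~= 0" "absv y <= absv c" for y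
    using B[OF that(2,3)] B[OF w(1) wc] that(1) by (simp add: v_def absv_divide divide_right_mono absv_diff_le')
  \<comment> \<open>The crude bound required near 0: inside the circle of \<open>w\<close> one has
    \<open>absv (y - w) = absv w\<close>, and from that circle outward \<open>v\<close> is rigid on
    an annulus, hence bounded.\<close>
  have "absv (v z) <= B / absv c"
  proof (rule pd_maximum_principle[OF c v, of "max K (B / absv w)" _ "{}"])
    fix y :: 'a assume y: "y ~= 0" "absv y <= absv c"
    show "absv (v y) <= max K (B / absv w)"
    proof (cases "absv w <= absv y")
      case True
      then show ?thesis using K(2) y by (simp add: le_max_iff_disj)
    next
      case False
      then have "absv (y - w) = absv w" using absv_eq_of_diff_less[of "y - w" "- w"] by simp
      moreover have "y ~= w" using False by auto
      ultimately show ?thesis using vq[OF _ y] by (simp add: le_max_iff_disj)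
    qed
  next
    fix y :: 'a assume y: "absv y = absv c"
    have "absv (y - w) = absv c" using absv_eq_of_diff_less[of "y - w" y] w(2) y by simp
    moreover have "y ~= w" "y ~= 0" using y w c by auto
    ultimately show "absv (v y) <= B / absv c" using vq[of y] y by simp
  qed (use B0 z in auto)
  then show ?thesis using False c by (simp add: v_def absv_divide field_simps)
qed simp

text \<open>Removable singularity. The Lipschitz estimate makes the values along a sequence tending
  to 0 converge to \<open>c0\<close>, and bounds \<open>h z - c0\<close> by a multiple of
  \<open>absv z\<close>; so the quotient by \<open>z\<close> satisfies the same hypotheses.\<close>

lemma pd_step:
  fixes c :: "'a::complete_nonarch_field"
  assumes c: "c ~= 0" and h: "pd c B h"
  shows "EX c0 h1. absv c0 <= B & pd c (B / absv c) h1 & (ALL z. z ~= 0 & absv z <= absv c --> h z = c0 + z * h1 z)"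
proof -
  have rg: "!!a. a ~= 0 ==> absv a <= absv c ==> rigidA a c h" and B: "!!z. z ~= 0 ==> absv z <= absv c ==> absv (h z) <= B"
    using h by (auto simp: pd_def)
  have B0: "0 <= B" using order_trans[OF absv_nonneg B[OF c]] by simp
  obtain t :: 'a where t: "t ~= 0" "absv t < min 1 (absv c)" using absv_small[of "min 1 (absv c)"] c by auto
  define x where "x n = t ^ Suc n" for n
  have x0: "x n ~= 0" for n using t by (simp add: x_def)
  have xdec: "absv (x m) <= absv (x n)" if "n <= m" for m n
    unfolding x_def absv_power using t that by (intro power_decreasing) auto
  have "absv (x n) <= absv t" for n using xdec[of 0 n] by (simp add: x_def)
  then have xc: "absv (x n) < absv c" for n using t by (meson le_less_trans less_le_trans min.cobounded2)
  have xlim: "EX N. ALL n>=N. absv (x n) < e" if e: "e > 0" for e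
  proof -
    have "(%n. absv t ^ n) \<longlonglongrightarrow> 0" using t by (intro LIMSEQ_power_zero) auto
    then obtain N where "ALL n>=N. dist (absv t ^ n) 0 < e" using e unfolding lim_sequentially by blast
    then have "ALL n>=N. absv (x n) < e" by (auto simp: x_def absv_power simp del: power_Suc)
    then show ?thesis by blast
  qed
  define M where "M = B / absv c + 1"
  have M: "M > 0" "B / absv c <= M" using B0 by (auto simp: M_def add_nonneg_pos)
  have lip: "absv (h z - h (x n)) <= B / absv c * absv (z - x n)" if "z ~= 0" "absv z <= absv c" for z n
    by (rule pd_lipschitz[OF c h x0 xc that])
  obtain c0 where c0: "(%n. h (x n)) \<longlonglongrightarrow> c0"
  proof (rule complete_limit[of "%n. h (x n)"])
    fix e :: real assume e: "e > 0"
    have "e / M > 0" using e M by simp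
    then obtain N where N: "ALL n>=N. absv (x n) < e / M" using xlim by blast
    have "absv (h (x m) - h (x n)) < e" if mn: "m \<ge> N" "n \<ge> N" for m n
    proof -
      have "absv (h (x m) - h (x n)) <= B / absv c * absv (x m - x n)" using lip[OF x0, of m n] xc[of m] by simp
      also have "\<dots> <= M * absv (x m - x n)" using M by (intro mult_right_mono) auto
      also have "\<dots> < M * (e / M)" using N mn M by (intro mult_strict_left_mono absv_diff_less') auto
      finally show ?thesis using M by simp
    qed
    then show "EX N. ALL m>=N. ALL n>=N. absv (h (x m) - h (x n)) < e" by blast
  qed blast
  have near: "absv (h z - c0) <= B / absv c * absv z" if z: "z ~= 0" "absv z <= absv c" for z
  proof -
    obtain N where N: "ALL n>=N. absv (x n) < absv z" using xlim[of "absv z"] z by auto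
    have "absv (c0 - h z) <= B / absv c * absv z"
    proof (rule absv_le_of_tendsto[OF c0, of N])
      fix n assume n: "n \<ge> N"
      have "absv (z - x n) <= absv z" using N n by (intro absv_diff_le') (auto intro: less_imp_le)
      then have "B / absv c * absv (z - x n) <= B / absv c * absv z" using B0 by (intro mult_left_mono) auto
      then show "absv (h (x n) - h z) <= B / absv c * absv z" using lip[OF z, of n] by (simp add: absv_commute[of "h (x n)"])
    qed
    then show ?thesis by (simp add: absv_commute[of "h z"])
  qed
  define h1 where "h1 z = (h z + (- c0)) * inverse z" for z
  have "absv (c0 - 0) <= B" by (rule absv_le_of_tendsto[OF c0, of 0]) (use B x0 xc in \<open>auto intro: less_imp_le\<close>)
  moreover have "pd c (B / absv c) h1" unfolding pd_def
  proof (intro conjI allI impI)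
    show "rigidA a c h1" if "a ~= 0 & absv a <= absv c" for a
      unfolding h1_def[abs_def] using that by (intro rigidA_mult rigidA_add rigidA_const rigidA_inverse rg) auto
    show "absv (h1 z) <= B / absv c" if "z ~= 0 & absv z <= absv c" for z
      using near[of z] that by (simp add: h1_def divide_inverse[symmetric] absv_divide divide_le_eq)
  qed
  moreover have "h z = c0 + z * h1 z" if "z ~= 0" for z using that by (simp add: h1_def field_simps)
  ultimately show ?thesis by (intro exI[of _ c0] exI[of _ h1]) auto
qed

section \<open>Power series expansions\<close>

lemma absv_triangle_le:
  "absv (x - y) <= e ==> absv (y - z) <= e ==> absv (x - z :: 'a::complete_nonarch_field) <= e"
  using absv_triangle[of x z y] by linarith

text \<open>The predicate \<open>P\<close> keeps the iteration independent of the domain: it is used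
  for full discs as well as for punctured ones.\<close>

lemma taylor_iterate:
  fixes D :: "'a::complete_nonarch_field set" and r :: real
  assumes step: "!!B h. P B h ==> EX c0 h1. absv c0 <= B & P (B / r) h1 & (ALL z:D. h z = c0 + z * h1 z)" and h: "P B h"
  shows "EX cs hs. hs 0 = h & (ALL N. P (B / r ^ N) (hs N) & absv (cs N :: 'a) <= B / r ^ N & (ALL z:D. hs N z = cs N + z * hs (Suc N) z))"
proof -
  have "EX ch. P B h --> absv (fst ch) <= B & P (B / r) (snd ch) & (ALL z:D. h z = fst ch + z * snd ch z)" for B h
  proof (cases "P B h")
    case True
    from step[OF this] obtain c0 h1 where "absv c0 <= B & P (B / r) h1 & (ALL z:D. h z = c0 + z * h1 z)" by blast
    then show ?thesis by (intro exI[of _ "(c0, h1)"]) simp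
  qed simp
  then obtain ch where ch: "!!B h. P B h ==> absv (fst (ch B h)) <= B & P (B / r) (snd (ch B h)) & (ALL z:D. h z = fst (ch B h) + z * snd (ch B h) z)"
    by metis
  define hs where "hs = rec_nat h (%N g. snd (ch (B / r ^ N) g))"
  define cs where "cs N = fst (ch (B / r ^ N) (hs N))" for N
  have hS: "hs (Suc N) = snd (ch (B / r ^ N) (hs N))" for N by (simp add: hs_def)
  have P: "P (B / r ^ N) (hs N)" for N
  proof (induction N)
    case 0
    show ?case using h by (simp add: hs_def)
  next
    case (Suc N)
    from ch[OF this] show ?case by (simp add: hS mult.commute)
  qed
  show ?thesis
  proof (intro exI[of _ cs] exI[of _ hs] conjI allI)
    show "hs 0 = h" by (simp add: hs_def)
    fix N
    show "P (B / r ^ N) (hs N)" by (rule P)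
    show "absv (cs N) <= B / r ^ N" "ALL z:D. hs N z = cs N + z * hs (Suc N) z"
      using ch[OF P[of N]] by (auto simp: cs_def hS)
  qed
qed

text \<open>The strictly smaller radius of \<open>disc b\<close> makes the series converge
  geometrically. The shift \<open>e\<close> starts the expansion at \<open>cs e\<close>, so that a
  power of the coordinate can be split off.\<close>

lemma series_an:
  fixes b :: "'a::complete_nonarch_field" and D :: "'a set"
  assumes b: "b ~= 0" "absv b < r" and cs: "!!N. absv (cs N) <= B / r ^ N"
    and hs: "!!N z. z : D ==> absv (hs N z) <= B / r ^ N" "!!N z. z : D ==> hs N z = cs N + z * hs (Suc N) z"
  shows "EX H:an (disc b). H 0 = cs e & (ALL z:D. absv z <= absv b --> H z = hs e z)"
proof -
  have r: "r > 0" using b by (meson absv_nonneg le_less_trans)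
  have B0: "0 <= B" using order_trans[OF absv_nonneg cs[of 0]] by simp
  define th where "th = absv b / r"
  have th: "0 <= th" "th < 1" using b r by (auto simp: th_def)
  define S where "S N x = (\<Sum>n<N. cs (e + n) * b ^ n * x 0 ^ n)" for N and x :: "nat \<Rightarrow> 'a"
  have "EX Q:tate 1. ALL x:polydisc. ALL J. absv (Q x - (\<Sum>n<J. cs (e + n) * b ^ n * x 0 ^ n)) <= B / r ^ e * th ^ J"
  proof (rule tate_series[OF _ _ th])
    show "(%x. cs (e + k) * b ^ k * x 0 ^ k) : tate 1" for k
      by (intro tate_mult tate_power tate_var tate_const) auto
    fix k and x :: "nat \<Rightarrow> 'a" assume x: "x : polydisc"
    have "absv (cs (e + k)) * absv b ^ k * absv (x 0) ^ k <= B / r ^ (e + k) * absv b ^ k * 1"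
      using B0 r by (intro mult_mono power_le_one polydiscD[OF x] cs) auto
    then show "absv (cs (e + k) * b ^ k * x 0 ^ k) <= B / r ^ e * th ^ k"
      by (simp add: absv_mult absv_power th_def power_divide power_add)
  qed
  then obtain Q where Q: "Q : tate 1" "ALL x:polydisc. ALL J. absv (Q x - S J x) <= B / r ^ e * th ^ J" unfolding S_def by blast
  have lim: "(%J. B / r ^ e * th ^ J) \<longlonglongrightarrow> 0" using th by (intro tendsto_mult_right_zero LIMSEQ_power_zero) auto
  define H where "H z = Q (ev (snd (disc b)) z)" for z
  have evd: "ev (snd (disc b)) z : polydisc" "ev (snd (disc b)) z 0 = z / b" if "absv z <= absv b" for z
    using that b by (auto simp: polydisc_def ev_def disc_def absv_divide divide_le_eq_1)
  have HS: "absv (H z - (\<Sum>n<J. cs (e + n) * z ^ n)) <= B / r ^ e * th ^ J" if z: "absv z <= absv b" for z J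
  proof -
    have "S J (ev (snd (disc b)) z) = (\<Sum>n<J. cs (e + n) * z ^ n)"
      unfolding S_def evd(2)[OF z] using b by (simp add: power_divide)
    then show ?thesis using Q(2) evd(1)[OF z] unfolding H_def by metis
  qed
  have "H : an (disc b)" by (rule anI[of Q]) (use Q(1) in \<open>auto simp: H_def disc_def\<close>)
  moreover have "H 0 = cs e"
  proof -
    have "(\<Sum>n<Suc J. cs (e + n) * 0 ^ n) = cs e" for J by (induction J) auto
    then have "absv (H 0 - cs e) <= B / r ^ e * th ^ Suc J" for J using HS[of 0 "Suc J"] by simp
    then have "absv (H 0 - cs e) <= 0" by (intro LIMSEQ_le_const[OF LIMSEQ_Suc[OF lim]]) auto
    then show ?thesis by simp
  qed
  moreover have "H z = hs e z" if z: "z : D" "absv z <= absv b" for z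
  proof -
    have tay: "hs e z = (\<Sum>n<J. cs (e + n) * z ^ n) + z ^ J * hs (e + J) z" for J
    proof (induction J)
      case (Suc J)
      then show ?case using hs(2)[OF z(1), of "e + J"] by (simp add: algebra_simps)
    qed simp
    have "absv (hs e z - (\<Sum>n<J. cs (e + n) * z ^ n)) <= B / r ^ e * th ^ J" for J
    proof -
      have "absv (hs e z - (\<Sum>n<J. cs (e + n) * z ^ n)) = absv z ^ J * absv (hs (e + J) z)"
        by (subst tay[of J]) (simp add: absv_mult absv_power)
      also have "\<dots> <= absv b ^ J * (B / r ^ (e + J))"
        using z hs(1)[OF z(1)] by (intro mult_mono power_mono) auto
      also have "\<dots> = B / r ^ e * th ^ J" by (simp add: th_def power_divide power_add)
      finally show ?thesis .
    qed
    then have "absv ((\<Sum>n<J. cs (e + n) * z ^ n) - hs e z) <= B / r ^ e * th ^ J" for J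
      by (simp add: absv_commute[of _ "hs e z"])
    from absv_triangle_le[OF HS[OF z(2)] this]
    have "absv (H z - hs e z) <= B / r ^ e * th ^ J" for J .
    then have "absv (H z - hs e z) <= 0" by (intro LIMSEQ_le_const[OF lim]) auto
    then show ?thesis by simp
  qed
  ultimately show ?thesis by blast
qed

lemma RA_ball_an:
  fixes b c :: "'a::complete_nonarch_field"
  assumes c: "c ~= 0" and h: "h : RA {z. absv z <= absv c}" and b: "b ~= 0" "absv b < absv c"
  shows "h : an (disc b)"
proof -
  let ?D = "{z :: 'a. absv z <= absv c}"
  have D: "rdom ?D" using rdom_ball[OF c, of 0] by simp
  obtain B where B: "B > 0" "ALL z:?D. absv (h z) <= B" using RA_bounded[OF D h] by blast
  define P where "P B h \<longleftrightarrow> h : RA ?D & (ALL z:?D. absv (h z) <= B)" for B h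
  have step: "EX c0 h1. absv c0 <= B & P (B / absv c) h1 & (ALL z:?D. h z = c0 + z * h1 z)" if Ph: "P B h" for B h
  proof -
    have hD: "h : RA ?D" and hB: "!!z. absv z <= absv c ==> absv (h z) <= B" using Ph by (auto simp: P_def)
    have 0: "0 : ?D" by simp
    have lip: "absv (h z - h 0) <= B / absv c * absv (z - 0)" if "absv z <= absv c" for z
      by (rule ball_quotient[OF c]) (use hD hB that in auto)
    define h1 where "h1 z = (if z = 0 then nonarch_deriv h 0 else (h z - h 0) / (z - 0))" for z
    have "h1 : RA ?D" using RA_quotient[OF D hD 0] by (simp add: h1_def[abs_def])
    moreover have "absv (nonarch_deriv h 0) <= B / absv c"
      by (rule Dq_bound[OF RA_deriv(2)[OF D hD 0] c lip]) simp
    then have "absv (h1 z) <= B / absv c" if "z : ?D" for z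
      using lip[of z] that by (auto simp: h1_def absv_divide divide_le_eq)
    ultimately have "P (B / absv c) h1" unfolding P_def by blast
    moreover have "absv (h 0) <= B" using hB[of 0] by simp
    moreover have "ALL z:?D. h z = h 0 + z * h1 z" by (simp add: h1_def)
    ultimately show ?thesis by blast
  qed
  have PB: "P B h" using h B by (simp add: P_def)
  obtain cs hs where cs: "hs 0 = h" "ALL N. P (B / absv c ^ N) (hs N) & absv (cs N :: 'a) <= B / absv c ^ N & (ALL z:?D. hs N z = cs N + z * hs (Suc N) z)"
    using taylor_iterate[of P "absv c" ?D, OF step PB] by blast
  obtain H where H: "H : an (disc b)" "ALL z:?D. absv z <= absv b --> H z = hs 0 z"
    using series_an[OF b, of cs B ?D hs 0] cs(2) unfolding P_def by blast
  show ?thesis by (rule an_cong[OF H(1)]) (use H(2) cs(1) b in \<open>auto simp: disc_def\<close>)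
qed

section \<open>Pulling back analytic functions\<close>

text \<open>The functions \<open>E\<close> are to be substituted into a Tate function, whose
  approximations hold only on the polydisc; hence they must be bounded by 1 on the whole source
  polydisc, not merely at the points of \<open>W\<close>.\<close>

lemma an_transfer:
  fixes V :: "('q, 'a::complete_nonarch_field) affinoid" and W :: "('p, 'a) affinoid"
  assumes f: "!!p. p : fst W ==> f p : fst V"
    and gens: "!!i. i < length (snd V) ==> EX E:tate (length (snd W)). (ALL x:polydisc. absv (E x) <= 1) &
        (ALL p:fst W. (snd V ! i) (f p) = E (ev (snd W) p))"
    and h: "h : an V"
  shows "h \<circ> f : an W"
proof -
  let ?n = "length (snd V)" and ?m = "length (snd W)"
  obtain H where H: "H : tate ?n" "!!p. p : fst V ==> h p = H (ev (snd V) p)" by (rule anE[OF h]) blast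
  have "ALL i. EX E. i < ?n --> E : tate ?m & (ALL x:polydisc. absv (E x) <= 1) & (ALL p:fst W. (snd V ! i) (f p) = E (ev (snd W) p))"
    using gens by blast
  then obtain E where E: "ALL i. i < ?n --> E i : tate ?m & (ALL x:polydisc. absv (E i x) <= 1) &
      (ALL p:fst W. (snd V ! i) (f p) = E i (ev (snd W) p))" by (rule choice[THEN exE])
  have "(%x. H (%i. if i < ?n then E i x else 0)) : tate ?m" by (rule tate_subst[OF H(1)]) (use E in simp_all)
  then show ?thesis
  proof (rule anI)
    fix p assume p: "p : fst W"
    have "(%i. if i < ?n then E i (ev (snd W) p) else 0) = ev (snd V) (f p)"
      using E p by (auto simp: ev_def fun_eq_iff)
    then show "(h \<circ> f) p = H (%i. if i < ?n then E i (ev (snd W) p) else 0)" using H(2)[OF f[OF p]] by simp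
  qed
qed

lemma an_pullback:
  fixes V :: "('q, 'a::complete_nonarch_field) affinoid" and W :: "('p, 'a) affinoid"
  assumes f: "!!p. p : fst W ==> f p : fst V"
    and gens: "!!g. g : set (snd V) ==> g \<circ> f : set (snd W)" and h: "h : an V"
  shows "h \<circ> f : an W"
proof (rule an_transfer[OF f _ h])
  fix i assume "i < length (snd V)"
  then obtain j where j: "j < length (snd W)" "snd W ! j = (snd V ! i) \<circ> f" using gens by (metis in_set_conv_nth nth_mem)
  then have "ALL p:fst W. (snd V ! i) (f p) = ev (snd W) p j" by (simp add: ev_def)
  then show "EX E:tate (length (snd W)). (ALL x:polydisc. absv (E x) <= 1) & (ALL p:fst W. (snd V ! i) (f p) = E (ev (snd W) p))"
    using polydiscD by (intro bexI[OF _ tate_var[OF j(1)]]) blast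
qed

lemma goodaff_sound: "goodaff W ==> sound W"
  by (simp add: goodaff_def presented_def)

text \<open>This is the rational subdomain with denominator 1: the points stay, only the
  presentation grows.\<close>

lemma add_generators:
  assumes W: "goodaff W" and hs: "set hs \<subseteq> an W" "!!h p. h : set hs ==> p : fst W ==> absv (h p) <= 1"
  shows "EX W'. goodaff W' & fst W' = fst W & snd W' = snd W @ hs & an W \<subseteq> an W'"
proof -
  let ?W' = "(fst W, snd W @ hs)"
  have "rational_subdomain W ?W'"
    unfolding rational_subdomain_def analytic_functions_eq[OF goodaff_sound[OF W]]
    by (intro exI[of _ "%_. 1"] exI[of _ hs]) (use hs in \<open>auto simp: an_const\<close>)
  then have "goodaff ?W'" "an W \<subseteq> an ?W'" using goodaff_rational[OF W] an_mono[OF goodaff_sound[OF W]] by blast+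
  then show ?thesis by (intro exI[of _ ?W']) simp
qed

lemma goodaff_subdomain:
  assumes W: "goodaff W" and g: "g : an W" "set fs \<subseteq> an W" and nz: "!!p. p : fst W ==> EX f:set (g # fs). f p ~= 0"
  shows "EX W'. goodaff W' & fst W' = {p : fst W. ALL f:set fs. absv (f p) <= absv (g p)} &
     snd W' = snd W @ map (%f p. f p / g p) fs & an W \<subseteq> an W'"
proof -
  let ?W' = "({p : fst W. ALL f:set fs. absv (f p) <= absv (g p)}, snd W @ map (%f p. f p / g p) fs)"
  have "rational_subdomain W ?W'"
    unfolding rational_subdomain_def analytic_functions_eq[OF goodaff_sound[OF W]]
    by (intro exI[of _ g] exI[of _ fs]) (use g nz in auto)
  then have "goodaff ?W'" "an W \<subseteq> an ?W'" using goodaff_rational[OF W] an_mono[OF goodaff_sound[OF W]] by blast+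
  then show ?thesis by (intro exI[of _ ?W']) simp
qed

text \<open>
  The preimage of an affinoid of the variety in an affinoid \<open>W\<close> of the line: first the part mapped
  to the chart of \<open>V\<close> is cut out, then the inequalities defining \<open>V\<close> are pulled back. At each step
  the pulled back functions are added to the generators.
\<close>

lemma affinoid_preimage:
  fixes X :: "'a::complete_nonarch_field ppoint set" and f :: "'a \<Rightarrow> 'a ppoint"
  assumes X: "projective_variety N X" and V: "V : affinoids N X"
    and W: "goodaff W" and fX: "!!z. z : fst W ==> f z : X" and fi: "!!z. z : fst W ==> f z : unit_chart i"
    and rat: "!!j. ratio j i \<circ> f : an W"
  shows "EX W'. goodaff W' & fst W' = {z : fst W. f z : fst V} & (ALL h:an V. h \<circ> f : an W')"
proof -
  obtain i' where i': "i' <= N" and sub: "rational_subdomain (standard_affinoid N X i') V"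
    using V unfolding affinoids_def by blast
  let ?A = "standard_affinoid N X i'"
  have Asnd: "sound ?A" using presented_standard[OF X i'] by (simp add: presented_def)
  have Apts: "fst ?A = X \<inter> unit_chart i'" and Agens: "set (snd ?A) = (%j. ratio j i') ` {..<Suc N}"
    by (auto simp: standard_affinoid_def simp del: upt_Suc)
  have hi: "hcoord (f z) i ~= 0" if "z : fst W" for z using fi[OF that] by (rule unit_chart_hcoord)
  \<comment> \<open>Coordinate \<open>i\<close> is dominant along \<open>f\<close>, so
    \<open>1 <= absv (ratio i' i (f z))\<close> says that coordinate \<open>i'\<close> is dominant
    too.\<close>
  have "EX W'. goodaff W' & fst W' = {p : fst W. ALL g:set [%_. 1]. absv (g p) <= absv ((ratio i' i \<circ> f) p)} &
     snd W' = snd W @ map (%g p. g p / (ratio i' i \<circ> f) p) [%_. 1] & an W \<subseteq> an W'"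
    using goodaff_subdomain[OF W rat, of "[%_. 1]" i'] by (simp add: an_const)
  then obtain W1 where W1: "goodaff W1" "fst W1 = {z : fst W. 1 <= absv (ratio i' i (f z))}"
     "snd W1 = snd W @ [%z. 1 / ratio i' i (f z)]" "an W \<subseteq> an W1" by auto
  have chart: "f z : unit_chart i' & ratio j i' (f z) = ratio j i (f z) * (1 / ratio i' i (f z))" if z: "z : fst W1" for z j
  proof -
    have zW: "z : fst W" and ge: "1 <= absv (ratio i' i (f z))" using z W1(2) by auto
    have h0: "hcoord (f z) i' ~= 0" using ge by (auto simp: ratio_def)
    have le: "absv (hcoord (f z) l) <= absv (hcoord (f z) i)" for l using fi[OF zW] by (simp add: unit_chart_def)
    have "absv (hcoord (f z) i) <= absv (hcoord (f z) i')"
      using ge hi[OF zW] by (simp add: ratio_def absv_divide le_divide_eq)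
    then have "f z : unit_chart i'" unfolding unit_chart_def using h0 le order_trans by blast
    then show ?thesis using h0 hi[OF zW] by (simp add: ratio_def)
  qed
  have rat': "ratio j i' \<circ> f : an W1" for j
  proof -
    have "(%z. (ratio j i \<circ> f) z * (%z. 1 / ratio i' i (f z)) z) : an W1"
      by (intro an_mult an_gen subsetD[OF W1(4) rat]) (simp add: W1(3))
    then show ?thesis by (rule an_cong) (use chart in auto)
  qed
  have "EX W'. goodaff W' & fst W' = fst W1 & snd W' = snd W1 @ map (%g. g \<circ> f) (snd ?A) & an W1 \<subseteq> an W'"
  proof (rule add_generators[OF W1(1)])
    show "set (map (%g. g \<circ> f) (snd ?A)) \<subseteq> an W1" using rat' Agens by auto
    show "absv (h p) <= 1" if "h : set (map (%g. g \<circ> f) (snd ?A))" "p : fst W1" for h p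
      using that(1) Agens unit_chart_ratio[OF conjunct1[OF chart[OF that(2)]]] by auto
  qed
  then obtain W2 where W2: "goodaff W2" "fst W2 = fst W1" "snd W2 = snd W1 @ map (%g. g \<circ> f) (snd ?A)" by blast
  have fA: "f z : fst ?A" if "z : fst W2" for z
    using that chart fX W1(2) by (auto simp: Apts W2(2))
  have pull: "h \<circ> f : an W2" if "h : an ?A" for h
    by (rule an_pullback[OF fA _ that]) (auto simp: W2(3))
  obtain g fs where g: "g : an ?A" "set fs \<subseteq> an ?A" and nz: "ALL p:fst ?A. EX f:set (g # fs). f p ~= 0"
     and Vpts: "fst V = {p : fst ?A. ALL f:set fs. absv (f p) <= absv (g p)}"
     and Vgens: "snd V = snd ?A @ map (%f p. f p / g p) fs"
    using sub unfolding rational_subdomain_def analytic_functions_eq[OF Asnd] by blast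
  have "EX W'. goodaff W' & fst W' = {p : fst W2. ALL k:set (map (%k. k \<circ> f) fs). absv (k p) <= absv ((g \<circ> f) p)} &
     snd W' = snd W2 @ map (%k p. k p / (g \<circ> f) p) (map (%k. k \<circ> f) fs) & an W2 \<subseteq> an W'"
  proof (rule goodaff_subdomain[OF W2(1)])
    show "g \<circ> f : an W2" by (rule pull[OF g(1)])
    show "set (map (%k. k \<circ> f) fs) \<subseteq> an W2" using g(2) pull by auto
    show "EX k:set ((g \<circ> f) # map (%k. k \<circ> f) fs). k p ~= 0" if "p : fst W2" for p using nz fA[OF that] by auto
  qed
  then obtain W3 where W3: "goodaff W3" "fst W3 = {p : fst W2. ALL k:set fs. absv (k (f p)) <= absv (g (f p))}"
     "snd W3 = snd W2 @ map (%k p. k p / (g \<circ> f) p) (map (%k. k \<circ> f) fs)" by auto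
  have fst3: "fst W3 = {z : fst W. f z : fst V}"
  proof (intro equalityI subsetI)
    fix z assume z: "z : fst W3"
    then show "z : {z : fst W. f z : fst V}" using fA[of z] by (auto simp: W3(2) W2(2) W1(2) Vpts)
  next
    fix z assume z: "z : {z : fst W. f z : fst V}"
    then have u: "f z : unit_chart i'" "z : fst W" by (auto simp: Vpts Apts)
    have "absv (hcoord (f z) i) <= absv (hcoord (f z) i')" using u(1) by (simp add: unit_chart_def)
    then have "1 <= absv (ratio i' i (f z))" using hi[OF u(2)] by (simp add: ratio_def absv_divide le_divide_eq)
    then show "z : fst W3" using z by (auto simp: W3(2) W2(2) W1(2) Vpts)
  qed
  have "h \<circ> f : an W3" if h: "h : an V" for h
  proof (rule an_pullback[OF _ _ h])
    show "f p : fst V" if "p : fst W3" for p using that fst3 by blast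
    show "k \<circ> f : set (snd W3)" if k: "k : set (snd V)" for k
      using k by (auto simp: Vgens W3(3) W2(3) comp_def)
  qed
  then show ?thesis using W3(1) fst3 by blast
qed

section \<open>Translations and bounds for jets\<close>

lemma Lim_shift:
  fixes xi et :: "'a::complete_nonarch_field" and h :: "'a \<Rightarrow> 'a"
  shows "(%y. h (xi + y)) \<midarrow>et\<rightarrow> l \<longleftrightarrow> h \<midarrow>(xi + et)\<rightarrow> l"
  unfolding LIM_def
proof (intro iffI allI impI)
  fix r :: real assume "ALL r>0. EX s>0. ALL x. x ~= et & dist x et < s --> dist (h (xi + x)) l < r" "r > 0"
  then obtain s where s: "s > 0" "ALL x. x ~= et & dist x et < s --> dist (h (xi + x)) l < r" by blast
  have "dist (h x) l < r" if "x ~= xi + et & dist x (xi + et) < s" for x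
    using s(2)[rule_format, of "x - xi"] that by (auto simp: dist_absv algebra_simps)
  then show "EX s>0. ALL x. x ~= xi + et & dist x (xi + et) < s --> dist (h x) l < r" using s(1) by blast
next
  fix r :: real assume "ALL r>0. EX s>0. ALL x. x ~= xi + et & dist x (xi + et) < s --> dist (h x) l < r" "r > 0"
  then obtain s where s: "s > 0" "ALL x. x ~= xi + et & dist x (xi + et) < s --> dist (h x) l < r" by blast
  have "dist (h (xi + x)) l < r" if "x ~= et & dist x et < s" for x
    using s(2)[rule_format, of "xi + x"] that by (auto simp: dist_absv)
  then show "EX s>0. ALL x. x ~= et & dist x et < s --> dist (h (xi + x)) l < r" using s(1) by blast
qed

lemma nonarch_deriv_shift:
  fixes h :: "'a::complete_nonarch_field \<Rightarrow> 'a"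
  shows "nonarch_deriv (%z. h (xi + z)) = (%et. nonarch_deriv h (xi + et))"
proof
  fix et
  let ?k = "%x. (h x - h (xi + et)) / (x - (xi + et))"
  have "(%y. (h (xi + y) - h (xi + et)) / (y - et)) = (%y. ?k (xi + y))"
    by (simp add: fun_eq_iff)
  then have "nonarch_deriv (%z. h (xi + z)) et = Lim (at et) (%y. ?k (xi + y))" unfolding nonarch_deriv_def by (rule arg_cong)
  also have "\<dots> = Lim (at (xi + et)) ?k" unfolding t2_space_class.Lim_def by (rule arg_cong[where f = The], rule ext, rule Lim_shift)
  finally show "nonarch_deriv (%z. h (xi + z)) et = nonarch_deriv h (xi + et)" unfolding nonarch_deriv_def .
qed

lemma nonarch_deriv_funpow_shift:
  "(nonarch_deriv ^^ j) (%z. h (x + z)) = (%y. (nonarch_deriv ^^ j) h (x + y))"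
  by (induction j) (simp_all add: nonarch_deriv_shift)

lemma jet_symbol_shift: "jet_symbol w (%z. f (x + z)) j i y = jet_symbol w f j i (x + y)"
proof -
  define h where "h = (coords w ! i) \<circ> f"
  have eq: "(coords w ! i) \<circ> (%z. f (x + z)) = (%z. h (x + z))" by (simp add: h_def comp_def)
  show ?thesis unfolding jet_symbol_def Let_def eq h_def[symmetric] nonarch_deriv_shift
      nonarch_deriv_funpow_shift[of _ "%z. nonarch_deriv h z / h z"] nonarch_deriv_funpow_shift[of _ h] by simp
qed

lemma jet_pullback_shift: "jet_pullback n k m w (%z. f (x + z)) y = jet_pullback n k m w f (x + y)"
  unfolding jet_pullback_def jet_symbol_shift ..

lemma RA_shift:
  fixes c x :: "'a::complete_nonarch_field"
  assumes "h : RA U" "!!z. absv z <= absv c ==> x + z : U"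
  shows "(%z. h (x + z)) : RA {z. absv z <= absv c}"
proof (rule RA_I)
  fix e :: real assume e: "e > 0"
  obtain p q where pq: "!!z. z : U ==> poly q z ~= 0" "!!z. z : U ==> absv (h z - poly p z / poly q z) <= e"
    by (rule RA_approx[OF assms(1) e]) blast
  show "EX p q. ALL z:{z. absv z <= absv c}. poly q z ~= 0 & absv (h (x + z) - poly p z / poly q z) <= e"
    by (intro exI[of _ "pcompose p [:x, 1:]"] exI[of _ "pcompose q [:x, 1:]"])
       (use pq assms(2) in \<open>auto simp: poly_pcompose mult.commute\<close>)
qed

lemma RA_funpow_deriv: "rdom U ==> h : RA U ==> (nonarch_deriv ^^ j) h : RA U"
  by (induction j) (simp_all add: RA_deriv(1))

lemma funpow_deriv_bound:
  fixes U :: "'a::complete_nonarch_field set"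
  assumes U: "rdom U" and h: "h : RA U" and r: "0 < r" and sub: "!!z. absv (z - x) < r ==> z : U"
    and B: "!!z. absv (z - x) < r ==> absv (h z) <= B"
  shows "absv (w - x) < r ==> absv ((nonarch_deriv ^^ j) h w) <= B / r ^ j"
proof (induction j arbitrary: w)
  case (Suc j)
  from RA_deriv_bound[OF U RA_funpow_deriv[OF U h] r sub Suc.IH Suc.prems]
  show ?case by (simp add: mult.commute)
qed (use B in simp)

text \<open>A function bounded away from 0 has the absolute value of a fraction whose numerator and
  denominator have no zeros in the disc.\<close>

lemma RA_unit_const_absv:
  fixes U :: "'a::complete_nonarch_field set"
  assumes U: "rdom U" and h: "h : RA U" and d: "d > 0" "!!z. z : U ==> d <= absv (h z)"
    and sub: "!!z. absv (z - x) < r ==> z : U" and z: "absv (z - x) < r"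
  shows "absv (h z) = absv (h x)"
proof -
  have "d / 2 > 0" using d by simp
  then obtain p q where q: "!!z. z : U ==> poly q z ~= 0" and ap: "!!z. z : U ==> absv (h z - poly p z / poly q z) <= d / 2"
    by (rule RA_approx[OF h]) blast
  have hu: "absv (h y) = absv (poly p y) / absv (poly q y) & poly p y ~= 0" if y: "y : U" for y
  proof -
    have "absv (h y) = absv (poly p y / poly q y)"
      by (rule absv_eq_of_diff_less') (use ap[OF y] d(1) d(2)[OF y] in linarith)
    then show ?thesis using d(1) d(2)[OF y] by (auto simp: absv_divide)
  qed
  let ?t = "absv (z - x)"
  have in_U: "y : U" if "absv (y - x) <= ?t" for y using sub that z by (meson le_less_trans)
  have pz: "absv (poly p z) = gnorm p x ?t" "absv (poly p x) = gnorm p x ?t"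
    using in_U hu by (auto intro!: absv_poly_no_roots)
  have qz: "absv (poly q z) = gnorm q x ?t" "absv (poly q x) = gnorm q x ?t"
    using in_U q by (auto intro!: absv_poly_no_roots)
  show ?thesis using hu[of z] hu[of x] in_U[of z] in_U[of x] pz qz by simp
qed

text \<open>On the disc \<open>absv (h z)\<close> is constant, so the Cauchy estimate for the
  derivative of \<open>h\<close>, divided by \<open>h\<close>, no longer depends on the size of
  \<open>h\<close>.\<close>

lemma log_deriv_bound:
  fixes U :: "'a::complete_nonarch_field set"
  assumes U: "rdom U" and h: "h : RA U" and d: "d > 0" "!!z. z : U ==> d <= absv (h z)"
    and r: "0 < r" and sub: "!!z. absv (z - x) < r ==> z : U"
  shows "(%z. nonarch_deriv h z / h z) : RA U"
    and "absv ((nonarch_deriv ^^ j) (%z. nonarch_deriv h z / h z) x) <= 1 / r ^ Suc j"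
proof -
  show L: "(%z. nonarch_deriv h z / h z) : RA U"
    using RA_mult[OF U RA_deriv(1)[OF U h] RA_inverse[OF U h d]] by (simp add: divide_inverse)
  have c: "absv (h z) = absv (h x)" if "absv (z - x) < r" for z by (rule RA_unit_const_absv[OF U h d sub that])
  have hx: "0 < absv (h x)" using d(1) d(2)[OF sub[of x]] r by fastforce
  have "absv (nonarch_deriv h z / h z) <= 1 / r" if z: "absv (z - x) < r" for z
  proof -
    have "absv (nonarch_deriv h z) <= absv (h x) / r"
      by (rule RA_deriv_bound[OF U h r sub _ z]) (use c in simp_all)
    then show ?thesis using c[OF z] hx r by (simp add: absv_divide field_simps)
  qed
  from funpow_deriv_bound[OF U L r sub this, where w = x and j = j] r
  show "absv ((nonarch_deriv ^^ j) (%z. nonarch_deriv h z / h z) x) <= 1 / r ^ Suc j" by simp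
qed

section \<open>Generic points of semialgebraic domains\<close>

lemma poly_const_on_rootless_ball:
  fixes x :: "'a::complete_nonarch_field"
  assumes "!!s. P ~= 0 ==> poly P s = 0 ==> r <= absv (x - s)" and w: "absv (w - x) < r"
  shows "absv (poly P w) = absv (poly P x)"
proof (cases "P = 0")
  case False
  have nr: "poly P y ~= 0" if "absv (y - x) <= absv (w - x)" for y
    using assms(1)[OF False, of y] w that by (auto simp: absv_commute)
  have "absv (poly P w) = gnorm P x (absv (w - x))" "absv (poly P x) = gnorm P x (absv (w - x))"
    using nr by (auto intro!: absv_poly_no_roots)
  then show ?thesis by simp
qed simp

text \<open>On an open disc that contains no zero of the defining polynomials their absolute values
  are constant, so the inequalities hold on all of it or nowhere. The finite set consists of these
  zeros.\<close>

lemma rdom_generic_ball: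
  fixes U :: "'a::complete_nonarch_field set"
  assumes "rdom U"
  shows "EX S. finite S & (ALL x:U. ALL r. (ALL s:S. r <= absv (x - s)) --> {w. absv (w - x) < r} \<subseteq> U)"
proof -
  obtain L where L: "finite L" "U = {z. ALL PQ:L. absv (poly (fst PQ) z) <= absv (poly (snd PQ) z)}"
    by (rule rdom_semialgebraic[OF assms])
  let ?S = "\<Union>P\<in>fst ` L \<union> snd ` L. {z. P ~= 0 & poly P z = 0}"
  have "ALL x:U. ALL r. (ALL s:?S. r <= absv (x - s)) --> {w. absv (w - x) < r} \<subseteq> U"
  proof (intro ballI allI impI subsetI)
    fix x r w assume x: "x : U" and r: "ALL s:?S. r <= absv (x - s)" and "w : {w. absv (w - x) < r}"
    then have w: "absv (w - x) < r" by simp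
    have "absv (poly P w) = absv (poly P x)" if "P : fst ` L \<union> snd ` L" for P
      by (rule poly_const_on_rootless_ball[OF _ w]) (use r that in blast)
    then show "w : U" using x unfolding L(2) by simp
  qed
  moreover have "finite ?S" by (rule finite_UN_I) (use L(1) finite_roots in auto)
  ultimately show ?thesis by (intro exI[of _ ?S] conjI)
qed

text \<open>
  One member of the covering contains generic points of radii tending to the outer one, hence by
  continuity of the Gauss norms all generic points of the outer circle, and there the function is
  arbitrarily small.
\<close>

lemma rigidA_zero_boundary:
  fixes a c :: "'a::complete_nonarch_field"
  assumes a: "a ~= 0" and ac: "absv a < absv c" and h: "rigidA a c h"
    and zero: "!!z. absv a <= absv z ==> absv z < absv c ==> h z = 0" and z: "absv z = absv c"
  shows "h z = 0"
proof (rule ccontr)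
  assume nz: "h z ~= 0"
  have "EX ep::'a. ep ~= 0 & absv ep < absv (h z)" by (rule absv_small) (use nz in simp)
  then obtain ep :: 'a where ep: "ep ~= 0" "absv ep < absv (h z)" by blast
  obtain Vs where Vs: "finite Vs" "\<Union>Vs = {z. absv a <= absv z & absv z <= absv c}" "ALL U:Vs. rdom U & h : RA U"
    using h unfolding rigidA_def by blast
  define A where "A U L p q \<longleftrightarrow> finite L & (ALL z. z : U \<longleftrightarrow> (ALL PQ:L. absv (poly (fst PQ) z) <= absv (poly (snd PQ) z))) &
     (ALL z:U. poly q z ~= 0 & absv (h z - poly p z / poly q z) <= absv ep)" for U L p q
  have "ALL U. EX Lpq. U : Vs --> A U (fst Lpq) (fst (snd Lpq)) (snd (snd Lpq))"
  proof
    fix U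
    show "EX Lpq. U : Vs --> A U (fst Lpq) (fst (snd Lpq)) (snd (snd Lpq))"
    proof (cases "U : Vs")
      case True
      then have U: "rdom U" "h : RA U" using Vs(3) by auto
      obtain L where L: "finite L" "U = {z. ALL PQ:L. absv (poly (fst PQ) z) <= absv (poly (snd PQ) z)}"
        by (rule rdom_semialgebraic[OF U(1)])
      obtain p q where "!!z. z : U ==> poly q z ~= 0" "!!z. z : U ==> absv (h z - poly p z / poly q z) <= absv ep"
        by (rule RA_approx[OF U(2), of "absv ep"]) (use ep in auto)
      then have "A U L p q" unfolding A_def using L(1) by (simp add: L(2)[THEN eqset_imp_iff])
      then show ?thesis by (intro exI[of _ "(L, p, q)"]) simp
    qed simp
  qed
  then obtain Lpq where Lpq: "ALL U. U : Vs --> A U (fst (Lpq U)) (fst (snd (Lpq U))) (snd (snd (Lpq U)))"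
    by (rule choice[THEN exE])
  define L where "L U = fst (Lpq U)" for U
  define p where "p U = fst (snd (Lpq U))" for U
  define q where "q U = snd (snd (Lpq U))" for U
  have A: "A U (L U) (p U) (q U)" if "U : Vs" for U using Lpq that by (simp add: L_def p_def q_def)
  have finL: "finite (L U)" if "U : Vs" for U using A[OF that] unfolding A_def by blast
  have mem: "z : U \<longleftrightarrow> (ALL PQ:L U. absv (poly (fst PQ) z) <= absv (poly (snd PQ) z))" if "U : Vs" for U z
    using A[OF that] unfolding A_def by blast
  have q0: "poly (q U) z ~= 0" if "U : Vs" "z : U" for U z
    using A[OF that(1)] that(2) unfolding A_def by blast
  have ap: "absv (h z - poly (p U) z / poly (q U) z) <= absv ep" if "U : Vs" "z : U" for U z
    using A[OF that(1)] that(2) unfolding A_def by blast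
  \<comment> \<open>The pair \<open>p U\<close> and \<open>smult ep (q U)\<close> is included so
    that the smallness of the fraction passes to the limiting radius in the same way as the
    inequalities that define \<open>U\<close>.\<close>
  define Ps where "Ps = (\<Union>U\<in>Vs. insert (p U) (insert (smult ep (q U)) (fst ` L U \<union> snd ` L U)))"
  define S where "S = insert 0 (\<Union>P\<in>Ps. {z. P ~= 0 & poly P z = 0})"
  have "finite Ps" unfolding Ps_def by (rule finite_UN_I) (use Vs(1) finL in auto)
  then have finS: "finite S" unfolding S_def using finite_roots by (intro finite.insertI finite_UN_I)
  have gn: "absv (poly P y) = gnorm P 0 (absv y)" if P: "P : Ps" and y: "ALL s:S. absv (y - s) = max (absv (0 - s)) (absv y)" for P y
  proof (rule gnorm_generic')
    fix s assume "P ~= 0" "poly P s = 0"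
    then have "s : S" unfolding S_def using P by blast
    then show "absv (y - s) = max (absv (0 - s)) (absv y)" using y by blast
  qed
  have gen: "EX y. absv y = absv e & (ALL s:S. absv (y - s) = max (absv (0 - s)) (absv y))" for e :: 'a
    using generic_point[OF finS, of 0 e] by auto
  have near: "EX U:Vs. ALL dl>0. EX y:U. absv c - dl < absv y & absv y < absv c & absv a <= absv y &
      (ALL s:S. absv (y - s) = max (absv (0 - s)) (absv y))"
  proof (rule ccontr)
    assume "\<not> ?thesis"
    then have "ALL U. EX dl. U : Vs --> dl > 0 & (ALL y:U. absv c - dl < absv y --> absv y < absv c --> absv a <= absv y -->
      \<not> (ALL s:S. absv (y - s) = max (absv (0 - s)) (absv y)))" by meson
    then obtain dl where dl: "ALL U. U : Vs --> dl U > (0::real) & (ALL y:U. absv c - dl U < absv y --> absv y < absv c --> absv a <= absv y -->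
      \<not> (ALL s:S. absv (y - s) = max (absv (0 - s)) (absv y)))" by (rule choice[THEN exE])
    define d where "d = Min (insert (absv c - absv a) (dl ` Vs))"
    have d: "0 < d" "d <= absv c - absv a" "!!U. U : Vs ==> d <= dl U" unfolding d_def using Vs(1) dl ac by auto
    have "EX e::'a. absv c - d < absv e & absv e < absv c"
      by (rule absv_dense) (use d(1,2) absv_nonneg[of a] in linarith)+
    then obtain e :: 'a where e: "absv c - d < absv e" "absv e < absv c" by blast
    obtain y where y: "absv y = absv e" "ALL s:S. absv (y - s) = max (absv (0 - s)) (absv y)" using gen by blast
    have "y : \<Union>Vs" unfolding Vs(2) using e d(2) y(1) by auto
    then obtain U where U: "U : Vs" "y : U" by blast
    have "absv c - dl U < absv y" "absv y < absv c" "absv a <= absv y" using e d(2) d(3)[OF U(1)] y(1) by auto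
    then show False using dl U y(2) by blast
  qed
  then obtain U where U: "U : Vs" and near: "ALL dl>0. EX y:U. absv c - dl < absv y & absv y < absv c & absv a <= absv y &
      (ALL s:S. absv (y - s) = max (absv (0 - s)) (absv y))" by blast
  have lim: "gnorm P 0 (absv c) <= gnorm Q 0 (absv c)"
    if PQ: "P : Ps" "Q : Ps" and le: "!!y. y : U ==> absv y < absv c ==> absv a <= absv y ==> absv (poly P y) <= absv (poly Q y)" for P Q
  proof (rule gnorm_limit_le[where R = "%r' dl. \<bar>r' - absv c\<bar> < dl"])
    fix dl :: real assume "dl > 0"
    then obtain y where y: "y : U" "absv c - dl < absv y" "absv y < absv c" "absv a <= absv y"
        "ALL s:S. absv (y - s) = max (absv (0 - s)) (absv y)" using near by blast
    have "gnorm P 0 (absv y) <= gnorm Q 0 (absv y)" using le[OF y(1,3,4)] gn[OF PQ(1) y(5)] gn[OF PQ(2) y(5)] by simp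
    then show "EX r'. \<bar>r' - absv c\<bar> < dl & gnorm P 0 r' <= gnorm Q 0 r'" using y by (intro exI[of _ "absv y"]) auto
  qed
  have inPs: "fst PQ : Ps" "snd PQ : Ps" if "PQ : L U" for PQ using U that unfolding Ps_def by blast+
  have inPs': "p U : Ps" "smult ep (q U) : Ps" using U unfolding Ps_def by blast+
  have generic_small: "absv (h y) <= absv ep" if y: "absv y = absv c" "ALL s:S. absv (y - s) = max (absv (0 - s)) (absv y)" for y
  proof -
    have "absv (poly (fst PQ) y) <= absv (poly (snd PQ) y)" if PQ: "PQ : L U" for PQ
    proof -
      have "gnorm (fst PQ) 0 (absv c) <= gnorm (snd PQ) 0 (absv c)"
        by (rule lim[OF inPs[OF PQ]]) (use mem[OF U] PQ in blast)
      then show ?thesis using gn[OF inPs(1)[OF PQ] y(2)] gn[OF inPs(2)[OF PQ] y(2)] y(1) by simp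
    qed
    then have yU: "y : U" using mem[OF U] by blast
    have "gnorm (p U) 0 (absv c) <= gnorm (smult ep (q U)) 0 (absv c)"
    proof (rule lim[OF inPs'])
      fix w assume w: "w : U" "absv w < absv c" "absv a <= absv w"
      have "absv (poly (p U) w / poly (q U) w) <= absv ep" using ap[OF U w(1)] zero[OF w(3,2)] by simp
      then show "absv (poly (p U) w) <= absv (poly (smult ep (q U)) w)"
        using q0[OF U w(1)] by (simp add: absv_divide absv_mult divide_le_eq)
    qed
    then have "absv (poly (p U) y) <= absv ep * absv (poly (q U) y)"
      using gn[OF inPs'(1) y(2)] gn[OF inPs'(2) y(2)] y(1) by (simp add: absv_mult)
    then have "absv (poly (p U) y / poly (q U) y) <= absv ep" using q0[OF U yU] by (simp add: absv_divide divide_le_eq)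
    then show ?thesis using ap[OF U yU] absv_add_le'[of "h y - poly (p U) y / poly (q U) y" "absv ep" "poly (p U) y / poly (q U) y"] by simp
  qed
  have "absv (h z) <= absv ep"
  proof (rule rigidA_maximum_principle[OF a _ h _ finS])
    fix y assume y: "absv y = absv a \<or> absv y = absv c" "ALL s:S. absv y <= absv (y - s)"
    show "absv (h y) <= absv ep"
    proof (cases "absv y = absv c")
      case True
      have "absv (y - s) = max (absv (0 - s)) (absv y)" if s: "s : S" for s
        using absv_ultra_eq[of y 0 s] y(2) s by simp
      then show ?thesis using generic_small[OF True] by blast
    qed (use y ac zero in auto)
  qed (use ac z in auto)
  then show False using ep(2) by simp
qed

text \<open>Inside the circle the bounds tend to 0. On the circle itself they do not, and the
  vanishing comes from \<open>rigidA_zero_boundary\<close>.\<close>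

lemma pd_zero:
  fixes c :: "'a::complete_nonarch_field"
  assumes c: "c ~= 0" and pd: "pd c C u"
    and u: "!!n z. z ~= 0 ==> absv z <= absv c ==> absv (u z) <= C * (absv z / absv c) ^ n"
  shows "u c = 0"
proof -
  have z0: "u z = 0" if z: "z ~= 0" "absv z < absv c" for z
  proof -
    have "(%n. C * (absv z / absv c) ^ n) \<longlonglongrightarrow> C * 0" by (intro tendsto_intros LIMSEQ_realpow_zero) (use z c in auto)
    then have "absv (u z) <= C * 0" by (rule LIMSEQ_le_const) (use u z in auto)
    then show ?thesis by simp
  qed
  have "EX a::'a. a ~= 0 & absv a < absv c" by (rule absv_small) (use c in simp)
  then obtain a :: 'a where a: "a ~= 0" "absv a < absv c" by blast
  show ?thesis
  proof (rule rigidA_zero_boundary[OF a, where h = u and z = c])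
    show "rigidA a c u" using pd a unfolding pd_def by auto
    show "u z = 0" if "absv a <= absv z" "absv z < absv c" for z
      using z0[of z] that a by (metis absv_pos_iff less_le_trans)
  qed simp
qed

text \<open>The third clause yields a nonzero coefficient from a nonzero value at \<open>c\<close>
  itself: the radius will be given by a point where the pullback does not vanish.\<close>

lemma pd_taylor:
  fixes c :: "'a::complete_nonarch_field"
  assumes c: "c ~= 0" and pd: "pd c C u"
  shows "EX cs hs. (ALL b e. b ~= 0 --> absv b < absv c --> (EX H:an (disc b). H 0 = cs e & (ALL z. z ~= 0 --> absv z <= absv b --> H z = hs e z))) &
     (ALL e. (ALL n<e. cs n = 0) --> (ALL z. z ~= 0 --> absv z <= absv c --> u z = z ^ e * hs e z)) &
     ((ALL n. cs n = 0) --> u c = 0)"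
proof -
  let ?D = "{z. z ~= 0 & absv z <= absv c}"
  have "EX cs hs. hs 0 = u & (ALL N. pd c (C / absv c ^ N) (hs N) & absv (cs N :: 'a) <= C / absv c ^ N & (ALL z:?D. hs N z = cs N + z * hs (Suc N) z))"
    by (rule taylor_iterate[where P = "pd c"]) (use pd pd_step[OF c] in simp_all)
  then obtain cs hs where hs0: "hs 0 = u" and tay: "ALL N. pd c (C / absv c ^ N) (hs N) & absv (cs N :: 'a) <= C / absv c ^ N &
     (ALL z:?D. hs N z = cs N + z * hs (Suc N) z)" by (elim exE conjE)
  have pdN: "pd c (C / absv c ^ N) (hs N)" and csN: "absv (cs N) <= C / absv c ^ N" for N
    using tay by blast+
  have step: "hs N z = cs N + z * hs (Suc N) z" if "z : ?D" for N z using tay that by blast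
  have hsb: "absv (hs N z) <= C / absv c ^ N" if "z : ?D" for N z using pdN[of N] that unfolding pd_def by auto
  have low: "ALL n<e. cs n = 0 ==> z : ?D ==> u z = z ^ e * hs e z" for e z
  proof (induction e)
    case (Suc e)
    then show ?case using step[OF Suc.prems(2), of e] by simp
  qed (simp add: hs0)
  have an: "EX H:an (disc b). H 0 = cs e & (ALL z:?D. absv z <= absv b --> H z = hs e z)" if "b ~= 0" "absv b < absv c" for b e
    by (rule series_an[OF that csN hsb step])
  have "u c = 0" if cs0: "ALL n. cs n = 0"
  proof (rule pd_zero[OF c pd])
    fix n and z :: 'a assume z: "z ~= 0" "absv z <= absv c"
    have "absv (u z) = absv z ^ n * absv (hs n z)" using low[of n z] cs0 z by (simp add: absv_mult absv_power)
    also have "\<dots> <= absv z ^ n * (C / absv c ^ n)" by (rule mult_left_mono) (use hsb z in auto)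
    finally show "absv (u z) <= C * (absv z / absv c) ^ n" by (simp add: power_divide mult.commute)
  qed
  moreover have "ALL b e. b ~= 0 --> absv b < absv c --> (EX H:an (disc b). H 0 = cs e & (ALL z. z ~= 0 --> absv z <= absv b --> H z = hs e z))"
  proof (intro allI impI)
    fix b :: 'a and e assume b: "b ~= 0" "absv b < absv c"
    obtain H where "H : an (disc b)" "H 0 = cs e" and H: "ALL z:?D. absv z <= absv b --> H z = hs e z" using an[OF b, of e] by blast
    moreover have "ALL z. z ~= 0 --> absv z <= absv b --> H z = hs e z" using H b(2) by simp
    ultimately show "EX H:an (disc b). H 0 = cs e & (ALL z. z ~= 0 --> absv z <= absv b --> H z = hs e z)" by blast
  qed
  moreover have "ALL e. (ALL n<e. cs n = 0) --> (ALL z. z ~= 0 --> absv z <= absv c --> u z = z ^ e * hs e z)"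
    using low by simp
  ultimately show ?thesis by (intro exI[of _ cs] exI[of _ hs] conjI impI)
qed

section \<open>The pullback of the twisted jet differential\<close>

locale jet_map =
  fixes N k m d M :: nat and X D :: "'a::complete_nonarch_field ppoint set" and f :: "'a \<Rightarrow> 'a ppoint"
    and R :: real and Vs :: "'a ppoint set list" and g :: "nat \<Rightarrow> nat \<Rightarrow> 'a ppoint \<Rightarrow> 'a"
    and s :: "nat \<Rightarrow> nat \<Rightarrow> 'a ppoint \<Rightarrow> 'a" and \<Omega> :: "'a jet_expression set"
  assumes X: "projective_variety N X" and f: "rigid_map_punctured_disc R (X - D) f"
    and lb: "line_bundle X Vs g"
    and sec: "!!r. r <= M ==> bundle_section X Vs (%i j p. g i j p ^ d) (s r)"
    and sec_nz: "!!i p. i < length Vs ==> p : Vs ! i ==> EX r<=M. s r i p ~= 0"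
    and \<Omega>: "log_jet_section N X D k m Vs g \<Omega>"
begin

abbreviation J :: "'a jet_expression \<Rightarrow> 'a \<Rightarrow> 'a" where
  "J \<omega> \<equiv> jet_pullback (variety_dim X) k m \<omega> f"

text \<open>A domain on which one local expression can be evaluated along \<open>f\<close>. The last
  clause bounds the logarithmic coordinates away from 0, so that their logarithmic derivatives stay
  in \<open>RA\<close>.\<close>

definition piece :: "'a set \<Rightarrow> 'a jet_expression \<Rightarrow> bool" where
  "piece U \<omega> \<longleftrightarrow> \<omega> : \<Omega> & rdom U & U ~= {} & f ` U \<subseteq> fst (dom \<omega>) & (ALL h:an (dom \<omega>). h \<circ> f : RA U) &
     (ALL i<nlog \<omega>. EX \<delta>>0. ALL z:U. \<delta> <= absv ((coords \<omega> ! i) (f z)))"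

lemma \<Omega>_dom:
  assumes "w : \<Omega>"
  shows "dom w : affinoids N X" "sound (dom w)" "analytic_functions (dom w) = an (dom w)"
    "triv w < length Vs" "fst (dom w) \<subseteq> Vs ! triv w" "log_jet_expression N X D k m w"
proof -
  show l: "log_jet_expression N X D k m w" and "triv w < length Vs" "fst (dom w) \<subseteq> Vs ! triv w"
    using \<Omega> assms unfolding log_jet_section_def by blast+
  show d: "dom w : affinoids N X" using l unfolding log_jet_expression_def by blast
  show "sound (dom w)" using affinoids_presented[OF X d] unfolding presented_def by blast
  then show "analytic_functions (dom w) = an (dom w)" by (rule analytic_functions_eq)
qed

lemma \<Omega>_coords:
  assumes "w : \<Omega>" "p : fst (dom w)"
  shows "length (coords w) = variety_dim X" "i < variety_dim X ==> coords w ! i : an (dom w)" "nlog w <= variety_dim X"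
    "p \<notin> D ==> i < nlog w ==> (coords w ! i) p ~= 0"
proof -
  have l: "set (coords w) \<subseteq> analytic_functions (dom w)" "regular_parameters (variety_dim X) (rigid_nbhds N X p) p (coords w)"
     "fst (dom w) \<inter> D = {p : fst (dom w). (\<Prod>i<nlog w. (coords w ! i) p) = 0}"
    and n: "nlog w <= variety_dim X"
    using \<Omega>_dom(6)[OF assms(1)] assms(2) unfolding log_jet_expression_def by blast+
  show n': "length (coords w) = variety_dim X" using l(2) unfolding regular_parameters_def by blast
  show "nlog w <= variety_dim X" by (rule n)
  show "coords w ! i : an (dom w)" if "i < variety_dim X"
    using l(1) that unfolding n'[symmetric] \<Omega>_dom(3)[OF assms(1)] by auto
  show "(coords w ! i) p ~= 0" if "p \<notin> D" "i < nlog w"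
  proof
    assume "(coords w ! i) p = 0"
    then have "(\<Prod>i<nlog w. (coords w ! i) p) = 0" using that(2) by (intro prod_zero) auto
    then have "p : fst (dom w) \<inter> D" unfolding l(3) using assms(2) by blast
    then show False using that(1) by blast
  qed
qed

lemma \<Omega>_cover: "finite \<Omega>" "p : X ==> EX w:\<Omega>. p : fst (dom w)"
proof -
  have "finite \<Omega>" and U: "(\<Union>w\<in>\<Omega>. fst (dom w)) = X" using \<Omega> by (simp_all add: log_jet_section_def)
  show "finite \<Omega>" by fact
  show "EX w:\<Omega>. p : fst (dom w)" if "p : X" using that unfolding U[symmetric] by blast
qed

lemma f_rigid: "(a::'a) ~= 0 ==> absv a <= absv (b::'a) ==> absv b <= R ==> rigid_map (annulus a b) (X - D) f"
  using f unfolding rigid_map_punctured_disc_def by blast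

lemma f_charts:
  fixes a b :: 'a
  assumes "a ~= 0" "absv a <= absv b" "absv b <= R"
  shows "EX Ws. {z. absv a <= absv z & absv z <= absv b} = \<Union>(fst ` set Ws) & (ALL W:set Ws. goodaff W & f ` fst W \<subseteq> X - D &
     (EX i. f ` fst W \<subseteq> unit_chart i & (ALL j. ratio j i \<circ> f : an W)))"
proof -
  obtain Ws where fX: "f ` fst (annulus a b) \<subseteq> X - D" and Ws: "fst (annulus a b) = \<Union>(fst ` set Ws)"
     "ALL W':set Ws. rational_subdomain (annulus a b) W' &
        (EX i. f ` fst W' \<subseteq> unit_chart i & (ALL j. ratio j i \<circ> f : analytic_functions W'))"
    using f_rigid[OF assms] unfolding rigid_map_def by (elim exE conjE)
  show ?thesis
  proof (intro exI[of _ Ws] conjI[of "_ = _"] ballI)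
    show "{z. absv a <= absv z & absv z <= absv b} = \<Union>(fst ` set Ws)" using Ws(1) unfolding annulus_def by (simp only: fst_conv)
    fix W assume W: "W : set Ws"
    have sub: "rational_subdomain (annulus a b) W" using Ws(2)[rule_format, OF W] by (elim conjE)
    have "goodaff W" by (rule goodaff_rational[OF goodaff_annulus[OF assms(1,2)] sub])
    moreover have "f ` fst W \<subseteq> X - D" using rational_subdomain_subset[OF sub] fX by blast
    moreover have "EX i. f ` fst W \<subseteq> unit_chart i & (ALL j. ratio j i \<circ> f : an W)"
      using Ws(2)[rule_format, OF W] unfolding analytic_functions_eq[OF goodaff_sound[OF \<open>goodaff W\<close>]] by (elim conjE)
    ultimately show "goodaff W & f ` fst W \<subseteq> X - D & (EX i. f ` fst W \<subseteq> unit_chart i & (ALL j. ratio j i \<circ> f : an W))" by (intro conjI)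
  qed
qed

lemma pieces:
  fixes a b :: 'a
  assumes ab: "a ~= 0" "absv a <= absv b" "absv b <= R"
  shows "EX \<U>. finite \<U> & \<Union>\<U> = {z. absv a <= absv z & absv z <= absv b} & (ALL U:\<U>. EX w. piece U w)"
proof -
  obtain Ws where cov: "{z. absv a <= absv z & absv z <= absv b} = \<Union>(fst ` set Ws)" and Ws: "ALL W:set Ws. goodaff W & f ` fst W \<subseteq> X - D &
     (EX i. f ` fst W \<subseteq> unit_chart i & (ALL j. ratio j i \<circ> f : an W))" using f_charts[OF ab] by (elim exE conjE)
  let ?U = "%W w. {z : fst W. f z : fst (dom w)}"
  \<comment> \<open>Empty preimages are discarded: the number of coordinates of a local expression
    is known only through a point of its domain.\<close>
  let ?\<U> = "(%(W, w). ?U W w) ` (set Ws \<times> \<Omega>) - {{}}"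
  have "finite ?\<U>" by (intro finite_Diff finite_imageI finite_cartesian_product finite_set \<Omega>_cover(1))
  moreover have "\<Union>?\<U> = \<Union>(fst ` set Ws)"
  proof (intro equalityI subsetI)
    fix z assume "z : \<Union>(fst ` set Ws)"
    then obtain W where W: "W : set Ws" "z : fst W" by blast
    then have "f z : X" using Ws[rule_format, OF W(1)] by blast
    then obtain w where "w : \<Omega>" "f z : fst (dom w)" using \<Omega>_cover(2) by blast
    then have zU: "z : ?U W w" and mem: "?U W w : (%(W, w). ?U W w) ` (set Ws \<times> \<Omega>)" using W by auto
    have "?U W w \<notin> {{}}" using zU by blast
    then show "z : \<Union>?\<U>" by (rule UnionI[OF DiffI[OF mem] zU])
  qed auto
  moreover have "EX w. piece U w" if "U : ?\<U>" for U
  proof -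
    obtain W w where W: "W : set Ws" "w : \<Omega>" and U: "U = ?U W w" "U ~= {}" using \<open>U \<in> ?\<U>\<close> by auto
    obtain i where i: "f ` fst W \<subseteq> unit_chart i" "ALL j. ratio j i \<circ> f : an W" and good: "goodaff W" and fX: "f ` fst W \<subseteq> X - D"
      using Ws[rule_format, OF W(1)] by (elim exE conjE)
    have "EX W'. goodaff W' & fst W' = {z : fst W. f z : fst (dom w)} & (ALL h:an (dom w). h \<circ> f : an W')"
    proof (rule affinoid_preimage[OF X \<Omega>_dom(1)[OF W(2)] good])
      show "ratio j i \<circ> f : an W" for j using i(2) by (rule spec)
    qed (use fX i(1) in blast)+
    then obtain W' where W': "goodaff W'" "fst W' = U" "ALL h:an (dom w). h \<circ> f : an W'" unfolding U(1)[symmetric] by (elim exE conjE)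
    have fU: "f z : fst (dom w)" "f z \<notin> D" if "z : U" for z using that U(1) fX by auto
    \<comment> \<open>\<open>f\<close> avoids the divisor, so a logarithmic coordinate has no zero
      on this affinoid, and the Nullstellensatz bounds it from below.\<close>
    have "EX d>0. ALL z:U. d <= absv ((coords w ! i) (f z))" if il: "i < nlog w" for i
    proof -
      obtain z0 where "z0 : U" using U(2) by blast
      then have "coords w ! i : an (dom w)" using \<Omega>_coords(2,3)[OF W(2) fU(1)] il by fastforce
      then have "{(coords w ! i) \<circ> f} \<subseteq> an W'" using W'(3) by simp
      then have "EX d>0. ALL p:fst W'. EX h:{(coords w ! i) \<circ> f}. absv (h p) \<ge> d"
      proof (rule presented_lower_bound[rotated])
        show "presented W'" using W'(1) unfolding goodaff_def by (elim conjE)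
        fix z assume "z : fst W'"
        then show "EX h:{(coords w ! i) \<circ> f}. h z ~= 0" using \<Omega>_coords(4)[OF W(2) fU(1) fU(2) il] unfolding W'(2) by simp
      qed
      then show ?thesis unfolding W'(2) by simp
    qed
    moreover have "ALL h:an (dom w). h \<circ> f : RA U" using W'(3) an_RA[OF W'(1)] unfolding W'(2) by blast
    moreover have "rdom U" using W'(1,2) unfolding goodaff_def by blast
    moreover have "f ` U \<subseteq> fst (dom w)" using fU(1) by blast
    ultimately have "piece U w" unfolding piece_def using W(2) U(2) by (intro conjI allI impI)
    then show ?thesis by (rule exI)
  qed
  ultimately show ?thesis unfolding cov by (intro exI[of _ ?\<U>] conjI ballI)
qed

lemma pieceD:
  assumes "piece U w"
  shows "w : \<Omega>" "rdom U" "U ~= {}" "!!z. z : U ==> f z : fst (dom w)" "!!h. h : an (dom w) ==> h \<circ> f : RA U"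
    "!!i. i < nlog w ==> EX d>0. ALL z:U. d <= absv ((coords w ! i) (f z))"
    "!!i. i < variety_dim X ==> (coords w ! i) \<circ> f : RA U"
proof -
  show 1: "w : \<Omega>" "rdom U" "U ~= {}" "!!z. z : U ==> f z : fst (dom w)" "!!h. h : an (dom w) ==> h \<circ> f : RA U"
    "!!i. i < nlog w ==> EX d>0. ALL z:U. d <= absv ((coords w ! i) (f z))"
    using assms unfolding piece_def by auto
  obtain z where "z : U" using 1(3) by blast
  then show "(coords w ! i) \<circ> f : RA U" if "i < variety_dim X" for i
    using 1(5)[OF \<Omega>_coords(2)[OF 1(1) 1(4) that]] by blast
qed

text \<open>For \<open>1 <= B\<close> the bound \<open>B / r ^ j\<close> also covers the logarithmic
  symbols, whose own bound is \<open>1 / r ^ j\<close>.\<close>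

lemma piece_symbol:
  assumes p: "piece U w" and i: "i < variety_dim X"
  shows "jet_symbol w f j i : RA U"
    and "1 <= j ==> 1 <= B ==> (!!q. q : fst (dom w) ==> absv ((coords w ! i) q) <= B) ==>
      0 < r ==> (!!z. absv (z - x) < r ==> z : U) ==> absv (jet_symbol w f j i x) <= B / r ^ j"
proof -
  let ?h = "(coords w ! i) \<circ> f"
  note U = pieceD(2)[OF p] and h = pieceD(7)[OF p i]
  show "jet_symbol w f j i : RA U"
  proof (cases "i < nlog w")
    case True
    obtain d where d: "d > 0" "ALL z:U. d <= absv ((coords w ! i) (f z))" using pieceD(6)[OF p True] by blast
    have "(%z. inverse (?h z)) : RA U" by (rule RA_inverse[OF U h d(1)]) (use d(2) in simp)
    then have "(%z. nonarch_deriv ?h z / ?h z) : RA U"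
      using RA_mult[OF U RA_deriv(1)[OF U h]] by (simp add: divide_inverse)
    then show ?thesis unfolding jet_symbol_def Let_def using True RA_funpow_deriv[OF U] by simp
  next
    case False
    then show ?thesis unfolding jet_symbol_def Let_def using RA_funpow_deriv[OF U h] by simp
  qed
  assume j: "1 <= j" and B: "1 <= B" "!!q. q : fst (dom w) ==> absv ((coords w ! i) q) <= B"
    and r: "0 < r" "!!z. absv (z - x) < r ==> z : U"
  show "absv (jet_symbol w f j i x) <= B / r ^ j"
  proof (cases "i < nlog w")
    case True
    obtain d where d: "d > 0" "ALL z:U. d <= absv ((coords w ! i) (f z))" using pieceD(6)[OF p True] by blast
    have "absv ((nonarch_deriv ^^ (j - 1)) (%z. nonarch_deriv ?h z / ?h z) x) <= 1 / r ^ Suc (j - 1)"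
      by (rule log_deriv_bound(2)[OF U h d(1) _ r]) (use d(2) in simp_all)
    also have "\<dots> <= B / r ^ j" using j B(1) r(1) by (simp add: divide_right_mono)
    finally show ?thesis unfolding jet_symbol_def Let_def using True by simp
  next
    case False
    have "absv ((nonarch_deriv ^^ j) ?h x) <= B / r ^ j"
    proof (rule funpow_deriv_bound[OF U h r])
      show "absv (((coords w ! i) \<circ> f) z) <= B" if "absv (z - x) < r" for z using B(2)[OF pieceD(4)[OF p r(2)[OF that]]] by simp
    qed (use r in auto)
    then show ?thesis unfolding jet_symbol_def Let_def using False by simp
  qed
qed

lemma piece_J:
  assumes p: "piece U w" shows "J w : RA U"
proof -
  note U = pieceD(2)[OF p]
  have "(%x. coeffs w mu (f x) * (\<Prod>(j, i)\<in>Poly_Mapping.keys mu. jet_symbol w f j i x ^ Poly_Mapping.lookup mu (j, i))) : RA U"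
    if mu: "mu : jet_monomials (variety_dim X) k m" for mu
  proof (rule RA_mult[OF U])
    have "coeffs w mu : an (dom w)"
      using \<Omega>_dom(6)[OF pieceD(1)[OF p]] mu unfolding log_jet_expression_def \<Omega>_dom(3)[OF pieceD(1)[OF p]] by blast
    then show "(%x. coeffs w mu (f x)) : RA U" using pieceD(5)[OF p] by (simp add: comp_def)
    have "(%x. \<Prod>v\<in>Poly_Mapping.keys mu. jet_symbol w f (fst v) (snd v) x ^ Poly_Mapping.lookup mu v) : RA U"
    proof (intro RA_prod RA_power U)
      fix v assume "v : Poly_Mapping.keys mu"
      then have "snd v < variety_dim X" using mu unfolding jet_monomials_def by auto
      then show "jet_symbol w f (fst v) (snd v) : RA U" by (rule piece_symbol(1)[OF p])
    qed
    then show "(%x. \<Prod>(j, i)\<in>Poly_Mapping.keys mu. jet_symbol w f j i x ^ Poly_Mapping.lookup mu (j, i)) : RA U"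
      by (simp add: case_prod_beta)
  qed
  then show ?thesis unfolding jet_pullback_def by (rule RA_sum)
qed

text \<open>The weights in a monomial add up to \<open>m\<close>, so the powers of \<open>r\<close>
  combine to \<open>r ^ m\<close>. The constant depends on the local expression alone, not on the
  piece, the point or the radius.\<close>

lemma J_bound:
  assumes w: "w : \<Omega>"
  shows "EX C>=0. ALL U x r. piece U w --> 0 < r --> (ALL z. absv (z - x) < r --> z : U) --> absv (J w x) <= C / r ^ m"
proof -
  let ?n = "variety_dim X" and ?A = "jet_monomials (variety_dim X) k m"
  have "EX B>0. ALL p:fst (dom w). absv (h p) <= B" if "h : an (dom w)" for h
    using an_bounded[OF \<Omega>_dom(2)[OF w] that] .
  then have "ALL h. EX B. h : an (dom w) --> B > 0 & (ALL p:fst (dom w). absv (h p) <= B)" by blast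
  then obtain b where b: "ALL h. h : an (dom w) --> b h > 0 & (ALL p:fst (dom w). absv (h p) <= b h)" by (rule choice[THEN exE])
  define B where "B = Max (insert 1 ((%i. b (coords w ! i)) ` {..<?n}))"
  have Bb: "b (coords w ! i) <= B" if "i < ?n" for i unfolding B_def using that by auto
  have B1: "1 <= B" unfolding B_def by simp
  define C where "C = (%mu. b (coeffs w mu) * (\<Prod>v\<in>Poly_Mapping.keys mu. B ^ Poly_Mapping.lookup mu v))"
  have coeff: "coeffs w mu : an (dom w)" if "mu : ?A" for mu
      using \<Omega>_dom(6)[OF w] that unfolding log_jet_expression_def \<Omega>_dom(3)[OF w] by blast
  have C0: "0 <= C mu" if "mu : ?A" for mu
    unfolding C_def using b coeff[OF that] B1 by (intro mult_nonneg_nonneg prod_nonneg) (auto simp: less_imp_le)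
  have main: "absv (J w x) <= (\<Sum>mu\<in>?A. C mu) / r ^ m"
    if p: "piece U w" and r: "0 < r" "ALL z. absv (z - x) < r --> z : U" for U x r
  \<comment> \<open>Over an infinite index set both sums would be 0 by convention, and the bound
    would hold trivially.\<close>
  proof (cases "finite ?A")
    case True
    have xU: "f x : fst (dom w)" using pieceD(4)[OF p, of x] r by simp
    have sym: "absv (jet_symbol w f j i x) <= B / r ^ j" if "1 <= j" "i < ?n" for j i
    proof (rule piece_symbol(2)[OF p that(2,1) B1 _ r(1)])
      fix q assume q: "q : fst (dom w)"
      have "absv ((coords w ! i) q) <= b (coords w ! i)" using b \<Omega>_coords(2)[OF w q that(2)] q by blast
      then show "absv ((coords w ! i) q) <= B" using Bb[OF that(2)] by linarith
    qed (use r(2) in blast)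
    show ?thesis unfolding jet_pullback_def
    proof (rule absv_sum_le)
      fix mu assume mu: "mu : ?A"
      let ?K = "Poly_Mapping.keys mu" and ?l = "Poly_Mapping.lookup mu"
      have mem: "1 <= fst v" "snd v < ?n" if "v : ?K" for v using mu that unfolding jet_monomials_def by auto
      have wt: "(\<Sum>v\<in>?K. fst v * ?l v) = m" using mu unfolding jet_monomials_def by (simp add: case_prod_beta)
      have "absv (coeffs w mu (f x) * (\<Prod>(j, i)\<in>?K. jet_symbol w f j i x ^ ?l (j, i))) =
         absv (coeffs w mu (f x)) * (\<Prod>v\<in>?K. absv (jet_symbol w f (fst v) (snd v) x) ^ ?l v)"
        by (simp add: absv_mult absv_prod absv_power case_prod_beta)
      also have "\<dots> <= b (coeffs w mu) * (\<Prod>v\<in>?K. (B / r ^ fst v) ^ ?l v)"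
      proof (rule mult_mono)
        show "absv (coeffs w mu (f x)) <= b (coeffs w mu)" using b coeff[OF mu] xU by blast
        show "0 <= b (coeffs w mu)" using b coeff[OF mu] by (simp add: less_imp_le)
        show "(\<Prod>v\<in>?K. absv (jet_symbol w f (fst v) (snd v) x) ^ ?l v) <= (\<Prod>v\<in>?K. (B / r ^ fst v) ^ ?l v)"
          using sym mem by (intro prod_mono conjI power_mono) auto
        show "0 <= (\<Prod>v\<in>?K. absv (jet_symbol w f (fst v) (snd v) x) ^ ?l v)" by (intro prod_nonneg) auto
      qed
      also have "(\<Prod>v\<in>?K. (B / r ^ fst v) ^ ?l v) = (\<Prod>v\<in>?K. B ^ ?l v) / (\<Prod>v\<in>?K. r ^ (fst v * ?l v))"
        by (simp add: power_divide power_mult prod_dividef)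
      also have "(\<Prod>v\<in>?K. r ^ (fst v * ?l v)) = r ^ m" unfolding wt[symmetric] by (simp add: power_sum)
      finally have "absv (coeffs w mu (f x) * (\<Prod>(j, i)\<in>?K. jet_symbol w f j i x ^ ?l (j, i))) <= C mu / r ^ m"
        unfolding C_def by simp
      also have "\<dots> <= (\<Sum>mu\<in>?A. C mu) / r ^ m"
        using member_le_sum[OF mu, of C] C0 True r(1) by (intro divide_right_mono) auto
      finally show "absv (coeffs w mu (f x) * (\<Prod>(j, i)\<in>?K. jet_symbol w f j i x ^ ?l (j, i))) <= (\<Sum>mu\<in>?A. C mu) / r ^ m" .
    qed (use C0 r(1) in \<open>auto intro!: divide_nonneg_nonneg sum_nonneg\<close>)
  qed (simp add: jet_pullback_def)
  have "0 <= (\<Sum>mu\<in>?A. C mu)" using C0 by (rule sum_nonneg)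
  then show ?thesis
  proof (intro exI[of _ "\<Sum>mu\<in>?A. C mu"] conjI allI impI)
    fix U x r assume "piece U w" "0 < r" "ALL z. absv (z - x) < r --> z : U"
    then show "absv (J w x) <= (\<Sum>mu\<in>?A. C mu) / r ^ m" by (rule main)
  qed
qed

end

lemma rational_subdomain_refl: "sound W ==> rational_subdomain W W"
  unfolding rational_subdomain_def
  by (intro exI[of _ "%_. 1"] exI[of _ "[]"]) (auto simp: analytic_functions_eq an_const)

lemma rigid_map_single:
  assumes W: "sound W" and "f ` fst W \<subseteq> Y" "f ` fst W \<subseteq> unit_chart i" "!!j. ratio j i \<circ> f : an W"
  shows "rigid_map W Y f"
proof -
  have "EX i. f ` fst W \<subseteq> unit_chart i & (ALL j. ratio j i \<circ> f : analytic_functions W)"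
    unfolding analytic_functions_eq[OF W] using assms(3,4) by (intro exI[of _ i] conjI allI)
  then show ?thesis unfolding rigid_map_def using assms(2) rational_subdomain_refl[OF W]
    by (intro conjI exI[of _ "[W]"] ballI) simp_all
qed

lemma sound_disc: "sound (disc (b::'a::complete_nonarch_field))"
  unfolding sound_def disc_def by (auto simp: absv_divide divide_le_eq)

context jet_map
begin

text \<open>
  The twists of the section and of the \<open>d\<close>-th power of the jet differential cancel, so this function on
  the punctured disc does not depend on the local expression.
\<close>

definition G :: "nat \<Rightarrow> 'a jet_expression \<Rightarrow> 'a \<Rightarrow> 'a" where
  "G r \<omega> \<xi> = s r (triv \<omega>) (f \<xi>) * J \<omega> \<xi> ^ d"

lemma sec_regular:
  assumes "r <= M" "i < length Vs"
  shows "s r i : regular_functions X (Vs ! i)"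
    and "j < length Vs ==> p : Vs ! i ==> p : Vs ! j ==> s r i p = g i j p ^ d * s r j p"
  using sec[OF assms(1)] assms(2) unfolding bundle_section_def by blast+

lemma sec_an: "r <= M ==> w : \<Omega> ==> s r (triv w) : an (dom w)"
  by (rule regular_function_analytic[OF X \<Omega>_dom(1) sec_regular(1) \<Omega>_dom(5)]) (simp_all add: \<Omega>_dom(4))

lemma piece_G:
  assumes p: "piece U w" and r: "r <= M" shows "G r w : RA U"
proof -
  have "(%x. (s r (triv w) \<circ> f) x * J w x ^ d) : RA U"
    by (intro RA_mult[OF pieceD(2)[OF p]] RA_power[OF pieceD(2)[OF p]] piece_J[OF p] pieceD(5)[OF p] sec_an[OF r pieceD(1)[OF p]])
  then show ?thesis by (rule RA_cong) (simp add: G_def)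
qed

lemma G_bound:
  assumes w: "w : \<Omega>" and r: "r <= M"
  shows "EX C>=0. ALL U x t. piece U w --> 0 < t --> (ALL z. absv (z - x) < t --> z : U) --> absv (G r w x) <= C / t ^ (m * d)"
proof -
  obtain C where C0: "C \<ge> 0" and C: "ALL U x t. piece U w --> 0 < t --> (ALL z. absv (z - x) < t --> z : U) --> absv (J w x) <= C / t ^ m"
    using J_bound[OF w] by (elim exE conjE)
  obtain B where B: "B > 0" "ALL p:fst (dom w). absv (s r (triv w) p) <= B" using an_bounded[OF \<Omega>_dom(2)[OF w] sec_an[OF r w]] by blast
  have "absv (G r w x) <= B * C ^ d / t ^ (m * d)"
    if p: "piece U w" and t: "0 < t" "ALL z. absv (z - x) < t --> z : U" for U x t
  proof -
    have "f x : fst (dom w)" by (rule pieceD(4)[OF p]) (use t in simp)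
    then have "absv (G r w x) <= B * (C / t ^ m) ^ d"
      unfolding G_def absv_mult absv_power using C[rule_format, OF p t(1) t(2)[rule_format]] B C0 t(1)
      by (intro mult_mono power_mono) auto
    then show ?thesis by (simp add: power_divide power_mult)
  qed
  then show ?thesis using B(1) C0 by (intro exI[of _ "B * C ^ d"] conjI allI impI) auto
qed

text \<open>Two local expressions are compared along the translates of the map \<open>f\<close> to small discs.\<close>

lemma J_compat:
  assumes om: "om : \<Omega>" "om' : \<Omega>" and x: "x ~= 0" "absv x <= R" and dom: "f x : fst (dom om)" "f x : fst (dom om')"
  shows "J om x = inverse (g (triv om) (triv om') (f x)) * J om' x"
proof -
  let ?ga = "%z. f (x + z)"
  obtain Ws where cov: "{z. absv x <= absv z & absv z <= absv x} = \<Union>(fst ` set Ws)" and Ws: "ALL W:set Ws. goodaff W & f ` fst W \<subseteq> X - D &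
     (EX i. f ` fst W \<subseteq> unit_chart i & (ALL j. ratio j i \<circ> f : an W))" using f_charts[OF x(1) order_refl x(2)] by (elim exE conjE)
  have "x : \<Union>(fst ` set Ws)" unfolding cov[symmetric] by simp
  then obtain W where W: "W : set Ws" "x : fst W" by blast
  obtain i where i: "f ` fst W \<subseteq> unit_chart i" "ALL j. ratio j i \<circ> f : an W" and good: "goodaff W" and fX: "f ` fst W \<subseteq> X - D"
    using Ws[rule_format, OF W(1)] by (elim exE conjE)
  have rd: "rdom (fst W)" using good unfolding goodaff_def by (elim conjE)
  obtain c :: 'a where c: "c ~= 0" and cW: "!!z w. z : fst W ==> absv (w - z) <= absv c ==> w : fst W"
    by (rule rdom_radius[OF rd]) blast
  have in_W: "x + z : fst W" if "absv z <= absv c" for z by (rule cW[OF W(2)]) (use that in simp)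
  \<comment> \<open>\<open>RA_ball_an\<close> expands a function only on strictly smaller
    discs.\<close>
  have "EX b::'a. b ~= 0 & absv b < absv c" by (rule absv_small) (use c in simp)
  then obtain b :: 'a where b: "b ~= 0" "absv b < absv c" by blast
  have rat: "ratio j i \<circ> ?ga : an (disc b)" for j
  proof -
    have "(%z. (ratio j i \<circ> f) (x + z)) : RA {z. absv z <= absv c}"
      by (rule RA_shift[OF an_RA[OF good spec[OF i(2)]] in_W])
    from RA_ball_an[OF c this b] show ?thesis by (simp add: comp_def)
  qed
  have "?ga z : X - D & ?ga z : unit_chart i" if "absv z <= absv b" for z
    using in_W[of z] that b(2) fX i(1) by fastforce
  then have "rigid_map (disc b) (X - D) ?ga"
    by (intro rigid_map_single[OF sound_disc _ _ rat]) (auto simp: disc_def)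
  then have "jet_pullback (variety_dim X) k m om ?ga 0 = inverse (g (triv om) (triv om') (?ga 0)) * jet_pullback (variety_dim X) k m om' ?ga 0"
    using \<Omega>[unfolded log_jet_section_def, THEN conjunct2, THEN conjunct2, THEN conjunct2, rule_format, OF om, of b ?ga] dom b(1) by simp
  then show ?thesis by (simp add: jet_pullback_shift)
qed

lemma G_compat:
  assumes w: "w : \<Omega>" "w' : \<Omega>" and x: "x ~= 0" "absv x <= R" and dom: "f x : fst (dom w)" "f x : fst (dom w')" and r: "r <= M"
  shows "G r w x = G r w' x"
proof -
  let ?t = "triv w" and ?t' = "triv w'" and ?p = "f x"
  note t = \<Omega>_dom(4)[OF w(1)] \<Omega>_dom(4)[OF w(2)]
  have p: "?p : Vs ! ?t" "?p : Vs ! ?t'" using \<Omega>_dom(5)[OF w(1)] \<Omega>_dom(5)[OF w(2)] dom by blast+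
  have "g ?t ?t' ?p * g ?t' ?t ?p = g ?t ?t ?p" "g ?t ?t ?p = 1" using lb t p unfolding line_bundle_def by blast+
  then have g0: "g ?t ?t' ?p ~= 0" by auto
  have "G r w x = (g ?t ?t' ?p ^ d * s r ?t' ?p) * (inverse (g ?t ?t' ?p) * J w' x) ^ d"
    unfolding G_def J_compat[OF w x dom] sec_regular(2)[OF r t p] ..
  also have "\<dots> = G r w' x" unfolding G_def using g0 by (simp add: power_mult_distrib power_inverse field_simps)
  finally show ?thesis .
qed

text \<open>By \<open>G_compat\<close> the value does not depend on the chosen local
  expression.\<close>

definition Gt :: "nat \<Rightarrow> 'a \<Rightarrow> 'a" where
  "Gt r \<xi> = G r (SOME \<omega>. \<omega> : \<Omega> & f \<xi> : fst (dom \<omega>)) \<xi>"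

lemma Gt_eq:
  assumes "w : \<Omega>" "f x : fst (dom w)" "x ~= 0" "absv x <= R" "r <= M"
  shows "Gt r x = G r w x"
proof -
  let ?w = "SOME w. w : \<Omega> & f x : fst (dom w)"
  have "?w : \<Omega> & f x : fst (dom ?w)" by (rule someI[of _ w]) (use assms in blast)
  then show ?thesis unfolding Gt_def using assms by (intro G_compat) auto
qed

lemma piece_Gt:
  assumes "piece U w" "r <= M" "!!z. z : U ==> z ~= 0 & absv z <= R"
  shows "Gt r : RA U" "z : U ==> Gt r z = G r w z"
proof -
  have eq: "Gt r z = G r w z" if "z : U" for z
    by (rule Gt_eq[OF pieceD(1)[OF assms(1)] pieceD(4)[OF assms(1) that]]) (use assms(2,3) that in auto)
  then show "Gt r : RA U" by (intro RA_cong[OF piece_G[OF assms(1,2)]])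
  show "z : U ==> Gt r z = G r w z" by (rule eq)
qed

lemma rigid_Gt:
  fixes a b :: 'a
  assumes ab: "a ~= 0" "absv a <= absv b" "absv b <= R" and r: "r <= M"
  shows "rigidA a b (Gt r)"
proof -
  obtain \<U> where \<U>: "finite \<U>" "\<Union>\<U> = {z. absv a <= absv z & absv z <= absv b}" "ALL U:\<U>. EX w. piece U w"
    using pieces[OF ab] by (elim exE conjE)
  have "rdom U & Gt r : RA U" if U: "U : \<U>" for U
  proof -
    obtain w where p: "piece U w" using \<U>(3) U by blast
    have "z ~= 0 & absv z <= R" if "z : U" for z
    proof -
      have "z : \<Union>\<U>" using U that by blast
      then show ?thesis unfolding \<U>(2) using ab by auto
    qed
    then show ?thesis using piece_Gt(1)[OF p r] pieceD(2)[OF p] by blast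
  qed
  then show ?thesis unfolding rigidA_def using \<U>(1,2) by (intro exI[of _ \<U>] conjI ballI) auto
qed

text \<open>Away from finitely many residue discs of the circle, the open disc of radius
  \<open>absv a\<close> around a point lies in a single piece, which gives the largest possible
  Cauchy radius. The constant is fixed before the circle; only the exceptional set depends on
  it.\<close>

lemma Gt_generic:
  assumes r: "r <= M"
  shows "EX C>=0. ALL a::'a. a ~= 0 --> absv a <= R --> (EX S. finite S &
     (ALL z. absv z = absv a --> (ALL s:S. absv z <= absv (z - s)) --> absv (Gt r z) <= C / absv a ^ (m * d)))"
proof -
  have "ALL om. EX C. om : \<Omega> --> C \<ge> 0 & (ALL U x t. piece U om --> 0 < t --> (ALL z. absv (z - x) < t --> z : U) --> absv (G r om x) <= C / t ^ (m * d))"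
    using G_bound[OF _ r] by blast
  then obtain C where C: "ALL om. om : \<Omega> --> C om \<ge> 0 & (ALL U x t. piece U om --> 0 < t --> (ALL z. absv (z - x) < t --> z : U) --> absv (G r om x) <= C om / t ^ (m * d))"
    by (rule choice[THEN exE])
  let ?C = "\<Sum>om\<in>\<Omega>. C om"
  have C0: "0 <= ?C" by (rule sum_nonneg) (use C in blast)
  show ?thesis
  proof (intro exI[of _ ?C] conjI C0 allI impI)
    fix a :: 'a assume a: "a ~= 0" "absv a <= R"
    obtain \<U> where \<U>: "finite \<U>" "\<Union>\<U> = {z. absv a <= absv z & absv z <= absv a}" "ALL U:\<U>. EX om. piece U om"
      using pieces[OF a(1) order_refl a(2)] by (elim exE conjE)
    have "ALL U :: 'a set. EX S. rdom U --> finite S & (ALL x:U. ALL r. (ALL s:S. r <= absv (x - s)) --> {w. absv (w - x) < r} \<subseteq> U)"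
      using rdom_generic_ball by blast
    then obtain S where S: "ALL U :: 'a set. rdom U --> finite (S U) & (ALL x:U. ALL r. (ALL s:S U. r <= absv (x - s)) --> {w. absv (w - x) < r} \<subseteq> U)"
      by (rule choice[THEN exE])
    have rd: "rdom U" if "U : \<U>" for U using \<U>(3) that pieceD(2) by blast
    show "EX S. finite S & (ALL z. absv z = absv a --> (ALL s:S. absv z <= absv (z - s)) --> absv (Gt r z) <= ?C / absv a ^ (m * d))"
    proof (intro exI[of _ "\<Union>U\<in>\<U>. S U"] conjI allI impI)
      show "finite (\<Union>U\<in>\<U>. S U)" using \<U>(1) S rd by blast
      fix z assume z: "absv z = absv a" "ALL s:(\<Union>U\<in>\<U>. S U). absv z <= absv (z - s)"
      have "z : \<Union>\<U>" unfolding \<U>(2) using z(1) by simp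
      then obtain U where U: "U : \<U>" "z : U" by blast
      obtain om where p: "piece U om" using \<U>(3) U by blast
      have sub: "{w. absv (w - z) < absv a} \<subseteq> U"
        using S[rule_format, OF rd[OF U(1)]] U z by auto
      have "absv (G r om z) <= C om / absv a ^ (m * d)"
        by (rule C[rule_format, OF pieceD(1)[OF p], THEN conjunct2, rule_format, OF p]) (use sub a(1) in auto)
      also have "\<dots> <= ?C / absv a ^ (m * d)"
        using member_le_sum[OF pieceD(1)[OF p], of C] C \<Omega>_cover(1) by (intro divide_right_mono) auto
      finally have "absv (G r om z) <= ?C / absv a ^ (m * d)" .
      moreover have "z ~= 0" using z(1) a(1) by (metis absv_eq_0_iff)
      ultimately show "absv (Gt r z) <= ?C / absv a ^ (m * d)"
        using Gt_eq[OF pieceD(1)[OF p] pieceD(4)[OF p U(2)] _ _ r] z(1) a(2) by simp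
    qed
  qed
qed

text \<open>The factor \<open>z ^ (m * d)\<close> makes the generic bounds on all circles equal to
  the same \<open>C\<close>. The maximum principle on the annulus between the circles of
  \<open>z\<close> and \<open>c\<close> then disposes of the exceptional points.\<close>

lemma pd_Gt:
  assumes r: "r <= M"
  shows "EX C. ALL c::'a. c ~= 0 --> absv c <= R --> pd c C (%z. z ^ (m * d) * Gt r z)"
proof -
  let ?u = "%z. z ^ (m * d) * Gt r z"
  obtain C where C0: "C \<ge> 0" and C: "ALL a::'a. a ~= 0 --> absv a <= R --> (EX S. finite S &
     (ALL z. absv z = absv a --> (ALL s:S. absv z <= absv (z - s)) --> absv (Gt r z) <= C / absv a ^ (m * d)))"
    using Gt_generic[OF r] by (elim exE conjE)
  have rig: "rigidA a c ?u" if "a ~= 0" "absv a <= absv c" "absv c <= R" for a c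
    by (intro rigidA_mult rigidA_power[OF that(1)] rigidA_id[OF that(1)] rigid_Gt[OF that r])
  have gen: "EX S. finite S & (ALL z. absv z = absv a --> (ALL s:S. absv z <= absv (z - s)) --> absv (?u z) <= C)"
    if a: "a ~= 0" "absv a <= R" for a :: 'a
  proof -
    obtain S where S: "finite S" "ALL z. absv z = absv a --> (ALL s:S. absv z <= absv (z - s)) --> absv (Gt r z) <= C / absv a ^ (m * d)"
      using C a by blast
    have "absv (?u z) <= C" if z: "absv z = absv a" "ALL s:S. absv z <= absv (z - s)" for z
      using S(2)[rule_format, OF z(1) z(2)[rule_format]] a(1) by (simp add: absv_mult absv_power z(1) field_simps)
    then show ?thesis using S(1) by blast
  qed
  have bound: "absv (?u z) <= C" if c: "absv c <= R" and z: "z ~= 0" "absv z <= absv c" for c z :: 'a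
  proof -
    obtain S1 where S1: "finite S1" "ALL y. absv y = absv z --> (ALL s:S1. absv y <= absv (y - s)) --> absv (?u y) <= C"
      using gen[OF z(1)] z(2) c by (meson order_trans)
    have "c ~= 0" using z by auto
    then obtain S2 where S2: "finite S2" "ALL y. absv y = absv c --> (ALL s:S2. absv y <= absv (y - s)) --> absv (?u y) <= C"
      using gen[OF _ c] by blast
    show ?thesis
    proof (rule rigidA_maximum_principle[OF z(1,2) rig[OF z c] C0])
      show "finite (S1 \<union> S2)" using S1(1) S2(1) by simp
      fix y assume y: "absv y = absv z \<or> absv y = absv c" "ALL s:S1 \<union> S2. absv y <= absv (y - s)"
      show "absv (?u y) <= C" using y(1)
      proof
        assume "absv y = absv z" then show ?thesis using S1(2) y(2) by blast
      next
        assume "absv y = absv c" then show ?thesis using S2(2) y(2) by blast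
      qed
    qed (use z in auto)
  qed
  show ?thesis
  proof (intro exI[of _ C] allI impI)
    fix c :: 'a assume c: "c ~= 0" "absv c <= R"
    show "pd c C ?u" unfolding pd_def
    proof (intro conjI allI impI)
      fix a :: 'a assume "a ~= 0 & absv a <= absv c"
      then show "rigidA a c ?u" using rig c(2) by blast
    next
      fix z :: 'a assume "z ~= 0 & absv z <= absv c"
      then show "absv (?u z) <= C" using bound[OF c(2)] by blast
    qed
  qed
qed

end

section \<open>Restriction and continuity of functions on discs\<close>

lemma an_disc_RA:
  fixes b :: "'a::complete_nonarch_field"
  assumes b: "b ~= 0" and h: "h : an (disc b)"
  shows "h : RA {z. absv z <= absv b}"
proof -
  obtain H where H: "H : tate (length (snd (disc b)))" "!!p. p : fst (disc b) ==> h p = H (ev (snd (disc b)) p)" by (rule anE[OF h]) blast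
  have U: "rdom {z::'a. absv z <= absv b}" using rdom_ball[OF b, of 0] by simp
  have "H : tate 1" using H(1) by (simp add: disc_def)
  then have "(%z. H (%i. if i < 1 then z / b else 0)) : RA {z. absv z <= absv b}"
  proof (rule RA_tate[OF U])
    show "(%z. z / b) : RA {z. absv z <= absv b}"
      using RA_rational[of "{z::'a. absv z <= absv b}" "[:b:]" "[:0, 1:]"] b by simp
  qed (use b in \<open>auto simp: absv_divide divide_le_eq\<close>)
  then show ?thesis
  proof (rule RA_cong)
    fix z :: 'a assume "z : {z. absv z <= absv b}"
    then have "h z = H (ev (snd (disc b)) z)" by (intro H(2)) (simp add: disc_def)
    then show "h z = H (%i. if i < 1 then z / b else 0)" by (simp add: disc_def ev_def cong: if_cong)
  qed
qed

lemma an_disc_restrict: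
  fixes b c :: "'a::complete_nonarch_field"
  assumes c: "c ~= 0" "absv c <= absv b" and h: "h : an (disc b)"
  shows "h : an (disc c)"
proof -
  have b: "b ~= 0" using c by auto
  have le: "absv (c / b) <= 1" using c b by (simp add: absv_divide)
  have "h \<circ> id : an (disc c)"
  proof (rule an_transfer[OF _ _ h])
    fix i assume "i < length (snd (disc b))"
    then have i: "i = 0" by (simp add: disc_def)
    have "(%x. x 0 * (c / b)) : tate (length (snd (disc c)))" by (intro tate_mult tate_const tate_var) (simp add: disc_def)
    moreover have "ALL x:polydisc. absv (x 0 * (c / b)) <= 1" unfolding absv_mult
      by (intro ballI mult_le_one polydiscD le absv_nonneg)
    moreover have "ALL p:fst (disc c). (snd (disc b) ! i) (id p) = ev (snd (disc c)) p 0 * (c / b)"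
      using c b by (simp add: disc_def ev_def i)
    ultimately show "EX E:tate (length (snd (disc c))). (ALL x:polydisc. absv (E x) <= 1) &
        (ALL p:fst (disc c). (snd (disc b) ! i) (id p) = E (ev (snd (disc c)) p))" by (intro bexI conjI)
  qed (use c in \<open>auto simp: disc_def\<close>)
  then show ?thesis by simp
qed

lemma an_disc_continuous:
  fixes b :: "'a::complete_nonarch_field"
  assumes b: "b ~= 0" and h: "h : an (disc b)" and e: "e > 0"
  shows "EX c::'a. c ~= 0 & absv c <= absv b & (ALL z::'a. absv z <= absv c --> absv (h z - h 0) <= e)"
proof -
  have U: "rdom {z::'a. absv z <= absv b}" using rdom_ball[OF b, of 0] by simp
  have "EX c::'a. c ~= 0 & (ALL z:{z::'a. absv z <= absv b}. ALL w. absv (w - z) <= absv c --> w : {z. absv z <= absv b} & absv (h w - h z) <= e)"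
    by (rule RA_uniformly_continuous[OF U an_disc_RA[OF b h] e])
  then obtain c :: 'a where c: "c ~= 0" "ALL z:{z::'a. absv z <= absv b}. ALL w. absv (w - z) <= absv c --> w : {z. absv z <= absv b} & absv (h w - h z) <= e"
    by (elim exE conjE)
  have c': "absv w <= absv b & absv (h w - h 0) <= e" if "absv w <= absv c" for w using c(2)[rule_format, of 0 w] that by simp
  then show ?thesis using c(1) by (intro exI[of _ c]) auto
qed

context jet_map
begin

text \<open>
  The \<open>H r\<close> are the sections along \<open>f\<close>, multiplied by the \<open>d\<close>-th power of the pullback of the jet
  differential and by \<open>z ^ (m * d)\<close>, and divided by the largest possible common power of \<open>z\<close>.
\<close>

lemma near_puncture:
  assumes nz: "pullback_nonzero X k m \<Omega> R f"
    and ph: "!!i p. i < length Vs ==> p : Vs ! i ==> ph p = abs_ppoint (%r. if r <= M then s r i p else 0)"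
  shows "EX b H. b ~= 0 & absv b <= R & (ALL r. H r : an (disc b)) & (EX r. ALL z. absv z <= absv b --> H r z ~= 0) &
     (ALL z. z ~= 0 --> absv z <= absv b --> ph (f z) = abs_ppoint (%r. H r z))"
proof -
  let ?u = "%r z. z ^ (m * d) * Gt r z"
  \<comment> \<open>A point with nonzero pullback provides the outer radius of the expansion; a
    section nonzero at its image then makes one component nonzero there.\<close>
  obtain w0 c where w0: "w0 : \<Omega>" and c: "0 < absv c" "absv c <= R" and fc: "f c : fst (dom w0)" and Jc: "J w0 c ~= 0"
    using nz unfolding pullback_nonzero_def by blast
  have c0: "c ~= 0" using c(1) by simp
  have "f c : Vs ! triv w0" using \<Omega>_dom(5)[OF w0] fc by blast
  then obtain r0 where r0: "r0 <= M" "s r0 (triv w0) (f c) ~= 0" using sec_nz[OF \<Omega>_dom(4)[OF w0]] by blast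
  have Gc: "?u r0 c ~= 0" using Gt_eq[OF w0 fc c0 c(2) r0(1)] r0(2) Jc c0 by (simp add: G_def)
  define P where "P r cs hs \<longleftrightarrow> (ALL b e. b ~= 0 --> absv b < absv c --> (EX H:an (disc b). H 0 = cs e & (ALL z. z ~= 0 --> absv z <= absv b --> H z = hs e z))) &
     (ALL e. (ALL n<e. cs n = 0) --> (ALL z. z ~= 0 --> absv z <= absv c --> ?u r z = z ^ e * hs e z)) &
     ((ALL n. cs n = 0) --> ?u r c = 0)" for r and cs :: "nat \<Rightarrow> 'a" and hs :: "nat \<Rightarrow> 'a \<Rightarrow> 'a"
  have "ALL r. EX cs. r <= M --> (EX hs. P r cs hs)"
  proof
    fix r
    show "EX cs. r <= M --> (EX hs. P r cs hs)"
    proof (cases "r <= M")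
      case True
      obtain C where "pd c C (?u r)" using pd_Gt[OF True] c0 c(2) by blast
      from pd_taylor[OF c0 this] obtain cs hs where "P r cs hs" unfolding P_def by (elim exE)
      then show ?thesis by blast
    qed simp
  qed
  then obtain cs where "ALL r. r <= M --> (EX hs. P r (cs r) hs)" by (rule choice[THEN exE])
  then have "ALL r. EX hs. r <= M --> P r (cs r) hs" by simp
  then obtain hs where hs: "ALL r. r <= M --> P r (cs r) (hs r)" by (rule choice[THEN exE])
  \<comment> \<open>The least order of vanishing at 0 among all components: dividing by
    \<open>z ^ e\<close> keeps every component analytic and leaves one of them nonzero at 0.\<close>
  define e where "e = (LEAST n. EX r<=M. cs r n ~= 0)"
  have "EX n. cs r0 n ~= 0" using hs[rule_format, OF r0(1)] Gc unfolding P_def by blast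
  then have "EX n. EX r<=M. cs r n ~= 0" using r0(1) by blast
  then have "EX r<=M. cs r e ~= 0" unfolding e_def by (rule LeastI_ex)
  then obtain r1 where r1: "r1 <= M" "cs r1 e ~= 0" by blast
  have low: "ALL n<e. cs r n = 0" if "r <= M" for r using not_less_Least[of _ "%n. EX r<=M. cs r n ~= 0"] that unfolding e_def by blast
  have "EX b::'a. b ~= 0 & absv b < absv c" by (rule absv_small) (use c in simp)
  then obtain b0 :: 'a where b0: "b0 ~= 0" "absv b0 < absv c" by blast
  \<comment> \<open>Components beyond \<open>M\<close> are 0, in agreement with the padding of the
    homogeneous coordinates.\<close>
  have "ALL r. EX H. H : an (disc b0) & (r <= M --> H 0 = cs r e & (ALL z. z ~= 0 --> absv z <= absv b0 --> H z = hs r e z)) & (\<not> r <= M --> H = (%_. 0))"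
  proof
    fix r
    show "EX H. H : an (disc b0) & (r <= M --> H 0 = cs r e & (ALL z. z ~= 0 --> absv z <= absv b0 --> H z = hs r e z)) & (\<not> r <= M --> H = (%_. 0))"
    proof (cases "r <= M")
      case True
      then have "EX H:an (disc b0). H 0 = cs r e & (ALL z. z ~= 0 --> absv z <= absv b0 --> H z = hs r e z)"
        using hs[rule_format, OF True, unfolded P_def, THEN conjunct1, rule_format, OF b0] by blast
      then show ?thesis using True by blast
    next
      case False
      then show ?thesis by (intro exI[of _ "%_. 0"]) (simp add: an_const)
    qed
  qed
  then obtain H where H: "ALL r. H r : an (disc b0) & (r <= M --> H r 0 = cs r e & (ALL z. z ~= 0 --> absv z <= absv b0 --> H r z = hs r e z)) & (\<not> r <= M --> H r = (%_. 0))"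
    by (rule choice[THEN exE])
  have H10: "H r1 0 ~= 0" using H r1 by simp
  have "EX ep::'a. ep ~= 0 & absv ep < absv (H r1 0)" by (rule absv_small) (use H10 in simp)
  then obtain ep :: 'a where ep: "ep ~= 0" "absv ep < absv (H r1 0)" by blast
  have "EX b::'a. b ~= 0 & absv b <= absv b0 & (ALL z. absv z <= absv b --> absv (H r1 z - H r1 0) <= absv ep)"
    by (rule an_disc_continuous[OF b0(1)]) (use H ep(1) in simp_all)
  then obtain b :: 'a where b: "b ~= 0" "absv b <= absv b0" "ALL z. absv z <= absv b --> absv (H r1 z - H r1 0) <= absv ep" by (elim exE conjE)
  have Hnz: "H r1 z ~= 0" if "absv z <= absv b" for z
  proof
    assume "H r1 z = 0"
    then have "absv (H r1 0) <= absv ep" using b(3)[rule_format, OF that] by simp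
    then show False using ep(2) by simp
  qed
  have "ph (f z) = abs_ppoint (%r. H r z)" if z: "z ~= 0" "absv z <= absv b" for z
  proof -
    have zR: "absv z <= absv b0" "absv z <= absv c" "absv z <= R" using z b(2) b0(2) c(2) by auto
    have "f z : X"
      using f_rigid[OF z(1) order_refl zR(3)] unfolding rigid_map_def annulus_def by auto
    then obtain w where w: "w : \<Omega>" "f z : fst (dom w)" using \<Omega>_cover(2) by blast
    let ?t = "triv w"
    have fV: "f z : Vs ! ?t" using \<Omega>_dom(5)[OF w(1)] w(2) by blast
    have Heq: "z ^ e * H r z = z ^ (m * d) * (s r ?t (f z) * J w z ^ d)" if r: "r <= M" for r
    proof -
      have "?u r z = z ^ e * hs r e z" using hs[rule_format, OF r, unfolded P_def] low[OF r] z(1) zR(2) by blast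
      moreover have "H r z = hs r e z" using H r z(1) zR(1) by blast
      ultimately show ?thesis using Gt_eq[OF w z(1) zR(3) r] by (simp add: G_def)
    qed
    \<comment> \<open>If the pullback vanished at \<open>z\<close>, so would every component,
      including \<open>H r1\<close>.\<close>
    have J0: "J w z ^ d ~= 0"
    proof
      assume "J w z ^ d = 0"
      then have "z ^ e * H r1 z = 0" using Heq[OF r1(1)] by simp
      then show False using Hnz[OF z(2)] z(1) by simp
    qed
    obtain r2 where r2: "r2 <= M" "s r2 ?t (f z) ~= 0" using sec_nz[OF \<Omega>_dom(4)[OF w(1)] fV] by blast
    let ?k = "z ^ (m * d) * J w z ^ d / z ^ e"
    have "abs_ppoint (%r. if r <= M then s r ?t (f z) else 0) = abs_ppoint (%r. H r z)"
    proof (rule abs_ppoint_eqI[of _ r2 ?k])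
      show "(if r2 <= M then s r2 ?t (f z) else 0) ~= 0" using r2 by simp
      show "?k ~= 0" using J0 z(1) by simp
      show "H r z = ?k * (if r <= M then s r ?t (f z) else 0)" for r
        using Heq[of r] H[rule_format, of r] z(1) by (cases "r <= M") (auto simp: field_simps)
    qed
    then show ?thesis using ph[OF \<Omega>_dom(4)[OF w(1)] fV] by simp
  qed
  moreover have "ALL r. H r : an (disc b)" using an_disc_restrict[OF b(1,2)] H by blast
  moreover have "EX r. ALL z. absv z <= absv b --> H r z ~= 0" using Hnz by blast
  moreover have "absv b <= R" using b(2) b0(2) c(2) by linarith
  ultimately show ?thesis using b(1) by (intro exI[of _ b] exI[of _ H] conjI) (assumption | blast)+
qed

end

section \<open>Extension over the puncture\<close>

lemma coordinate_poly:
  "EX P :: 'a::field mpoly. homogeneous 1 P & (ALL p. peval P p = hcoord p i)"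
proof -
  let ?P = "Poly_Mapping.single (Poly_Mapping.single i 1) 1 :: 'a mpoly"
  have "homogeneous 1 ?P" "peval ?P p = hcoord p i" for p by (simp_all add: homogeneous_def peval_def)
  then show ?thesis by blast
qed

lemma affine_chart:
  fixes X :: "'a::field ppoint set"
  shows "zopen X (X \<inter> {p. hcoord p i ~= 0})" and "ratio j i : regular_functions X (X \<inter> {p. hcoord p i ~= 0})"
proof -
  obtain P :: "'a mpoly" where P: "homogeneous 1 P" "ALL p. peval P p = hcoord p j" using coordinate_poly by blast
  obtain Q :: "'a mpoly" where Q: "homogeneous 1 Q" "ALL p. peval Q p = hcoord p i" using coordinate_poly by blast
  have "pclosed {p :: 'a ppoint. hcoord p i = 0}" unfolding pclosed_def
    by (intro exI[of _ "{Q}"]) (use Q in auto)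
  then show o: "zopen X (X \<inter> {p. hcoord p i ~= 0})" unfolding zopen_def
    by (intro exI[of _ "{p. hcoord p i = 0}"]) auto
  show "ratio j i : regular_functions X (X \<inter> {p. hcoord p i ~= 0})" unfolding regular_functions_def
  proof (intro CollectI ballI)
    fix p assume "p : X \<inter> {p. hcoord p i ~= 0}"
    then show "EX V P Q d. zopen X V & p : V & V \<subseteq> X \<inter> {p. hcoord p i ~= 0} &
       homogeneous d P & homogeneous d Q & (ALL q:V. peval Q q ~= 0 & ratio j i q = peval P q / peval Q q)"
      using o P Q by (intro exI[of _ "X \<inter> {p. hcoord p i ~= 0}"] exI[of _ P] exI[of _ Q] exI[of _ 1]) (simp add: ratio_def)
  qed
qed

lemma an_disc_nonzero:
  fixes b :: "'a::complete_nonarch_field"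
  assumes b: "b ~= 0" and h: "h : an (disc b)" and h0: "h 0 ~= 0"
  shows "EX c::'a. c ~= 0 & absv c <= absv b & (EX d>0. ALL z::'a. absv z <= absv c --> d <= absv (h z))"
proof -
  have "EX c::'a. c ~= 0 & absv c <= absv b & (ALL z::'a. absv z <= absv c --> absv (h z - h 0) <= absv (h 0) / 2)"
    by (rule an_disc_continuous[OF b h]) (use h0 in simp)
  then obtain c :: 'a where c: "c ~= 0" "absv c <= absv b" "ALL z::'a. absv z <= absv c --> absv (h z - h 0) <= absv (h 0) / 2"
    by (elim exE conjE)
  have h0': "0 < absv (h 0)" using h0 by simp
  have "absv (h 0) <= absv (h z)" if "absv z <= absv c" for z :: 'a
    by (rule eq_refl[OF absv_eq_of_diff_less[symmetric]]) (use c(3)[rule_format, OF that] h0' in linarith)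
  then show ?thesis using c(1,2) h0' by (intro exI[of _ c] conjI exI[of _ "absv (h 0)"] allI impI)
qed

lemma an_disc_divide:
  fixes b :: "'a::complete_nonarch_field"
  assumes b: "b ~= 0" and h: "h : an (disc b)" "k : an (disc b)" and k0: "k 0 ~= 0"
  shows "EX c::'a. c ~= 0 & absv c <= absv b & (%z. h z / k z) : an (disc c)"
proof -
  obtain c d where c: "(c::'a) ~= 0" "absv c <= absv b" and d: "d > 0" "ALL z::'a. absv z <= absv c --> d <= absv (k z)"
    using an_disc_nonzero[OF b h(2) k0] by (elim exE conjE)
  have U: "rdom {z::'a. absv z <= absv c}" using rdom_ball[OF c(1), of 0] by simp
  note hc = an_disc_RA[OF c(1) an_disc_restrict[OF c(1,2) h(1)]] and kc = an_disc_RA[OF c(1) an_disc_restrict[OF c(1,2) h(2)]]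
  have "(%z. inverse (k z)) : RA {z. absv z <= absv c}" by (rule RA_inverse[OF U kc d(1)]) (use d(2) in simp)
  then have RA: "(%z. h z / k z) : RA {z. absv z <= absv c}" using RA_mult[OF U hc] by (simp add: divide_inverse)
  have "EX e::'a. e ~= 0 & absv e < absv c" by (rule absv_small) (use c(1) in simp)
  then obtain e :: 'a where e: "e ~= 0" "absv e < absv c" by blast
  have "(%z. h z / k z) : an (disc e)" by (rule RA_ball_an[OF c(1) RA e])
  then show ?thesis using e c(2) by (intro exI[of _ e]) auto
qed

text \<open>Each equation of \<open>Y\<close>, evaluated at the coordinate vector, is an analytic
  function on the disc that vanishes off 0; by continuity it vanishes at 0.\<close>

lemma closed_at_puncture:
  fixes b :: "'a::complete_nonarch_field"
  assumes b: "b ~= 0" and H: "!!r. H r : an (disc b)" and r1: "!!z. absv z <= absv b ==> H r1 z ~= 0"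
    and Y: "pclosed Y" and in_Y: "!!z. z ~= 0 ==> absv z <= absv b ==> abs_ppoint (%r. H r z) : Y"
  shows "abs_ppoint (%r. H r 0) : Y"
proof -
  obtain T where T: "ALL P:T. EX d. homogeneous d P" "Y = {p. ALL P:T. peval P p = 0}" using Y unfolding pclosed_def by blast
  have "peval P (abs_ppoint (%r. H r 0)) = 0" if P: "P : T" for P
  proof -
    obtain d where d: "homogeneous d P" using T(1) P by blast
    let ?h = "%z. ins P (%r. H r z)"
    have h: "?h : an (disc b)" by (rule ins_an) (rule H)
    have z: "?h z = 0" if zz: "z ~= 0" "absv z <= absv b" for z
    proof -
      have "peval P (abs_ppoint (%r. H r z)) = 0" using in_Y[OF zz] P unfolding T(2) by blast
      moreover obtain c where "c ~= 0" "peval P (abs_ppoint (%r. H r z)) = c * ?h z"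
        using peval_abs[OF d, of "%r. H r z" r1] r1[OF zz(2)] by blast
      ultimately show ?thesis by simp
    qed
    have "?h 0 = 0"
    proof (rule ccontr)
      assume "?h 0 ~= 0"
      from an_disc_nonzero[OF b h this] obtain c dl where c: "(c::'a) ~= 0" "absv c <= absv b"
         "dl > 0" "ALL z::'a. absv z <= absv c --> dl <= absv (?h z)" by (elim exE conjE)
      then show False using z[OF c(1,2)] c(4)[rule_format, OF order_refl] by simp
    qed
    moreover obtain c where "peval P (abs_ppoint (%r. H r 0)) = c * ?h 0"
      using peval_abs[OF d, of "%r. H r 0" r1] r1[of 0] by auto
    ultimately show ?thesis by simp
  qed
  then show ?thesis unfolding T(2) by blast
qed

text \<open>Near the image of 0 the function is a single fraction of forms of equal degree, so the
  scaling of the coordinates cancels and a quotient of analytic functions remains, with denominator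
  nonzero at 0.\<close>

lemma regular_along_disc:
  fixes b :: "'a::complete_nonarch_field"
  assumes b: "b ~= 0" and H: "!!r. H r : an (disc b)" and r1: "!!z. absv z <= absv b ==> H r1 z ~= 0"
    and in_Y: "!!z. absv z <= absv b ==> abs_ppoint (%r. H r z) : Y"
    and s: "s : regular_functions Y U" and U: "abs_ppoint (%r. H r 0) : U"
  shows "EX c::'a. c ~= 0 & absv c <= absv b & (%z. s (abs_ppoint (%r. H r z))) : an (disc c) &
     (ALL z::'a. absv z <= absv c --> abs_ppoint (%r. H r z) : U)"
proof -
  let ?Ph = "%z. abs_ppoint (%r. H r z)"
  obtain V P Q d where V: "zopen Y V" "?Ph 0 : V" "V \<subseteq> U" and PQ: "homogeneous d P" "homogeneous d Q"
    and sV: "ALL q:V. peval Q q ~= 0 & s q = peval P q / peval Q q" using s U unfolding regular_functions_def by blast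
  have pev: "EX c. c ~= 0 & peval A (?Ph z) = c ^ e * ins A (%r. H r z) & hcoord (?Ph z) = (%r. c * H r z)"
    if hom: "homogeneous e A" "absv z <= absv b" for A e z
  proof -
    obtain c where c: "c ~= 0" "hcoord (?Ph z) = (%r. c * H r z)" using hcoord_abs[of "%r. H r z" r1] r1[OF hom(2)] by blast
    then show ?thesis using ins_homogeneous[OF hom(1), of c "%r. H r z"] by (intro exI[of _ c]) (simp add: peval_ins)
  qed
  obtain Z where Z: "pclosed Z" "V = Y - Z" using V(1) unfolding zopen_def by blast
  obtain T where T: "ALL P:T. EX d. homogeneous d P" "Z = {p. ALL P:T. peval P p = 0}" using Z(1) unfolding pclosed_def by blast
  obtain A where A: "A : T" "peval A (?Ph 0) ~= 0" using V(2) unfolding Z(2) T(2) by blast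
  obtain e where e: "homogeneous e A" using T(1) A(1) by blast
  have iA: "ins A (%r. H r 0) ~= 0" using pev[OF e, of 0] A(2) by auto
  have "EX c::'a. c ~= 0 & absv c <= absv b & (EX dl>0. ALL z::'a. absv z <= absv c --> dl <= absv (ins A (%r. H r z)))"
    by (rule an_disc_nonzero[OF b ins_an[OF H] iA])
  then obtain c1 dl where c1: "(c1::'a) ~= 0" "absv c1 <= absv b" "dl > 0" "ALL z::'a. absv z <= absv c1 --> dl <= absv (ins A (%r. H r z))"
    by (elim exE conjE)
  have inV: "?Ph z : V" if z: "absv z <= absv c1" for z
  proof -
    have zb: "absv z <= absv b" using z c1(2) by linarith
    have "ins A (%r. H r z) ~= 0" using c1(3) c1(4)[rule_format, OF z] by auto
    then have "peval A (?Ph z) ~= 0" using pev[OF e zb] by auto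
    then show ?thesis unfolding Z(2) T(2) using A(1) in_Y[OF zb] by blast
  qed
  have sP: "s (?Ph z) = ins P (%r. H r z) / ins Q (%r. H r z) & ins Q (%r. H r z) ~= 0" if z: "absv z <= absv c1" for z
  proof -
    have zb: "absv z <= absv b" using z c1(2) by linarith
    obtain c where c: "c ~= 0" "peval P (?Ph z) = c ^ d * ins P (%r. H r z)" "hcoord (?Ph z) = (%r. c * H r z)" using pev[OF PQ(1) zb] by blast
    have "peval Q (?Ph z) = c ^ d * ins Q (%r. H r z)" unfolding peval_ins c(3) by (rule ins_homogeneous[OF PQ(2)])
    then show ?thesis using sV inV[OF z] c(1,2) by auto
  qed
  have "EX c::'a. c ~= 0 & absv c <= absv c1 & (%z. ins P (%r. H r z) / ins Q (%r. H r z)) : an (disc c)"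
    by (rule an_disc_divide[OF c1(1)]) (use sP[of 0] an_disc_restrict[OF c1(1,2)] H in \<open>auto intro!: ins_an\<close>)
  then obtain c :: 'a where c: "c ~= 0" "absv c <= absv c1" "(%z. ins P (%r. H r z) / ins Q (%r. H r z)) : an (disc c)" by (elim exE conjE)
  have "(%z. s (?Ph z)) : an (disc c)" by (rule an_cong[OF c(3)]) (use sP c(2) in \<open>simp add: disc_def\<close>)
  moreover have "ALL z::'a. absv z <= absv c --> ?Ph z : U" using inV V(3) c(2) by (meson order_trans subsetD)
  ultimately show ?thesis using c(1,2) c1(2) by (intro exI[of _ c] conjI) auto
qed

text \<open>The curve is completed inside the closed image of \<open>ph\<close>. The inverse
  morphism carries it back to \<open>X\<close>, where the coordinate ratios of a chart around the
  limit point are regular and hence analytic along the disc.\<close>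

lemma extend_puncture:
  fixes b :: "'a::complete_nonarch_field" and f :: "'a \<Rightarrow> 'a ppoint"
  assumes X: "projective_variety N X" and ph: "closed_immersion X ph" and b: "b ~= 0"
    and H: "!!r. H r : an (disc b)" and r1: "!!z. absv z <= absv b ==> H r1 z ~= 0"
    and fX: "!!z. z ~= 0 ==> absv z <= absv b ==> f z : X"
    and \<phi>f: "!!z. z ~= 0 ==> absv z <= absv b ==> ph (f z) = abs_ppoint (%r. H r z)"
  shows "EX F c i. (c::'a) ~= 0 & absv c <= absv b & (ALL z. z ~= 0 --> F z = f z) &
     (ALL z::'a. absv z <= absv c --> F z : X & F z : unit_chart i) & (ALL j. ratio j i \<circ> F : an (disc c))"
proof -
  let ?Ph = "%z. abs_ppoint (%r. H r z)" and ?ps = "inv_into X ph"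
  have pc: "pclosed (ph ` X)" and inj: "inj_on ph X" and mor: "morphism (ph ` X) X ?ps"
    using ph unfolding closed_immersion_def by auto
  have Ph1: "?Ph z : ph ` X" if "z ~= 0" "absv z <= absv b" for z using \<phi>f[OF that] fX[OF that] by (metis imageI)
  have "?Ph 0 : ph ` X" by (rule closed_at_puncture[OF b H r1 pc Ph1])
  then have \<Phi>X: "?Ph z : ph ` X" if "absv z <= absv b" for z using Ph1[of z] that by (cases "z = 0") auto
  define F where "F z = (if z = 0 then ?ps (?Ph 0) else f z)" for z
  have F: "F z = ?ps (?Ph z)" if "absv z <= absv b" for z
    using \<phi>f[of z, symmetric] fX[of z] that inj by (auto simp: F_def)
  have FX: "F z : X" if "absv z <= absv b" for z unfolding F[OF that] by (rule inv_into_into[OF \<Phi>X[OF that]])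
  have XN: "X \<subseteq> pspace N" using X unfolding projective_variety_def by blast
  obtain i where i: "i <= N" "F 0 : unit_chart i" using unit_chart_exists[of "F 0" N] FX[of 0] XN by auto
  let ?V = "X \<inter> {p. hcoord p i ~= 0}" and ?V' = "ph ` X \<inter> ?ps -` (X \<inter> {p. hcoord p i ~= 0})"
  have reg: "ratio j i \<circ> ?ps : regular_functions (ph ` X) ?V'" for j
    using mor affine_chart(1)[of X i] affine_chart(2)[of j i X] unfolding morphism_def by blast
  have mem: "?Ph 0 : ?V'" using \<Phi>X[of 0] F[of 0] FX[of 0] unit_chart_hcoord[OF i(2)] by simp
  have along: "EX c::'a. c ~= 0 & absv c <= absv b & (%z. (ratio j i \<circ> ?ps) (?Ph z)) : an (disc c) &
     (ALL z::'a. absv z <= absv c --> ?Ph z : ?V')" for j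
    by (rule regular_along_disc[OF b H r1 \<Phi>X reg mem])
  have step: "EX c::'a. c ~= 0 & absv c <= absv b & ratio j i \<circ> F : an (disc c) &
      (ALL z::'a. absv z <= absv c --> hcoord (F z) i ~= 0 & absv (ratio j i (F z)) <= 1)" for j
  proof -
    obtain c :: 'a where c: "c ~= 0" "absv c <= absv b" and an: "(%z. (ratio j i \<circ> ?ps) (?Ph z)) : an (disc c)"
      and V: "ALL z::'a. absv z <= absv c --> ?Ph z : ?V'" using along[of j] by (elim exE conjE)
    have an': "ratio j i \<circ> F : an (disc c)" by (rule an_cong[OF an]) (use c(2) F in \<open>simp add: disc_def\<close>)
    \<comment> \<open>A tolerance of 1 suffices: the ratio at 0 is at most 1, and adding a
      difference of at most 1 does not leave the unit disc.\<close>
    obtain e :: 'a where e: "e ~= 0" "absv e <= absv c" "ALL z::'a. absv z <= absv e --> absv ((ratio j i \<circ> F) z - (ratio j i \<circ> F) 0) <= 1"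
      using an_disc_continuous[OF c(1) an' zero_less_one] by (elim exE conjE)
    have "hcoord (F z) i ~= 0 & absv (ratio j i (F z)) <= 1" if z: "absv z <= absv e" for z
    proof -
      have zc: "absv z <= absv c" "absv z <= absv b" using z e(2) c(2) by auto
      have "hcoord (F z) i ~= 0" using V[rule_format, OF zc(1)] unfolding F[OF zc(2)] by simp
      moreover have "absv (ratio j i (F z)) <= 1"
        using absv_add_le'[OF e(3)[rule_format, OF z], of "(ratio j i \<circ> F) 0"] unit_chart_ratio[OF i(2)] by simp
      ultimately show ?thesis by blast
    qed
    then show ?thesis using e(1,2) c(2) an_disc_restrict[OF e(1,2) an'] by (intro exI[of _ e]) auto
  qed
  then have "ALL j. EX c::'a. c ~= 0 & absv c <= absv b & ratio j i \<circ> F : an (disc c) &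
      (ALL z::'a. absv z <= absv c --> hcoord (F z) i ~= 0 & absv (ratio j i (F z)) <= 1)" by blast
  then obtain c :: "nat \<Rightarrow> 'a" where c: "ALL j. c j ~= 0 & absv (c j) <= absv b & ratio j i \<circ> F : an (disc (c j)) &
      (ALL z::'a. absv z <= absv (c j) --> hcoord (F z) i ~= 0 & absv (ratio j i (F z)) <= 1)" by (rule choice[THEN exE])
  \<comment> \<open>Ratios with index above \<open>N\<close> are 0 on \<open>pspace N\<close>, so
    finitely many radii have a positive common lower bound.\<close>
  let ?m = "Min ((%j. absv (c j)) ` {..N})"
  have "?m > 0" using c by (subst Min_gr_iff) auto
  then obtain e :: 'a where e: "e ~= 0" "absv e < ?m" using absv_small by blast
  have le: "absv e <= absv (c j)" if "j <= N" for j
    using e(2) Min_le[of "(%j. absv (c j)) ` {..N}" "absv (c j)"] that by force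
  have eb: "absv e <= absv b" using le[of 0] c by (meson le0 order_trans)
  have r0: "ratio j i (F z) = 0" if "j > N" "absv z <= absv b" for j z
    using ratio_pspace[OF subsetD[OF XN FX[OF that(2)]] that(1)] .
  have chart: "F z : unit_chart i" if z: "absv z <= absv e" for z
  proof (rule unit_chartI)
    show "hcoord (F z) i ~= 0" using c le[of 0] z by (meson le0 order_trans)
    show "absv (ratio j i (F z)) <= 1" for j
    proof (cases "j <= N")
      case True
      then show ?thesis using c le[of j] z by (meson order_trans)
    qed (use r0[of j z] z eb in simp)
  qed
  have rat: "ratio j i \<circ> F : an (disc e)" for j
  proof (cases "j <= N")
    case True
    then show ?thesis using an_disc_restrict[OF e(1) le[OF True]] c by blast
  next
    case False
    show ?thesis by (rule an_cong[OF an_const[of 0]]) (use False r0[of j] eb in \<open>simp add: disc_def\<close>)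
  qed
  have "ALL z. z ~= 0 --> F z = f z" by (simp add: F_def)
  moreover have "ALL z::'a. absv z <= absv e --> F z : X & F z : unit_chart i" using chart FX eb by (meson order_trans)
  ultimately show ?thesis using e(1) eb rat by (intro exI[of _ F] exI[of _ e] exI[of _ i] conjI) blast+
qed

section \<open>From the annulus to the disc\<close>

lemma an_poly:
  assumes "(%z. z) : an W" shows "(%z. poly p z) : an W"
proof (induction p)
  case (pCons a p)
  have "(%z. a + z * poly p z) : an W" by (intro an_add an_const an_mult assms pCons.IH)
  then show ?case by simp
qed (simp add: an_const)

text \<open>In the generators \<open>z / b\<close> and \<open>a / z\<close> a polynomial is a
  Laurent polynomial; \<open>K\<close> clears its negative powers.\<close>

lemma polyfun_laurent:
  fixes q :: "(nat \<Rightarrow> 'a::complete_nonarch_field) \<Rightarrow> 'a" and a b :: 'a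
  assumes "q : polyfun n"
  shows "EX P K. ALL z. z ~= 0 --> q (ev [%z. z / b, %z. a / z] z) * z ^ K = poly P z"
  using assms
proof induction
  case (const c)
  show ?case by (intro exI[of _ "[:c:]"] exI[of _ 0]) simp
next
  case (var i)
  have "ev [%z. z / b, %z. a / z] z i * z ^ 1 = poly (if i = 0 then [:0, 0, 1 / b:] else if i = 1 then [:a:] else 0) z" if "z ~= 0" for z
    using that by (cases "i = 0"; cases "i = 1") (auto simp: ev_def)
  then show ?case by blast
next
  case (add p q)
  then obtain P K Q L where PQ: "ALL z. z ~= 0 --> p (ev [%z. z / b, %z. a / z] z) * z ^ K = poly P z"
    "ALL z. z ~= 0 --> q (ev [%z. z / b, %z. a / z] z) * z ^ L = poly Q z" by blast
  have "(p (ev [%z. z / b, %z. a / z] z) + q (ev [%z. z / b, %z. a / z] z)) * z ^ (K + L) = poly (P * monom 1 L + Q * monom 1 K) z"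
    if "z ~= 0" for z
    using PQ(1)[rule_format, OF that, symmetric] PQ(2)[rule_format, OF that, symmetric]
    by (simp add: poly_monom algebra_simps power_add)
  then show ?case by blast
next
  case (mult p q)
  then obtain P K Q L where PQ: "ALL z. z ~= 0 --> p (ev [%z. z / b, %z. a / z] z) * z ^ K = poly P z"
    "ALL z. z ~= 0 --> q (ev [%z. z / b, %z. a / z] z) * z ^ L = poly Q z" by blast
  have "(p (ev [%z. z / b, %z. a / z] z) * q (ev [%z. z / b, %z. a / z] z)) * z ^ (K + L) = poly (P * Q) z"
    if "z ~= 0" for z
    using PQ(1)[rule_format, OF that, symmetric] PQ(2)[rule_format, OF that, symmetric]
    by (simp add: algebra_simps power_add)
  then show ?case by blast
qed

text \<open>
  The error is bounded on the whole polydisc of the generators, not only on the annulus.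
\<close>

lemma an_annulus_laurent:
  fixes a b c :: "'a::complete_nonarch_field"
  assumes a: "a ~= 0" and c: "c ~= 0" and h: "h : an (annulus a b)"
  shows "EX E P K. E : tate 2 & (ALL x:polydisc. absv (E x) <= 1 / 2) &
     (ALL z. absv a <= absv z & absv z <= absv b --> (h z - c * E (ev [%z. z / b, %z. a / z] z)) * z ^ K = poly P z)"
proof -
  obtain H where H: "H : tate (length (snd (annulus a b)))" "!!p. p : fst (annulus a b) ==> h p = H (ev (snd (annulus a b)) p)" by (rule anE[OF h]) blast
  have cancel: "c * (t * inverse c) = t" for t using c by simp
  have H2: "H : tate 2" using H(1) by (simp add: annulus_def numeral_2_eq_2)
  obtain q where q: "q : polyfun 2" "!!x. x : polydisc ==> absv (H x - q x) <= absv c / 2"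
    using tate_approx[OF H2, of "absv c / 2"] c by auto
  obtain P K where PK: "ALL z. z ~= 0 --> q (ev [%z. z / b, %z. a / z] z) * z ^ K = poly P z" using polyfun_laurent[OF q(1)] by blast
  let ?E = "%x. (H x - q x) * inverse c"
  have "?E : tate 2" by (intro tate_mult tate_diff H2 polyfun_tate q(1) tate_const)
  moreover have "ALL x:polydisc. absv (?E x) <= 1 / 2"
    using q(2) c by (auto simp: absv_mult absv_inverse absv_divide field_simps)
  moreover have "ALL z. absv a <= absv z & absv z <= absv b --> (h z - c * ?E (ev [%z. z / b, %z. a / z] z)) * z ^ K = poly P z"
  proof (intro allI impI)
    fix z :: 'a assume z: "absv a <= absv z & absv z <= absv b"
    then have z0: "z ~= 0" using a by auto
    have "h z = H (ev [%z. z / b, %z. a / z] z)" using H(2)[of z] z by (simp add: annulus_def)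
    then show "(h z - c * ?E (ev [%z. z / b, %z. a / z] z)) * z ^ K = poly P z"
      unfolding cancel using PK z0 by simp
  qed
  ultimately show ?thesis by blast
qed

lemma rescale_identities:
  assumes "p ~= (0 :: 'a::field)"
  shows "p * (1 + c / p * e) = p + c * e" "p * (x / p + c / p * e) = x + c * e"
  using assms by (simp_all add: distrib_left)

text \<open>
  With \<open>c\<close> small against the lower bound of \<open>|g|\<close>, the inequalities \<open>|f| \<le> |g|\<close> may be replaced by
  those between the Laurent approximations, together with \<open>|c| \<le> |g|\<close>. After multiplication by a power of \<open>z\<close> they
  are inequalities between polynomials, to which a nonzero constant is added.
\<close>

lemma annulus_subdomain_disc:
  fixes a b :: "'a::complete_nonarch_field"
  assumes a: "a ~= 0" "absv a <= absv b" and sub: "rational_subdomain (annulus a b) W"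
  shows "EX W'. rational_subdomain (disc b) W' & fst W' = fst W & an W \<subseteq> an W'"
proof -
  let ?A = "annulus a b" and ?y = "ev [%z. z / b, %z. a / z]"
  have b0: "b ~= 0" using a by auto
  have pres: "presented ?A" by (rule presented_annulus[OF a])
  then have sA: "sound ?A" by (simp add: presented_def)
  have inA: "z : fst ?A \<longleftrightarrow> absv a <= absv z & absv z <= absv b" for z by (simp add: annulus_def)
  have z0: "z ~= 0" if "z : fst ?A" for z using that a(1) unfolding inA by auto
  obtain g fs where g: "g : an ?A" "set fs \<subseteq> an ?A" and nz: "ALL p:fst ?A. EX f:set (g # fs). f p ~= 0"
     and Wp: "fst W = {p : fst ?A. ALL f:set fs. absv (f p) <= absv (g p)}"
     and Wg: "snd W = snd ?A @ map (%f p. f p / g p) fs"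
    using sub unfolding rational_subdomain_def analytic_functions_eq[OF sA] by blast
  define hs where "hs = g # fs"
  let ?L = "length fs"
  have hs_an: "set hs \<subseteq> an ?A" using g unfolding hs_def by simp
  have "EX d>0. ALL p:fst ?A. EX h:set hs. absv (h p) \<ge> d"
    by (rule presented_lower_bound[OF pres hs_an]) (use nz in \<open>simp add: hs_def\<close>)
  then obtain d where d: "d > 0" "ALL p:fst ?A. EX h:set hs. absv (h p) \<ge> d" by (elim exE conjE)
  obtain c :: 'a where c: "c ~= 0" "absv c < d" using absv_small[OF d(1)] by blast
  have "ALL i. EX EPK. i < Suc ?L --> fst EPK : tate 2 & (ALL x:polydisc. absv (fst EPK x) <= 1 / 2) &
     (ALL z. absv a <= absv z & absv z <= absv b --> ((hs ! i) z - c * fst EPK (?y z)) * z ^ snd (snd EPK) = poly (fst (snd EPK)) z)"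
  proof
    fix i
    show "EX EPK. i < Suc ?L --> fst EPK : tate 2 & (ALL x:polydisc. absv (fst EPK x) <= 1 / 2) &
     (ALL z. absv a <= absv z & absv z <= absv b --> ((hs ! i) z - c * fst EPK (?y z)) * z ^ snd (snd EPK) = poly (fst (snd EPK)) z)"
    proof (cases "i < Suc ?L")
      case True
      then have "hs ! i : an ?A" by (intro subsetD[OF hs_an] nth_mem) (simp add: hs_def)
      from an_annulus_laurent[OF a(1) c(1) this] obtain E P K where "E : tate 2 & (ALL x:polydisc. absv (E x) <= 1 / 2) &
        (ALL z. absv a <= absv z & absv z <= absv b --> ((hs ! i) z - c * E (?y z)) * z ^ K = poly P z)" by blast
      then show ?thesis by (intro exI[of _ "(E, P, K)"]) simp
    qed simp
  qed
  then obtain EPK where EPK: "ALL i. i < Suc ?L --> fst (EPK i) : tate 2 & (ALL x:polydisc. absv (fst (EPK i) x) <= 1 / 2) &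
     (ALL z. absv a <= absv z & absv z <= absv b --> ((hs ! i) z - c * fst (EPK i) (?y z)) * z ^ snd (snd (EPK i)) = poly (fst (snd (EPK i))) z)"
    by (rule choice[THEN exE])
  define E where "E i = fst (EPK i)" for i
  define P where "P i = fst (snd (EPK i))" for i
  define K where "K i = snd (snd (EPK i))" for i
  note EPK = EPK[folded E_def P_def K_def]
  have E: "E i : tate 2" "x : polydisc ==> absv (E i x) <= 1 / 2" if "i < Suc ?L" for i x using EPK that by blast+
  have P: "((hs ! i) z - c * E i (?y z)) * z ^ K i = poly (P i) z" if "i < Suc ?L" "absv a <= absv z & absv z <= absv b" for i z
    using EPK that by blast
  \<comment> \<open>One exponent that clears the denominators of all approximations.\<close>
  define M where "M = (\<Sum>i<Suc ?L. K i)"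
  define Q where "Q i = P i * monom 1 (M - K i)" for i
  let ?p = "%i z. (hs ! i) z - c * E i (?y z)"
  have Q: "poly (Q i) z = ?p i z * z ^ M" if "i < Suc ?L" "z : fst ?A" for i z
  proof -
    have "K i <= M" unfolding M_def using that(1) by (intro member_le_sum) auto
    then have "z ^ M = z ^ K i * z ^ (M - K i)" by (simp add: power_add[symmetric])
    then show ?thesis using P[OF that(1), of z] that(2) unfolding inA Q_def by (simp add: poly_monom mult.assoc)
  qed
  have yA: "?y z : polydisc" if "z : fst ?A" for z using soundD[OF sA that] by (simp add: annulus_def)
  have err: "absv (c * E i (?y z)) <= absv c / 2" if "i < Suc ?L" "z : fst ?A" for i z
    using mult_left_mono[OF E(2)[OF that(1) yA[OF that(2)]], of "absv c"] by (simp add: absv_mult)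
  have c2: "absv c / 2 < absv c" using c(1) by simp
  have W_ge: "absv c <= absv (g z)" if z: "z : fst W" for z
  proof -
    obtain h where h: "h : set hs" "absv (h z) \<ge> d" using d(2) z Wp by blast
    have "absv (h z) <= absv (g z)" using h(1) z unfolding hs_def Wp by auto
    then show ?thesis using h(2) c(2) by linarith
  qed
  have Wp': "z : fst W \<longleftrightarrow> z : fst ?A & absv c <= absv (?p 0 z) & (ALL j<?L. absv (?p (Suc j) z) <= absv (?p 0 z))" for z
  proof
    assume z: "z : fst W"
    then have zA: "z : fst ?A" using Wp by blast
    have gp: "g z - ?p 0 z = c * E 0 (?y z)" by (simp add: hs_def)
    have eq: "absv (g z) = absv (?p 0 z)"
      by (rule absv_eq_of_diff_less', unfold gp) (use err[of 0, OF _ zA] W_ge[OF z] c2 in linarith)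
    have "absv (?p (Suc j) z) <= absv (?p 0 z)" if j: "j < ?L" for j
    proof -
      have "absv ((hs ! Suc j) z) <= absv (?p 0 z)" using z j eq unfolding Wp hs_def by auto
      moreover have "absv (c * E (Suc j) (?y z)) <= absv (?p 0 z)" using err[of "Suc j", OF _ zA] j W_ge[OF z] eq c2 by linarith
      ultimately show ?thesis by (rule absv_diff_le')
    qed
    then show "z : fst ?A & absv c <= absv (?p 0 z) & (ALL j<?L. absv (?p (Suc j) z) <= absv (?p 0 z))" using zA eq W_ge[OF z] by simp
  next
    assume z: "z : fst ?A & absv c <= absv (?p 0 z) & (ALL j<?L. absv (?p (Suc j) z) <= absv (?p 0 z))"
    then have zA: "z : fst ?A" by blast
    have gp: "g z - ?p 0 z = c * E 0 (?y z)" by (simp add: hs_def)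
    have eq: "absv (g z) = absv (?p 0 z)"
      by (rule absv_eq_of_diff_less, unfold gp) (use err[of 0, OF _ zA] z c2 in linarith)
    have "absv (f z) <= absv (g z)" if f: "f : set fs" for f
    proof -
      obtain j where j: "j < ?L" "f = fs ! j" using f by (metis in_set_conv_nth)
      have "absv (?p (Suc j) z + c * E (Suc j) (?y z)) <= absv (?p 0 z)"
      proof (rule absv_add_le')
        show "absv (?p (Suc j) z) <= absv (?p 0 z)" using z j(1) by blast
        show "absv (c * E (Suc j) (?y z)) <= absv (?p 0 z)" using err[of "Suc j", OF _ zA] j(1) z c2 by linarith
      qed
      then show ?thesis using eq j(2) by (simp add: hs_def)
    qed
    then show "z : fst W" unfolding Wp using zA by blast
  qed
  define G where "G z = z * poly (Q 0) z" for z
  \<comment> \<open>Compared with \<open>G\<close>, the first entry encodes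
    \<open>absv a <= absv z\<close> and the second the lower bound \<open>absv c\<close> for the
    approximation of \<open>g\<close>. The third is the nonzero constant that excludes common zeros;
    its inequality follows from these two. The remaining entries compare the approximations of
    \<open>fs\<close> with that of \<open>g\<close>.\<close>
  define Fs where "Fs = [%z. a * poly (Q 0) z, %z. c * z ^ (M + 1), %z. c * a ^ (M + 1)] @ map (%j z. z * poly (Q (Suc j)) z) [0..<?L]"
  let ?W = "({z : fst (disc b). ALL f:set Fs. absv (f z) <= absv (G z)}, snd (disc b) @ map (%f z. f z / G z) Fs)"
  have Fs_set: "(ALL f:set Fs. absv (f z) <= absv (G z)) \<longleftrightarrow> absv (a * poly (Q 0) z) <= absv (G z) & absv (c * z ^ (M + 1)) <= absv (G z) &
     absv (c * a ^ (M + 1)) <= absv (G z) & (ALL j<?L. absv (z * poly (Q (Suc j)) z) <= absv (G z))" for z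
    unfolding Fs_def by auto
  have iff: "z : fst ?W \<longleftrightarrow> z : fst W" for z
  proof
    assume "z : fst ?W"
    then have z: "absv z <= absv b" "absv (a * poly (Q 0) z) <= absv (G z)" "absv (c * z ^ (M + 1)) <= absv (G z)"
     "absv (c * a ^ (M + 1)) <= absv (G z)" "ALL j<?L. absv (z * poly (Q (Suc j)) z) <= absv (G z)" using Fs_set[of z] by (auto simp: disc_def)
    have "c * a ^ (M + 1) ~= 0" using c(1) a(1) by simp
    then have "0 < absv (c * a ^ (M + 1))" by (simp only: absv_pos_iff not_False_eq_True)
    then have "0 < absv (G z)" using z(4) by linarith
    then have nz: "z ~= 0" "poly (Q 0) z ~= 0" unfolding G_def by auto
    have zA: "z : fst ?A" unfolding inA using z(1,2) nz by (auto simp: G_def absv_mult)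
    have "absv c * absv z ^ M <= absv (?p 0 z) * absv z ^ M"
      using z(3) nz by (auto simp: G_def Q[OF _ zA] absv_mult absv_power)
    then have "absv c <= absv (?p 0 z)" using nz(1) by (simp add: mult_le_cancel_right)
    moreover have "absv (?p (Suc j) z) <= absv (?p 0 z)" if "j < ?L" for j
    proof -
      have "absv (?p (Suc j) z) * absv z ^ M <= absv (?p 0 z) * absv z ^ M"
        using z(5) that nz by (auto simp: G_def Q[OF _ zA] absv_mult absv_power)
      then show ?thesis using nz(1) by (simp add: mult_le_cancel_right)
    qed
    ultimately show "z : fst W" using Wp' zA by blast
  next
    assume "z : fst W"
    then have zA: "z : fst ?A" and z: "absv c <= absv (?p 0 z)" "ALL j<?L. absv (?p (Suc j) z) <= absv (?p 0 z)" using Wp' by blast+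
    have za: "absv a <= absv z" "absv z <= absv b" using zA unfolding inA by auto
    have 1: "absv (a * poly (Q 0) z) <= absv (G z)" unfolding G_def absv_mult using za(1) by (intro mult_right_mono) simp_all
    have 2: "absv (c * z ^ (M + 1)) <= absv (G z)" using mult_right_mono[OF z(1), of "absv z ^ (M + 1)"]
      by (simp add: G_def Q[OF _ zA] absv_mult absv_power mult.left_commute)
    have 3: "absv (c * a ^ (M + 1)) <= absv (c * z ^ (M + 1))" unfolding absv_mult absv_power
      using za(1) by (intro mult_left_mono power_mono) simp_all
    have 4: "absv (z * poly (Q (Suc j)) z) <= absv (G z)" if "j < ?L" for j
      using mult_right_mono[OF z(2)[rule_format, OF that], of "absv z ^ (M + 1)"] that
      by (simp add: G_def Q[OF _ zA] absv_mult absv_power mult.left_commute)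
    show "z : fst ?W" using 1 2 order_trans[OF 3 2] 4 za(2) Fs_set[of z] by (simp add: disc_def)
  qed
  then have fstW: "fst ?W = fst W" by blast
  have id_an: "(%z. z) : an (disc b)"
  proof -
    have "(%z. (%z. z / b) z * (%_. b) z) : an (disc b)" by (intro an_mult an_const an_gen) (simp add: disc_def)
    then show ?thesis using b0 by simp
  qed
  have rat: "rational_subdomain (disc b) ?W"
    unfolding rational_subdomain_def analytic_functions_eq[OF sound_disc]
  proof (intro exI[of _ G] exI[of _ Fs] conjI ballI)
    show "G : an (disc b)" unfolding G_def by (intro an_mult id_an an_poly)
    show "set Fs \<subseteq> an (disc b)" unfolding Fs_def
      by (auto intro!: an_mult an_const id_an an_poly an_power simp del: power_Suc)
    show "EX f:set (G # Fs). f p ~= 0" if "p : fst (disc b)" for p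
      by (intro bexI[of _ "%z. c * a ^ (M + 1)"]) (use a c in \<open>auto simp: Fs_def\<close>)
  qed simp_all
  have nz: "z ~= 0 & ?p 0 z ~= 0" if z: "z : fst W" for z
  proof -
    have "absv c <= absv (?p 0 z)" "z ~= 0" using Wp'[of z] z z0 by blast+
    then show ?thesis using c(1) by auto
  qed
  have len: "length (snd ?W) = ?L + 4" by (simp add: disc_def Fs_def)
  \<comment> \<open>The offset 4 skips \<open>z / b\<close> and the quotients belonging to the first
    three entries of \<open>Fs\<close>.\<close>
  have gen: "ev (snd ?W) z 0 = z / b" "ev (snd ?W) z 1 = a / z" "ev (snd ?W) z 2 = c / ?p 0 z"
    "!!j. j < ?L ==> ev (snd ?W) z (4 + j) = ?p (Suc j) z / ?p 0 z" if z: "z : fst W" for z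
  proof -
    have zA: "z : fst ?A" using z Wp by blast
    have n: "z ~= 0" "?p 0 z ~= 0" using nz[OF z] by blast+
    have n': "poly (Q 0) z = ?p 0 z * z ^ M" "z ^ M ~= 0" using Q[OF _ zA, of 0] n by auto
    show "ev (snd ?W) z 0 = z / b" by (simp add: ev_def disc_def)
    show "ev (snd ?W) z 1 = a / z" using n n' by (simp add: ev_def disc_def Fs_def G_def)
    show "ev (snd ?W) z 2 = c / ?p 0 z" using n n' by (simp add: ev_def disc_def Fs_def G_def numeral_2_eq_2)
    show "ev (snd ?W) z (4 + j) = ?p (Suc j) z / ?p 0 z" if j: "j < ?L" for j
    proof -
      have "ev (snd ?W) z (4 + j) = z * poly (Q (Suc j)) z / G z"
        using j by (simp add: ev_def disc_def Fs_def nth_append numeral_eq_Suc)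
      then show ?thesis using n n' j Q[OF _ zA, of "Suc j"] by (simp add: G_def)
    qed
  qed
  have "an W \<subseteq> an ?W"
  proof
    fix h assume h: "h : an W"
    define T where "T E x = E (%i. if i < 2 then x i else 0)" for E :: "(nat \<Rightarrow> 'a) \<Rightarrow> 'a" and x
    have Tt: "T (E i) : tate (length (snd ?W))" and Tb: "!!x. x : polydisc ==> absv (T (E i) x) <= 1 / 2" if "i < Suc ?L" for i
    proof -
      show "T (E i) : tate (length (snd ?W))" unfolding T_def[abs_def] len
        by (rule tate_subst[OF E(1)[OF that]]) (auto simp: polydiscD intro: tate_var)
      show "absv (T (E i) x) <= 1 / 2" if x: "x : polydisc" for x
        unfolding T_def by (rule E(2)[OF \<open>i < Suc ?L\<close>]) (use x in \<open>auto simp: polydisc_def\<close>)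
    qed
    have Ty: "T (E i) (ev (snd ?W) z) = E i (?y z)" if z: "z : fst W" for i z
    proof -
      have "(%i. if i < 2 then ev (snd ?W) z i else 0) = ?y z"
      proof
        fix i :: nat
        consider "i = 0" | "i = 1" | "i \<ge> 2" by linarith
        then show "(if i < 2 then ev (snd ?W) z i else 0) = ?y z i"
          by cases (use gen(1,2)[OF z] in \<open>simp_all add: ev_def\<close>)
      qed
      then show ?thesis unfolding T_def by (rule arg_cong)
    qed
    have Yb: "absv (x 2 * T (E i) x) <= 1 / 2" if "i < Suc ?L" "x : polydisc" for i x
      using mult_mono[OF polydiscD[OF that(2), of 2] Tb[OF that]] by (simp add: absv_mult)
    note Tt = Tt[unfolded len]
    \<comment> \<open>The generators of \<open>W\<close> are quotients of the true \<open>f\<close>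
      and \<open>g\<close>, not of their approximations. In
      \<open>g = ?p 0 * (1 + c / ?p 0 * E 0)\<close> the second factor is inverted by a geometric
      series on the whole polydisc, since \<open>E 0\<close> is at most \<open>1 / 2\<close>
      there.\<close>
    have "EX k:tate (?L + 4). ALL x:polydisc. k x * (1 - (- (x 2 * T (E 0) x))) = 1 & absv (k x) <= 1"
      by (rule tate_geometric[of _ _ "1 / 2"]) (use Tt[of 0] Yb[of 0] in \<open>auto intro!: tate_uminus tate_mult tate_var\<close>)
    then obtain k where k: "k : tate (?L + 4)" "ALL x:polydisc. k x * (1 - (- (x 2 * T (E 0) x))) = 1 & absv (k x) <= 1" by blast
    have snW: "sound ?W" by (rule rational_subdomain_sound[OF sound_disc rat])
    have "h \<circ> id : an ?W"
    proof (rule an_transfer[OF _ _ h])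
      show "id z : fst W" if "z : fst ?W" for z using that unfolding fstW by (simp only: id_apply)
      fix i assume "i < length (snd W)"
      then have iL: "i < ?L + 2" by (simp add: Wg annulus_def)
      consider "i = 0" | "i = 1" | j where "i = 2 + j" "j < ?L" using iL by (cases i; cases "i - 1") auto
      then show "EX E:tate (length (snd ?W)). (ALL x:polydisc. absv (E x) <= 1) &
        (ALL p:fst ?W. (snd W ! i) (id p) = E (ev (snd ?W) p))"
      proof cases
        case 1
        have "(snd W ! i) (id p) = ev (snd ?W) p 0" if "p : fst ?W" for p
          using gen(1)[OF that[unfolded fstW]] by (simp add: 1 Wg annulus_def)
        then show ?thesis unfolding len by (intro bexI[of _ "%x. x 0"] conjI ballI tate_var polydiscD) simp_all
      next
        case 2
        have "(snd W ! i) (id p) = ev (snd ?W) p 1" if "p : fst ?W" for p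
          using gen(2)[OF that[unfolded fstW]] by (simp add: 2 Wg annulus_def)
        then show ?thesis unfolding len by (intro bexI[of _ "%x. x 1"] conjI ballI tate_var polydiscD) simp_all
      next
        case (3 j)
        let ?E = "%x. (x (4 + j) + x 2 * T (E (Suc j)) x) * k x"
        have tE: "?E : tate (length (snd ?W))" unfolding len using Tt[of "Suc j"] 3(2) k(1) by (intro tate_mult tate_add tate_var) auto
        have bE: "ALL x:polydisc. absv (?E x) <= 1"
        proof
          fix x :: "nat \<Rightarrow> 'a" assume x: "x : polydisc"
          have "absv (x (4 + j) + x 2 * T (E (Suc j)) x) <= 1"
            by (rule absv_add_le'[OF polydiscD[OF x]]) (use Yb[of "Suc j" x] x 3(2) in simp)
          then show "absv (?E x) <= 1" unfolding absv_mult using k(2) x by (intro mult_le_one) auto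
        qed
        have "(snd W ! i) (id z) = ?E (ev (snd ?W) z)" if "z : fst ?W" for z
        proof -
          have z: "z : fst W" using that unfolding fstW .
          have zA: "z : fst ?A" using z Wp by blast
          let ?v = "ev (snd ?W) z"
          have v: "?v : polydisc" by (rule soundD[OF snW that])
          have n: "?p 0 z ~= 0" using nz[OF z] by blast
          have k1: "k ?v * (1 + c / ?p 0 z * E 0 (?y z)) = 1" using k(2)[rule_format, OF v] gen(3)[OF z] Ty[OF z] by simp
          have gz: "g z = ?p 0 z * (1 + c / ?p 0 z * E 0 (?y z))" unfolding rescale_identities[OF n] by (simp add: hs_def)
          have fz: "(fs ! j) z = ?p 0 z * (?p (Suc j) z / ?p 0 z + c / ?p 0 z * E (Suc j) (?y z))" unfolding rescale_identities[OF n] by (simp add: hs_def)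
          have k2: "inverse (1 + c / ?p 0 z * E 0 (?y z)) = k ?v" by (rule inverse_unique[OF trans[OF mult.commute k1]])
          have "(snd W ! i) (id z) = (fs ! j) z / g z" using 3 by (simp add: Wg annulus_def nth_append)
          also have "\<dots> = (?p (Suc j) z / ?p 0 z + c / ?p 0 z * E (Suc j) (?y z)) / (1 + c / ?p 0 z * E 0 (?y z))"
            unfolding gz fz by (rule mult_divide_mult_cancel_left[OF n])
          also have "\<dots> = ?E ?v" unfolding divide_inverse[of _ "1 + _"] k2 gen(3)[OF z] gen(4)[OF z 3(2)] Ty[OF z] ..
          finally show ?thesis .
        qed
        then have "ALL z:fst ?W. (snd W ! i) (id z) = ?E (ev (snd ?W) z)" by (rule ballI)
        with bE show ?thesis by (intro bexI[OF _ tE] conjI)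
      qed
    qed
    then show "h : an ?W" by simp
  qed
  then show ?thesis using rat fstW by blast
qed

text \<open>Imposing \<open>absv z <= absv c\<close> adds the generator \<open>z / c\<close>, which
  is the generator of the smaller disc.\<close>

lemma inner_disc:
  fixes b c :: "'a::complete_nonarch_field"
  assumes c: "c ~= 0" "absv c <= absv b"
  shows "EX W. rational_subdomain (disc b) W & fst W = {z. absv z <= absv c} & an (disc c) \<subseteq> an W"
proof -
  let ?W = "({z : fst (disc b). ALL f:set [%z. z]. absv (f z) <= absv c}, snd (disc b) @ map (%f z. f z / c) [%z. z])"
  have b0: "b ~= 0" using c by auto
  have "(%z. (%z. z / b) z * (%_. b) z) : an (disc b)" by (intro an_mult an_const an_gen) (simp add: disc_def)
  then have "(%z. z) : an (disc b)" using b0 by simp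
  then have rat: "rational_subdomain (disc b) ?W"
    unfolding rational_subdomain_def analytic_functions_eq[OF sound_disc]
    by (intro exI[of _ "%_. c"] exI[of _ "[%z. z]"]) (simp add: an_const c(1))
  have fstW: "fst ?W = {z. absv z <= absv c}" using c(2) by (auto simp: disc_def)
  have "an (disc c) \<subseteq> an ?W"
  proof
    fix h assume h: "h : an (disc c)"
    have "h \<circ> id : an ?W"
      by (rule an_pullback[OF _ _ h]) (auto simp: disc_def)
    then show "h : an ?W" by simp
  qed
  then show ?thesis using rat fstW by (intro exI[of _ ?W] conjI)
qed

text \<open>The inner disc and the given covering of the annulus together cover the large disc, and
  each member is, with a new presentation, a rational subdomain of it.\<close>

lemma rigid_map_disc:
  fixes b c :: "'a::complete_nonarch_field" and F :: "'a \<Rightarrow> 'a ppoint"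
  assumes c: "c ~= 0" "absv c <= absv b" and f: "rigid_map (annulus c b) Y f"
    and Ff: "!!z. z ~= 0 ==> F z = f z"
    and F: "!!z. absv z <= absv c ==> F z : Y & F z : unit_chart i" "!!j. ratio j i \<circ> F : an (disc c)"
  shows "rigid_map (disc b) Y F"
proof -
  have sA: "sound (annulus c b)" using presented_annulus[OF c] by (simp add: presented_def)
  obtain Ws where fY: "f ` fst (annulus c b) \<subseteq> Y" and Ws: "fst (annulus c b) = \<Union>(fst ` set Ws)"
    "ALL W:set Ws. rational_subdomain (annulus c b) W & (EX i. f ` fst W \<subseteq> unit_chart i & (ALL j. ratio j i \<circ> f : analytic_functions W))"
    using f unfolding rigid_map_def by (elim exE conjE)
  obtain W0 where W0: "rational_subdomain (disc b) W0" "fst W0 = {z. absv z <= absv c}" "an (disc c) \<subseteq> an W0"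
    using inner_disc[OF c] by (elim exE conjE)
  have "ALL W. EX W'. W : set Ws --> rational_subdomain (disc b) W' & fst W' = fst W & an W \<subseteq> an W'"
    using annulus_subdomain_disc[OF c] Ws(2) by blast
  then obtain T where T: "ALL W. W : set Ws --> rational_subdomain (disc b) (T W) & fst (T W) = fst W & an W \<subseteq> an (T W)"
    by (rule choice[THEN exE])
  have A0: "z ~= 0" if "z : fst (annulus c b)" for z using that c(1) by (auto simp: annulus_def)
  have cov: "fst (disc b) = {z. absv z <= absv c} \<union> fst (annulus c b)" using c(2) by (auto simp: disc_def annulus_def)
  have chart: "rational_subdomain (disc b) (T W) & (EX i. F ` fst (T W) \<subseteq> unit_chart i & (ALL j. ratio j i \<circ> F : analytic_functions (T W)))"
    if W: "W : set Ws" for W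
  proof -
    obtain i where i: "f ` fst W \<subseteq> unit_chart i" "ALL j. ratio j i \<circ> f : analytic_functions W" and sub: "rational_subdomain (annulus c b) W"
      using Ws(2)[rule_format, OF W] by (elim exE conjE)
    have t: "rational_subdomain (disc b) (T W)" "fst (T W) = fst W" "an W \<subseteq> an (T W)" using T W by blast+
    have eq: "F z = f z" if "z : fst W" for z
      by (rule Ff[OF A0]) (use rational_subdomain_subset[OF sub] that in blast)
    have "ratio j i \<circ> F : analytic_functions (T W)" for j
      unfolding analytic_functions_eq[OF rational_subdomain_sound[OF sound_disc t(1)]]
    proof (rule an_cong)
      show "ratio j i \<circ> f : an (T W)"
        using i(2) t(3) unfolding analytic_functions_eq[OF rational_subdomain_sound[OF sA sub]] by blast
      show "(ratio j i \<circ> F) z = (ratio j i \<circ> f) z" if "z : fst (T W)" for z using eq that t(2) by simp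
    qed
    moreover have "F ` fst (T W) \<subseteq> unit_chart i" using i(1) eq t(2) by auto
    ultimately show ?thesis using t(1) by (intro conjI exI[of _ i] allI)
  qed
  have chart0: "EX i. F ` fst W0 \<subseteq> unit_chart i & (ALL j. ratio j i \<circ> F : analytic_functions W0)"
    unfolding analytic_functions_eq[OF rational_subdomain_sound[OF sound_disc W0(1)]] W0(2)
    by (intro exI[of _ i] conjI allI subsetD[OF W0(3)] F(2)) (use F(1) in blast)
  show ?thesis unfolding rigid_map_def
  proof (intro conjI exI[of _ "W0 # map T Ws"] ballI)
    show "F ` fst (disc b) \<subseteq> Y" unfolding cov using F(1) fY Ff[OF A0] by fastforce
    have "(\<Union>W\<in>set Ws. fst (T W)) = (\<Union>W\<in>set Ws. fst W)" by (rule SUP_cong[OF refl]) (use T in blast)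
    then have "\<Union>(fst ` set (map T Ws)) = fst (annulus c b)" unfolding Ws(1) by (simp add: image_image)
    then show "fst (disc b) = \<Union>(fst ` set (W0 # map T Ws))" unfolding cov by (simp add: W0(2))
    fix W assume "W : set (W0 # map T Ws)"
    then consider "W = W0" | V where "V : set Ws" "W = T V" by auto
    then show "rational_subdomain (disc b) W" "EX i. F ` fst W \<subseteq> unit_chart i & (ALL j. ratio j i \<circ> F : analytic_functions W)"
      by (cases; use W0(1) chart0 chart in blast)+
  qed
qed

theorem theorem1p2:
  fixes X :: "'a::complete_nonarch_field ppoint set"
    and \<D> :: "'a ppoint set set"
    and f :: "'a \<Rightarrow> 'a ppoint"
    and R :: real
    and N :: nat
  assumes "projective_variety N X"
    and "nonsingular X"
    and "snc_divisor X \<D>"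
    and "0 < R"
    and "rigid_map_punctured_disc R (X - \<Union>\<D>) f"
    and "\<exists>k\<ge>1. \<exists>m\<ge>1. \<exists>Vs g. line_bundle X Vs g \<and> ample X Vs g \<and>
           (\<exists>\<Omega>. log_jet_section N X (\<Union>\<D>) k m Vs g \<Omega> \<and> pullback_nonzero X k m \<Omega> R f)"
  shows "\<exists>F. rigid_map_closed_disc R X F \<and> (\<forall>\<xi>. 0 < absv \<xi> \<and> absv \<xi> \<le> R \<longrightarrow> F \<xi> = f \<xi>)"
proof -
  note X = assms(1)
  obtain k m Vs g \<Omega> where lb: "line_bundle X Vs g" "ample X Vs g" and \<Omega>: "log_jet_section N X (\<Union>\<D>) k m Vs g \<Omega>"
    and nz: "pullback_nonzero X k m \<Omega> R f" using assms(6) by (elim exE conjE)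
  obtain d where "very_ample X Vs (\<lambda>i j p. g i j p ^ d)" using lb(2) unfolding ample_def by (elim exE conjE)
  then obtain M s \<phi> where s: "\<forall>r\<le>M. bundle_section X Vs (\<lambda>i j p. g i j p ^ d) (s r)"
    and \<phi>: "\<forall>i<length Vs. \<forall>p\<in>Vs ! i. (\<exists>r\<le>M. s r i p \<noteq> 0) \<and> \<phi> p = abs_ppoint (\<lambda>r. if r \<le> M then s r i p else 0)"
    and imm: "closed_immersion X \<phi>" unfolding very_ample_def by (elim exE conjE)
  interpret jet_map N k m d M X "\<Union>\<D>" f R Vs g s \<Omega>
    by unfold_locales (use X assms(5) lb(1) s \<phi> \<Omega> in blast)+
  have "\<exists>b H. b \<noteq> 0 \<and> absv b \<le> R \<and> (\<forall>r. H r \<in> an (disc b)) \<and> (\<exists>r. \<forall>z. absv z \<le> absv b \<longrightarrow> H r z \<noteq> 0) \<and>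
     (\<forall>z. z \<noteq> 0 \<longrightarrow> absv z \<le> absv b \<longrightarrow> \<phi> (f z) = abs_ppoint (\<lambda>r. H r z))"
    by (rule near_puncture[OF nz]) (use \<phi> in blast)
  then obtain b H r1 where b: "b \<noteq> 0" "absv b \<le> R" and H: "\<forall>r. H r \<in> an (disc b)" and r1: "\<forall>z. absv z \<le> absv b \<longrightarrow> H r1 z \<noteq> 0"
     and \<phi>H: "\<forall>z. z \<noteq> 0 \<longrightarrow> absv z \<le> absv b \<longrightarrow> \<phi> (f z) = abs_ppoint (\<lambda>r. H r z)"
    by (elim exE conjE)
  have rigid: "rigid_map (annulus a c) X f" if "(a::'a) \<noteq> 0" "absv a \<le> absv (c::'a)" "absv c \<le> R" for a c
    using f_rigid[OF that] unfolding rigid_map_def by blast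
  have fX: "f z \<in> X" if "z \<noteq> 0" "absv z \<le> absv b" for z
    using rigid[OF that(1) order_refl] that(2) b(2) unfolding rigid_map_def annulus_def by auto
  have "\<exists>F c i. (c::'a) \<noteq> 0 \<and> absv c \<le> absv b \<and> (\<forall>z. z \<noteq> 0 \<longrightarrow> F z = f z) \<and>
     (\<forall>z::'a. absv z \<le> absv c \<longrightarrow> F z \<in> X \<and> F z \<in> unit_chart i) \<and> (\<forall>j. ratio j i \<circ> F \<in> an (disc c))"
    by (rule extend_puncture[OF X imm b(1), of H r1]) (use H r1 fX \<phi>H in blast)+
  then obtain F c i where c: "(c::'a) \<noteq> 0" "absv c \<le> absv b" and Ff: "\<forall>z. z \<noteq> 0 \<longrightarrow> F z = f z"
    and F: "\<forall>z::'a. absv z \<le> absv c \<longrightarrow> F z \<in> X \<and> F z \<in> unit_chart i" "\<forall>j. ratio j i \<circ> F \<in> an (disc c)" by (elim exE conjE)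
  \<comment> \<open>Discs inside the one that carries the extension inherit it by restriction;
    larger discs are put together from that disc and the annulus around it.\<close>
  have "rigid_map (disc e) X F" if e: "e \<noteq> 0" "absv e \<le> R" for e
  proof (cases "absv c \<le> absv e")
    case True
    show ?thesis
      by (rule rigid_map_disc[OF c(1) True rigid[OF c(1) True e(2)], of F i]) (use Ff F in blast)+
  next
    case False
    then have ec: "absv e \<le> absv c" by simp
    show ?thesis
    proof (rule rigid_map_single[OF sound_disc])
      show "F ` fst (disc e) \<subseteq> X" "F ` fst (disc e) \<subseteq> unit_chart i" using F(1) ec by (auto simp: disc_def)
      show "ratio j i \<circ> F \<in> an (disc e)" for j using an_disc_restrict[OF e(1) ec] F(2) by blast
    qed
  qed
  then show ?thesis unfolding rigid_map_closed_disc_def using Ff by (intro exI[of _ F]) auto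
qed

end
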